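(* Let $\Omega\subset\mathbb{R}^3$ be a bounded connected open set with $\mathscr{C}^{1,1}$ boundary and exterior unit normal $\boldsymbol{n}$. Assume that $$\boldsymbol{M}\in L^2(\Omega)^3,\quad \operatorname{div}\boldsymbol{M}\in L^2(\Omega),\quad \boldsymbol{M}\cdot\boldsymbol{n}\in H^{1/2}(\partial\Omega).$$ Let $u\in W^1_0(\mathbb{R}^3)$ be the solution of $\Delta u=\operatorname{div}(\boldsymbol{M}\chi_\Omega)$ in $\mathbb{R}^3$ (in the sense of distributions). Then: 1. $u_{|\Omega}\in H^2(\Omega)$; 2. $u_{|\mathbb{R}^3\setminus\overline{\Omega}}\in W^2_2(\mathbb{R}^3\setminus\overline{\Omega})$, so that $(|\boldsymbol{x}|^2+1)\dfrac{\partial^2u}{\partial x_i\partial x_j}\in L^2(\mathbb{R}^3\setminus\overline{\Omega})$ for all $1\leq i,j\leq 3$; 3. if $\boldsymbol{M}\cdot\boldsymbol{n}=0$ on $\partial\Omega$, then $u\in W^2_2(\mathbb{R}^3)$.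
   Context: For integers $m,\ell\geq 0$, $W^m_\ell(\mathbb{R}^3)$ is the weighted space of all functions (distributions) $v$ on $\mathbb{R}^3$ such that $(1+|\boldsymbol{x}|^2)^{(\ell+|\lambda|-m)/2}D^\lambda v\in L^2(\mathbb{R}^3)$ for every multi-index $\lambda$ with $|\lambda|\leq m$. For an open set $G\subset\mathbb{R}^3$, $W^m_\ell(G)$ is defined in the same way with $\mathbb{R}^3$ replaced by $G$. Thus $v\in W^1_0(\mathbb{R}^3)$ means $(1+|\boldsymbol{x}|^2)^{-1/2}v\in L^2$ and $\nabla v\in L^2$; and $v\in W^2_2(G)$ means $v\in L^2(G)$, $(1+|\boldsymbol{x}|^2)^{1/2}\nabla v\in L^2(G)^3$ and $(1+|\boldsymbol{x}|^2)D^\lambda v\in L^2(G)$ for $|\lambda|=2$. $\chi_\Omega$ is the indicator function of $\Omega$, and $\boldsymbol{M}\chi_\Omega$ is the extension of $\boldsymbol{M}$ by zero. $\boldsymbol{M}\cdot\boldsymbol{n}$ denotes the normal trace, which is well defined in $H^{-1/2}(\partial\Omega)$ when $\boldsymbol{M}$ and $\operatorname{div}\boldsymbol{M}$ are in $L^2(\Omega)$. For every $\boldsymbol{M}\in L^2(\Omega)^3$ the equation $\Delta u=\operatorname{div}(\boldsymbol{M}\chi_\Omega)$ has exactly one solution in $W^1_0(\mathbb{R}^3)$. *)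

theory Defs
  imports "HOL-Analysis.Analysis"
begin

definition pd :: "'n::finite \<Rightarrow> (real^'n \<Rightarrow> real) \<Rightarrow> real^'n \<Rightarrow> real" where
  "pd i f x = frechet_derivative f (at x) (axis i 1)"

definition grad :: "(real^'n::finite \<Rightarrow> real) \<Rightarrow> real^'n \<Rightarrow> real^'n" where
  "grad f x = (\<chi> i. pd i f x)"

fun Ck :: "nat \<Rightarrow> (real^'n::finite \<Rightarrow> real) \<Rightarrow> bool" where
  "Ck 0 f = continuous_on UNIV f"
| "Ck (Suc k) f = ((\<forall>x. f differentiable (at x)) \<and> (\<forall>i. Ck k (pd i f)))"

definition test_function :: "(real^3) set \<Rightarrow> (real^3 \<Rightarrow> real) \<Rightarrow> bool" where
  "test_function G \<phi> \<longleftrightarrow>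
     (\<forall>k. Ck k \<phi>) \<and> compact (closure {x. \<phi> x \<noteq> 0}) \<and> closure {x. \<phi> x \<noteq> 0} \<subseteq> G"

text \<open>
  A distribution on an open set \<open>G\<close> is represented by its action on test functions; only its
  values on the test functions of \<open>G\<close> matter, and equality of distributions is \<open>distr_eq\<close>.
  Every distribution used here is a distributional derivative of a locally integrable function,
  so that linearity and continuity hold automatically.
\<close>

type_synonym distr = "(real^3 \<Rightarrow> real) \<Rightarrow> real"

definition locally_integrable :: "(real^3) set \<Rightarrow> (real^3 \<Rightarrow> real) \<Rightarrow> bool" where
  "locally_integrable G f \<longleftrightarrow>
     (\<forall>K. compact K \<and> K \<subseteq> G \<longrightarrow> integrable (lebesgue_on K) f)"

definition distr_of :: "(real^3) set \<Rightarrow> (real^3 \<Rightarrow> real) \<Rightarrow> distr" where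
  "distr_of G f = (\<lambda>\<phi>. LINT x|lebesgue_on G. f x * \<phi> x)"

definition distr_eq :: "(real^3) set \<Rightarrow> distr \<Rightarrow> distr \<Rightarrow> bool" where
  "distr_eq G S T \<longleftrightarrow> (\<forall>\<phi>. test_function G \<phi> \<longrightarrow> S \<phi> = T \<phi>)"

definition ddiff :: "3 \<Rightarrow> distr \<Rightarrow> distr" where
  "ddiff i T = (\<lambda>\<phi>. - T (pd i \<phi>))"

definition ddiff_multi :: "nat^3 \<Rightarrow> distr \<Rightarrow> distr" where
  "ddiff_multi l T = (ddiff 1 ^^ (l $ 1)) ((ddiff 2 ^^ (l $ 2)) ((ddiff 3 ^^ (l $ 3)) T))"

definition mi_order :: "nat^3 \<Rightarrow> nat" where
  "mi_order l = (\<Sum>i\<in>UNIV. l $ i)"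

definition distr_laplacian :: "distr \<Rightarrow> distr" where
  "distr_laplacian T = (\<lambda>\<phi>. \<Sum>i\<in>UNIV. ddiff i (ddiff i T) \<phi>)"

definition distr_div :: "(3 \<Rightarrow> distr) \<Rightarrow> distr" where
  "distr_div T = (\<lambda>\<phi>. \<Sum>i\<in>UNIV. ddiff i (T i) \<phi>)"

definition L2 :: "(real^3) set \<Rightarrow> (real^3 \<Rightarrow> real) \<Rightarrow> bool" where
  "L2 G f \<longleftrightarrow>
     f \<in> borel_measurable (lebesgue_on G) \<and> integrable (lebesgue_on G) (\<lambda>x. (f x)\<^sup>2)"

definition L2_vec :: "(real^3) set \<Rightarrow> (real^3 \<Rightarrow> real^3) \<Rightarrow> bool" where
  "L2_vec G F \<longleftrightarrow> (\<forall>i. L2 G (\<lambda>x. F x $ i))"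

text \<open>
  The multi-index \<open>0\<close> forces every element of the two spaces below to be a function, so they are
  predicates on functions. In both, \<open>w\<close> is the (a.e. unique) function representing the
  derivative of \<open>v\<close> on \<open>G\<close>.
\<close>

definition sobolev_H :: "nat \<Rightarrow> (real^3) set \<Rightarrow> (real^3 \<Rightarrow> real) \<Rightarrow> bool" where
  "sobolev_H m G v \<longleftrightarrow> locally_integrable G v \<and>
     (\<forall>l. mi_order l \<le> m \<longrightarrow>
        (\<exists>w. L2 G w \<and> distr_eq G (ddiff_multi l (distr_of G v)) (distr_of G w)))"

definition weighted_W :: "nat \<Rightarrow> nat \<Rightarrow> (real^3) set \<Rightarrow> (real^3 \<Rightarrow> real) \<Rightarrow> bool" where
  "weighted_W m k G v \<longleftrightarrow> locally_integrable G v \<and>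
     (\<forall>l. mi_order l \<le> m \<longrightarrow>
        (\<exists>w. locally_integrable G w \<and>
             distr_eq G (ddiff_multi l (distr_of G v)) (distr_of G w) \<and>
             L2 G (\<lambda>x. (1 + (norm x)\<^sup>2) powr ((real k + real (mi_order l) - real m) / 2) * w x)))"

definition has_div_L2 :: "(real^3) set \<Rightarrow> (real^3 \<Rightarrow> real^3) \<Rightarrow> (real^3 \<Rightarrow> real) \<Rightarrow> bool" where
  "has_div_L2 G F d \<longleftrightarrow> L2 G d \<and>
     distr_eq G (distr_div (\<lambda>i. distr_of G (\<lambda>x. F x $ i))) (distr_of G d)"

definition H1_with_grad ::
  "(real^3) set \<Rightarrow> (real^3 \<Rightarrow> real) \<Rightarrow> (real^3 \<Rightarrow> real^3) \<Rightarrow> bool" where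
  "H1_with_grad G v Dv \<longleftrightarrow> L2 G v \<and> L2_vec G Dv \<and>
     (\<forall>i. distr_eq G (ddiff i (distr_of G v)) (distr_of G (\<lambda>x. Dv x $ i)))"

definition C11 :: "(real^2 \<Rightarrow> real) \<Rightarrow> bool" where
  "C11 \<psi> \<longleftrightarrow> (\<forall>y. \<psi> differentiable (at y)) \<and> (\<exists>L. L-lipschitz_on UNIV (grad \<psi>))"

definition chart_point :: "real^3 \<Rightarrow> real^3^3 \<Rightarrow> real^2 \<Rightarrow> real \<Rightarrow> real^3" where
  "chart_point p A y t = p + A *v vector [y $ 1, y $ 2, t]"

text \<open>
  In the orthonormal frame given by the columns of \<open>A\<close>, centred at the boundary point \<open>p\<close>, the set
  \<open>\<Omega>\<close> is, inside the ball of radius \<open>r\<close> about \<open>p\<close>, the region strictly above the graph of \<open>\<psi>\<close>.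
  In particular \<open>\<Omega>\<close> lies on one side of its boundary there.
\<close>

definition graph_chart ::
  "(real^3) set \<Rightarrow> real^3 \<Rightarrow> real \<Rightarrow> real^3^3 \<Rightarrow> (real^2 \<Rightarrow> real) \<Rightarrow> bool" where
  "graph_chart \<Omega> p r A \<psi> \<longleftrightarrow>
     p \<in> frontier \<Omega> \<and> r > 0 \<and> orthogonal_matrix A \<and> C11 \<psi> \<and>
     (\<forall>y t. chart_point p A y t \<in> ball p r \<longrightarrow> (chart_point p A y t \<in> \<Omega> \<longleftrightarrow> \<psi> y < t))"

definition C11_boundary :: "(real^3) set \<Rightarrow> bool" where
  "C11_boundary \<Omega> \<longleftrightarrow> (\<forall>p\<in>frontier \<Omega>. \<exists>r A \<psi>. graph_chart \<Omega> p r A \<psi>)"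

text \<open>
  The surface (area) measure of the boundary, as a Borel measure on the whole space that is
  concentrated on the boundary and has area element
  \<open>sqrt (1 + |grad \<psi>|\<^sup>2) dy\<close> in every graph chart. For a bounded set with \<open>C11_boundary\<close> there
  is exactly one such measure: the area formula does not depend on the chart, and finitely many
  charts cover the boundary.
\<close>

definition is_surface_measure :: "(real^3) set \<Rightarrow> (real^3) measure \<Rightarrow> bool" where
  "is_surface_measure \<Omega> \<sigma> \<longleftrightarrow>
     sets \<sigma> = sets borel \<and> emeasure \<sigma> (- frontier \<Omega>) = 0 \<and>
     (\<forall>p r A \<psi>. graph_chart \<Omega> p r A \<psi> \<longrightarrow>
        (\<forall>B\<in>sets borel. B \<subseteq> ball p r \<longrightarrow>
           emeasure \<sigma> B =
             (\<integral>\<^sup>+ y. indicator B (chart_point p A y (\<psi> y)) *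
                    ennreal (sqrt (1 + (norm (grad \<psi> y))\<^sup>2)) \<partial>lborel)))"

text \<open>
  \<open>h\<close> is the trace on the boundary of \<open>v\<close>, an \<open>H\<^sup>1\<close> function with weak gradient \<open>Dv\<close>: the trace
  operator is the continuous extension to \<open>H\<^sup>1\<close> of the restriction of smooth functions to the
  boundary.
\<close>

definition has_trace ::
  "(real^3) set \<Rightarrow> (real^3) measure \<Rightarrow> (real^3 \<Rightarrow> real) \<Rightarrow> (real^3 \<Rightarrow> real^3) \<Rightarrow> (real^3 \<Rightarrow> real)
     \<Rightarrow> bool" where
  "has_trace \<Omega> \<sigma> v Dv h \<longleftrightarrow>
     H1_with_grad \<Omega> v Dv \<and> h \<in> borel_measurable \<sigma> \<and> integrable \<sigma> (\<lambda>x. (h x)\<^sup>2) \<and>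
     (\<exists>\<phi> :: nat \<Rightarrow> real^3 \<Rightarrow> real.
        (\<forall>k. test_function UNIV (\<phi> k)) \<and>
        (\<lambda>k. LINT x|lebesgue_on \<Omega>. (\<phi> k x - v x)\<^sup>2) \<longlonglongrightarrow> 0 \<and>
        (\<lambda>k. LINT x|lebesgue_on \<Omega>. (norm (grad (\<phi> k) x - Dv x))\<^sup>2) \<longlonglongrightarrow> 0 \<and>
        (\<lambda>k. LINT x|\<sigma>. (\<phi> k x - h x)\<^sup>2) \<longlonglongrightarrow> 0)"

text \<open>
  \<open>H\<^sup>1\<^sup>/\<^sup>2\<close> of the boundary is the range of the trace operator on \<open>H\<^sup>1(\<Omega>)\<close>.
\<close>

definition boundary_H_half ::
  "(real^3) set \<Rightarrow> (real^3) measure \<Rightarrow> (real^3 \<Rightarrow> real) \<Rightarrow> bool" where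
  "boundary_H_half \<Omega> \<sigma> g \<longleftrightarrow> (\<exists>v Dv. has_trace \<Omega> \<sigma> v Dv g)"

text \<open>
  The normal trace of \<open>M\<close> (exterior normal) is the functional on the space of traces given by
  Green's formula,
  \<open><M\<cdot>n, h> = \<integral>\<^sub>\<Omega> (M \<cdot> Dv + (div M) v) dx\<close> for any \<open>v\<close> in \<open>H\<^sup>1(\<Omega>)\<close> with trace \<open>h\<close>.
  It is identified with the boundary function \<open>g\<close> when \<open><M\<cdot>n, h> = \<integral> g h d\<sigma>\<close> for all such \<open>h\<close>.
\<close>

definition has_normal_trace ::
  "(real^3) set \<Rightarrow> (real^3) measure \<Rightarrow> (real^3 \<Rightarrow> real^3) \<Rightarrow> (real^3 \<Rightarrow> real) \<Rightarrow> bool" where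
  "has_normal_trace \<Omega> \<sigma> M g \<longleftrightarrow>
     (\<exists>d. has_div_L2 \<Omega> M d \<and>
        (\<forall>v Dv h. has_trace \<Omega> \<sigma> v Dv h \<longrightarrow>
           (LINT x|lebesgue_on \<Omega>. M x \<bullet> Dv x + d x * v x) = (LINT x|\<sigma>. g x * h x)))"

end

theory Submission
  imports Defs
begin

text \<open>
  All regularity statements are proved by duality: by Riesz, a distribution \<open>T\<close> is a function with
  \<open>(1 + |x|\<^sup>2)\<close>-weighted square integrability as soon as \<open>|T \<phi>|\<close> is bounded by the dual weighted
  norm of the test function \<open>\<phi>\<close>. The basic estimate bounds \<open>\<integral> z \<partial>\<^sub>i \<phi>\<close> when \<open>\<integral> z \<Delta> \<zeta>\<close> is bounded by the
  norm of the gradient of \<open>\<zeta>\<close>. Applied to cut-offs of \<open>u\<close> and of its weak gradient times powers of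
  \<open>(1 + |x|\<^sup>2)\<close>, together with Hardy's inequality, it gives the decay at infinity and the regularity
  away from the boundary. Near a boundary point, Green's formula and integration by parts in the
  vertical direction \<open>e\<^sub>3\<close> of a graph chart turn the surface density \<open>M \<cdot> n\<close> into a right-hand side of the form
  \<open>\<integral> f \<phi> + \<integral> g \<partial>\<^sub>3 \<phi>\<close>, supported in the closure of \<open>\<Omega>\<close>, where \<open>g\<close> is a weight times an \<open>H\<^sup>1\<close> extension of
  \<open>M \<cdot> n\<close>. The maps \<open>x \<mapsto> x + s a + (\<psi>(x + s a) - \<psi>(x)) e\<^sub>3\<close> with \<open>a\<close> orthogonal to \<open>e\<^sub>3\<close> preserve
  both the volume and the graph, so difference quotients of \<open>u\<close> along them are controlled by
  the basic estimate. This bounds the second derivatives with at least one tangential direction,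
  and the equation, which off the boundary has a square-integrable right-hand side, yields the last one.
\<close>

section \<open>Square-integrable functions\<close>

text \<open>The obstacle is the interface: the extension of the normal trace by zero jumps across
  the boundary, so its derivatives are not square integrable on the whole space, and only increments
  between points on the same side of the boundary are of the size of the displacement. Straightening
  the boundary would in turn bring second derivatives of the graph into the Laplacian. The maps of
  the overview avoid both: locally they preserve \<Omega>, and they commute with the Laplacian up to
  increments of the gradient of \<psi>, which C^{1,1} regularity makes of order \<open>s\<close>.
  These coefficients are constant along the vertical direction, so vertical integration by parts
  never differentiates them. At infinity the decay comes from the divergence form of the source: by
  Hardy's inequality the pairing of \<open>u\<close> with a Laplacian is bounded by the norm of that
  Laplacian, so \<open>u\<close> is square integrable up to a harmonic function, which a Liouville
  argument removes; each further derivative gains one power of the weight. If the normal trace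
  vanishes, the surface term disappears and the interior estimate applies across the
  boundary.\<close>

definition sq_int :: "'a measure \<Rightarrow> ('a \<Rightarrow> real) \<Rightarrow> bool" where
  "sq_int M f \<longleftrightarrow> f \<in> borel_measurable M \<and> integrable M (\<lambda>x. (f x)\<^sup>2)"

definition l2n :: "'a measure \<Rightarrow> ('a \<Rightarrow> real) \<Rightarrow> real" where
  "l2n M f = sqrt (LINT x|M. (f x)\<^sup>2)"

lemma l2n_nonneg [simp]: "0 \<le> l2n M f"
  by (simp add: l2n_def)

lemma l2n_sq: "(l2n M f)\<^sup>2 = (LINT x|M. (f x)\<^sup>2)"
  by (simp add: l2n_def)

lemma sq_int_measurable [dest]: "sq_int M f \<Longrightarrow> f \<in> borel_measurable M"
  by (simp add: sq_int_def)

lemma sq_int_integrable_mult: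
  assumes "sq_int M f" "sq_int M g"
  shows "integrable M (\<lambda>x. f x * g x)"
proof (rule Bochner_Integration.integrable_bound)
  show "integrable M (\<lambda>x. (f x)\<^sup>2 + (g x)\<^sup>2)"
    using assms by (simp add: sq_int_def)
  show "(\<lambda>x. f x * g x) \<in> borel_measurable M"
    using assms by (auto simp: sq_int_def)
  have "\<bar>f x * g x\<bar> \<le> (f x)\<^sup>2 + (g x)\<^sup>2" for x
  proof -
    have "0 \<le> (\<bar>f x\<bar> - \<bar>g x\<bar>)\<^sup>2" by simp
    then have "2 * (\<bar>f x\<bar> * \<bar>g x\<bar>) \<le> (f x)\<^sup>2 + (g x)\<^sup>2"
      by (simp add: power2_diff)
    moreover have "0 \<le> \<bar>f x\<bar> * \<bar>g x\<bar>" by simp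
    ultimately show ?thesis by (simp only: abs_mult)
  qed
  then show "AE x in M. norm (f x * g x) \<le> norm ((f x)\<^sup>2 + (g x)\<^sup>2)"
    by simp
qed

lemma sq_int_cmult: "sq_int M f \<Longrightarrow> sq_int M (\<lambda>x. c * f x)"
  by (auto simp: sq_int_def power_mult_distrib)

lemma sq_int_add:
  assumes "sq_int M f" "sq_int M g" shows "sq_int M (\<lambda>x. f x + g x)"
proof -
  have "integrable M (\<lambda>x. (f x)\<^sup>2 + (g x)\<^sup>2 + 2 * (f x * g x))"
    using assms sq_int_integrable_mult[OF assms] by (simp add: sq_int_def)
  moreover have "(\<lambda>x. (f x + g x)\<^sup>2) = (\<lambda>x. (f x)\<^sup>2 + (g x)\<^sup>2 + 2 * (f x * g x))"
    by (simp add: power2_sum algebra_simps)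
  ultimately show ?thesis using assms by (auto simp: sq_int_def)
qed

lemma sq_int_diff:
  assumes "sq_int M f" "sq_int M g" shows "sq_int M (\<lambda>x. f x - g x)"
  using sq_int_add[OF assms(1) sq_int_cmult[OF assms(2), of "-1"]] by simp

lemma sq_int_abs: "sq_int M f \<Longrightarrow> sq_int M (\<lambda>x. \<bar>f x\<bar>)"
  by (auto simp: sq_int_def)

lemma sq_int_zero [simp]: "sq_int M (\<lambda>x. 0)"
  by (simp add: sq_int_def)

lemma sq_int_sum:
  assumes "\<And>i. i \<in> I \<Longrightarrow> sq_int M (f i)" shows "sq_int M (\<lambda>x. \<Sum>i\<in>I. f i x)"
  using assms by (induction I rule: infinite_finite_induct) (auto intro: sq_int_add)

lemma sq_int_bound:
  assumes "sq_int M g" "f \<in> borel_measurable M" "AE x in M. \<bar>f x\<bar> \<le> \<bar>g x\<bar>"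
  shows "sq_int M f"
  unfolding sq_int_def
proof (intro conjI assms(2), rule Bochner_Integration.integrable_bound)
  show "integrable M (\<lambda>x. (g x)\<^sup>2)" using assms(1) by (simp add: sq_int_def)
  show "(\<lambda>x. (f x)\<^sup>2) \<in> borel_measurable M" using assms(2) by simp
  show "AE x in M. norm ((f x)\<^sup>2) \<le> norm ((g x)\<^sup>2)"
    using assms(3) by eventually_elim (simp add: abs_le_square_iff)
qed

lemma l2n_mono:
  assumes "sq_int M g" "f \<in> borel_measurable M" "AE x in M. \<bar>f x\<bar> \<le> \<bar>g x\<bar>"
  shows "l2n M f \<le> l2n M g"
  unfolding l2n_def
proof (rule real_sqrt_le_mono, rule integral_mono_AE)
  show "integrable M (\<lambda>x. (g x)\<^sup>2)" using assms(1) by (simp add: sq_int_def)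
  show "integrable M (\<lambda>x. (f x)\<^sup>2)" using sq_int_bound[OF assms] by (simp add: sq_int_def)
  show "AE x in M. (f x)\<^sup>2 \<le> (g x)\<^sup>2"
    using assms(3) by eventually_elim (simp add: abs_le_square_iff)
qed

lemma l2n_cmult: "l2n M (\<lambda>x. c * f x) = \<bar>c\<bar> * l2n M f"
  by (simp add: l2n_def power_mult_distrib real_sqrt_mult)

lemma l2n_abs: "l2n M (\<lambda>x. \<bar>f x\<bar>) = l2n M f"
  by (simp add: l2n_def)

lemma l2n_zero [simp]: "l2n M (\<lambda>x. 0) = 0"
  by (simp add: l2n_def)

lemma l2n_add_sq:
  assumes "sq_int M f" "sq_int M g"
  shows "(l2n M (\<lambda>x. f x + c * g x))\<^sup>2
    = (l2n M f)\<^sup>2 + 2 * c * (LINT x|M. f x * g x) + c\<^sup>2 * (l2n M g)\<^sup>2"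
proof -
  have "(\<lambda>x. (f x + c * g x)\<^sup>2) = (\<lambda>x. (f x)\<^sup>2 + 2 * c * (f x * g x) + c\<^sup>2 * (g x)\<^sup>2)"
    by (simp add: power2_sum power_mult_distrib algebra_simps)
  then show ?thesis
    using assms sq_int_integrable_mult[OF assms] by (simp add: l2n_sq sq_int_def)
qed

text \<open>The squared norm of \<open>f + c g\<close> is a quadratic polynomial in \<open>c\<close>
  without negative values, so its discriminant is not positive; a vanishing leading coefficient is
  treated separately.\<close>

lemma l2n_CS:
  assumes "sq_int M f" "sq_int M g"
  shows "\<bar>LINT x|M. f x * g x\<bar> \<le> l2n M f * l2n M g"
proof -
  let ?I = "LINT x|M. f x * g x"
  have "0 \<le> (l2n M f)\<^sup>2 + 2 * c * ?I + c\<^sup>2 * (l2n M g)\<^sup>2" for c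
    using l2n_add_sq[OF assms, of c] by (metis zero_le_power2)
  note q = this
  have "?I\<^sup>2 \<le> (l2n M f)\<^sup>2 * (l2n M g)\<^sup>2"
  proof (cases "l2n M g = 0")
    case True
    have "?I = 0"
    proof (rule ccontr)
      assume n: "?I \<noteq> 0"
      \<comment> \<open>The polynomial is affine here, and this value of \<open>c\<close> would make
        it equal to -1.\<close>
      have "0 \<le> (l2n M f)\<^sup>2 + 2 * (- ((l2n M f)\<^sup>2 + 1) / (2 * ?I)) * ?I"
        using q[of "- ((l2n M f)\<^sup>2 + 1) / (2 * ?I)"] True by simp
      with n show False by (simp add: field_simps)
    qed
    then show ?thesis by simp
  next
    case False
    then have p: "(l2n M g)\<^sup>2 > 0" by simp
    have e: "A + 2 * (- I / G) * I + (- I / G)\<^sup>2 * G = A - I\<^sup>2 / G" if "G > 0" for A I G :: real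
      using that by (simp add: field_simps power2_eq_square)
    have "0 \<le> (l2n M f)\<^sup>2 - ?I\<^sup>2 / (l2n M g)\<^sup>2"
      using q[of "- ?I / (l2n M g)\<^sup>2"] unfolding e[OF p] .
    with p show ?thesis by (simp add: field_simps)
  qed
  then have "\<bar>?I\<bar>\<^sup>2 \<le> (l2n M f * l2n M g)\<^sup>2" by (simp add: power_mult_distrib)
  then show ?thesis by (rule power2_le_imp_le) simp
qed

lemma l2n_triangle:
  assumes "sq_int M f" "sq_int M g"
  shows "l2n M (\<lambda>x. f x + g x) \<le> l2n M f + l2n M g"
proof (rule power2_le_imp_le)
  have "(LINT x|M. f x * g x) \<le> l2n M f * l2n M g"
    using l2n_CS[OF assms] by simp
  then show "(l2n M (\<lambda>x. f x + g x))\<^sup>2 \<le> (l2n M f + l2n M g)\<^sup>2"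
    using l2n_add_sq[OF assms, of 1] by (simp add: power2_sum algebra_simps)
qed simp

lemma l2n_sum_le:
  assumes "\<And>i. i \<in> I \<Longrightarrow> sq_int M (f i)"
  shows "l2n M (\<lambda>x. \<Sum>i\<in>I. f i x) \<le> (\<Sum>i\<in>I. l2n M (f i))"
  using assms
proof (induction I rule: infinite_finite_induct)
  case (insert i I)
  have "l2n M (\<lambda>x. f i x + (\<Sum>i\<in>I. f i x)) \<le> l2n M (f i) + l2n M (\<lambda>x. \<Sum>i\<in>I. f i x)"
    by (rule l2n_triangle) (auto intro!: sq_int_sum insert)
  with insert show ?case by (force simp: insert.hyps)
qed auto

text \<open>Riesz-Fischer for a sequence that already converges geometrically, so no subsequence is
  extracted. Monotone convergence makes the series of absolute increments finite almost everywhere,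
  which gives the pointwise limit; Fatou's lemma turns the tail bound into convergence in
  norm.\<close>

lemma L2_complete_rapid:
  assumes f: "\<And>n. sq_int M (f n)"
    and r: "\<And>n. l2n M (\<lambda>x. f (Suc n) x - f n x) \<le> c * (1/2)^n"
  shows "\<exists>q. sq_int M q \<and> (\<lambda>n. l2n M (\<lambda>x. f n x - q x)) \<longlonglongrightarrow> 0"
proof -
  have [measurable]: "f n \<in> borel_measurable M" for n using f by auto
  define g where "g n x = \<bar>f (Suc n) x - f n x\<bar>" for n x
  have [measurable]: "g n \<in> borel_measurable M" for n
    unfolding g_def by measurable
  have sg: "sq_int M (g n)" for n
    unfolding g_def by (intro sq_int_abs sq_int_diff f)
  have c0: "0 \<le> c" using order_trans[OF l2n_nonneg r[of 0]] by simp
  have geo: "(\<Sum>i<n. c * (1/2)^i) \<le> 2 * c" for n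
  proof -
    have "(\<Sum>i<n. (1/2::real)^i) \<le> 2"
      by (simp add: sum_gp_strict)
    then show ?thesis using c0 by (simp add: sum_distrib_left[symmetric] mult_left_mono mult.commute)
  qed
  have tail: "l2n M (\<lambda>x. \<Sum>i<n. g (i + m) x) \<le> 2 * c * (1/2)^m" for n m
  proof -
    have "l2n M (\<lambda>x. \<Sum>i<n. g (i + m) x) \<le> (\<Sum>i<n. l2n M (g (i+m)))"
      by (intro l2n_sum_le sg)
    also have "\<dots> \<le> (\<Sum>i<n. c * (1/2)^i * (1/2)^m)"
    proof (rule sum_mono)
      fix i
      show "l2n M (g (i+m)) \<le> c * (1/2)^i * (1/2)^m"
        using r[of "i+m"] unfolding g_def[abs_def] l2n_abs power_add by (simp only: mult.assoc)
    qed
    also have "\<dots> = (\<Sum>i<n. c * (1/2)^i) * (1/2)^m" by (simp add: sum_distrib_right)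
    also have "\<dots> \<le> 2 * c * (1/2)^m" by (intro mult_right_mono geo) simp
    finally show ?thesis .
  qed
  define G where "G n x = (\<Sum>i<n. g i x)" for n x
  have [measurable]: "G n \<in> borel_measurable M" for n unfolding G_def by measurable
  have nnG: "(\<integral>\<^sup>+x. ennreal ((G n x)\<^sup>2) \<partial>M) \<le> ennreal ((2*c)\<^sup>2)" for n
  proof -
    have "sq_int M (G n)" unfolding G_def by (intro sq_int_sum sg)
    then have "(\<integral>\<^sup>+x. ennreal ((G n x)\<^sup>2) \<partial>M) = ennreal ((l2n M (G n))\<^sup>2)"
      by (simp add: l2n_sq sq_int_def nn_integral_eq_integral)
    also have "l2n M (G n) \<le> 2 * c" using tail[where n=n and m=0] by (simp add: G_def[abs_def])
    then have "ennreal ((l2n M (G n))\<^sup>2) \<le> ennreal ((2*c)\<^sup>2)"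
      by (intro ennreal_leI power_mono) auto
    finally show ?thesis .
  qed
  have "(\<integral>\<^sup>+x. (SUP n. ennreal ((G n x)\<^sup>2)) \<partial>M) = (SUP n. \<integral>\<^sup>+x. ennreal ((G n x)\<^sup>2) \<partial>M)"
    by (rule nn_integral_monotone_convergence_SUP)
      (auto simp: incseq_def le_fun_def G_def g_def intro!: ennreal_leI power_mono sum_mono2 sum_nonneg)
  also have "\<dots> \<le> ennreal ((2*c)\<^sup>2)" by (intro SUP_least nnG)
  also have "\<dots> < \<infinity>" by simp
  finally have "AE x in M. (SUP n. ennreal ((G n x)\<^sup>2)) \<noteq> \<infinity>"
    by (intro nn_integral_PInf_AE) auto
  then have conv: "AE x in M. convergent (\<lambda>n. f n x)"
  proof eventually_elim
    case (elim x)
    then obtain b where b: "(SUP n. ennreal ((G n x)\<^sup>2)) = ennreal b" "0 \<le> b"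
      by (cases "SUP n. ennreal ((G n x)\<^sup>2)") auto
    have "(G n x)\<^sup>2 \<le> b" for n
    proof -
      have "ennreal ((G n x)\<^sup>2) \<le> ennreal b" using b(1) by (metis SUP_upper UNIV_I)
      then show ?thesis using b(2) by simp
    qed
    then have "(\<Sum>i<n. g i x) \<le> sqrt b" for n
      using real_le_rsqrt by (auto simp: G_def)
    then have "summable (\<lambda>i. g i x)"
      by (intro summableI_nonneg_bounded[where x="sqrt b"]) (auto simp: g_def)
    then have "summable (\<lambda>i. f (Suc i) x - f i x)"
      unfolding g_def by (rule summable_rabs_cancel)
    then have "convergent (\<lambda>n. \<Sum>i<n. (f (Suc i) x - f i x))"
      by (simp add: summable_iff_convergent)
    then have "convergent (\<lambda>n. (f n x - f 0 x) + f 0 x)"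
      by (subst (asm) sum_lessThan_telescope, subst convergent_add_const_right_iff)
    then show "convergent (\<lambda>n. f n x)" by simp
  qed
  \<comment> \<open>Where the sequence diverges, the value of \<open>lim\<close> is arbitrary; this
    happens on a null set only.\<close>
  define q where "q x = lim (\<lambda>n. f n x)" for x
  have [measurable]: "q \<in> borel_measurable M"
    unfolding q_def by (intro borel_measurable_lim_metric) simp
  have lq: "AE x in M. (\<lambda>n. f n x) \<longlonglongrightarrow> q x"
    using conv by eventually_elim (simp add: q_def convergent_LIMSEQ_iff)
  have est: "(\<integral>\<^sup>+x. ennreal ((f n x - q x)\<^sup>2) \<partial>M) \<le> ennreal ((2*c*(1/2)^n)\<^sup>2)" for n
  proof -
    have "(\<integral>\<^sup>+x. ennreal ((f n x - q x)\<^sup>2) \<partial>M)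
        \<le> (\<integral>\<^sup>+x. liminf (\<lambda>m. ennreal ((f n x - f (m+n) x)\<^sup>2)) \<partial>M)"
    proof (rule nn_integral_mono_AE)
      show "AE x in M. ennreal ((f n x - q x)\<^sup>2) \<le> liminf (\<lambda>m. ennreal ((f n x - f (m+n) x)\<^sup>2))"
        using lq
      proof eventually_elim
        case (elim x)
        have "(\<lambda>m. ennreal ((f n x - f (m+n) x)\<^sup>2)) \<longlonglongrightarrow> ennreal ((f n x - q x)\<^sup>2)"
          by (intro tendsto_intros LIMSEQ_ignore_initial_segment elim) 
        then show ?case
          by (intro eq_refl lim_imp_Liminf[symmetric] trivial_limit_sequentially)
      qed
    qed
    also have "\<dots> \<le> liminf (\<lambda>m. \<integral>\<^sup>+x. ennreal ((f n x - f (m+n) x)\<^sup>2) \<partial>M)"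
      by (rule nn_integral_liminf) simp
    also have "\<dots> \<le> ennreal ((2*c*(1/2)^n)\<^sup>2)"
    proof (rule order_trans[OF Liminf_le_Limsup Limsup_bounded], simp, intro always_eventually allI)
      fix m
      have s: "sq_int M (\<lambda>x. f n x - f (m+n) x)" by (intro sq_int_diff f)
      have "\<bar>f n x - f (m+n) x\<bar> \<le> \<bar>\<Sum>i<m. g (i+n) x\<bar>" for x
      proof -
        have "f (m+n) x - f n x = (\<Sum>i<m. f (Suc (i+n)) x - f (i+n) x)"
          using sum_lessThan_telescope[of "\<lambda>i. f (i+n) x" m] by simp
        then have "\<bar>f (m+n) x - f n x\<bar> \<le> (\<Sum>i<m. g (i+n) x)"
          unfolding g_def by (simp add: sum_abs)
        then show ?thesis by linarith
      qed
      then have "l2n M (\<lambda>x. f n x - f (m+n) x) \<le> l2n M (\<lambda>x. \<Sum>i<m. g (i+n) x)"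
        by (intro l2n_mono sq_int_sum sg) auto
      also have "\<dots> \<le> 2*c*(1/2)^n" by (rule tail)
      finally have "(l2n M (\<lambda>x. f n x - f (m+n) x))\<^sup>2 \<le> (2*c*(1/2)^n)\<^sup>2"
        by (intro power_mono) auto
      then have "ennreal ((l2n M (\<lambda>x. f n x - f (m+n) x))\<^sup>2) \<le> ennreal ((2*c*(1/2)^n)\<^sup>2)"
        by (rule ennreal_leI)
      moreover have "(\<integral>\<^sup>+x. ennreal ((f n x - f (m+n) x)\<^sup>2) \<partial>M) = ennreal ((l2n M (\<lambda>x. f n x - f (m+n) x))\<^sup>2)"
        using s by (simp add: l2n_sq sq_int_def nn_integral_eq_integral)
      ultimately show "(\<integral>\<^sup>+x. ennreal ((f n x - f (m+n) x)\<^sup>2) \<partial>M) \<le> ennreal ((2*c*(1/2)^n)\<^sup>2)"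
        by (simp only:)
    qed
    finally show ?thesis .
  qed
  have sd: "sq_int M (\<lambda>x. f n x - q x)" for n
    unfolding sq_int_def
  proof (intro conjI integrableI_bounded)
    show "(\<integral>\<^sup>+x. ennreal (norm ((f n x - q x)\<^sup>2)) \<partial>M) < \<infinity>"
      using le_less_trans[OF est[of n]] by simp
  qed measurable
  have "norm (l2n M (\<lambda>x. f n x - q x)) \<le> 2*c*(1/2)^n" for n
    unfolding real_norm_def abs_of_nonneg[OF l2n_nonneg]
  proof (rule power2_le_imp_le)
    have "ennreal ((l2n M (\<lambda>x. f n x - q x))\<^sup>2) \<le> ennreal ((2*c*(1/2)^n)\<^sup>2)"
      using sd[of n] est[of n] by (simp add: l2n_sq sq_int_def nn_integral_eq_integral)
    then show "(l2n M (\<lambda>x. f n x - q x))\<^sup>2 \<le> (2*c*(1/2)^n)\<^sup>2"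
      by (subst (asm) ennreal_le_iff) auto
  qed (use c0 in simp)
  moreover have "(\<lambda>n. 2*c*(1/2::real)^n) \<longlonglongrightarrow> 0"
    by (intro tendsto_mult_right_zero LIMSEQ_power_zero) simp
  ultimately have "(\<lambda>n. l2n M (\<lambda>x. f n x - q x)) \<longlonglongrightarrow> 0"
    by (rule Lim_null_comparison[OF always_eventually[OF allI]])
  moreover have "sq_int M q"
    using sq_int_diff[OF f[of 0] sd[of 0]] by simp
  ultimately show ?thesis by blast
qed

text \<open>The representer is the limit of a minimising sequence of \<open>(l2n M f)\<^sup>2 - 2 * L f\<close> over the subspace.\<close>

lemma L2_riesz:
  assumes V: "\<And>f. f \<in> V \<Longrightarrow> sq_int M f" "V \<noteq> {}"
    and lin: "\<And>f g c. f \<in> V \<Longrightarrow> g \<in> V \<Longrightarrow> (\<lambda>x. f x + c * g x) \<in> V"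
    and l: "\<And>f g c. f \<in> V \<Longrightarrow> g \<in> V \<Longrightarrow> L (\<lambda>x. f x + c * g x) = L f + c * L g"
    and bd: "\<And>f. f \<in> V \<Longrightarrow> \<bar>L f\<bar> \<le> C * l2n M f"
  shows "\<exists>q. sq_int M q \<and> (\<forall>f\<in>V. L f = (LINT x|M. q x * f x))"
proof -
  define J where "J f = (l2n M f)\<^sup>2 - 2 * L f" for f
  have Jlb: "- C\<^sup>2 \<le> J f" if "f \<in> V" for f
  proof -
    have "0 \<le> (l2n M f - C)\<^sup>2" by simp
    then show ?thesis using bd[OF that] by (simp add: J_def power2_diff algebra_simps)
  qed
  define m where "m = Inf (J ` V)"
  have mle: "m \<le> J f" if "f \<in> V" for f
    unfolding m_def using Jlb that by (intro cInf_lower bdd_belowI[of _ "- C\<^sup>2"]) auto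
  have ex: "\<exists>f\<in>V. J f < m + e" if "0 < e" for e
    using cInf_lessD[of "J ` V" "m + e"] V(2) that unfolding m_def by auto
  \<comment> \<open>A gap of (1/4)^n in \<open>J\<close> becomes a distance of order (1/2)^n in
    norm, the rate that \<open>L2_complete_rapid\<close> asks for.\<close>
  have "\<forall>n. \<exists>f. f \<in> V \<and> J f < m + (1/4)^n"
    using ex by (metis zero_less_power zero_less_divide_1_iff zero_less_numeral)
  then obtain F where F: "\<And>n. F n \<in> V" "\<And>n. J (F n) < m + (1/4)^n" by metis
  \<comment> \<open>Parallelogram identity: the midpoint of \<open>f\<close> and \<open>g\<close>
    lies in \<open>V\<close>, and \<open>J\<close> is at least \<open>m\<close> there.\<close>
  have cauchy: "(l2n M (\<lambda>x. f x - g x))\<^sup>2 \<le> 2 * (J f - m) + 2 * (J g - m)"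
    if "f \<in> V" "g \<in> V" for f g
  proof -
    have z: "(\<lambda>x. 0) \<in> V" using lin[OF that(1) that(1), of "-1"] by simp
    have s: "(\<lambda>x. f x + 1 * g x) \<in> V" using that by (rule lin)
    have h: "(\<lambda>x. 0 + (1/2) * (f x + 1 * g x)) \<in> V" using lin[OF z s] .
    have l0: "L (\<lambda>x. 0) = 0" using l[OF z z, of 1] by simp
    have lh: "L (\<lambda>x. 0 + (1/2) * (f x + 1 * g x)) = (L f + L g) / 2"
      using l[OF z s, of "1/2"] l[OF that, of 1] l0 by simp
    have "l2n M (\<lambda>x. 0 + (1/2) * (f x + 1 * g x)) = l2n M (\<lambda>x. f x + 1 * g x) / 2"
      using l2n_cmult[of M "1/2" "\<lambda>x. f x + 1 * g x"] by simp
    note hh = this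
    have nh: "(l2n M (\<lambda>x. 0 + (1/2) * (f x + 1 * g x)))\<^sup>2
        = ((l2n M f)\<^sup>2 + 2 * (LINT x|M. f x * g x) + (l2n M g)\<^sup>2) / 4"
      unfolding hh power_divide
      using l2n_add_sq[OF V(1)[OF that(1)] V(1)[OF that(2)], of 1] by simp
    have "m \<le> ((l2n M f)\<^sup>2 + 2 * (LINT x|M. f x * g x) + (l2n M g)\<^sup>2) / 4 - (L f + L g)"
      using mle[OF h] unfolding J_def nh lh by (simp add: field_simps)
    moreover have "(l2n M (\<lambda>x. f x - g x))\<^sup>2 = (l2n M f)\<^sup>2 - 2 * (LINT x|M. f x * g x) + (l2n M g)\<^sup>2"
      using l2n_add_sq[OF V(1)[OF that(1)] V(1)[OF that(2)], of "-1"] by simp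
    ultimately show ?thesis by (simp add: J_def field_simps)
  qed
  have "l2n M (\<lambda>x. F (Suc n) x - F n x) \<le> 2 * (1/2)^n" for n
  proof (rule power2_le_imp_le)
    have "(l2n M (\<lambda>x. F (Suc n) x - F n x))\<^sup>2 \<le> 2 * (1/4)^Suc n + 2 * (1/4)^n"
      using cauchy[OF F(1)[of "Suc n"] F(1)[of n]] F(2)[of "Suc n"] F(2)[of n] by simp
    also have "\<dots> \<le> 4 * (1/4)^n" by simp
    also have "\<dots> = (2 * (1/2)^n)\<^sup>2" by (simp add: power2_eq_square power_mult_distrib[symmetric])
    finally show "(l2n M (\<lambda>x. F (Suc n) x - F n x))\<^sup>2 \<le> (2 * (1/2)^n)\<^sup>2" .
  qed simp
  then obtain q where q: "sq_int M q" "(\<lambda>n. l2n M (\<lambda>x. F n x - q x)) \<longlonglongrightarrow> 0"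
    using L2_complete_rapid[of M F 2] V(1) F(1) by blast
  \<comment> \<open>Approximate Euler-Lagrange equation: \<open>F n\<close> minimises
    \<open>J\<close> up to (1/4)^n, the square of (1/2)^n, so varying it by plus and minus (1/2)^n
    times \<open>f\<close> leaves an error of order (1/2)^n.\<close>
  have var: "\<bar>(LINT x|M. F n x * f x) - L f\<bar> \<le> (1/2)^n * ((l2n M f)\<^sup>2 + 1)" if "f \<in> V" for f n
  proof -
    let ?D = "(LINT x|M. F n x * f x) - L f"
    have e: "- ((1/4)^n) \<le> 2 * t * ?D + t\<^sup>2 * (l2n M f)\<^sup>2" for t
      using mle[OF lin[OF F(1)[of n] that, of t]] F(2)[of n]
      by (simp add: J_def l2n_add_sq V(1) F(1) that l algebra_simps)
    define h where "h = (1/2::real)^n"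
    have h: "h > 0" "(1/4::real)^n = h * h"
      by (simp_all add: h_def power_mult_distrib[symmetric])
    have "h * (2 * \<bar>?D\<bar>) \<le> h * (h * ((l2n M f)\<^sup>2 + 1))"
      using e[of h] e[of "- h"] h(2) by (simp add: power2_eq_square algebra_simps abs_if)
    then have "2 * \<bar>?D\<bar> \<le> h * ((l2n M f)\<^sup>2 + 1)"
      using h(1) by (rule mult_left_le_imp_le)
    then have "\<bar>?D\<bar> \<le> h * ((l2n M f)\<^sup>2 + 1)"
      by (rule order_trans[rotated]) simp
    then show ?thesis unfolding h_def .
  qed
  have "L f = (LINT x|M. q x * f x)" if f: "f \<in> V" for f
  proof (rule LIMSEQ_unique)
    show "(\<lambda>n. LINT x|M. F n x * f x) \<longlonglongrightarrow> L f"
    proof (rule LIM_zero_cancel, rule Lim_null_comparison[OF always_eventually])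
      show "\<forall>n. norm ((LINT x|M. F n x * f x) - L f) \<le> (1/2)^n * ((l2n M f)\<^sup>2 + 1)"
        using var[OF f] by simp
      show "(\<lambda>n. (1/2)^n * ((l2n M f)\<^sup>2 + 1)) \<longlonglongrightarrow> 0"
        by (intro tendsto_mult_left_zero LIMSEQ_power_zero) simp
    qed
    show "(\<lambda>n. LINT x|M. F n x * f x) \<longlonglongrightarrow> (LINT x|M. q x * f x)"
    proof (rule LIM_zero_cancel, rule Lim_null_comparison[OF always_eventually])
      show "\<forall>n. norm ((LINT x|M. F n x * f x) - (LINT x|M. q x * f x)) \<le> l2n M (\<lambda>x. F n x - q x) * l2n M f"
      proof
        fix n
        have "(LINT x|M. F n x * f x) - (LINT x|M. q x * f x) = (LINT x|M. (F n x - q x) * f x)"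
          using V(1)[OF f] V(1)[OF F(1)] q(1)
          by (simp add: left_diff_distrib sq_int_integrable_mult)
        then show "norm ((LINT x|M. F n x * f x) - (LINT x|M. q x * f x)) \<le> l2n M (\<lambda>x. F n x - q x) * l2n M f"
          using l2n_CS[OF sq_int_diff[OF V(1)[OF F(1)] q(1)] V(1)[OF f]] by simp
      qed
      show "(\<lambda>n. l2n M (\<lambda>x. F n x - q x) * l2n M f) \<longlonglongrightarrow> 0"
        by (rule tendsto_mult_left_zero) (rule q)
    qed
  qed
  then show ?thesis using q(1) by blast
qed

section \<open>Smooth functions\<close>

definition smooth :: "(real^'n::finite \<Rightarrow> real) \<Rightarrow> bool" where
  "smooth f \<longleftrightarrow> (\<forall>k. Ck k f)"

text \<open>A combination of partial derivatives rather than the Frechet derivative, hence linear in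
  \<open>e\<close> at every point; \<open>has_derivative_dd\<close> identifies the two where
  \<open>f\<close> is differentiable.\<close>

definition dd :: "real^'n::finite \<Rightarrow> (real^'n \<Rightarrow> real) \<Rightarrow> real^'n \<Rightarrow> real" where
  "dd e f x = (\<Sum>i\<in>UNIV. e $ i * pd i f x)"

definition lap :: "(real^'n::finite \<Rightarrow> real) \<Rightarrow> real^'n \<Rightarrow> real" where
  "lap f x = (\<Sum>i\<in>UNIV. pd i (pd i f) x)"

lemma Ck_SucD: "Ck (Suc k) f \<Longrightarrow> Ck k f"
proof (induction k arbitrary: f)
  case 0
  then show ?case
    by (auto intro!: continuous_at_imp_continuous_on differentiable_imp_continuous_within)
next
  case (Suc k)
  then show ?case by (metis Ck.simps(2))
qed

lemma smooth_differentiable: "smooth f \<Longrightarrow> f differentiable (at x)"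
  using Ck.simps(2)[of 0 f] unfolding smooth_def by blast

lemma smooth_pd: "smooth f \<Longrightarrow> smooth (pd i f)"
  unfolding smooth_def by (metis Ck.simps(2))

lemma smooth_continuous: "smooth f \<Longrightarrow> continuous_on A f"
  unfolding smooth_def by (metis Ck.simps(1) continuous_on_subset subset_UNIV)

lemma pd_has_derivative: "(f has_derivative f') (at x) \<Longrightarrow> pd i f x = f' (axis i 1)"
  unfolding pd_def using frechet_derivative_at by metis

lemma has_derivative_dd:
  assumes "f differentiable (at x)"
  shows "(f has_derivative (\<lambda>h. dd h f x)) (at x)"
proof -
  obtain f' where f': "(f has_derivative f') (at x)"
    using assms by (auto simp: differentiable_def)
  have "f' h = dd h f x" for h
  proof -
    interpret bounded_linear f' using f' by (rule has_derivative_bounded_linear)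
    have "f' h = f' (\<Sum>i\<in>UNIV. (h $ i) *\<^sub>R axis i 1)"
      by (simp add: basis_expansion scalar_mult_eq_scaleR[symmetric])
    also have "\<dots> = dd h f x"
      by (simp add: sum scaleR dd_def pd_has_derivative[OF f'])
    finally show ?thesis .
  qed
  with f' show ?thesis by (metis ext)
qed

lemma dd_has_derivative:
  assumes "(f has_derivative f') (at x)" shows "dd e f x = f' e"
  using has_derivative_dd[of f x] has_derivative_unique[of f f' x "\<lambda>h. dd h f x"] assms
  by (auto simp: differentiable_def)

lemma dd_axis [simp]: "dd (axis i 1) f x = pd i f x"
  by (simp add: dd_def axis_def if_distrib[of "\<lambda>u. u * _"] cong: if_cong)

lemma dd_eq_grad: "dd e f x = grad f x \<bullet> e"
  by (simp add: dd_def grad_def inner_vec_def mult.commute)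

lemma line_has_derivative:
  assumes "f differentiable (at (x + t *\<^sub>R e))"
  shows "((\<lambda>t. f (x + t *\<^sub>R e)) has_real_derivative dd e f (x + t *\<^sub>R e)) (at t)"
proof -
  have "((\<lambda>t. f (x + t *\<^sub>R e)) has_derivative (\<lambda>h. dd (h *\<^sub>R e) f (x + t *\<^sub>R e))) (at t)"
    by (rule has_derivative_compose[of "\<lambda>t. x + t *\<^sub>R e", OF _ has_derivative_dd[OF assms]])
      (auto intro!: derivative_eq_intros)
  moreover have "dd (h *\<^sub>R e) f y = dd e f y * h" for h y
    by (simp add: dd_def sum_distrib_left mult_ac)
  ultimately show ?thesis by (simp add: has_field_derivative_def)
qed

lemma pd_add:
  assumes "f differentiable (at x)" "g differentiable (at x)"
  shows "pd i (\<lambda>x. f x + g x) x = pd i f x + pd i g x"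
  using pd_has_derivative[OF has_derivative_add[OF has_derivative_dd[OF assms(1)] has_derivative_dd[OF assms(2)]], of i]
  by simp

lemma pd_diff:
  assumes "f differentiable (at x)" "g differentiable (at x)"
  shows "pd i (\<lambda>x. f x - g x) x = pd i f x - pd i g x"
  using pd_has_derivative[OF has_derivative_diff[OF has_derivative_dd[OF assms(1)] has_derivative_dd[OF assms(2)]], of i]
  by simp

lemma pd_mult:
  assumes "f differentiable (at x)" "g differentiable (at x)"
  shows "pd i (\<lambda>x. f x * g x) x = f x * pd i g x + pd i f x * g x"
  using pd_has_derivative[OF has_derivative_mult[OF has_derivative_dd[OF assms(1)] has_derivative_dd[OF assms(2)]], of i]
  by simp

lemma pd_const [simp]: "pd i (\<lambda>x. c) = (\<lambda>x. 0)"
  using pd_has_derivative[OF has_derivative_const] by fastforce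

lemma pd_cmult:
  assumes "f differentiable (at x)"
  shows "pd i (\<lambda>x. c * f x) x = c * pd i f x"
  using pd_mult[of "\<lambda>x. c" x f i] assms by simp

lemma Ck_const [simp]: "Ck k (\<lambda>x. c)"
  by (induction k arbitrary: c) auto

lemma Ck_add: "Ck k f \<Longrightarrow> Ck k g \<Longrightarrow> Ck k (\<lambda>x. f x + g x)"
proof (induction k arbitrary: f g)
  case (Suc k)
  then have "pd i (\<lambda>x. f x + g x) = (\<lambda>x. pd i f x + pd i g x)" for i
    by (intro ext pd_add) auto
  with Suc show ?case by (auto intro: differentiable_add)
qed (auto intro: continuous_on_add)

lemma Ck_mult: "Ck k f \<Longrightarrow> Ck k g \<Longrightarrow> Ck k (\<lambda>x. f x * g x)"
proof (induction k arbitrary: f g)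
  case (Suc k)
  then have "pd i (\<lambda>x. f x * g x) = (\<lambda>x. f x * pd i g x + pd i f x * g x)" for i
    by (intro ext pd_mult) auto
  moreover have "Ck k (\<lambda>x. f x * pd i g x + pd i f x * g x)" for i
    using Suc Ck_SucD by (intro Ck_add Suc.IH) (auto simp del: Ck.simps(1))
  ultimately show ?case using Suc.prems by (auto intro: differentiable_mult)
qed (auto intro: continuous_on_mult)

lemma smooth_const [simp]: "smooth (\<lambda>x. c)"
  by (simp add: smooth_def)

lemma smooth_add: "smooth f \<Longrightarrow> smooth g \<Longrightarrow> smooth (\<lambda>x. f x + g x)"
  by (simp add: smooth_def Ck_add)

lemma smooth_mult: "smooth f \<Longrightarrow> smooth g \<Longrightarrow> smooth (\<lambda>x. f x * g x)"
  by (simp add: smooth_def Ck_mult)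

lemma smooth_diff: "smooth f \<Longrightarrow> smooth g \<Longrightarrow> smooth (\<lambda>x. f x - g x)"
  using smooth_add[of f "\<lambda>x. (-1) * g x"] smooth_mult[of "\<lambda>x. -1" g] by simp

lemma smooth_sum: "(\<And>i. i \<in> I \<Longrightarrow> smooth (f i)) \<Longrightarrow> smooth (\<lambda>x. \<Sum>i\<in>I. f i x)"
  by (induction I rule: infinite_finite_induct) (auto intro: smooth_add)

lemma smooth_power: "smooth f \<Longrightarrow> smooth (\<lambda>x. f x ^ n)"
  by (induction n) (auto intro: smooth_mult)

lemma pd_add_smooth: "smooth f \<Longrightarrow> smooth g \<Longrightarrow> pd i (\<lambda>x. f x + g x) = (\<lambda>x. pd i f x + pd i g x)"
  by (auto intro!: pd_add smooth_differentiable)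

lemma pd_diff_smooth: "smooth f \<Longrightarrow> smooth g \<Longrightarrow> pd i (\<lambda>x. f x - g x) = (\<lambda>x. pd i f x - pd i g x)"
  by (auto intro!: pd_diff smooth_differentiable)

lemma pd_mult_smooth: "smooth f \<Longrightarrow> smooth g \<Longrightarrow> pd i (\<lambda>x. f x * g x) = (\<lambda>x. f x * pd i g x + pd i f x * g x)"
  by (auto intro!: pd_mult smooth_differentiable)

lemma pd_cmult_smooth: "smooth f \<Longrightarrow> pd i (\<lambda>x. c * f x) = (\<lambda>x. c * pd i f x)"
  by (auto intro!: pd_cmult smooth_differentiable)

lemma pd_sum_smooth:
  "(\<And>i. i \<in> I \<Longrightarrow> smooth (f i)) \<Longrightarrow> pd j (\<lambda>x. \<Sum>i\<in>I. f i x) = (\<lambda>x. \<Sum>i\<in>I. pd j (f i) x)"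
proof (induction I rule: infinite_finite_induct)
  case (insert i I)
  then show ?case by (simp add: pd_add_smooth smooth_sum)
qed auto

lemma pd_coord: "pd i (\<lambda>x. x $ j) = (\<lambda>x. if i = j then 1 else 0)"
proof
  fix x
  show "pd i (\<lambda>x. x $ j) x = (if i = j then 1 else 0)"
    using pd_has_derivative[OF bounded_linear_imp_has_derivative[OF bounded_linear_vec_nth[of j]], of i x]
    by (simp add: axis_def eq_commute)
qed

lemma smooth_coord: "smooth (\<lambda>x. x $ j)"
  unfolding smooth_def
proof
  fix k show "Ck k (\<lambda>x. x $ j)"
    by (cases k) (auto simp: pd_coord intro: continuous_intros
        bounded_linear_imp_differentiable[OF bounded_linear_vec_nth])
qed

lemma norm_sq_vec: "(norm (x::real^'n::finite))\<^sup>2 = (\<Sum>i\<in>UNIV. (x $ i)\<^sup>2)"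
  by (simp add: norm_vec_def L2_set_def sum_nonneg)

lemma smooth_norm_sq: "smooth (\<lambda>x. (norm x)\<^sup>2)"
  unfolding norm_sq_vec by (intro smooth_sum smooth_power smooth_coord)

lemma pd_norm_sq: "pd i (\<lambda>x. (norm x)\<^sup>2) = (\<lambda>x. 2 * x $ i)"
  unfolding norm_sq_vec
  by (simp add: pd_sum_smooth smooth_coord smooth_power pd_mult_smooth power2_eq_square smooth_mult pd_coord
      if_distrib[of "\<lambda>u. _ * u"] if_distrib[of "\<lambda>u. u * _"] sum.distrib cong: if_cong)

lemma pd_affine:
  assumes "f differentiable (at (c *\<^sub>R x + a))"
  shows "pd i (\<lambda>x. f (c *\<^sub>R x + a)) x = c * pd i f (c *\<^sub>R x + a)"
    and "(\<lambda>x. f (c *\<^sub>R x + a)) differentiable (at x)"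
proof -
  have "((\<lambda>x. f (c *\<^sub>R x + a)) has_derivative (\<lambda>h. dd (c *\<^sub>R h) f (c *\<^sub>R x + a))) (at x)"
    by (rule has_derivative_compose[of "\<lambda>x. c *\<^sub>R x + a", OF _ has_derivative_dd[OF assms]])
      (auto intro!: derivative_eq_intros)
  note d = this
  show "pd i (\<lambda>x. f (c *\<^sub>R x + a)) x = c * pd i f (c *\<^sub>R x + a)"
    unfolding pd_has_derivative[OF d]
    by (simp add: dd_def mult.assoc sum_distrib_left[symmetric] axis_def if_distrib[of "\<lambda>u. u * _"] cong: if_cong)
  show "(\<lambda>x. f (c *\<^sub>R x + a)) differentiable (at x)" using d by (auto simp: differentiable_def)
qed

lemma Ck_affine: "Ck k f \<Longrightarrow> Ck k (\<lambda>x. f (c *\<^sub>R x + a))"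
proof (induction k arbitrary: f)
  case 0
  then show ?case
    by (auto intro!: continuous_on_compose2[of UNIV f] continuous_intros)
next
  case (Suc k)
  then have "pd i (\<lambda>x. f (c *\<^sub>R x + a)) = (\<lambda>x. c * pd i f (c *\<^sub>R x + a))" for i
    by (auto intro!: pd_affine)
  moreover have "Ck k (\<lambda>x. c * pd i f (c *\<^sub>R x + a))" for i
    using Suc by (intro Ck_mult) auto
  ultimately show ?case using Suc.prems by (auto intro: pd_affine)
qed

lemma smooth_affine: "smooth f \<Longrightarrow> smooth (\<lambda>x. f (c *\<^sub>R x + a))"
  by (simp add: smooth_def Ck_affine)

lemma pd_compose_real:
  assumes "(h has_real_derivative d) (at (q x))" "q differentiable (at x)"
  shows "pd i (\<lambda>x. h (q x)) x = d * pd i q x"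
    and "(\<lambda>x. h (q x)) differentiable (at x)"
proof -
  have d: "((\<lambda>x. h (q x)) has_derivative (\<lambda>e. d * dd e q x)) (at x)"
    using has_derivative_compose[OF has_derivative_dd[OF assms(2)]
        assms(1)[unfolded has_field_derivative_def]] by simp
  show "pd i (\<lambda>x. h (q x)) x = d * pd i q x"
    unfolding pd_has_derivative[OF d] by simp
  show "(\<lambda>x. h (q x)) differentiable (at x)" using d by (auto simp: differentiable_def)
qed

text \<open>The functions t^(-n) exp(-1/t), extended by zero to t \<le> 0. Their linear combinations
  are closed under differentiation, so the induction in \<open>Ck_flat\<close> treats all
  \<open>n\<close> at once.\<close>

definition flat :: "nat \<Rightarrow> real \<Rightarrow> real" where
  "flat n t = (if t \<le> 0 then 0 else inverse t ^ n * exp (- inverse t))"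

lemma flat_tendsto_0: "(flat n \<longlongrightarrow> 0) (at 0)"
proof -
  have "((\<lambda>t. inverse t ^ n / exp (inverse t)) \<longlongrightarrow> 0) (at_right (0::real))"
    by (rule filterlim_compose[OF tendsto_power_div_exp_0 filterlim_inverse_at_top_right])
  then have r: "(flat n \<longlongrightarrow> 0) (at_right 0)"
    by (rule Lim_transform_eventually)
      (auto simp: flat_def eventually_at_right_less exp_minus divide_inverse
        intro!: eventually_mono[OF eventually_at_right_less[of 0]])
  have l: "(flat n \<longlongrightarrow> 0) (at_left 0)"
    by (rule Lim_transform_eventually[OF tendsto_const])
      (auto simp: flat_def eventually_at_filter)
  show ?thesis using l r by (simp add: filterlim_at_split)
qed

lemma flat_has_derivative:
  "(flat n has_real_derivative (flat (n + 2) t - real n * flat (n + 1) t)) (at t)"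
proof -
  consider "t < 0" | "t = 0" | "t > 0" by linarith
  then show ?thesis
  proof cases
    case 1
    have "((\<lambda>t. 0) has_real_derivative 0) (at t)" by simp
    then have "(flat n has_real_derivative 0) (at t)"
      by (rule has_field_derivative_transform_within_open[of _ _ _ "{..<0}"])
        (use 1 in \<open>auto simp: flat_def\<close>)
    then show ?thesis using 1 by (simp add: flat_def)
  next
    case 2
    \<comment> \<open>At the origin the difference quotient of \<open>flat n\<close> is
      \<open>flat (n+1)\<close>, which tends to zero.\<close>
    have "((\<lambda>h. (flat n (0 + h) - flat n 0) / h) \<longlongrightarrow> 0) (at 0)"
      by (rule Lim_transform_eventually[OF flat_tendsto_0[of "n+1"]])
        (auto simp: flat_def eventually_at_filter field_simps)
    then show ?thesis using 2 by (simp add: DERIV_def flat_def)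
  next
    case 3
    have "((\<lambda>t. inverse t ^ n * exp (- inverse t)) has_real_derivative
        (inverse t ^ n * (exp (- inverse t) * inverse t ^ 2)
          + (real n * (inverse t ^ (n - 1) * - (inverse t ^ 2))) * exp (- inverse t))) (at t)"
      using 3 by (auto intro!: derivative_eq_intros simp: power2_eq_square)
    moreover have "inverse t ^ n * (exp (- inverse t) * inverse t ^ 2)
          + (real n * (inverse t ^ (n - 1) * - (inverse t ^ 2))) * exp (- inverse t)
        = flat (n + 2) t - real n * flat (n + 1) t"
      using 3 by (cases n) (simp_all add: flat_def power_add power2_eq_square algebra_simps)
    ultimately have "((\<lambda>t. inverse t ^ n * exp (- inverse t)) has_real_derivative
        (flat (n + 2) t - real n * flat (n + 1) t)) (at t)" by simp
    then show ?thesis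
      by (rule has_field_derivative_transform_within_open[of _ _ _ "{0<..}"])
        (use 3 in \<open>auto simp: flat_def\<close>)
  qed
qed

lemma Ck_flat:
  assumes "smooth q" shows "Ck k (\<lambda>x. flat n (q x))"
proof (induction k arbitrary: n)
  case 0
  have "continuous_on UNIV (flat n)"
    using flat_has_derivative[of n] DERIV_isCont
    by (intro continuous_at_imp_continuous_on) blast
  then show ?case using smooth_continuous[OF assms]
    by (auto intro: continuous_on_compose2)
next
  case (Suc k)
  note d = pd_compose_real[OF flat_has_derivative[of n] smooth_differentiable[OF assms]]
  have "pd i (\<lambda>x. flat n (q x))
      = (\<lambda>x. (flat (n + 2) (q x) + - real n * flat (n + 1) (q x)) * pd i q x)" for i
    using d(1) by auto
  moreover have "Ck k (\<lambda>x. (flat (n + 2) (q x) + - real n * flat (n + 1) (q x)) * pd i q x)" for i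
    by (intro Ck_mult Ck_add Suc.IH Ck_const smooth_pd[OF assms, unfolded smooth_def, rule_format])
  ultimately show ?case using d(2) by simp
qed

lemma smooth_flat: "smooth q \<Longrightarrow> smooth (\<lambda>x. flat n (q x))"
  unfolding smooth_def[of "\<lambda>x. flat n (q x)"] using Ck_flat by blast

text \<open>The Japanese bracket of \<open>x\<close> to the power \<open>s\<close>;
  \<open>jb (k + j - m)\<close> is the weight that \<open>weighted_W m k\<close> puts on derivatives
  of order \<open>j\<close>.\<close>

definition jb :: "real \<Rightarrow> real^'n::finite \<Rightarrow> real" where
  "jb s x = (1 + (norm x)\<^sup>2) powr (s / 2)"

lemma one_norm_sq_pos: "0 < 1 + (norm x)\<^sup>2"
  by (simp add: add_pos_nonneg)

lemma jb_pos [simp]: "0 < jb s x"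
  using one_norm_sq_pos[of x] unfolding jb_def by auto

lemma jb_nonneg [simp]: "0 \<le> jb s x" and jb_nz [simp]: "jb s x \<noteq> 0"
  using jb_pos[of s x] by linarith+

lemma jb_add: "jb (s + t) x = jb s x * jb t x"
  by (simp add: jb_def add_divide_distrib powr_add)

lemma jb_0 [simp]: "jb 0 x = 1"
  using one_norm_sq_pos[of x] by (simp add: jb_def)

lemma jb_2: "jb 2 x = 1 + (norm x)\<^sup>2"
  using one_norm_sq_pos[of x] by (simp add: jb_def)

lemma jb_minus: "jb (- s) x = inverse (jb s x)"
  by (simp add: jb_def powr_minus)

lemma has_real_derivative_powr_pos:
  "0 < t \<Longrightarrow> ((\<lambda>t. t powr s) has_real_derivative s * t powr (s - 1)) (at t)"
  by (rule has_real_derivative_powr)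

lemma smooth_jb_diff: 
  shows "(jb s :: real^'n::finite \<Rightarrow> real) differentiable (at x)"
    and "pd i (jb s) x = s * x $ i * jb (s - 2) (x::real^'n::finite)"
proof -
  have d: "(\<lambda>x::real^'n. 1 + (norm x)\<^sup>2) differentiable (at x)"
    by (intro smooth_differentiable smooth_add smooth_norm_sq smooth_const)
  note c = pd_compose_real[OF has_real_derivative_powr_pos[OF one_norm_sq_pos, where s="s/2"] d]
  show "(jb s :: real^'n::finite \<Rightarrow> real) differentiable (at x)"
    using c(2) by (simp add: jb_def[abs_def])
  have "pd i (\<lambda>x::real^'n. 1 + (norm x)\<^sup>2) x = 2 * x $ i"
    by (simp add: pd_add_smooth smooth_norm_sq pd_norm_sq)
  then show "pd i (jb s) x = s * x $ i * jb (s - 2) x"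
    using c(1)[of i] by (simp add: jb_def[abs_def] diff_divide_distrib)
qed

lemma Ck_jb: "Ck k (jb s)"
proof (induction k arbitrary: s)
  case 0
  then show ?case using smooth_jb_diff(1)
    by (auto intro!: continuous_at_imp_continuous_on differentiable_imp_continuous_within)
next
  case (Suc k)
  have "pd i (jb s) = (\<lambda>x. s * x $ i * jb (s - 2) x)" for i :: 'a
    using smooth_jb_diff(2) by blast
  moreover have "Ck k (\<lambda>x. s * x $ i * jb (s - 2) x)" for i :: 'a
    using smooth_coord unfolding smooth_def by (intro Ck_mult Suc.IH Ck_const) blast
  ultimately show ?case by (simp add: smooth_jb_diff(1))
qed

lemma smooth_jb: "smooth (jb s)"
  by (simp add: smooth_def Ck_jb del: Ck.simps)

lemma pd_jb: "pd i (jb s) = (\<lambda>x. s * x $ i * jb (s - 2) x)"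
  using smooth_jb_diff(2) by blast

section \<open>Symmetry of second derivatives\<close>

lemma second_difference_mvt:
  assumes f: "smooth f" and h: "h > 0"
  shows "\<exists>y\<in>cball x (2 * h). f (x + h *\<^sub>R axis i 1 + h *\<^sub>R axis j 1) - f (x + h *\<^sub>R axis i 1)
      - f (x + h *\<^sub>R axis j 1) + f x = h\<^sup>2 * pd j (pd i f) y"
proof -
  let ?i = "axis i 1 :: real^'a" and ?j = "axis j 1 :: real^'a"
  define g where "g s = f (x + h *\<^sub>R ?j + s *\<^sub>R ?i) - f (x + s *\<^sub>R ?i)" for s
  have "(g has_real_derivative (pd i f (x + h *\<^sub>R ?j + s *\<^sub>R ?i) - pd i f (x + s *\<^sub>R ?i))) (at s)" for s
    unfolding g_def using line_has_derivative[OF smooth_differentiable[OF f]]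
    by (intro DERIV_diff) (metis dd_axis)+
  then obtain s where s: "0 < s" "s < h"
      "g h - g 0 = (h - 0) * (pd i f (x + h *\<^sub>R ?j + s *\<^sub>R ?i) - pd i f (x + s *\<^sub>R ?i))"
    using MVT2[of 0 h g "\<lambda>s. pd i f (x + h *\<^sub>R ?j + s *\<^sub>R ?i) - pd i f (x + s *\<^sub>R ?i)"] h by blast
  have "((\<lambda>t. pd i f ((x + s *\<^sub>R ?i) + t *\<^sub>R ?j)) has_real_derivative pd j (pd i f) ((x + s *\<^sub>R ?i) + t *\<^sub>R ?j)) (at t)" for t
    using line_has_derivative[OF smooth_differentiable[OF smooth_pd[OF f]]] by (metis dd_axis)
  then obtain t where t: "0 < t" "t < h"
      "pd i f ((x + s *\<^sub>R ?i) + h *\<^sub>R ?j) - pd i f ((x + s *\<^sub>R ?i) + 0 *\<^sub>R ?j)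
        = (h - 0) * pd j (pd i f) ((x + s *\<^sub>R ?i) + t *\<^sub>R ?j)"
    using MVT2[of 0 h "\<lambda>t. pd i f ((x + s *\<^sub>R ?i) + t *\<^sub>R ?j)" "\<lambda>t. pd j (pd i f) ((x + s *\<^sub>R ?i) + t *\<^sub>R ?j)"] h
    by blast
  have "norm (s *\<^sub>R ?i + t *\<^sub>R ?j) \<le> 2 * h"
    using norm_triangle_ineq[of "s *\<^sub>R ?i" "t *\<^sub>R ?j"] s t by simp
  then have "(x + s *\<^sub>R ?i) + t *\<^sub>R ?j \<in> cball x (2 * h)"
    by (metis (no_types) mem_cball dist_norm norm_minus_cancel add_diff_cancel_left' diff_minus_eq_add
        minus_diff_eq add.assoc diff_add_cancel)
  moreover have "g h - g 0 = h\<^sup>2 * pd j (pd i f) ((x + s *\<^sub>R ?i) + t *\<^sub>R ?j)"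
    using s(3) t(3) by (simp add: power2_eq_square add_ac)
  ultimately show ?thesis by (auto simp: g_def add_ac intro!: bexI)
qed

text \<open>The second difference of \<open>f\<close> does not depend on the order of the two steps,
  and by \<open>second_difference_mvt\<close> it is h^2 times either mixed derivative at a point
  near \<open>x\<close>; different values at \<open>x\<close> would contradict continuity.\<close>

lemma pd_commute:
  assumes f: "smooth f" shows "pd i (pd j f) = pd j (pd i f)"
proof (rule ext, rule ccontr)
  fix x
  let ?A = "pd i (pd j f)" and ?B = "pd j (pd i f)"
  assume n: "?A x \<noteq> ?B x"
  define e where "e = \<bar>?A x - ?B x\<bar> / 2"
  have e: "e > 0" using n by (simp add: e_def)
  have "isCont ?A x" "isCont ?B x"
    using smooth_continuous[OF smooth_pd[OF smooth_pd[OF f]], of UNIV]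
    by (simp_all add: continuous_on_eq_continuous_at)
  then obtain d1 d2 where d: "d1 > 0" "\<And>y. dist y x < d1 \<Longrightarrow> dist (?A y) (?A x) < e"
      "d2 > 0" "\<And>y. dist y x < d2 \<Longrightarrow> dist (?B y) (?B x) < e"
    using e unfolding continuous_at_eps_delta dist_norm by metis
  define h where "h = min d1 d2 / 4"
  have h: "h > 0" "2 * h < d1" "2 * h < d2" using d by (auto simp: h_def)
  obtain y where y: "y \<in> cball x (2*h)" "f (x + h *\<^sub>R axis i 1 + h *\<^sub>R axis j 1) - f (x + h *\<^sub>R axis i 1)
      - f (x + h *\<^sub>R axis j 1) + f x = h\<^sup>2 * ?B y"
    using second_difference_mvt[OF f h(1)] by metis
  obtain z where z: "z \<in> cball x (2*h)" "f (x + h *\<^sub>R axis j 1 + h *\<^sub>R axis i 1) - f (x + h *\<^sub>R axis j 1)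
      - f (x + h *\<^sub>R axis i 1) + f x = h\<^sup>2 * ?A z"
    using second_difference_mvt[OF f h(1)] by metis
  have "h\<^sup>2 * ?B y = h\<^sup>2 * ?A z"
    unfolding y(2)[symmetric] z(2)[symmetric] by (simp add: add_ac)
  then have "?B y = ?A z" using h(1) by simp
  moreover have "dist z x < d1" "dist y x < d2"
    using h y(1) z(1) by (auto simp: dist_commute)
  then have "dist (?A z) (?A x) < e" "dist (?B y) (?B x) < e"
    by (auto intro: d(2) d(4))
  ultimately have "\<bar>?B y - ?A x\<bar> < e" "\<bar>?B y - ?B x\<bar> < e" by (simp_all add: dist_real_def)
  then have "\<bar>?A x - ?B x\<bar> < 2 * e" by (smt (verit))
  then show False by (simp add: e_def)
qed

lemma smooth_lap: "smooth f \<Longrightarrow> smooth (lap f)"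
  unfolding lap_def[abs_def] by (intro smooth_sum smooth_pd)

lemma pd_lap:
  assumes "smooth f" shows "pd i (lap f) = lap (pd i f)"
proof -
  have "pd i (lap f) = (\<lambda>x. \<Sum>j\<in>UNIV. pd i (pd j (pd j f)) x)"
    unfolding lap_def[abs_def] by (intro pd_sum_smooth smooth_pd assms)
  also have "\<dots> = lap (pd i f)"
    using assms by (simp add: lap_def[abs_def] pd_commute[of _ i] smooth_pd)
  finally show ?thesis .
qed

lemma lap_mult:
  assumes "smooth f" "smooth g"
  shows "lap (\<lambda>x. f x * g x) x = f x * lap g x + 2 * (\<Sum>i\<in>UNIV. pd i f x * pd i g x) + lap f x * g x"
  using assms
  by (simp add: lap_def pd_mult_smooth pd_add_smooth smooth_mult smooth_pd sum.distrib
      sum_distrib_left sum_distrib_right algebra_simps)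

lemma smooth_dd: "smooth f \<Longrightarrow> smooth (dd e f)"
  unfolding dd_def[abs_def] by (intro smooth_sum smooth_mult smooth_pd smooth_const)

lemma dd_mult_smooth:
  "smooth f \<Longrightarrow> smooth g \<Longrightarrow> dd e (\<lambda>x. f x * g x) x = f x * dd e g x + dd e f x * g x"
  by (simp add: dd_def pd_mult_smooth sum.distrib sum_distrib_left sum_distrib_right algebra_simps)

lemma dd_commute: "smooth f \<Longrightarrow> dd e (dd e' f) x = dd e' (dd e f) x"
  by (simp add: dd_def[abs_def] pd_sum_smooth smooth_mult smooth_pd pd_cmult_smooth
      sum_distrib_left pd_commute mult.left_commute)
    (subst sum.swap, simp add: mult.left_commute pd_commute)

section \<open>Test functions and locally integrable functions\<close>

lemma test_functionI:
  assumes "smooth \<phi>" "compact K" "K \<subseteq> G" "\<And>x. x \<notin> K \<Longrightarrow> \<phi> x = 0"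
  shows "test_function G \<phi>"
proof -
  have "closure {x. \<phi> x \<noteq> 0} \<subseteq> K"
    using assms by (intro closure_minimal compact_imp_closed) auto
  moreover from this have "compact (closure {x. \<phi> x \<noteq> 0})"
    using compact_Int_closed[OF assms(2) closed_closure, of "{x. \<phi> x \<noteq> 0}"] by (simp add: Int_absorb1)
  ultimately show ?thesis
    using assms(1,3) unfolding test_function_def smooth_def by blast
qed

lemma test_functionE:
  assumes "test_function G \<phi>"
  obtains K where "smooth \<phi>" "compact K" "K \<subseteq> G" "\<And>x. x \<notin> K \<Longrightarrow> \<phi> x = 0"
proof (rule that[of "closure {x. \<phi> x \<noteq> 0}"])
  fix x assume "x \<notin> closure {x. \<phi> x \<noteq> 0}"
  then show "\<phi> x = 0" using closure_subset[of "{x. \<phi> x \<noteq> 0}"] by blast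
qed (use assms in \<open>simp_all add: test_function_def smooth_def\<close>)

lemma test_function_smooth: "test_function G \<phi> \<Longrightarrow> smooth \<phi>"
  by (simp add: test_function_def smooth_def)

lemma test_function_mono: "test_function G \<phi> \<Longrightarrow> G \<subseteq> H \<Longrightarrow> test_function H \<phi>"
  by (auto simp: test_function_def)

lemma test_function_UNIV: "test_function G \<phi> \<Longrightarrow> test_function UNIV \<phi>"
  by (rule test_function_mono) auto

lemma test_function_outside: "test_function G \<phi> \<Longrightarrow> x \<notin> G \<Longrightarrow> \<phi> x = 0"
  by (erule test_functionE) blast

lemma test_function_mult: "smooth a \<Longrightarrow> test_function G \<phi> \<Longrightarrow> test_function G (\<lambda>x. a x * \<phi> x)"
  by (erule test_functionE, rule test_functionI) (auto intro: smooth_mult)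

lemma test_function_mult2: "test_function G \<phi> \<Longrightarrow> smooth a \<Longrightarrow> test_function G (\<lambda>x. \<phi> x * a x)"
  using test_function_mult[of a G \<phi>] by (simp add: mult.commute)

lemma test_function_zero [simp]: "test_function G (\<lambda>x. 0)"
  by (rule test_functionI[of _ "{}"]) auto

lemma test_function_add:
  assumes "test_function G f" "test_function G g" shows "test_function G (\<lambda>x. f x + g x)"
proof -
  obtain K where K: "compact K" "K \<subseteq> G" "\<And>x. x \<notin> K \<Longrightarrow> f x = 0" using assms(1) by (rule test_functionE) blast
  obtain L where L: "compact L" "L \<subseteq> G" "\<And>x. x \<notin> L \<Longrightarrow> g x = 0" using assms(2) by (rule test_functionE) blast
  show ?thesis
    using K L assms by (intro test_functionI[of _ "K \<union> L"]) (auto intro: smooth_add test_function_smooth)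
qed

lemma test_function_sum:
  "(\<And>i. i \<in> I \<Longrightarrow> test_function G (f i)) \<Longrightarrow> test_function G (\<lambda>x. \<Sum>i\<in>I. f i x)"
  by (induction I rule: infinite_finite_induct) (auto intro: test_function_add)

lemma pd_zero_outside:
  assumes "closed K" "\<And>x. x \<notin> K \<Longrightarrow> f x = 0" "x \<notin> K" shows "pd i f x = 0"
proof -
  have "(f has_derivative (\<lambda>h. 0)) (at x)"
    by (rule has_derivative_transform_within_open[of "\<lambda>x. 0" _ _ _ "- K"]) (use assms in auto)
  from pd_has_derivative[OF this] show ?thesis by simp
qed

lemma test_function_pd: "test_function G \<phi> \<Longrightarrow> test_function G (pd i \<phi>)"
  by (erule test_functionE, rule test_functionI)
    (auto intro: smooth_pd pd_zero_outside compact_imp_closed)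

lemma test_function_dd: "test_function G \<phi> \<Longrightarrow> test_function G (dd e \<phi>)"
  unfolding dd_def[abs_def] by (intro test_function_sum test_function_mult test_function_pd smooth_const)

lemma test_function_lap: "test_function G \<phi> \<Longrightarrow> test_function G (lap \<phi>)"
  unfolding lap_def[abs_def] by (intro test_function_sum test_function_pd)

text \<open>Composing a test function with the flow of a graph leaves in general only a C^1
  function. This larger class is closed under such compositions and still pairs with every locally
  integrable function.\<close>

definition cc :: "(real^3 \<Rightarrow> real) \<Rightarrow> bool" where
  "cc f \<longleftrightarrow> continuous_on UNIV f \<and> (\<exists>R. \<forall>x. R < norm x \<longrightarrow> f x = 0)"

lemma ccI: "continuous_on UNIV f \<Longrightarrow> (\<And>x. R < norm x \<Longrightarrow> f x = 0) \<Longrightarrow> cc f"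
  unfolding cc_def by blast

lemma ccE:
  assumes "cc f"
  obtains R where "0 < R" "continuous_on UNIV f" "\<And>x. R < norm x \<Longrightarrow> f x = 0"
proof -
  obtain R where "continuous_on UNIV f" "\<forall>x. R < norm x \<longrightarrow> f x = 0"
    using assms by (auto simp: cc_def)
  then show ?thesis by (intro that[of "max R 1"]) auto
qed

lemma cc_compactI:
  assumes "continuous_on UNIV f" "compact K" "\<And>x. x \<notin> K \<Longrightarrow> f x = 0" shows "cc f"
proof -
  obtain R where "\<And>x. x \<in> K \<Longrightarrow> norm x \<le> R"
    using compact_imp_bounded[OF assms(2)] by (auto simp: bounded_iff)
  then show ?thesis using assms by (intro ccI[of _ R]) force+
qed

lemma cc_test: "test_function G \<phi> \<Longrightarrow> cc \<phi>"
  by (erule test_functionE) (rule cc_compactI, auto intro: smooth_continuous)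

lemma cc_mult: "continuous_on UNIV a \<Longrightarrow> cc f \<Longrightarrow> cc (\<lambda>x. a x * f x)"
  unfolding cc_def by (auto intro!: continuous_intros)

lemma cc_add:
  assumes "cc f" "cc g" shows "cc (\<lambda>x. f x + g x)"
proof -
  from assms(1) obtain R where "continuous_on UNIV f" "\<And>x. R < norm x \<Longrightarrow> f x = 0" by (rule ccE) blast
  moreover from assms(2) obtain S where "continuous_on UNIV g" "\<And>x. S < norm x \<Longrightarrow> g x = 0" by (rule ccE) blast
  ultimately show ?thesis by (intro ccI[of _ "max R S"]) (auto intro!: continuous_intros)
qed

lemma cc_cmult: "cc f \<Longrightarrow> cc (\<lambda>x. c * f x)"
  by (rule cc_mult) auto

lemma cc_borel [measurable_dest]: "cc f \<Longrightarrow> f \<in> borel_measurable borel"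
  unfolding cc_def using borel_measurable_continuous_onI by blast

lemma cc_bounded:
  assumes "cc f" obtains B where "0 < B" "\<And>x. \<bar>f x\<bar> \<le> B"
proof -
  from assms obtain R where R: "0 < R" "continuous_on UNIV f" "\<And>x. R < norm x \<Longrightarrow> f x = 0"
    by (rule ccE) blast
  have "compact (f ` cball 0 R)"
    by (intro compact_continuous_image continuous_on_subset[OF R(2)]) auto
  then obtain B where B: "0 < B" "\<And>x. x \<in> cball 0 R \<Longrightarrow> \<bar>f x\<bar> \<le> B"
    using bounded_pos[of "f ` cball 0 R"] compact_imp_bounded by auto
  have "\<bar>f x\<bar> \<le> B" for x
    using B R(3)[of x] by (cases "norm x \<le> R") auto
  with B(1) show ?thesis using that by blast
qed

section \<open>Local integrability and local square integrability\<close>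

lemma cball_borel [measurable]: "cball (0::real^3) R \<in> sets borel"
  by (simp add: borel_closed)

lemma integrable_cball: "integrable lborel (indicator (cball 0 R) :: real^3 \<Rightarrow> real)"
  using emeasure_bounded_finite[OF bounded_cball, of "0::real^3" R]
  by (intro integrable_real_indicator) auto

text \<open>Borel functions integrated with \<open>lborel\<close>, so that pushforwards and Fubini
  apply without passing through the completion. Lebesgue-measurable data enter through Borel
  representatives.\<close>

definition lloc :: "(real^3 \<Rightarrow> real) \<Rightarrow> bool" where
  "lloc w \<longleftrightarrow> w \<in> borel_measurable borel \<and> (\<forall>R. integrable lborel (\<lambda>x. indicator (cball 0 R) x * w x))"

lemma lloc_borel [measurable_dest]: "lloc w \<Longrightarrow> w \<in> borel_measurable borel"
  by (simp add: lloc_def)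

lemma lloc_cc_integrable:
  assumes "lloc w" "cc f" shows "integrable lborel (\<lambda>x. w x * f x)"
proof -
  from assms(2) obtain R where R: "0 < R" "continuous_on UNIV f" "\<And>x. R < norm x \<Longrightarrow> f x = 0" by (rule ccE) blast
  from assms(2) obtain B where B: "0 < B" "\<And>x. \<bar>f x\<bar> \<le> B" by (rule cc_bounded) blast
  note [measurable] = lloc_borel[OF assms(1)] cc_borel[OF assms(2)]
  show ?thesis
  proof (rule Bochner_Integration.integrable_bound)
    show "integrable lborel (\<lambda>x. B * (indicator (cball 0 R) x * w x))"
      using assms(1) by (simp add: lloc_def)
    have "\<bar>w x * f x\<bar> \<le> \<bar>B * (indicator (cball 0 R) x * w x)\<bar>" for x
      using mult_left_mono[OF B(2)[of x], of "\<bar>w x\<bar>"] B(1) R(3)[of x]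
      by (auto simp: indicator_def abs_mult mult.commute)
    then show "AE x in lborel. norm (w x * f x) \<le> norm (B * (indicator (cball 0 R) x * w x))" by simp
  qed simp_all
qed

lemma lloc_continuous: 
  assumes "continuous_on UNIV w" shows "lloc w"
  unfolding lloc_def
proof (intro conjI allI)
  show "w \<in> borel_measurable borel" using assms by (rule borel_measurable_continuous_onI)
  fix R
  show "integrable lborel (\<lambda>x. indicator (cball 0 R) x * w x)"
    using borel_integrable_compact[of "cball 0 R" w] continuous_on_subset[OF assms] by simp
qed

lemma cc_lloc: "cc f \<Longrightarrow> lloc f"
  by (auto simp: cc_def intro: lloc_continuous)

lemma cc_integrable: "cc f \<Longrightarrow> integrable lborel f"
  using lloc_cc_integrable[of "\<lambda>x. 1" f] by (simp add: lloc_continuous)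

lemma cc_mult_cc: "cc f \<Longrightarrow> cc g \<Longrightarrow> cc (\<lambda>x. f x * g x)"
  by (rule cc_mult) (auto simp: cc_def)

lemma cc_sq_int: "cc f \<Longrightarrow> sq_int lborel f"
  unfolding sq_int_def using cc_integrable[OF cc_mult_cc, of f f]
  by (auto simp: power2_eq_square)

lemma lloc_mult_continuous:
  assumes "lloc w" "continuous_on UNIV a" shows "lloc (\<lambda>x. a x * w x)"
  unfolding lloc_def
proof (intro conjI allI)
  note [measurable] = lloc_borel[OF assms(1)] borel_measurable_continuous_onI[OF assms(2)]
  show "(\<lambda>x. a x * w x) \<in> borel_measurable borel" by measurable
  fix R
  have "compact (a ` cball 0 R)"
    by (intro compact_continuous_image continuous_on_subset[OF assms(2)]) auto
  then obtain B where B: "0 < B" "\<And>x. x \<in> cball 0 R \<Longrightarrow> \<bar>a x\<bar> \<le> B"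
    using bounded_pos[of "a ` cball 0 R"] compact_imp_bounded by auto
  show "integrable lborel (\<lambda>x. indicator (cball 0 R) x * (a x * w x))"
  proof (rule Bochner_Integration.integrable_bound)
    show "integrable lborel (\<lambda>x. B * (indicator (cball 0 R) x * w x))"
      using assms(1) by (simp add: lloc_def)
    have "\<bar>indicator (cball 0 R) x * (a x * w x)\<bar> \<le> \<bar>B * (indicator (cball 0 R) x * w x)\<bar>" for x
      using mult_right_mono[OF B(2)[of x], of "\<bar>w x\<bar>"] B(1)
      by (auto simp: indicator_def abs_mult)
    then show "AE x in lborel. norm (indicator (cball 0 R) x * (a x * w x)) \<le> norm (B * (indicator (cball 0 R) x * w x))"
      by simp
  qed simp_all
qed

lemma lloc_add: "lloc v \<Longrightarrow> lloc w \<Longrightarrow> lloc (\<lambda>x. v x + w x)"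
  unfolding lloc_def by (auto simp: distrib_left)

lemma lloc_cmult: "lloc w \<Longrightarrow> lloc (\<lambda>x. c * w x)"
  using lloc_mult_continuous[of w "\<lambda>x. c"] by simp

lemma lloc_diff: "lloc v \<Longrightarrow> lloc w \<Longrightarrow> lloc (\<lambda>x. v x - w x)"
  using lloc_add[of v "\<lambda>x. -1 * w x"] lloc_cmult[of w "-1"] by simp

lemma sq_int_ball: "sq_int lborel (\<lambda>x::real^3. indicator (cball 0 R) x)"
  unfolding sq_int_def
  by (simp add: power2_eq_square indicator_inter_arith[symmetric] integrable_cball)

lemma sq_int_indicator:
  assumes "sq_int lborel w" "S \<in> sets borel" shows "sq_int lborel (\<lambda>x. indicator S x * w x)"
  using assms by (intro sq_int_bound[OF assms(1)]) (auto simp: indicator_def)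

definition sqloc :: "(real^3 \<Rightarrow> real) \<Rightarrow> bool" where
  "sqloc w \<longleftrightarrow> w \<in> borel_measurable borel \<and> (\<forall>R. sq_int lborel (\<lambda>x. indicator (cball 0 R) x * w x))"

lemma sqloc_lloc: "sqloc w \<Longrightarrow> lloc w"
  unfolding sqloc_def lloc_def
proof (elim conjE, intro conjI allI)
  fix R assume "\<forall>R. sq_int lborel (\<lambda>x. indicator (cball 0 R) x * w x)"
  then have "integrable lborel (\<lambda>x. indicator (cball 0 R) x * (indicator (cball 0 R) x * w x))"
    using sq_int_integrable_mult[OF sq_int_ball] by blast
  then show "integrable lborel (\<lambda>x. indicator (cball 0 R) x * w x)"
    by (simp add: mult.assoc[symmetric] indicator_inter_arith[symmetric])
qed

lemma sq_int_sqloc: "sq_int lborel w \<Longrightarrow> sqloc w"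
  unfolding sqloc_def by (auto intro: sq_int_indicator)

lemma sqloc_mult_continuous:
  assumes "sqloc w" "continuous_on UNIV a" shows "sqloc (\<lambda>x. a x * w x)"
  unfolding sqloc_def
proof (intro conjI allI)
  have [measurable]: "w \<in> borel_measurable borel" "a \<in> borel_measurable borel"
    using assms by (auto simp: sqloc_def intro: borel_measurable_continuous_onI)
  show "(\<lambda>x. a x * w x) \<in> borel_measurable borel" by measurable
  fix R
  have "compact (a ` cball 0 R)"
    by (intro compact_continuous_image continuous_on_subset[OF assms(2)]) auto
  then obtain B where B: "0 < B" "\<And>x. x \<in> cball 0 R \<Longrightarrow> \<bar>a x\<bar> \<le> B"
    using bounded_pos[of "a ` cball 0 R"] compact_imp_bounded by auto
  show "sq_int lborel (\<lambda>x. indicator (cball 0 R) x * (a x * w x))"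
  proof (rule sq_int_bound)
    show "sq_int lborel (\<lambda>x. B * (indicator (cball 0 R) x * w x))"
      using assms(1) by (simp add: sqloc_def sq_int_cmult)
    have "\<bar>indicator (cball 0 R) x * (a x * w x)\<bar> \<le> \<bar>B * (indicator (cball 0 R) x * w x)\<bar>" for x
      using mult_right_mono[OF B(2)[of x], of "\<bar>w x\<bar>"] B(1)
      by (auto simp: indicator_def abs_mult)
    then show "AE x in lborel. \<bar>indicator (cball 0 R) x * (a x * w x)\<bar> \<le> \<bar>B * (indicator (cball 0 R) x * w x)\<bar>"
      by simp
  qed simp_all
qed

lemma sqloc_add: "sqloc v \<Longrightarrow> sqloc w \<Longrightarrow> sqloc (\<lambda>x. v x + w x)"
  unfolding sqloc_def by (auto simp: distrib_left intro: sq_int_add)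

lemma cc_uniformly_continuous:
  assumes "cc f" "0 < e"
  obtains d where "0 < d" "\<And>x y. norm (x - y) < d \<Longrightarrow> \<bar>f x - f y\<bar> < e"
proof -
  from assms(1) obtain R where R: "0 < R" "continuous_on UNIV f" "\<And>x. R < norm x \<Longrightarrow> f x = 0" by (rule ccE) blast
  have "uniformly_continuous_on (cball 0 (R + 1)) f"
    by (intro compact_uniformly_continuous continuous_on_subset[OF R(2)]) auto
  then obtain d where d: "0 < d" "\<And>x y. x \<in> cball 0 (R+1) \<Longrightarrow> y \<in> cball 0 (R+1) \<Longrightarrow> dist y x < d \<Longrightarrow> dist (f y) (f x) < e"
    using assms(2) unfolding uniformly_continuous_on_def by metis
  show ?thesis
  proof (rule that[of "min d 1"])
    fix x y :: "real^3" assume xy: "norm (x - y) < min d 1"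
    have "norm x \<le> norm y + norm (x - y)" "norm y \<le> norm x + norm (x - y)"
      using norm_triangle_sub[of x y] norm_triangle_sub[of y x] by (auto simp: norm_minus_commute)
    then consider "norm x \<le> R + 1" "norm y \<le> R + 1" | "R < norm x" "R < norm y"
      using xy by force
    then show "\<bar>f x - f y\<bar> < e"
    proof cases
      case 1
      then show ?thesis using d(2)[of y x] xy by (auto simp: dist_norm)
    next
      case 2
      then show ?thesis using R(3) assms(2) by simp
    qed
  qed (use d in auto)
qed

text \<open>Dominated convergence along an arbitrary sequence of increments, the quotients being
  bounded by the mean value inequality. A majorant is asked for only at distance at most 1 from
  \<open>t0\<close>, because functions moved by a translation or a flow have a common bounded
  support only for bounded times.\<close>

lemma deriv_under_integral:
  fixes g :: "real \<Rightarrow> 'a \<Rightarrow> real"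
  assumes int: "\<And>t. integrable M (g t)"
    and der: "\<And>t x. x \<in> space M \<Longrightarrow> ((\<lambda>t. g t x) has_real_derivative g' t x) (at t)"
    and bd: "\<And>t x. x \<in> space M \<Longrightarrow> \<bar>t - t0\<bar> \<le> 1 \<Longrightarrow> \<bar>g' t x\<bar> \<le> B x"
    and B: "integrable M B" and meas: "g' t0 \<in> borel_measurable M"
  shows "((\<lambda>t. LINT x|M. g t x) has_real_derivative (LINT x|M. g' t0 x)) (at t0)"
  unfolding DERIV_def tendsto_at_iff_sequentially comp_def
proof (intro allI impI)
  fix h :: "nat \<Rightarrow> real" assume h: "\<forall>i. h i \<in> UNIV - {0}" "h \<longlonglongrightarrow> 0"
  \<comment> \<open>From index \<open>N\<close> on, the increments stay in the interval where the
    majorant is available.\<close>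
  obtain N where N: "\<And>n. n \<ge> N \<Longrightarrow> \<bar>h n\<bar> < 1"
    using h(2) unfolding lim_sequentially dist_real_def by (metis diff_zero zero_less_one)
  have "(\<lambda>n. LINT x|M. (g (t0 + h (n+N)) x - g t0 x) / h (n+N)) \<longlonglongrightarrow> (LINT x|M. g' t0 x)"
  proof (rule integral_dominated_convergence[where w=B])
    show "AE x in M. (\<lambda>n. (g (t0 + h (n+N)) x - g t0 x) / h (n+N)) \<longlonglongrightarrow> g' t0 x"
    proof (rule AE_I2)
      fix x assume x: "x \<in> space M"
      have "(\<lambda>n. (g (t0 + h n) x - g t0 x) / h n) \<longlonglongrightarrow> g' t0 x"
        using der[OF x, of t0] h unfolding DERIV_def tendsto_at_iff_sequentially comp_def by blast
      then show "(\<lambda>n. (g (t0 + h (n+N)) x - g t0 x) / h (n+N)) \<longlonglongrightarrow> g' t0 x"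
        by (rule LIMSEQ_ignore_initial_segment)
    qed
    fix n
    show "AE x in M. norm ((g (t0 + h (n+N)) x - g t0 x) / h (n+N)) \<le> B x"
    proof (rule AE_I2)
      fix x assume x: "x \<in> space M"
      have "norm (g (t0 + h (n+N)) x - g t0 x) \<le> B x * norm (t0 + h (n+N) - t0)"
      proof (rule field_differentiable_bound[of "cball t0 1" "\<lambda>t. g t x" "\<lambda>t. g' t x"])
        show "norm (g' t x) \<le> B x" if "t \<in> cball t0 1" for t
          using bd[OF x, of t] that by (auto simp: dist_real_def abs_minus_commute)
        show "t0 + h (n+N) \<in> cball t0 1" using N[of "n+N"] by (auto simp: dist_real_def)
      qed (auto intro: DERIV_subset[OF der[OF x]])
      then show "norm ((g (t0 + h (n+N)) x - g t0 x) / h (n+N)) \<le> B x"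
        using h(1) by (auto simp: divide_le_eq)
    qed
  qed (use int B meas in auto)
  then have "(\<lambda>n. LINT x|M. (g (t0 + h n) x - g t0 x) / h n) \<longlonglongrightarrow> (LINT x|M. g' t0 x)"
    by (rule LIMSEQ_offset)
  then show "(\<lambda>n. ((LINT x|M. g (t0 + h n) x) - (LINT x|M. g t0 x)) / h n) \<longlonglongrightarrow> (LINT x|M. g' t0 x)"
    by (simp add: int)
qed

section \<open>Translation invariance and integration by parts\<close>

lemma lborel_reflect: "distr lborel borel (\<lambda>x::real^3. t - x) = lborel"
  using lborel_affine[of "-1::real" t] by (simp add: density_1 comp_def one_ennreal_def[symmetric])

lemma integral_reflect:
  fixes f :: "real^3 \<Rightarrow> real"
  assumes [measurable]: "f \<in> borel_measurable borel"
  shows "(LINT x|lborel. f (t - x)) = (LINT x|lborel. f x)"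
  using integral_distr[of "\<lambda>x. t - x" lborel borel f] by (simp add: lborel_reflect)

lemma integral_translate:
  fixes f :: "real^3 \<Rightarrow> real"
  assumes [measurable]: "f \<in> borel_measurable borel"
  shows "(LINT x|lborel. f (x + t)) = (LINT x|lborel. f x)"
proof -
  have "(LINT x|distr lborel borel ((+) t). f x) = (LINT x|lborel. f (t + x))"
    by (rule integral_distr) auto
  then show ?thesis unfolding lborel_distr_plus by (simp add: add.commute)
qed

definition has_dir :: "real^3 \<Rightarrow> (real^3 \<Rightarrow> real) \<Rightarrow> (real^3 \<Rightarrow> real) \<Rightarrow> bool" where
  "has_dir e f f' \<longleftrightarrow> (\<forall>x t. ((\<lambda>t. f (x + t *\<^sub>R e)) has_real_derivative f' (x + t *\<^sub>R e)) (at t))"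

lemma has_dir_differentiable:
  "(\<And>x. f differentiable (at x)) \<Longrightarrow> has_dir e f (dd e f)"
  unfolding has_dir_def by (auto intro: line_has_derivative)

lemma has_dir_smooth: "smooth f \<Longrightarrow> has_dir e f (dd e f)"
  by (auto intro: has_dir_differentiable smooth_differentiable)

lemma cc_shift_bound:
  assumes "\<And>x. R < norm x \<Longrightarrow> f x = (0::real)" "\<And>x. \<bar>f x\<bar> \<le> B" "norm (y - x) \<le> r"
  shows "\<bar>f y\<bar> \<le> B * indicator (cball 0 (R + r)) (x::real^3)"
proof (cases "norm x \<le> R + r")
  case True then show ?thesis using assms(2) by simp
next
  case False
  have "norm x \<le> norm y + r" using norm_triangle_sub[of x y] assms(3) by (simp add: norm_minus_commute)
  with False show ?thesis using assms(1)[of y] by simp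
qed

text \<open>By translation invariance the integral of \<open>f (x + t *\<^sub>R e)\<close> does not
  depend on \<open>t\<close>, and its derivative at 0 is the integral in question.\<close>

lemma integral_dir_zero:
  assumes f: "cc f" "cc f'" and d: "has_dir e f f'"
  shows "(LINT x|lborel. f' x) = 0"
proof -
  note [measurable] = cc_borel[OF f(1)] cc_borel[OF f(2)]
  from f(2) obtain R where R: "0 < R" "\<And>x. R < norm x \<Longrightarrow> f' x = 0" by (rule ccE) blast
  from f(2) obtain B where B: "0 < B" "\<And>x. \<bar>f' x\<bar> \<le> B" by (rule cc_bounded) blast
  have "((\<lambda>t. LINT x|lborel. f (x + t *\<^sub>R e)) has_real_derivative (LINT x|lborel. f' (x + 0 *\<^sub>R e))) (at 0)"
  proof (rule deriv_under_integral[where B="\<lambda>x. B * indicator (cball 0 (R + norm e)) x"])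
    fix t
    have "integrable lborel (\<lambda>x. f (t *\<^sub>R e + x))"
      using integrable_distr_eq[of "\<lambda>x. t *\<^sub>R e + x" lborel borel f] cc_integrable[OF f(1)]
      by (simp add: lborel_distr_plus)
    then show "integrable lborel (\<lambda>x. f (x + t *\<^sub>R e))" by (simp add: add.commute)
    fix x
    show "((\<lambda>t. f (x + t *\<^sub>R e)) has_real_derivative f' (x + t *\<^sub>R e)) (at t)"
      using d by (simp add: has_dir_def)
    assume "\<bar>t - 0\<bar> \<le> 1"
    then show "\<bar>f' (x + t *\<^sub>R e)\<bar> \<le> B * indicator (cball 0 (R + norm e)) x"
      by (intro cc_shift_bound R B) (auto intro: mult_left_le_one_le)
  qed (auto intro!: integrable_mult_right integrable_cball)
  moreover have "(\<lambda>t. LINT x|lborel. f (x + t *\<^sub>R e)) = (\<lambda>t. LINT x|lborel. f x)"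
    by (simp add: integral_translate)
  ultimately have "((\<lambda>t. LINT x|lborel. f x) has_real_derivative (LINT x|lborel. f' x)) (at 0)" by simp
  from DERIV_unique[OF this DERIV_const] show ?thesis .
qed

lemma integral_by_parts:
  assumes "smooth a" "test_function G \<phi>"
  shows "(LINT x|lborel. a x * dd e \<phi> x) = - (LINT x|lborel. dd e a x * \<phi> x)"
proof -
  have s: "smooth \<phi>" using assms(2) by (rule test_function_smooth)
  have "cc (\<lambda>x. a x * dd e \<phi> x)" "cc (\<lambda>x. dd e a x * \<phi> x)"
    by (auto intro!: cc_mult smooth_continuous smooth_dd assms(1)
        cc_test[OF test_function_dd[OF assms(2)]] cc_test[OF assms(2)])
  note c = this
  have "(LINT x|lborel. dd e (\<lambda>x. a x * \<phi> x) x) = 0"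
    by (rule integral_dir_zero[OF _ _ has_dir_smooth])
      (auto intro!: cc_test[of G] test_function_dd test_function_mult smooth_mult s assms)
  then show ?thesis using c by (simp add: dd_mult_smooth assms s cc_integrable)
qed

lemma integral_by_parts_pd:
  assumes "smooth a" "test_function G \<phi>"
  shows "(LINT x|lborel. a x * pd i \<phi> x) = - (LINT x|lborel. pd i a x * \<phi> x)"
  using integral_by_parts[OF assms, of "axis i 1"] by simp

section \<open>Mollification\<close>

definition moll :: "real \<Rightarrow> real^3 \<Rightarrow> real" where
  "moll e x = flat 0 (e\<^sup>2 - (norm x)\<^sup>2) / (LINT y|lborel. flat 0 (e\<^sup>2 - (norm (y::real^3))\<^sup>2))"

lemma flat_nonneg: "0 \<le> flat n t"
  by (simp add: flat_def)

lemma bump_smooth: "smooth (\<lambda>x. flat 0 (e\<^sup>2 - (norm x)\<^sup>2))"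
  by (intro smooth_flat smooth_diff smooth_const smooth_norm_sq)

lemma bump_zero: "0 < e \<Longrightarrow> e \<le> norm x \<Longrightarrow> flat 0 (e\<^sup>2 - (norm x)\<^sup>2) = 0"
  by (simp add: flat_def power_mono)

lemma bump_cc: "0 < e \<Longrightarrow> cc (\<lambda>x. flat 0 (e\<^sup>2 - (norm x)\<^sup>2))"
  by (intro ccI[of _ e] smooth_continuous bump_smooth bump_zero) auto

lemma bump_integral_pos:
  assumes "0 < e" shows "0 < (LINT y|lborel. flat 0 (e\<^sup>2 - (norm (y::real^3))\<^sup>2))"
proof (rule ccontr)
  let ?b = "\<lambda>y::real^3. flat 0 (e\<^sup>2 - (norm y)\<^sup>2)"
  assume "\<not> 0 < (LINT y|lborel. ?b y)"
  moreover have "0 \<le> (LINT y|lborel. ?b y)" by (intro integral_nonneg_AE) (simp add: flat_nonneg)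
  ultimately have "(LINT y|lborel. ?b y) = 0" by simp
  then have "AE y in lborel. ?b y = 0"
    using integral_nonneg_eq_0_iff_AE[OF cc_integrable[OF bump_cc[OF assms]]] by (simp add: flat_nonneg)
  moreover have "?b y \<noteq> 0" if "y \<in> ball 0 e" for y
  proof -
    have "(norm y)\<^sup>2 < e\<^sup>2" using that by (intro power_strict_mono) auto
    then show ?thesis by (simp add: flat_def)
  qed
  ultimately have "AE y in lborel. y \<notin> ball (0::real^3) e" by (auto elim: eventually_mono)
  then have "ball (0::real^3) e \<in> null_sets lborel"
    using AE_iff_null_sets[of "ball (0::real^3) e" lborel] by simp
  then have "negligible (ball (0::real^3) e)"
    by (simp add: negligible_iff_null_sets null_sets_completionI)
  then show False using open_not_negligible[of "ball (0::real^3) e"] assms by simp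
qed

context
  fixes e :: real
  assumes e: "0 < e"
begin

lemma moll_nonneg: "0 \<le> moll e x"
  unfolding moll_def using bump_integral_pos[OF e] by (intro divide_nonneg_pos flat_nonneg)

lemma moll_zero: "e \<le> norm x \<Longrightarrow> moll e x = 0"
  by (simp add: moll_def bump_zero[OF e])

lemma moll_minus: "moll e (- x) = moll e x"
  by (simp add: moll_def)

lemma moll_swap: "moll e (x - y) = moll e (y - x)"
  using moll_minus[of "x - y"] by simp

lemma moll_smooth: "smooth (moll e)"
  unfolding moll_def[abs_def] divide_inverse by (intro smooth_mult bump_smooth smooth_const)

lemma moll_test: "test_function UNIV (moll e)"
  by (rule test_functionI[of _ "cball 0 e"]) (auto intro: moll_smooth moll_zero)

lemma moll_cc: "cc (moll e)"
  by (rule cc_test[OF moll_test])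

lemma moll_integral: "(LINT x|lborel. moll e x) = 1"
  unfolding moll_def using bump_integral_pos[OF e] by simp

end

lemma lloc_abs_integrable:
  "lloc f \<Longrightarrow> integrable lborel (\<lambda>y. \<bar>indicator (cball 0 R) y * f y\<bar>)"
  by (intro integrable_abs) (simp add: lloc_def)

lemma integral_norm_le:
  fixes f g :: "'a \<Rightarrow> real"
  assumes "integrable M f" "integrable M g" "\<And>x. norm (f x) \<le> g x"
  shows "norm (LINT x|M. f x) \<le> (LINT x|M. g x)"
  using assms by (intro order_trans[OF integral_norm_bound integral_mono] integrable_norm)

definition conv :: "(real^3 \<Rightarrow> real) \<Rightarrow> (real^3 \<Rightarrow> real) \<Rightarrow> real^3 \<Rightarrow> real" where
  "conv f \<rho> x = (LINT y|lborel. f y * \<rho> (x - y))"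

lemma cc_reflect: "cc \<rho> \<Longrightarrow> cc (\<lambda>y. \<rho> (x - y))"
proof (erule ccE)
  fix R assume R: "0 < R" "continuous_on UNIV \<rho>" "\<And>x. R < norm x \<Longrightarrow> \<rho> x = 0"
  show "cc (\<lambda>y. \<rho> (x - y))"
  proof (rule ccI[of _ "norm x + R"])
    show "continuous_on UNIV (\<lambda>y. \<rho> (x - y))"
      by (rule continuous_on_compose2[OF R(2)]) (auto intro!: continuous_intros)
    fix y :: "real^3" assume "norm x + R < norm y"
    then show "\<rho> (x - y) = 0"
      using norm_triangle_ineq2[of y x] by (intro R(3)) (simp add: norm_minus_commute)
  qed
qed

lemma conv_alt:
  assumes [measurable]: "f \<in> borel_measurable borel" "\<rho> \<in> borel_measurable borel"
  shows "conv f \<rho> x = (LINT y|lborel. f (x - y) * \<rho> y)"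
  unfolding conv_def
  using integral_reflect[of "\<lambda>y. f y * \<rho> (x - y)" x] by simp

text \<open>Uniform continuity of the partial derivatives makes the Taylor remainder small relative
  to |h| uniformly in \<open>x\<close>. Integrated against a locally integrable function, this gives
  the differentiability of a convolution.\<close>

lemma test_uniform_derivative:
  assumes r: "test_function UNIV \<rho>" and e: "0 < e"
  shows "\<exists>d>0. \<forall>x h. norm h < d \<longrightarrow> \<bar>\<rho> (x + h) - \<rho> x - dd h \<rho> x\<bar> \<le> e * norm h"
proof -
  have "\<forall>i. \<exists>d>0. \<forall>x y. norm (x - y) < d \<longrightarrow> \<bar>pd i \<rho> x - pd i \<rho> y\<bar> < e / 3"
  proof
    fix i
    show "\<exists>d>0. \<forall>x y. norm (x - y) < d \<longrightarrow> \<bar>pd i \<rho> x - pd i \<rho> y\<bar> < e / 3"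
      by (rule cc_uniformly_continuous[OF cc_test[OF test_function_pd[OF r]], of "e/3" i])
        (use e in auto)
  qed
  then obtain d where d: "\<And>i. d i > 0" "\<And>i x y. norm (x - y) < d i \<Longrightarrow> \<bar>pd i \<rho> x - pd i \<rho> y\<bar> < e / 3"
    by metis
  define D where "D = Min (range d)"
  have D: "D > 0" "\<And>i. D \<le> d i" using d(1) by (auto simp: D_def)
  have "\<bar>\<rho> (x + h) - \<rho> x - dd h \<rho> x\<bar> \<le> e * norm h" if h: "norm h < D" for x h
  proof -
    have "((\<lambda>t. \<rho> (x + t *\<^sub>R h)) has_real_derivative dd h \<rho> (x + t *\<^sub>R h)) (at t)" for t
      by (intro line_has_derivative smooth_differentiable test_function_smooth[OF r])
    then obtain t where t: "0 < t" "t < 1" "\<rho> (x + 1 *\<^sub>R h) - \<rho> (x + 0 *\<^sub>R h) = (1 - 0) * dd h \<rho> (x + t *\<^sub>R h)"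
      using MVT2[of 0 1 "\<lambda>t. \<rho> (x + t *\<^sub>R h)" "\<lambda>t. dd h \<rho> (x + t *\<^sub>R h)"] by auto
    have "norm (t *\<^sub>R h) \<le> norm h" using t by (simp add: mult_left_le_one_le)
    then have n: "norm ((x + t *\<^sub>R h) - x) < d i" for i using h D(2)[of i] by simp
    have "\<rho> (x + h) - \<rho> x - dd h \<rho> x = (\<Sum>i\<in>UNIV. h $ i * (pd i \<rho> (x + t *\<^sub>R h) - pd i \<rho> x))"
      using t(3) by (simp add: dd_def sum_subtractf right_diff_distrib)
    also have "\<bar>\<dots>\<bar> \<le> (\<Sum>i\<in>UNIV. \<bar>h $ i * (pd i \<rho> (x + t *\<^sub>R h) - pd i \<rho> x)\<bar>)"
      by (rule sum_abs)
    also have "\<dots> \<le> (\<Sum>i\<in>(UNIV::3 set). norm h * (e / 3))"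
    proof (rule sum_mono)
      fix i :: 3
      have "\<bar>h $ i\<bar> * \<bar>pd i \<rho> (x + t *\<^sub>R h) - pd i \<rho> x\<bar> \<le> norm h * (e / 3)"
        by (intro mult_mono component_le_norm_cart less_imp_le[OF d(2)[OF n]]) auto
      then show "\<bar>h $ i * (pd i \<rho> (x + t *\<^sub>R h) - pd i \<rho> x)\<bar> \<le> norm h * (e / 3)"
        by (simp add: abs_mult)
    qed
    also have "\<dots> = e * norm h" by simp
    finally show ?thesis .
  qed
  with D(1) show ?thesis by blast
qed

lemma lloc_reflect_integrable:
  "lloc f \<Longrightarrow> cc \<rho> \<Longrightarrow> integrable lborel (\<lambda>y. f y * \<rho> (x - y))"
  by (intro lloc_cc_integrable cc_reflect)

lemma conv_dd: 
  assumes f: "lloc f" and r: "test_function UNIV \<rho>"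
  shows "conv f (dd h \<rho>) x = (\<Sum>i\<in>UNIV. h $ i * conv f (pd i \<rho>) x)"
proof -
  have "conv f (dd h \<rho>) x = (LINT y|lborel. (\<Sum>i\<in>UNIV. h $ i * (f y * pd i \<rho> (x - y))))"
    by (simp add: conv_def dd_def sum_distrib_left mult.left_commute)
  also have "\<dots> = (\<Sum>i\<in>UNIV. h $ i * conv f (pd i \<rho>) x)"
    by (simp add: conv_def lloc_reflect_integrable[OF f cc_test[OF test_function_pd[OF r]]])
  finally show ?thesis .
qed

lemma conv_has_derivative:
  assumes f: "lloc f" and r: "test_function UNIV \<rho>"
  shows "(conv f \<rho> has_derivative (\<lambda>h. conv f (dd h \<rho>) x)) (at x)"
  unfolding has_derivative_at_alt
proof (intro conjI allI impI)
  show "bounded_linear (\<lambda>h. conv f (dd h \<rho>) x)"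
    unfolding conv_dd[OF f r]
    by (intro bounded_linear_sum bounded_linear_mult_const bounded_linear_vec_nth)
  fix e :: real assume e: "0 < e"
  from cc_test[OF r] obtain R where R: "0 < R" "continuous_on UNIV \<rho>" "\<And>x. R < norm x \<Longrightarrow> \<rho> x = 0"
    by (rule ccE) (rule that)
  have R': "dd h \<rho> z = 0" if "R < norm z" for z h
  proof -
    have "pd i \<rho> z = 0" for i
      using that R(3) by (intro pd_zero_outside[of "cball 0 R"]) auto
    then show ?thesis by (simp add: dd_def)
  qed
  \<comment> \<open>The displacement will be shorter than 1, so outside the ball of radius
    \<open>S\<close> all three terms of the Taylor remainder vanish.\<close>
  define S where "S = norm x + R + 1"
  define K where "K = (LINT y|lborel. \<bar>indicator (cball 0 S) y * f y\<bar>)"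
  have K0: "0 \<le> K" unfolding K_def by (intro integral_nonneg_AE) simp
  have iK: "integrable lborel (\<lambda>y. \<bar>indicator (cball 0 S) y * f y\<bar>)"
    by (rule lloc_abs_integrable[OF f])
  obtain d where d: "d > 0" "\<And>x h. norm h < d \<Longrightarrow> \<bar>\<rho> (x + h) - \<rho> x - dd h \<rho> x\<bar> \<le> e / (K + 1) * norm h"
    using test_uniform_derivative[OF r, of "e / (K+1)"] e K0 by auto
  show "\<exists>d>0. \<forall>z. norm (z - x) < d \<longrightarrow>
      norm (conv f \<rho> z - conv f \<rho> x - conv f (dd (z - x) \<rho>) x) \<le> e * norm (z - x)"
  proof (intro exI[of _ "min d 1"] conjI allI impI)
    fix z assume z: "norm (z - x) < min d 1"
    define h where "h = z - x"
    define G where "G y = f y * (\<rho> (x - y + h) - \<rho> (x - y) - dd h \<rho> (x - y))" for y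
    have "conv f \<rho> z - conv f \<rho> x - conv f (dd (z - x) \<rho>) x = (LINT y|lborel. G y)"
      unfolding conv_def G_def
      using lloc_reflect_integrable[OF f cc_test[OF r], of z] lloc_reflect_integrable[OF f cc_test[OF r], of x]
        lloc_reflect_integrable[OF f cc_test[OF test_function_dd[OF r, of h]], of x]
      by (simp add: h_def right_diff_distrib)
    also have "norm \<dots> \<le> (LINT y|lborel. (e / (K+1) * norm h) * \<bar>indicator (cball 0 S) y * f y\<bar>)"
    proof (rule integral_norm_le)
      show "integrable lborel G"
        unfolding G_def right_diff_distrib
        using lloc_reflect_integrable[OF f cc_test[OF r], of z] lloc_reflect_integrable[OF f cc_test[OF r], of x]
          lloc_reflect_integrable[OF f cc_test[OF test_function_dd[OF r, of h]], of x]
        by (simp add: h_def)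
      show "integrable lborel (\<lambda>y. (e / (K+1) * norm h) * \<bar>indicator (cball 0 S) y * f y\<bar>)"
        by (intro integrable_mult_right iK)
      fix y
      have q: "\<bar>\<rho> (x - y + h) - \<rho> (x - y) - dd h \<rho> (x - y)\<bar> \<le> e / (K+1) * norm h"
        using z by (intro d) (simp add: h_def)
      show "norm (G y) \<le> (e / (K+1) * norm h) * \<bar>indicator (cball 0 S) y * f y\<bar>"
      proof (cases "norm y \<le> S")
        case True
        then show ?thesis
          using mult_left_mono[OF q, of "\<bar>f y\<bar>"] by (simp add: G_def abs_mult mult_ac)
      next
        case False
        have "norm y \<le> norm x + norm (x - y)" using norm_triangle_sub[of y x] by (simp add: norm_minus_commute)
        then have a: "R + 1 < norm (x - y)" using False by (simp add: S_def)
        have "norm (x - y) \<le> norm (x - y + h) + norm h" using norm_triangle_ineq4[of "x - y + h" h] by simp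
        then have b: "R < norm (x - y + h)" using a z by (simp add: h_def)
        have "G y = 0" using a b R(3) R' by (simp add: G_def)
        then show ?thesis using e K0 by simp
      qed
    qed
    also have "\<dots> = e * norm h * (K / (K+1))" by (simp add: K_def)
    also have "\<dots> \<le> e * norm h" using K0 e by (intro mult_left_le) auto
    finally show "norm (conv f \<rho> z - conv f \<rho> x - conv f (dd (z - x) \<rho>) x) \<le> e * norm (z - x)"
      by (simp add: h_def)
  qed (use d in auto)
qed

lemma pd_conv: "lloc f \<Longrightarrow> test_function UNIV \<rho> \<Longrightarrow> pd i (conv f \<rho>) = conv f (pd i \<rho>)"
proof
  fix x
  assume "lloc f" "test_function UNIV \<rho>"
  then show "pd i (conv f \<rho>) x = conv f (pd i \<rho>) x"
    using pd_has_derivative[OF conv_has_derivative, of f \<rho> i x] by (simp add: dd_axis[abs_def])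
qed

lemma conv_differentiable: "lloc f \<Longrightarrow> test_function UNIV \<rho> \<Longrightarrow> conv f \<rho> differentiable (at x)"
  using conv_has_derivative by (auto simp: differentiable_def)

lemma Ck_conv: "lloc f \<Longrightarrow> test_function UNIV \<rho> \<Longrightarrow> Ck k (conv f \<rho>)"
proof (induction k arbitrary: \<rho>)
  case 0
  then show ?case using conv_differentiable[OF 0]
    by (auto intro!: continuous_at_imp_continuous_on differentiable_imp_continuous_within)
next
  case (Suc k)
  then show ?case by (simp add: pd_conv test_function_pd conv_differentiable)
qed

lemma conv_smooth: "lloc f \<Longrightarrow> test_function UNIV \<rho> \<Longrightarrow> smooth (conv f \<rho>)"
  by (simp add: smooth_def Ck_conv)

definition cv :: "real \<Rightarrow> (real^3 \<Rightarrow> real) \<Rightarrow> real^3 \<Rightarrow> real" where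
  "cv e f = conv f (moll e)"

lemma cv_smooth: "0 < e \<Longrightarrow> lloc f \<Longrightarrow> smooth (cv e f)"
  unfolding cv_def by (intro conv_smooth moll_test)

text \<open>The mollifier is a probability density supported in the ball of radius \<open>e\<close>,
  so \<open>cv e f x\<close> is a mean of values of \<open>f\<close> near \<open>x\<close>.
  Constants, vanishing and uniform convergence are all read off from this bound.\<close>

lemma cv_bound:
  assumes e: "0 < e" and f: "lloc f" and b: "\<And>y. norm (x - y) < e \<Longrightarrow> \<bar>f y - c\<bar> \<le> b"
  shows "\<bar>cv e f x - c\<bar> \<le> b"
proof -
  note i = lloc_reflect_integrable[OF _ moll_cc[OF e], of _ x]
  have i1: "integrable lborel (\<lambda>y. moll e (x - y))"
    using i[of "\<lambda>y. 1"] by (simp add: lloc_continuous)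
  have [measurable]: "moll e \<in> borel_measurable borel" by (rule cc_borel[OF moll_cc[OF e]])
  have I1: "(LINT y|lborel. moll e (x - y)) = 1"
    using integral_reflect[of "moll e" x] moll_integral[OF e] by simp
  have "cv e f x - c = (LINT y|lborel. (f y - c) * moll e (x - y))"
    using i[OF f] i1 I1 by (simp add: cv_def conv_def left_diff_distrib)
  also have "norm \<dots> \<le> (LINT y|lborel. b * moll e (x - y))"
  proof (rule integral_norm_le)
    show "integrable lborel (\<lambda>y. (f y - c) * moll e (x - y))"
      using i[OF f] i1 by (simp add: left_diff_distrib)
    show "integrable lborel (\<lambda>y. b * moll e (x - y))" using i1 by simp
    fix y show "norm ((f y - c) * moll e (x - y)) \<le> b * moll e (x - y)"
      using b[of y] moll_nonneg[OF e, of "x - y"] moll_zero[OF e, of "x - y"]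
      by (cases "norm (x - y) < e") (auto simp: abs_mult intro: mult_right_mono)
  qed
  also have "\<dots> = b" using I1 by simp
  finally show ?thesis by simp
qed

lemma cv_zero:
  assumes e: "0 < e" and f: "lloc f" and b: "\<And>y. norm (x - y) < e \<Longrightarrow> f y = 0"
  shows "cv e f x = 0"
  using cv_bound[OF e f, of x 0 0] b by simp

lemma cv_const: "0 < e \<Longrightarrow> cv e (\<lambda>x. c) x = c"
  using cv_bound[of e "\<lambda>x. c" x c 0] by (simp add: lloc_continuous)

lemma cv_uniform:
  assumes "cc f" "0 < b"
  shows "\<exists>d>0. \<forall>e. 0 < e \<and> e < d \<longrightarrow> (\<forall>x. \<bar>cv e f x - f x\<bar> \<le> b)"
proof -
  obtain d where d: "0 < d" "\<And>x y. norm (x - y) < d \<Longrightarrow> \<bar>f x - f y\<bar> < b"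
    by (rule cc_uniformly_continuous[OF assms]) (rule that)
  have "\<bar>cv e f x - f x\<bar> \<le> b" if "0 < e" "e < d" for e x
    using that d(2)[of x] by (intro cv_bound cc_lloc assms(1)) (auto simp: abs_minus_commute intro!: less_imp_le)
  then show ?thesis using d(1) by blast
qed

lemma cv_test:
  assumes e: "0 < e" and f: "lloc f" and K: "compact K" "\<And>x. x \<notin> K \<Longrightarrow> f x = 0"
    and G: "\<And>x. x \<in> K \<Longrightarrow> cball x e \<subseteq> G"
  shows "test_function G (cv e f)"
proof (rule test_functionI)
  show "smooth (cv e f)" by (rule cv_smooth[OF e f])
  show "compact {x + y |x y. x \<in> K \<and> y \<in> cball 0 e}" by (intro compact_sums K) auto
  show "{x + y |x y. x \<in> K \<and> y \<in> cball 0 e} \<subseteq> G"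
    using G by (force simp: dist_norm)
  fix x assume x: "x \<notin> {x + y |x y. x \<in> K \<and> y \<in> cball 0 e}"
  show "cv e f x = 0"
  proof (rule cv_zero[OF e f], rule K(2), rule notI)
    fix y assume y: "norm (x - y) < e" "y \<in> K"
    then have "x = y + (x - y) \<and> y \<in> K \<and> x - y \<in> cball 0 e" by simp
    with x show False by blast
  qed
qed

lemma cc_compact_support:
  assumes "cc f" obtains K where "compact K" "\<And>x. x \<notin> K \<Longrightarrow> f x = 0"
proof -
  from assms obtain R where "0 < R" "continuous_on UNIV f" "\<And>x. R < norm x \<Longrightarrow> f x = 0" by (rule ccE) (rule that)
  then show ?thesis by (intro that[of "cball 0 R"]) auto
qed

lemma cv_test_UNIV: "0 < e \<Longrightarrow> cc f \<Longrightarrow> test_function UNIV (cv e f)"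
proof (rule cc_compact_support)
  assume "0 < e" "cc f"
  then show "test_function UNIV (cv e f)" if "compact K" "\<And>x. x \<notin> K \<Longrightarrow> f x = 0" for K
    using that by (intro cv_test[where K=K] cc_lloc) auto
qed

lemma has_dir_at:
  "has_dir e f f' \<Longrightarrow> ((\<lambda>t. f (x + t *\<^sub>R e)) has_real_derivative f' (x + t *\<^sub>R e)) (at t)"
  by (simp add: has_dir_def)

text \<open>With the convolution written as the integral of \<open>f (x - y)\<close> against the
  mollifier, the derivative falls on \<open>f\<close>, and only the behaviour of \<open>f\<close>
  along lines in direction \<open>a\<close> matters. So derivatives of mollifications are identified
  for functions that are not smooth.\<close>

lemma cv_dir:
  assumes e: "0 < e" and f: "continuous_on UNIV f" "continuous_on UNIV f'" and d: "has_dir a f f'"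
  shows "dd a (cv e f) = cv e f'"
proof
  fix x :: "real^3"
  have [measurable]: "f \<in> borel_measurable borel" "f' \<in> borel_measurable borel" "moll e \<in> borel_measurable borel"
    using f cc_borel[OF moll_cc[OF e]] by (auto intro: borel_measurable_continuous_onI)
  define S where "S = norm x + norm a + e"
  have "compact (f' ` cball 0 S)"
    by (intro compact_continuous_image continuous_on_subset[OF f(2)]) auto
  then obtain B where B: "0 < B" "\<And>x. x \<in> cball 0 S \<Longrightarrow> \<bar>f' x\<bar> \<le> B"
    using bounded_pos[of "f' ` cball 0 S"] compact_imp_bounded by auto
  have alt: "cv e g z = (LINT y|lborel. g (z - y) * moll e y)" if "g \<in> borel_measurable borel" for g z
    unfolding cv_def using that by (intro conv_alt) auto
  have "((\<lambda>t. LINT y|lborel. f (x + t *\<^sub>R a - y) * moll e y) has_real_derivative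
      (LINT y|lborel. f' (x + 0 *\<^sub>R a - y) * moll e y)) (at 0)"
  proof (rule deriv_under_integral[where B="\<lambda>y. B * moll e y"])
    fix t
    show "integrable lborel (\<lambda>y. f (x + t *\<^sub>R a - y) * moll e y)"
      by (intro lloc_cc_integrable moll_cc[OF e] lloc_continuous continuous_on_compose2[OF f(1)] continuous_intros) auto
    fix y :: "real^3"
    show "((\<lambda>t. f (x + t *\<^sub>R a - y) * moll e y) has_real_derivative f' (x + t *\<^sub>R a - y) * moll e y) (at t)"
      using has_dir_at[OF d, of "x - y" t] by (intro DERIV_cmult_right) (simp add: algebra_simps)
    assume t: "\<bar>t - 0\<bar> \<le> 1"
    show "\<bar>f' (x + t *\<^sub>R a - y) * moll e y\<bar> \<le> B * moll e y"
    proof (cases "norm y < e")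
      case True
      have "norm (x + t *\<^sub>R a - y) \<le> norm x + norm (t *\<^sub>R a) + norm y"
        using norm_triangle_ineq4[of "x + t *\<^sub>R a" y] norm_triangle_ineq[of x "t *\<^sub>R a"] by linarith
      also have "norm (t *\<^sub>R a) \<le> norm a" using t by (simp add: mult_left_le_one_le)
      finally have "\<bar>f' (x + t *\<^sub>R a - y)\<bar> \<le> B" using True by (intro B) (simp add: S_def)
      then show ?thesis using moll_nonneg[OF e, of y] by (simp add: abs_mult mult_right_mono)
    next
      case False
      then show ?thesis using moll_zero[OF e, of y] by simp
    qed
  qed (auto intro: cc_integrable moll_cc e)
  then have "((\<lambda>t. cv e f (x + t *\<^sub>R a)) has_real_derivative cv e f' x) (at 0)"
    by (simp add: alt)
  moreover have "((\<lambda>t. cv e f (x + t *\<^sub>R a)) has_real_derivative dd a (cv e f) (x + 0 *\<^sub>R a)) (at 0)"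
    by (intro line_has_derivative smooth_differentiable cv_smooth e lloc_continuous f)
  ultimately show "dd a (cv e f) x = cv e f' x" by (simp add: DERIV_unique)
qed

lemma cv_dd: "0 < e \<Longrightarrow> smooth f \<Longrightarrow> dd a (cv e f) = cv e (dd a f)"
  by (intro cv_dir smooth_continuous smooth_dd has_dir_smooth)

lemma cv_pd: "0 < e \<Longrightarrow> smooth f \<Longrightarrow> pd i (cv e f) = cv e (pd i f)"
  using cv_dd[of e f "axis i 1"] by (simp add: fun_eq_iff[of "dd _ _"] dd_axis[abs_def])

lemma cv_sum:
  assumes "0 < e" "\<And>i. i \<in> I \<Longrightarrow> lloc (f i)"
  shows "cv e (\<lambda>x. \<Sum>i\<in>I. f i x) x = (\<Sum>i\<in>I. cv e (f i) x)"
  unfolding cv_def conv_def sum_distrib_right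
  using lloc_reflect_integrable[OF assms(2) moll_cc[OF assms(1)]] by (simp add: Bochner_Integration.integral_sum)

lemma cv_lap:
  assumes "0 < e" "smooth f" shows "lap (cv e f) = cv e (lap f)"
proof
  fix x
  show "lap (cv e f) x = cv e (lap f) x"
    unfolding lap_def[abs_def] using assms
    by (simp add: cv_sum cv_pd smooth_pd lloc_continuous smooth_continuous)
qed

lemma DERIV_abs_le:
  assumes "(f has_real_derivative D) (at 0)" "\<And>t. \<bar>f t - f 0\<bar> \<le> K * \<bar>t\<bar>"
  shows "\<bar>D\<bar> \<le> K"
proof -
  have "((\<lambda>h. \<bar>(f (0 + h) - f 0) / h\<bar>) \<longlongrightarrow> \<bar>D\<bar>) (at 0)"
    using assms(1) unfolding DERIV_def by (rule tendsto_rabs)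
  moreover have "\<forall>\<^sub>F h in at 0. \<bar>(f (0 + h) - f 0) / h\<bar> \<le> K"
    using assms(2) by (auto simp: eventually_at_filter abs_divide divide_le_eq intro!: always_eventually)
  ultimately show ?thesis by (intro tendsto_upperbound[of _ _ "at 0"]) auto
qed

text \<open>An increment of the mollification is a mean of increments of \<open>f\<close>, so the
  Lipschitz constant survives without any derivative of \<open>f\<close> being formed.\<close>

lemma cv_lipschitz_dd:
  assumes e: "0 < e" and L: "\<And>x y. \<bar>f x - f y\<bar> \<le> L * norm (x - y)" and f: "continuous_on UNIV f"
  shows "\<bar>dd a (cv e f) x\<bar> \<le> L * norm a"
proof (rule DERIV_abs_le)
  have "((\<lambda>t. cv e f (x + t *\<^sub>R a)) has_real_derivative dd a (cv e f) (x + 0 *\<^sub>R a)) (at 0)"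
    by (intro line_has_derivative smooth_differentiable cv_smooth e lloc_continuous f)
  then show "((\<lambda>t. cv e f (x + t *\<^sub>R a)) has_real_derivative dd a (cv e f) x) (at 0)" by simp
  fix t
  have [measurable]: "f \<in> borel_measurable borel" "moll e \<in> borel_measurable borel"
    using f cc_borel[OF moll_cc[OF e]] by (auto intro: borel_measurable_continuous_onI)
  have "integrable lborel (\<lambda>y. f (z - y) * moll e y)" for z
    by (intro lloc_cc_integrable moll_cc[OF e] lloc_continuous continuous_on_compose2[OF f] continuous_intros) auto
  note i = this
  have "cv e f (x + t *\<^sub>R a) - cv e f (x + 0 *\<^sub>R a) = (LINT y|lborel. (f (x + t *\<^sub>R a - y) - f (x - y)) * moll e y)"
    using i by (simp add: cv_def conv_alt left_diff_distrib)
  also have "norm \<dots> \<le> (LINT y|lborel. (L * norm (t *\<^sub>R a)) * moll e y)"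
  proof (rule integral_norm_le)
    fix y
    have "\<bar>f (x + t *\<^sub>R a - y) - f (x - y)\<bar> \<le> L * norm (t *\<^sub>R a)"
      using L[of "x + t *\<^sub>R a - y" "x - y"] by simp
    then show "norm ((f (x + t *\<^sub>R a - y) - f (x - y)) * moll e y) \<le> (L * norm (t *\<^sub>R a)) * moll e y"
      using moll_nonneg[OF e, of y] by (simp add: abs_mult mult_right_mono)
  qed (use i cc_integrable[OF moll_cc[OF e]] in \<open>simp_all add: left_diff_distrib\<close>)
  also have "\<dots> = L * norm a * \<bar>t\<bar>" by (simp add: moll_integral[OF e])
  finally show "\<bar>cv e f (x + t *\<^sub>R a) - cv e f (x + 0 *\<^sub>R a)\<bar> \<le> L * norm a * \<bar>t\<bar>" by simp
qed

text \<open>Fubini together with the evenness of the mollifier: mollification is symmetric for the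
  integral pairing.\<close>

lemma cv_pairing:
  assumes e: "0 < e" and z: "lloc z" and p: "cc \<phi>"
  shows "(LINT x|lborel. cv e z x * \<phi> x) = (LINT x|lborel. z x * cv e \<phi> x)"
proof -
  note [measurable] = lloc_borel[OF z] cc_borel[OF p] cc_borel[OF moll_cc[OF e]]
  from p obtain R where R: "0 < R" "continuous_on UNIV \<phi>" "\<And>x. R < norm x \<Longrightarrow> \<phi> x = 0" by (rule ccE) (rule that)
  define S where "S = R + e"
  obtain M where M: "0 < M" "\<And>x. \<bar>moll e x\<bar> \<le> M" by (rule cc_bounded[OF moll_cc[OF e]]) (rule that)
  define F where "F xy = (z (snd xy) * moll e (fst xy - snd xy)) * \<phi> (fst xy)" for xy :: "(real^3) \<times> (real^3)"
  have F: "F (x, y) = (z y * moll e (x - y)) * \<phi> x" for x y by (simp add: F_def)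
  \<comment> \<open>The support of \<phi> and that of the mollifier confine \<open>y\<close> to the
    ball of radius \<open>S\<close>, which gives a majorant with separated variables.\<close>
  have bF: "\<bar>F (x, y)\<bar> \<le> (M * \<bar>\<phi> x\<bar>) * \<bar>indicator (cball 0 S) y * z y\<bar>" for x y
  proof (cases "F (x, y) = 0")
    case True then show ?thesis using M(1) by simp
  next
    case False
    then have "norm x \<le> R" "norm (x - y) < e"
      using R(3)[of x] moll_zero[OF e, of "x - y"] by (force simp: F)+
    then have "norm y \<le> S" using norm_triangle_sub[of y x] by (simp add: S_def norm_minus_commute)
    then have "\<bar>F (x, y)\<bar> = \<bar>moll e (x - y)\<bar> * (\<bar>\<phi> x\<bar> * \<bar>indicator (cball 0 S) y * z y\<bar>)"
      by (simp add: F abs_mult mult_ac)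
    also have "\<dots> \<le> M * (\<bar>\<phi> x\<bar> * \<bar>indicator (cball 0 S) y * z y\<bar>)"
      by (intro mult_right_mono M) auto
    finally show ?thesis by (simp add: mult_ac)
  qed
  have iz: "integrable lborel (\<lambda>y. \<bar>indicator (cball 0 S) y * z y\<bar>)"
    by (rule lloc_abs_integrable[OF z])
  have [measurable]: "F \<in> borel_measurable (borel \<Otimes>\<^sub>M borel)" unfolding F_def by measurable
  have i2: "integrable lborel (\<lambda>y. F (x, y))" for x
  proof (rule Bochner_Integration.integrable_bound)
    show "integrable lborel (\<lambda>y. (M * \<bar>\<phi> x\<bar>) * \<bar>indicator (cball 0 S) y * z y\<bar>)" by (intro integrable_mult_right iz)
    show "AE y in lborel. norm (F (x, y)) \<le> norm ((M * \<bar>\<phi> x\<bar>) * \<bar>indicator (cball 0 S) y * z y\<bar>)"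
      using bF M(1) by (simp add: abs_mult)
  qed (simp add: F)
  have "integrable (lborel \<Otimes>\<^sub>M lborel) F"
  proof (rule lborel_pair.Fubini_integrable)
    show "F \<in> borel_measurable (lborel \<Otimes>\<^sub>M lborel)" by measurable
    show "AE x in lborel. integrable lborel (\<lambda>y. F (x, y))" using i2 by simp
    define A where "A = (LINT y|lborel. \<bar>indicator (cball 0 S) y * z y\<bar>)"
    show "integrable lborel (\<lambda>x. LINT y|lborel. norm (F (x, y)))"
    proof (rule Bochner_Integration.integrable_bound)
      show "integrable lborel (\<lambda>x. (M * \<bar>\<phi> x\<bar>) * A)"
        using cc_integrable[OF p] by (intro integrable_mult_left integrable_mult_right integrable_abs)
      show "(\<lambda>x. LINT y|lborel. norm (F (x, y))) \<in> borel_measurable lborel" by measurable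
      have A0: "0 \<le> A" unfolding A_def by (intro integral_nonneg_AE) simp
      have "(LINT y|lborel. norm (F (x, y))) \<le> (LINT y|lborel. (M * \<bar>\<phi> x\<bar>) * \<bar>indicator (cball 0 S) y * z y\<bar>)" for x
        using bF i2 iz by (intro integral_mono integrable_norm) auto
      then have "\<bar>LINT y|lborel. norm (F (x, y))\<bar> \<le> \<bar>(M * \<bar>\<phi> x\<bar>) * A\<bar>" for x
        using A0 M(1) by (simp add: A_def abs_mult)
      then show "AE x in lborel. norm (LINT y|lborel. norm (F (x, y))) \<le> norm ((M * \<bar>\<phi> x\<bar>) * A)" by simp
    qed
  qed
  then have "(LINT y|lborel. LINT x|lborel. F (x, y)) = (LINT x|lborel. LINT y|lborel. F (x, y))"
    using lborel_pair.Fubini_integral[of "\<lambda>x y. F (x, y)"] by simp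
  moreover have "(LINT y|lborel. F (x, y)) = cv e z x * \<phi> x" for x
    by (simp add: F cv_def conv_def)
  moreover have "(LINT x|lborel. F (x, y)) = z y * cv e \<phi> y" for y
  proof -
    have "(LINT x|lborel. F (x, y)) = (LINT x|lborel. z y * (\<phi> x * moll e (y - x)))"
      by (simp add: F moll_swap[OF e, of _ y] mult_ac)
    then show ?thesis by (simp add: cv_def conv_def)
  qed
  ultimately show ?thesis by simp
qed

lemma cv_cc: "0 < e \<Longrightarrow> cc f \<Longrightarrow> cc (cv e f)"
  by (intro cc_test[OF cv_test_UNIV])

lemma cv_integral: "0 < e \<Longrightarrow> cc g \<Longrightarrow> (LINT x|lborel. cv e g x) = (LINT x|lborel. g x)"
  using cv_pairing[of e "\<lambda>x. 1" g] by (simp add: cv_const lloc_continuous)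

text \<open>Jensen's inequality, obtained from the nonnegative variance of \<phi> under the density
  of the mollifier centred at \<open>x\<close>; integration in \<open>x\<close> then preserves mass
  by \<open>cv_integral\<close>.\<close>

lemma cv_l2n:
  assumes e: "0 < e" and p: "cc \<phi>" shows "l2n lborel (cv e \<phi>) \<le> l2n lborel \<phi>"
proof -
  have p2: "cc (\<lambda>x. (\<phi> x)\<^sup>2)" using cc_mult_cc[OF p p] by (simp add: power2_eq_square)
  have j: "(cv e \<phi> x)\<^sup>2 \<le> cv e (\<lambda>x. (\<phi> x)\<^sup>2) x" for x
  proof -
    let ?c = "cv e \<phi> x"
    note i = lloc_reflect_integrable[OF cc_lloc moll_cc[OF e], of _ x]
    have i1: "integrable lborel (\<lambda>y. moll e (x - y))"
      using lloc_reflect_integrable[OF lloc_continuous moll_cc[OF e], of "\<lambda>y. 1" x] by simp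
    have I1: "(LINT y|lborel. moll e (x - y)) = 1"
      using cv_const[OF e, of 1 x] by (simp add: cv_def conv_def)
    have "0 \<le> (LINT y|lborel. (\<phi> y - ?c)\<^sup>2 * moll e (x - y))"
      using moll_nonneg[OF e] by (intro integral_nonneg_AE) simp
    also have "\<dots> = (LINT y|lborel. (\<phi> y)\<^sup>2 * moll e (x - y) - 2 * ?c * (\<phi> y * moll e (x - y)) + ?c\<^sup>2 * moll e (x - y))"
      by (intro Bochner_Integration.integral_cong) (auto simp: power2_diff algebra_simps)
    also have "\<dots> = cv e (\<lambda>x. (\<phi> x)\<^sup>2) x - 2 * ?c * ?c + ?c\<^sup>2"
      using i[OF p] i[OF p2] i1 I1 by (simp add: cv_def conv_def)
    finally show ?thesis by (simp add: power2_eq_square)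
  qed
  have "(LINT x|lborel. (cv e \<phi> x)\<^sup>2) \<le> (LINT x|lborel. cv e (\<lambda>x. (\<phi> x)\<^sup>2) x)"
    using cc_sq_int[OF cv_cc[OF e p]] cc_integrable[OF cv_cc[OF e p2]]
    by (intro integral_mono j) (auto simp: sq_int_def)
  also have "\<dots> = (LINT x|lborel. (\<phi> x)\<^sup>2)" by (rule cv_integral[OF e p2])
  finally show ?thesis by (simp add: l2n_def)
qed

text \<open>Uniform convergence controls the pairing with a locally integrable function because all
  functions vanish outside one common ball.\<close>

lemma pairing_tendsto:
  assumes w: "lloc w" and c: "\<And>n. cc (f n)" "cc g"
    and s: "\<And>n x. R < norm x \<Longrightarrow> f n x = 0" "\<And>x. R < norm x \<Longrightarrow> g x = 0"
    and u: "\<And>b. 0 < b \<Longrightarrow> \<forall>\<^sub>F n in sequentially. \<forall>x. \<bar>f n x - g x\<bar> \<le> b"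
  shows "(\<lambda>n. LINT x|lborel. w x * f n x) \<longlonglongrightarrow> (LINT x|lborel. w x * g x)"
proof (rule tendstoI)
  fix b :: real assume b: "0 < b"
  define K where "K = (LINT y|lborel. \<bar>indicator (cball 0 R) y * w y\<bar>)"
  have iK: "integrable lborel (\<lambda>y. \<bar>indicator (cball 0 R) y * w y\<bar>)"
    by (rule lloc_abs_integrable[OF w])
  have K0: "0 \<le> K" unfolding K_def by (intro integral_nonneg_AE) simp
  have "\<forall>\<^sub>F n in sequentially. \<forall>x. \<bar>f n x - g x\<bar> \<le> b / (K + 1)"
    using b K0 by (intro u) auto
  then show "\<forall>\<^sub>F n in sequentially. dist (LINT x|lborel. w x * f n x) (LINT x|lborel. w x * g x) < b"
  proof eventually_elim
    case (elim n)
    have i: "integrable lborel (\<lambda>x. w x * f n x)" "integrable lborel (\<lambda>x. w x * g x)"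
      by (intro lloc_cc_integrable w c)+
    have "(LINT x|lborel. w x * f n x) - (LINT x|lborel. w x * g x) = (LINT x|lborel. w x * (f n x - g x))"
      using i by (simp add: right_diff_distrib)
    also have "norm \<dots> \<le> (LINT x|lborel. b / (K+1) * \<bar>indicator (cball 0 R) x * w x\<bar>)"
    proof (rule integral_norm_le)
      fix x
      show "norm (w x * (f n x - g x)) \<le> b / (K+1) * \<bar>indicator (cball 0 R) x * w x\<bar>"
      proof (cases "norm x \<le> R")
        case True
        then show ?thesis using mult_left_mono[OF elim[rule_format, of x], of "\<bar>w x\<bar>"]
          by (simp add: abs_mult mult.commute)
      next
        case False
        then show ?thesis using s(1)[of x n] s(2)[of x] K0 b by simp
      qed
    qed (use i iK in \<open>simp_all add: right_diff_distrib\<close>)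
    also have "\<dots> = b * (K / (K+1))" by (simp add: K_def)
    also have "\<dots> < b" using K0 b by (simp add: field_simps)
    finally show ?case by (simp add: dist_real_def)
  qed
qed

lemma cv_pairing_tendsto:
  assumes w: "lloc w" and f: "cc f" and en: "\<And>n. 0 < en n" "\<And>n. en n \<le> 1" "en \<longlonglongrightarrow> 0"
  shows "(\<lambda>n. LINT x|lborel. w x * cv (en n) f x) \<longlonglongrightarrow> (LINT x|lborel. w x * f x)"
proof -
  from f obtain R where R: "0 < R" "continuous_on UNIV f" "\<And>x. R < norm x \<Longrightarrow> f x = 0" by (rule ccE) (rule that)
  show ?thesis
  proof (rule pairing_tendsto[OF w cv_cc[OF en(1) f] f, where R="R + 1"])
    fix n x assume "R + 1 < norm (x::real^3)"
    show "cv (en n) f x = 0"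
    proof (rule cv_zero[OF en(1) cc_lloc[OF f]])
      fix y assume "norm (x - y) < en n"
      then show "f y = 0"
        using norm_triangle_sub[of x y] en(2)[of n] \<open>R + 1 < norm x\<close> by (intro R(3)) linarith
    qed
  next
    fix b :: real assume "0 < b"
    then obtain d where d: "d > 0" "\<And>e x. 0 < e \<Longrightarrow> e < d \<Longrightarrow> \<bar>cv e f x - f x\<bar> \<le> b"
      using cv_uniform[OF f] by metis
    have "\<forall>\<^sub>F n in sequentially. en n < d" using en(3) d(1) by (rule order_tendstoD)
    then show "\<forall>\<^sub>F n in sequentially. \<forall>x. \<bar>cv (en n) f x - f x\<bar> \<le> b"
      by eventually_elim (use d(2) en(1) in blast)
  qed (use R in auto)
qed

lemma has_dir_zero_outside:
  assumes "has_dir e f f'" "closed K" "\<And>x. x \<notin> K \<Longrightarrow> f x = 0" "x \<notin> K"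
  shows "f' x = 0"
proof -
  have d: "((\<lambda>t. f (x + t *\<^sub>R e)) has_real_derivative f' x) (at 0)"
    using has_dir_at[OF assms(1), of x 0] by simp
  have "open ((\<lambda>t. x + t *\<^sub>R e) -` (- K))"
    using assms(2) by (intro open_vimage continuous_intros) auto
  then have "((\<lambda>t. 0) has_real_derivative f' x) (at 0)"
    by (rule has_field_derivative_transform_within_open[OF d]) (use assms in auto)
  from DERIV_unique[OF this DERIV_const] show ?thesis .
qed

text \<open>Identities that are linear in a test function and its directional derivatives extend to
  continuous compactly supported functions along this approximation.\<close>

lemma test_approx:
  assumes G: "open G" and K: "compact K" "K \<subseteq> G" and f: "continuous_on UNIV f" "\<And>x. x \<notin> K \<Longrightarrow> f x = 0"
  obtains F where "\<And>n::nat. test_function G (F n)"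
    "\<And>w. lloc w \<Longrightarrow> (\<lambda>n. LINT x|lborel. w x * F n x) \<longlonglongrightarrow> (LINT x|lborel. w x * f x)"
    "\<And>w e f'. lloc w \<Longrightarrow> continuous_on UNIV f' \<Longrightarrow> has_dir e f f' \<Longrightarrow>
      (\<lambda>n. LINT x|lborel. w x * dd e (F n) x) \<longlonglongrightarrow> (LINT x|lborel. w x * f' x)"
proof -
  obtain d where d: "d > 0" "(\<Union>x\<in>K. cball x d) \<subseteq> G"
    using compact_subset_open_imp_cball_epsilon_subset[OF K(1) G K(2)] by blast
  \<comment> \<open>The bound \<open>d\<close> keeps the supports inside \<open>G\<close>, the bound
    1 inside a common ball.\<close>
  define en where "en n = min (min d 1) (inverse (real (Suc n)))" for n
  have en: "\<And>n. 0 < en n" "\<And>n. en n \<le> 1" "\<And>n. en n \<le> d" using d by (auto simp: en_def)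
  have "en \<longlonglongrightarrow> 0"
  proof (rule tendsto_sandwich[OF _ _ tendsto_const LIMSEQ_inverse_real_of_nat])
    show "\<forall>\<^sub>F n in sequentially. 0 \<le> en n" using en(1) by (simp add: less_imp_le)
    show "\<forall>\<^sub>F n in sequentially. en n \<le> inverse (real (Suc n))" by (simp add: en_def)
  qed
  note en0 = this
  have cf: "cc f" by (rule cc_compactI[OF f(1) K(1) f(2)])
  show ?thesis
  proof (rule that[of "\<lambda>n. cv (en n) f"])
    fix n
    show "test_function G (cv (en n) f)"
    proof (rule cv_test[OF en(1) cc_lloc[OF cf] K(1) f(2)])
      fix x assume "x \<in> K"
      then show "cball x (en n) \<subseteq> G"
        using d(2) subset_cball[OF en(3)[of n], of x] by blast
    qed
  next
    fix w assume w: "lloc w"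
    show "(\<lambda>n. LINT x|lborel. w x * cv (en n) f x) \<longlonglongrightarrow> (LINT x|lborel. w x * f x)"
      by (rule cv_pairing_tendsto[OF w cf en(1,2) en0])
  next
    fix w e f' assume w: "lloc w" and f': "continuous_on UNIV f'" "has_dir e f f'"
    have "cc f'"
      by (rule cc_compactI[OF f'(1) K(1) has_dir_zero_outside[OF f'(2) compact_imp_closed[OF K(1)] f(2)]])
    then show "(\<lambda>n. LINT x|lborel. w x * dd e (cv (en n) f) x) \<longlonglongrightarrow> (LINT x|lborel. w x * f' x)"
      unfolding cv_dir[OF en(1) f(1) f'] by (intro cv_pairing_tendsto w en en0)
  qed
qed

text \<open>Weak derivatives are defined with smooth test functions, whereas flows produce functions
  of lower regularity; the identity survives the limit along \<open>test_approx\<close>.\<close>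

lemma weak_derivative_extend:
  assumes G: "open G" and K: "compact K" "K \<subseteq> G" and f: "continuous_on UNIV f" "\<And>x. x \<notin> K \<Longrightarrow> f x = 0"
    and f': "continuous_on UNIV f'" "has_dir e f f'"
    and u: "lloc u" "lloc p"
    and wk: "\<And>\<phi>. test_function G \<phi> \<Longrightarrow> (LINT x|lborel. u x * dd e \<phi> x) = - (LINT x|lborel. p x * \<phi> x)"
  shows "(LINT x|lborel. u x * f' x) = - (LINT x|lborel. p x * f x)"
proof -
  obtain F where F: "\<And>n::nat. test_function G (F n)"
    "\<And>w. lloc w \<Longrightarrow> (\<lambda>n. LINT x|lborel. w x * F n x) \<longlonglongrightarrow> (LINT x|lborel. w x * f x)"
    "\<And>w e f'. lloc w \<Longrightarrow> continuous_on UNIV f' \<Longrightarrow> has_dir e f f' \<Longrightarrow>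
      (\<lambda>n. LINT x|lborel. w x * dd e (F n) x) \<longlonglongrightarrow> (LINT x|lborel. w x * f' x)"
    using test_approx[OF G K f] by blast
  have "(\<lambda>n. LINT x|lborel. u x * dd e (F n) x) \<longlonglongrightarrow> - (LINT x|lborel. p x * f x)"
    unfolding wk[OF F(1)] by (intro tendsto_minus F(2) u)
  from LIMSEQ_unique[OF F(3)[OF u(1) f'] this] show ?thesis .
qed

section \<open>Hardy inequality and energy estimates\<close>

abbreviation n2 :: "(real^3 \<Rightarrow> real) \<Rightarrow> real" where
  "n2 \<equiv> l2n lborel"

abbreviation tf :: "(real^3 \<Rightarrow> real) \<Rightarrow> bool" where
  "tf \<equiv> test_function UNIV"

definition gn :: "(real^3 \<Rightarrow> real) \<Rightarrow> real" where
  "gn \<zeta> = sqrt (\<Sum>i\<in>UNIV. (n2 (pd i \<zeta>))\<^sup>2)"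

lemma gn_nonneg [simp]: "0 \<le> gn \<zeta>"
  by (simp add: gn_def sum_nonneg)

lemma gn_sq: "(gn \<zeta>)\<^sup>2 = (\<Sum>i\<in>UNIV. (n2 (pd i \<zeta>))\<^sup>2)"
  by (simp add: gn_def sum_nonneg)

lemma n2_pd_le_gn: "n2 (pd i \<zeta>) \<le> gn \<zeta>"
  unfolding gn_def by (intro real_le_rsqrt member_le_sum) auto

lemma sum_UNIV3_le:
  assumes "\<And>i::3. f i \<le> (b::real)" shows "(\<Sum>i\<in>UNIV. f i) \<le> 3 * b"
  using sum_bounded_above[of "UNIV::3 set" f b] assms by simp

lemma tf_sq_int: "test_function G f \<Longrightarrow> sq_int lborel f"
  by (rule cc_sq_int[OF cc_test])

lemma n2_mono_tf:
  assumes "test_function G g" "f \<in> borel_measurable borel" "\<And>x. \<bar>f x\<bar> \<le> \<bar>g x\<bar>"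
  shows "n2 f \<le> n2 g"
  using assms by (intro l2n_mono tf_sq_int[of G]) auto

lemma tf_borel: "test_function G f \<Longrightarrow> f \<in> borel_measurable borel"
  by (rule cc_borel[OF cc_test])

lemma smooth_borel: "smooth f \<Longrightarrow> f \<in> borel_measurable borel"
  by (rule borel_measurable_continuous_onI[OF smooth_continuous])

lemma n2_le_mult:
  assumes "test_function G g" "f \<in> borel_measurable borel" "\<And>x. \<bar>f x\<bar> \<le> c * \<bar>g x\<bar>"
  shows "n2 f \<le> c * n2 g"
proof -
  have "c * \<bar>g x\<bar> \<le> \<bar>c * g x\<bar>" for x using abs_ge_self[of "c * \<bar>g x\<bar>"] by (simp add: abs_mult)
  then have b: "\<bar>f x\<bar> \<le> \<bar>c * g x\<bar>" for x using assms(3) order_trans by blast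
  show ?thesis
  proof (cases "c \<ge> 0")
    case True
    have "n2 f \<le> n2 (\<lambda>x. c * g x)"
      using assms b by (intro l2n_mono sq_int_cmult tf_sq_int[of G]) auto
    then show ?thesis using True by (simp add: l2n_cmult)
  next
    case False
    have "g x = 0 \<and> f x = 0" for x
    proof -
      have "0 \<le> c * \<bar>g x\<bar>" using assms(3)[of x] abs_ge_zero order_trans by blast
      then have "\<bar>g x\<bar> \<le> 0" using False by (simp add: zero_le_mult_iff)
      then show ?thesis using assms(3)[of x] by simp
    qed
    then have "f = (\<lambda>x. 0)" "g = (\<lambda>x. 0)" by auto
    then show ?thesis by simp
  qed
qed

lemma tf_CS:
  assumes "test_function G f" "test_function H g"
  shows "\<bar>LINT x|lborel. f x * g x\<bar> \<le> n2 f * n2 g"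
  using assms by (intro l2n_CS tf_sq_int)

lemma n2_sq: "(n2 f)\<^sup>2 = (LINT x|lborel. f x * f x)"
  unfolding l2n_sq by (simp only: power2_eq_square)

lemma green:
  assumes z: "smooth z" and w: "test_function G w"
  shows "(LINT x|lborel. z x * lap w x) = - (\<Sum>i\<in>UNIV. LINT x|lborel. pd i z x * pd i w x)"
proof -
  have i: "integrable lborel (\<lambda>x. z x * pd i (pd i w) x)" for i
    by (intro cc_integrable cc_mult smooth_continuous z cc_test[OF test_function_pd[OF test_function_pd[OF w]]])
  have "(LINT x|lborel. z x * lap w x) = (\<Sum>i\<in>UNIV. LINT x|lborel. z x * pd i (pd i w) x)"
    using i by (simp add: lap_def sum_distrib_left)
  also have "\<dots> = (\<Sum>i\<in>UNIV. - (LINT x|lborel. pd i z x * pd i w x))"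
    by (intro sum.cong refl integral_by_parts_pd[OF z test_function_pd[OF w]])
  finally show ?thesis by (simp add: sum_negf)
qed

lemma green_self: "test_function G w \<Longrightarrow> (LINT x|lborel. w x * lap w x) = - (gn w)\<^sup>2"
  by (simp add: green[OF test_function_smooth] gn_sq n2_sq)

lemma coord_jb_le: "\<bar>x $ i\<bar> \<le> jb 1 (x::real^'n::finite)"
proof -
  have "\<bar>x $ i\<bar> \<le> norm x" by (rule component_le_norm_cart)
  also have "\<dots> \<le> sqrt (1 + (norm x)\<^sup>2)" by (rule real_le_rsqrt) simp
  finally show ?thesis using one_norm_sq_pos[of x] by (simp add: jb_def powr_half_sqrt)
qed

lemma tf_jb_mult: "test_function G f \<Longrightarrow> test_function G (\<lambda>x. jb s x * f x)"
  by (intro test_function_mult smooth_jb)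

lemma jb_cancel: "jb (- s) x * jb s x = 1"
  by (simp flip: jb_add)

text \<open>The field x / (1 + |x|^2) has divergence at least 1 / (1 + |x|^2) in dimension three.
  Integrating this against f^2 by parts and applying Cauchy-Schwarz gives the factor 6: for each of
  three coordinates a 2 from the derivative of f^2. One factor of the squared norm on the left is
  then cancelled.\<close>

lemma hardy:
  assumes f: "test_function G f" shows "n2 (\<lambda>x. jb (-1) x * f x) \<le> 6 * gn f"
proof -
  let ?N = "n2 (\<lambda>x. jb (-1) x * f x)"
  have s: "smooth f" by (rule test_function_smooth[OF f])
  define X where "X i x = x $ i * jb (-2) x" for i and x :: "real^3"
  have sX: "smooth (X i)" for i unfolding X_def[abs_def] by (intro smooth_mult smooth_coord smooth_jb)
  have pX: "pd i (X i) x = jb (-2) x - 2 * (x $ i)\<^sup>2 * jb (-4) x" for i x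
    unfolding X_def[abs_def] by (simp add: pd_mult_smooth smooth_coord smooth_jb pd_jb pd_coord power2_eq_square)
  have div: "jb (-2) x \<le> (\<Sum>i\<in>UNIV. pd i (X i) x)" for x :: "real^3"
  proof -
    have "(\<Sum>i\<in>UNIV. pd i (X i) x) = 3 * jb (-2) x - 2 * (norm x)\<^sup>2 * jb (-4) x"
      by (simp add: pX sum_subtractf norm_sq_vec sum_distrib_left sum_distrib_right)
    moreover have "(norm x)\<^sup>2 * jb (-4) x \<le> jb (-2) x"
    proof -
      have "(norm x)\<^sup>2 * jb (-4) x \<le> jb 2 x * jb (-4) x" by (intro mult_right_mono) (auto simp: jb_2)
      also have "\<dots> = jb (-2) x" by (simp flip: jb_add)
      finally show ?thesis .
    qed
    ultimately show ?thesis by simp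
  qed
  have jj: "jb (-1) x * jb (-1) x = jb (-2) x" for x :: "real^3" by (simp flip: jb_add)
  have ff: "test_function G (\<lambda>x. f x * f x)" by (intro test_function_mult s f)
  have iX: "integrable lborel (\<lambda>x. pd i (X i) x * (f x * f x))" for i
    by (intro cc_integrable cc_mult smooth_continuous smooth_pd sX cc_test[OF ff])
  have "?N\<^sup>2 = (LINT x|lborel. jb (-2) x * (f x * f x))"
    by (simp add: n2_sq jj[symmetric] mult_ac)
  also have "\<dots> \<le> (LINT x|lborel. (\<Sum>i\<in>UNIV. pd i (X i) x * (f x * f x)))"
  proof (rule integral_mono)
    show "integrable lborel (\<lambda>x. jb (-2) x * (f x * f x))"
      by (intro cc_integrable cc_mult smooth_continuous smooth_jb cc_test[OF ff])
    fix x
    show "jb (-2) x * (f x * f x) \<le> (\<Sum>i\<in>UNIV. pd i (X i) x * (f x * f x))"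
      using mult_right_mono[OF div[of x], of "f x * f x"] by (simp add: sum_distrib_right)
  qed (intro Bochner_Integration.integrable_sum iX)
  also have "\<dots> = (\<Sum>i\<in>UNIV. LINT x|lborel. pd i (X i) x * (f x * f x))"
    using iX by simp
  also have "\<dots> \<le> 3 * (2 * (?N * gn f))"
  proof (rule sum_UNIV3_le)
    fix i :: 3
    have t1: "test_function G (\<lambda>x. jb (-1) x * f x)" by (rule tf_jb_mult[OF f])
    have t2: "test_function G (\<lambda>x. (x $ i * jb (-1) x) * pd i f x)"
      by (intro test_function_mult smooth_mult smooth_coord smooth_jb test_function_pd f)
    have "(LINT x|lborel. pd i (X i) x * (f x * f x)) = - (LINT x|lborel. X i x * pd i (\<lambda>x. f x * f x) x)"
      using integral_by_parts_pd[OF sX ff, of i i] by simp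
    also have "\<dots> = - (LINT x|lborel. 2 * ((jb (-1) x * f x) * ((x $ i * jb (-1) x) * pd i f x)))"
      by (simp add: pd_mult_smooth s X_def jj[symmetric] mult_ac distrib_left)
    also have "\<dots> \<le> 2 * \<bar>LINT x|lborel. (jb (-1) x * f x) * ((x $ i * jb (-1) x) * pd i f x)\<bar>"
      by simp
    also have "\<dots> \<le> 2 * (?N * n2 (\<lambda>x. (x $ i * jb (-1) x) * pd i f x))"
      using tf_CS[OF t1 t2] by simp
    also have "n2 (\<lambda>x. (x $ i * jb (-1) x) * pd i f x) \<le> n2 (pd i f)"
    proof (rule n2_mono_tf[OF test_function_pd[OF f] tf_borel[OF t2]])
      fix x :: "real^3"
      have "\<bar>x $ i * jb (-1) x\<bar> \<le> jb 1 x * jb (-1) x"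
        by (simp add: abs_mult mult_right_mono coord_jb_le)
      also have "\<dots> = 1" by (simp flip: jb_add)
      finally show "\<bar>(x $ i * jb (-1) x) * pd i f x\<bar> \<le> \<bar>pd i f x\<bar>"
        unfolding abs_mult[of _ "pd i f x"] by (intro mult_left_le_one_le) auto
    qed
    also note n2_pd_le_gn[of i f]
    finally show "(LINT x|lborel. pd i (X i) x * (f x * f x)) \<le> 2 * (?N * gn f)"
      by (simp add: mult_left_mono)
  qed
  finally have "?N * ?N \<le> ?N * (6 * gn f)" by (simp add: power2_eq_square mult_ac)
  then show ?thesis
    by (cases "?N = 0") (auto simp: mult_le_cancel_left less_le)
qed

text \<open>Two integrations by parts turn the square of a mixed derivative into a product of pure
  second derivatives; summed over all indices, these products form the square of the
  Laplacian.\<close>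

lemma second_derivatives_le_lap:
  assumes w: "test_function G w" shows "gn (pd j w) \<le> n2 (lap w)"
proof -
  have s: "smooth w" by (rule test_function_smooth[OF w])
  have t: "(n2 (pd i (pd j w)))\<^sup>2 = (LINT x|lborel. pd i (pd i w) x * pd j (pd j w) x)" for i j
  proof -
    have "(n2 (pd i (pd j w)))\<^sup>2 = (LINT x|lborel. pd i (pd j w) x * pd i (pd j w) x)"
      by (rule n2_sq)
    also have "\<dots> = - (LINT x|lborel. pd i (pd i (pd j w)) x * pd j w x)"
      by (rule integral_by_parts_pd[OF smooth_pd[OF smooth_pd[OF s]] test_function_pd[OF w]])
    also have "\<dots> = - (LINT x|lborel. pd j (pd i (pd i w)) x * pd j w x)"
      using pd_commute[OF s, of i j] pd_commute[OF smooth_pd[OF s, of i], of i j] by simp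
    also have "\<dots> = (LINT x|lborel. pd i (pd i w) x * pd j (pd j w) x)"
      using integral_by_parts_pd[OF smooth_pd[OF smooth_pd[OF s]] test_function_pd[OF w], of i i j j] by simp
    finally show ?thesis .
  qed
  have i: "integrable lborel (\<lambda>x. pd i (pd i w) x * pd j (pd j w) x)" for i j
    by (intro sq_int_integrable_mult tf_sq_int[OF test_function_pd[OF test_function_pd[OF w]]])
  have "(gn (pd j w))\<^sup>2 \<le> (\<Sum>j\<in>UNIV. (gn (pd j w))\<^sup>2)"
    by (intro member_le_sum) auto
  also have "\<dots> = (\<Sum>j\<in>UNIV. \<Sum>i\<in>UNIV. LINT x|lborel. pd i (pd i w) x * pd j (pd j w) x)"
    by (simp add: gn_sq t)
  also have "\<dots> = (LINT x|lborel. (\<Sum>j\<in>UNIV. \<Sum>i\<in>UNIV. pd i (pd i w) x * pd j (pd j w) x))"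
    using i by simp
  also have "\<dots> = (n2 (lap w))\<^sup>2"
    by (simp add: n2_sq lap_def sum_product mult.commute)
  finally show ?thesis by (rule power2_le_imp_le) simp
qed

section \<open>The basic energy estimate\<close>

lemma en_props: "0 < inverse (real (Suc n))" "inverse (real (Suc n)) \<le> 1"
  "(\<lambda>n. inverse (real (Suc n))) \<longlonglongrightarrow> 0"
  using LIMSEQ_inverse_real_of_nat by (auto simp: inverse_le_1_iff)

lemma abs_LIMSEQ_le:
  assumes "f \<longlonglongrightarrow> (l::real)" "\<And>n. \<bar>f n\<bar> \<le> b" shows "\<bar>l\<bar> \<le> b"
  using tendsto_upperbound[OF tendsto_rabs[OF assms(1)], of b] assms(2) by simp

text \<open>Elliptic regularity in its simplest form: testing with \<open>cv e (cv e z)\<close> gives a uniform energy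
  bound for the mollifications of \<open>z\<close>.\<close>

lemma weak_gradient_bound:
  assumes z: "lloc z" and zR: "\<And>x. R < norm x \<Longrightarrow> z x = 0"
    and b: "\<And>\<zeta>. tf \<zeta> \<Longrightarrow> \<bar>LINT x|lborel. z x * lap \<zeta> x\<bar> \<le> C * gn \<zeta>" and C: "0 \<le> C"
    and p: "tf \<phi>"
  shows "\<bar>LINT x|lborel. z x * pd i \<phi> x\<bar> \<le> C * n2 \<phi>"
    and "\<bar>LINT x|lborel. z x * \<phi> x\<bar> \<le> 6 * C * n2 (\<lambda>x. jb 1 x * \<phi> x)"
proof -
  have tz: "tf (cv e z)" if "0 < e" for e
    by (rule cv_test[OF that z compact_cball[of 0 R]]) (use zR in auto)
  have g: "gn (cv e z) \<le> C" if e: "0 < e" for e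
  proof -
    let ?w = "cv e z"
    have s: "smooth ?w" by (rule test_function_smooth[OF tz[OF e]])
    have "(gn ?w)\<^sup>2 = - (LINT x|lborel. ?w x * lap ?w x)"
      by (simp add: green_self[OF tz[OF e]])
    also have "\<dots> = - (LINT x|lborel. z x * lap (cv e ?w) x)"
      unfolding cv_lap[OF e s] by (subst cv_pairing[OF e z cc_test[OF test_function_lap[OF tz[OF e]]]]) simp
    also have "\<dots> \<le> C * gn (cv e ?w)"
      using b[OF cv_test_UNIV[OF e cc_test[OF tz[OF e]]]] by simp
    finally have 1: "(gn ?w)\<^sup>2 \<le> C * gn (cv e ?w)" .
    \<comment> \<open>Mollification does not increase the Dirichlet norm, so the quadratic left-hand
      side absorbs one factor and leaves a bound independent of \<open>e\<close>.\<close>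
    have "gn (cv e ?w) \<le> gn ?w"
      unfolding gn_def cv_pd[OF e s]
      by (intro real_sqrt_le_mono sum_mono power_mono cv_l2n e cc_test[OF test_function_pd[OF tz[OF e]]]) auto
    from order_trans[OF 1 mult_left_mono[OF this C]]
    have "gn ?w * gn ?w \<le> gn ?w * C" by (simp add: power2_eq_square mult.commute)
    then show ?thesis using C by (cases "gn ?w = 0") (auto simp: mult_le_cancel_left less_le)
  qed
  show "\<bar>LINT x|lborel. z x * pd i \<phi> x\<bar> \<le> C * n2 \<phi>"
  proof (rule abs_LIMSEQ_le[OF cv_pairing_tendsto[OF z cc_test[OF test_function_pd[OF p]] en_props]])
    fix n
    define e where "e = inverse (real (Suc n))"
    have e: "0 < e" by (simp add: e_def)
    have "\<bar>LINT x|lborel. z x * cv e (pd i \<phi>) x\<bar> = \<bar>LINT x|lborel. cv e z x * pd i \<phi> x\<bar>"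
      by (subst cv_pairing[OF e z cc_test[OF test_function_pd[OF p]]]) simp
    also have "\<dots> = \<bar>LINT x|lborel. pd i (cv e z) x * \<phi> x\<bar>"
      by (subst integral_by_parts_pd[OF test_function_smooth[OF tz[OF e]] p]) simp
    also have "\<dots> \<le> n2 (pd i (cv e z)) * n2 \<phi>"
      by (rule tf_CS[OF test_function_pd[OF tz[OF e]] p])
    also have "\<dots> \<le> C * n2 \<phi>"
      using n2_pd_le_gn[of i "cv e z"] g[OF e] by (intro mult_right_mono) auto
    finally show "\<bar>LINT x|lborel. z x * cv (inverse (real (Suc n))) (pd i \<phi>) x\<bar> \<le> C * n2 \<phi>"
      by (simp add: e_def)
  qed
  show "\<bar>LINT x|lborel. z x * \<phi> x\<bar> \<le> 6 * C * n2 (\<lambda>x. jb 1 x * \<phi> x)"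
  proof (rule abs_LIMSEQ_le[OF cv_pairing_tendsto[OF z cc_test[OF p] en_props]])
    fix n
    define e where "e = inverse (real (Suc n))"
    have e: "0 < e" by (simp add: e_def)
    \<comment> \<open>The two weights cancel; the one on the mollified function is the weight of
      Hardy's inequality.\<close>
    have "(jb (-1) x * cv e z x) * (jb 1 x * \<phi> x) = (jb (-1) x * jb 1 x) * (cv e z x * \<phi> x)" for x
      by (simp only: mult_ac)
    then have "(jb (-1) x * cv e z x) * (jb 1 x * \<phi> x) = cv e z x * \<phi> x" for x
      by (simp add: jb_cancel)
    then have "\<bar>LINT x|lborel. z x * cv e \<phi> x\<bar> = \<bar>LINT x|lborel. (jb (-1) x * cv e z x) * (jb 1 x * \<phi> x)\<bar>"
      by (simp only: cv_pairing[OF e z cc_test[OF p]])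
    also have "\<dots> \<le> n2 (\<lambda>x. jb (-1) x * cv e z x) * n2 (\<lambda>x. jb 1 x * \<phi> x)"
      by (rule tf_CS[OF tf_jb_mult[OF tz[OF e]] tf_jb_mult[OF p]])
    also have "\<dots> \<le> 6 * C * n2 (\<lambda>x. jb 1 x * \<phi> x)"
      using hardy[OF tz[OF e]] g[OF e] by (intro mult_right_mono) auto
    finally show "\<bar>LINT x|lborel. z x * cv (inverse (real (Suc n))) \<phi> x\<bar> \<le> 6 * C * n2 (\<lambda>x. jb 1 x * \<phi> x)"
      by (simp add: e_def)
  qed
qed

text \<open>The indicator of the ball of radius (r + s)/2, mollified at scale (s - r)/2: from a
  point at distance at most \<open>r\<close> or at least \<open>s\<close> from \<open>p\<close>, the
  mollifier sees only one of its two values.\<close>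

lemma plateau:
  fixes p :: "real^3"
  assumes "r < s"
  obtains b where "smooth b" "\<And>x. 0 \<le> b x" "\<And>x. b x \<le> 1"
    "\<And>x. norm (x - p) \<le> r \<Longrightarrow> b x = 1" "\<And>x. s \<le> norm (x - p) \<Longrightarrow> b x = 0"
proof -
  define e where "e = (s - r) / 2"
  have e: "0 < e" using assms by (simp add: e_def)
  define f where "f = (indicator (cball p ((r + s) / 2)) :: real^3 \<Rightarrow> real)"
  have f: "lloc f"
    unfolding lloc_def f_def
  proof (intro conjI allI)
    show "indicator (cball p ((r + s) / 2)) \<in> borel_measurable borel"
      by (intro borel_measurable_indicator borel_closed closed_cball)
    fix R
    have "integrable lborel (indicator (cball 0 R \<inter> cball p ((r + s) / 2)) :: real^3 \<Rightarrow> real)"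
      by (intro integrable_real_indicator emeasure_bounded_finite bounded_Int)
        (auto intro!: borel_closed)
    then show "integrable lborel (\<lambda>x. indicator (cball 0 R) x * indicator (cball p ((r + s) / 2)) x :: real)"
      by (simp add: indicator_inter_arith[symmetric])
  qed
  show ?thesis
  proof (rule that[of "cv e f"])
    show "smooth (cv e f)" by (rule cv_smooth[OF e f])
    fix x
    have "\<bar>cv e f x - 1/2\<bar> \<le> 1/2"
      by (rule cv_bound[OF e f]) (simp add: f_def indicator_def)
    then show "0 \<le> cv e f x" "cv e f x \<le> 1" by linarith+
    show "cv e f x = 1" if "norm (x - p) \<le> r"
    proof -
      have "\<bar>cv e f x - 1\<bar> \<le> 0"
      proof (rule cv_bound[OF e f])
        fix y assume "norm (x - y) < e"
        then have "norm (y - p) \<le> (r + s) / 2"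
          using norm_triangle_ineq[of "y - x" "x - p"] that by (simp add: e_def norm_minus_commute field_simps)
        then show "\<bar>f y - 1\<bar> \<le> 0" by (simp add: f_def dist_norm norm_minus_commute)
      qed
      then show ?thesis by simp
    qed
    show "cv e f x = 0" if "s \<le> norm (x - p)"
    proof (rule cv_zero[OF e f])
      fix y assume "norm (x - y) < e"
      then have "\<not> norm (y - p) \<le> (r + s) / 2"
        using norm_triangle_ineq[of "x - y" "y - p"] that by (simp add: e_def field_simps)
      then show "f y = 0" by (simp add: f_def dist_norm norm_minus_commute)
    qed
  qed
qed

text \<open>Half-radius balls are reduced to a finite cover, and a partition of unity is built by
  induction: the plateau of one ball is split off, and what remains is a test function of the union
  of the other balls. Additivity of \<open>L\<close> is enough for this.\<close>

lemma local_to_global_bound: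
  assumes K: "compact K"
    and add: "\<And>f g. test_function G f \<Longrightarrow> test_function G g \<Longrightarrow> L (\<lambda>x. f x + g x) = L f + L g"
    and loc: "\<And>x. x \<in> K \<Longrightarrow> \<exists>r>0. \<exists>C\<ge>0. \<forall>\<phi>. test_function (G \<inter> ball x r) \<phi> \<longrightarrow> \<bar>L \<phi>\<bar> \<le> C * n2 \<phi>"
  shows "\<exists>C\<ge>0. \<forall>\<phi>. test_function G \<phi> \<longrightarrow> (\<forall>x. x \<notin> K \<longrightarrow> \<phi> x = 0) \<longrightarrow> \<bar>L \<phi>\<bar> \<le> C * (n2 \<phi> :: real)"
proof -
  obtain r C where rC: "\<And>x. x \<in> K \<Longrightarrow> 0 < r x" "\<And>x. x \<in> K \<Longrightarrow> 0 \<le> C x"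
    "\<And>x \<phi>. x \<in> K \<Longrightarrow> test_function (G \<inter> ball x (r x)) \<phi> \<Longrightarrow> \<bar>L \<phi>\<bar> \<le> C x * n2 \<phi>"
    using loc by metis
  have sub: "K \<subseteq> (\<Union>x\<in>K. ball x (r x / 2))" using rC(1) by force
  obtain F where F: "F \<subseteq> K" "finite F" "K \<subseteq> (\<Union>x\<in>F. ball x (r x / 2))"
    by (rule compactE_image[OF K _ sub]) (simp, rule that)
  have L0: "L (\<lambda>x. 0) = 0" using add[of "\<lambda>x. 0" "\<lambda>x. 0"] by simp
  have "\<exists>C\<ge>0. \<forall>\<phi>. test_function (G \<inter> (\<Union>x\<in>F. ball x (r x / 2))) \<phi> \<longrightarrow> \<bar>L \<phi>\<bar> \<le> C * n2 \<phi>"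
    using F(2,1)
  proof (induction F rule: finite_induct)
    case empty
    have "\<phi> = (\<lambda>x. 0)" if "test_function {} \<phi>" for \<phi>
      using test_function_outside[OF that] by auto
    then show ?case using L0 by (intro exI[of _ 0]) auto
  next
    case (insert y F)
    then obtain D where D: "D \<ge> 0" "\<And>\<phi>. test_function (G \<inter> (\<Union>x\<in>F. ball x (r x / 2))) \<phi> \<Longrightarrow> \<bar>L \<phi>\<bar> \<le> D * n2 \<phi>"
      by auto
    have y: "y \<in> K" "0 < r y" using insert rC(1) by auto
    \<comment> \<open>The plateau is 1 on the half ball, so the remainder avoids it, and it vanishes
      beyond 3/4 of the radius, so the piece split off has compact support in the ball where the
      local bound holds.\<close>
    obtain b where b: "smooth b" "\<And>x. 0 \<le> b x" "\<And>x. b x \<le> 1"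
      "\<And>x. norm (x - y) \<le> r y / 2 \<Longrightarrow> b x = 1" "\<And>x. 3/4 * r y \<le> norm (x - y) \<Longrightarrow> b x = 0"
      by (rule plateau[of "r y / 2" "3/4 * r y" y]) (use y in auto)
    show ?case
    proof (intro exI[of _ "C y + D"] conjI allI impI)
      fix \<phi> assume p: "test_function (G \<inter> (\<Union>x\<in>insert y F. ball x (r x / 2))) \<phi>"
      obtain S where S: "compact S" "S \<subseteq> G \<inter> (\<Union>x\<in>insert y F. ball x (r x / 2))" "\<And>x. x \<notin> S \<Longrightarrow> \<phi> x = 0"
        using p by (rule test_functionE) (rule that)
      have s: "smooth \<phi>" by (rule test_function_smooth[OF p])
      have 1: "test_function (G \<inter> ball y (r y)) (\<lambda>x. b x * \<phi> x)"
      proof (rule test_functionI[of _ "S \<inter> cball y (3/4 * r y)"])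
        show "S \<inter> cball y (3/4 * r y) \<subseteq> G \<inter> ball y (r y)" using S(2) y by auto
        fix x assume "x \<notin> S \<inter> cball y (3/4 * r y)"
        then show "b x * \<phi> x = 0"
          using S(3)[of x] b(5)[of x] by (auto simp: dist_norm norm_minus_commute)
      qed (intro smooth_mult b s S compact_Int compact_cball)+
      have 2: "test_function (G \<inter> (\<Union>x\<in>F. ball x (r x / 2))) (\<lambda>x. (1 - b x) * \<phi> x)"
      proof (rule test_functionI[of _ "S - ball y (r y / 2)"])
        show "compact (S - ball y (r y / 2))" by (intro compact_diff S) auto
        show "S - ball y (r y / 2) \<subseteq> G \<inter> (\<Union>x\<in>F. ball x (r x / 2))" using S(2) by auto
        fix x assume "x \<notin> S - ball y (r y / 2)"
        then show "(1 - b x) * \<phi> x = 0"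
          using S(3)[of x] b(4)[of x] by (auto simp: dist_norm norm_minus_commute)
      qed (intro smooth_mult smooth_diff smooth_const b s)
      have G: "test_function G (\<lambda>x. b x * \<phi> x)" "test_function G (\<lambda>x. (1 - b x) * \<phi> x)"
        using 1 2 by (auto elim: test_function_mono)
      have "L \<phi> = L (\<lambda>x. b x * \<phi> x) + L (\<lambda>x. (1 - b x) * \<phi> x)"
        using add[OF G] by (simp add: left_diff_distrib)
      moreover have "\<bar>L (\<lambda>x. b x * \<phi> x)\<bar> \<le> C y * n2 (\<lambda>x. b x * \<phi> x)" by (rule rC(3)[OF y(1) 1])
      moreover have "n2 (\<lambda>x. b x * \<phi> x) \<le> n2 \<phi>"
        using b by (intro n2_mono_tf[OF p] tf_borel[OF 1]) (auto simp: abs_mult intro: mult_left_le_one_le)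
      moreover have "\<bar>L (\<lambda>x. (1 - b x) * \<phi> x)\<bar> \<le> D * n2 (\<lambda>x. (1 - b x) * \<phi> x)" by (rule D(2)[OF 2])
      moreover have "n2 (\<lambda>x. (1 - b x) * \<phi> x) \<le> n2 \<phi>"
        using b by (intro n2_mono_tf[OF p] tf_borel[OF 2]) (auto simp: abs_mult intro: mult_left_le_one_le)
      ultimately have "\<bar>L \<phi>\<bar> \<le> C y * n2 \<phi> + D * n2 \<phi>"
        using mult_left_mono[of "n2 (\<lambda>x. b x * \<phi> x)" "n2 \<phi>" "C y"]
          mult_left_mono[of "n2 (\<lambda>x. (1 - b x) * \<phi> x)" "n2 \<phi>" D] rC(2)[OF y(1)] D(1) by linarith
      then show "\<bar>L \<phi>\<bar> \<le> (C y + D) * n2 \<phi>" by (simp add: distrib_right)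
    qed (use rC(2)[OF y(1)] D in auto)
  qed
  then obtain D where D: "D \<ge> 0" "\<And>\<phi>. test_function (G \<inter> (\<Union>x\<in>F. ball x (r x / 2))) \<phi> \<Longrightarrow> \<bar>L \<phi>\<bar> \<le> D * n2 \<phi>"
    by auto
  show ?thesis
  proof (intro exI[of _ D] conjI allI impI D)
    fix \<phi> assume p: "test_function G \<phi>" "\<forall>x. x \<notin> K \<longrightarrow> \<phi> x = 0"
    obtain S where S: "compact S" "S \<subseteq> G" "\<And>x. x \<notin> S \<Longrightarrow> \<phi> x = 0"
      using p(1) by (rule test_functionE) (rule that)
    show "test_function (G \<inter> (\<Union>x\<in>F. ball x (r x / 2))) \<phi>"
    proof (rule test_functionI[of _ "S \<inter> K"])
      show "S \<inter> K \<subseteq> G \<inter> (\<Union>x\<in>F. ball x (r x / 2))" using S(2) F(3) by blast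
      fix x assume "x \<notin> S \<inter> K" then show "\<phi> x = 0" using S(3) p(2) by blast
    qed (use S K p test_function_smooth in auto)
  qed
qed

text \<open>The functional is transported to the functions \<open>jb (-s) x * \<phi> x\<close>, on
  which it is bounded in the unweighted norm; the representer times \<open>jb (-s)\<close> is then
  \<open>w\<close>.\<close>

lemma test_riesz:
  assumes lin: "\<And>f g c. test_function G f \<Longrightarrow> test_function G g \<Longrightarrow> L (\<lambda>x. f x + c * g x) = L f + c * L g"
    and b: "\<And>\<phi>. test_function G \<phi> \<Longrightarrow> \<bar>L \<phi>\<bar> \<le> C * n2 (\<lambda>x. jb (- s) x * \<phi> x)"
  obtains w where "w \<in> borel_measurable borel" "sq_int lborel (\<lambda>x. jb s x * w x)"
    "\<And>\<phi>. test_function G \<phi> \<Longrightarrow> L \<phi> = (LINT x|lborel. w x * \<phi> x)"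
proof -
  have j: "jb s x * (jb (-s) x * y) = y" "jb (-s) x * (jb s x * y) = y" for x :: "real^3" and y
    using jb_add[of s "-s" x] by (simp_all add: mult.assoc[symmetric] mult.commute[of "jb (-s) x"])
  let ?V = "{\<lambda>x. jb (-s) x * \<phi> x |\<phi>. test_function G \<phi>}"
  have "\<exists>q. sq_int lborel q \<and> (\<forall>f\<in>?V. L (\<lambda>x. jb s x * f x) = (LINT x|lborel. q x * f x))"
  proof (rule L2_riesz[where C=C])
    show "sq_int lborel f" if "f \<in> ?V" for f using that by (auto intro: tf_sq_int tf_jb_mult)
    show "?V \<noteq> {}" using test_function_zero by blast
    show "(\<lambda>x. f x + c * g x) \<in> ?V" if fg: "f \<in> ?V" "g \<in> ?V" for f g c
    proof -
      from fg obtain \<phi> \<psi> where p: "f = (\<lambda>x. jb (-s) x * \<phi> x)" "g = (\<lambda>x. jb (-s) x * \<psi> x)"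
        "test_function G \<phi>" "test_function G \<psi>" by auto
      show ?thesis unfolding p using p(3,4)
        by (auto intro!: exI[of _ "\<lambda>x. \<phi> x + c * \<psi> x"] test_function_add test_function_mult simp: algebra_simps)
    qed
    fix f g c assume fg: "f \<in> ?V" "g \<in> ?V"
    then obtain \<phi> \<psi> where p: "f = (\<lambda>x. jb (-s) x * \<phi> x)" "g = (\<lambda>x. jb (-s) x * \<psi> x)"
        "test_function G \<phi>" "test_function G \<psi>" by auto
    show "L (\<lambda>x. jb s x * (f x + c * g x)) = L (\<lambda>x. jb s x * f x) + c * L (\<lambda>x. jb s x * g x)"
      using lin[OF p(3,4), of c] by (simp add: p(1,2) j distrib_left mult.left_commute[of _ c])
  next
    fix f assume "f \<in> ?V"
    then obtain \<phi> where "f = (\<lambda>x. jb (-s) x * \<phi> x)" "test_function G \<phi>" by auto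
    then show "\<bar>L (\<lambda>x. jb s x * f x)\<bar> \<le> C * n2 f" using b by (simp add: j)
  qed
  then obtain q where q: "sq_int lborel q" "\<And>f. f \<in> ?V \<Longrightarrow> L (\<lambda>x. jb s x * f x) = (LINT x|lborel. q x * f x)"
    by auto
  show ?thesis
  proof (rule that[of "\<lambda>x. jb (-s) x * q x"])
    have [measurable]: "q \<in> borel_measurable borel" using q(1) by (auto simp: sq_int_def)
    have [measurable]: "jb (-s) \<in> borel_measurable borel" by (rule smooth_borel[OF smooth_jb])
    show "(\<lambda>x. jb (-s) x * q x) \<in> borel_measurable borel" by measurable
    show "sq_int lborel (\<lambda>x. jb s x * (jb (-s) x * q x))" using q(1) by (simp add: j)
    fix \<phi> assume "test_function G \<phi>"
    then have "L (\<lambda>x. jb s x * (jb (-s) x * \<phi> x)) = (LINT x|lborel. q x * (jb (-s) x * \<phi> x))"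
      by (intro q(2)) auto
    then have "L \<phi> = (LINT x|lborel. q x * (jb (-s) x * \<phi> x))" by (simp only: j)
    then show "L \<phi> = (LINT x|lborel. (jb (-s) x * q x) * \<phi> x)" by (simp add: mult_ac)
  qed
qed

text \<open>Symbols of order \<open>s\<close>, controlled up to two derivatives: each derivative
  lowers the growth by one power. The constant \<open>A\<close> is part of the predicate so that
  estimates can be uniform over a family of cut-offs.\<close>

definition symb :: "real \<Rightarrow> real \<Rightarrow> (real^3 \<Rightarrow> real) \<Rightarrow> bool" where
  "symb s A f \<longleftrightarrow> smooth f \<and> 0 \<le> A \<and> (\<forall>x. \<bar>f x\<bar> \<le> A * jb s x) \<and>
     (\<forall>x i. \<bar>pd i f x\<bar> \<le> A * jb (s - 1) x) \<and> (\<forall>x i j. \<bar>pd j (pd i f) x\<bar> \<le> A * jb (s - 2) x)"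

text \<open>The factor 4 counts the terms in the second derivative of a product, the largest number
  that occurs.\<close>

lemma symb_mult:
  assumes "symb s A f" "symb t B g" shows "symb (s + t) (4 * A * B) (\<lambda>x. f x * g x)"
proof -
  note f = assms(1)[unfolded symb_def] and g = assms(2)[unfolded symb_def]
  have m: "\<bar>a * b\<bar> \<le> A * B * jb (s + t - (c + d)) x"
    if "\<bar>a\<bar> \<le> A * jb (s - c) x" "\<bar>b\<bar> \<le> B * jb (t - d) x" for a b c d and x :: "real^3"
  proof -
    have "\<bar>a * b\<bar> \<le> (A * jb (s - c) x) * (B * jb (t - d) x)"
      unfolding abs_mult using that f by (intro mult_mono) auto
    also have "\<dots> = A * B * jb (s - c + (t - d)) x" by (simp add: jb_add mult_ac)
    finally show ?thesis by (simp add: algebra_simps)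
  qed
  have AB: "0 \<le> A * B" using f g by simp
  have nn: "0 \<le> A * B * jb u x" for u and x :: "real^3" by (rule mult_nonneg_nonneg[OF AB jb_nonneg])
  note m00 = m[of _ 0 _ _ 0, simplified] and m01 = m[of _ 0 _ _ 1, simplified] and m10 = m[of _ 1 _ _ 0, simplified]
    and m11 = m[of _ 1 _ _ 1, simplified] and m02 = m[of _ 0 _ _ 2, simplified] and m20 = m[of _ 2 _ _ 0, simplified]
  have 0: "\<bar>f x * g x\<bar> \<le> 4 * A * B * jb (s + t) x" for x
    using m00[of "f x" x "g x"] f g nn[of "s+t" x] by fastforce
  have 1: "\<bar>pd i (\<lambda>x. f x * g x) x\<bar> \<le> 4 * A * B * jb (s + t - 1) x" for x i
  proof -
    have "\<bar>f x * pd i g x\<bar> \<le> A * B * jb (s + t - 1) x" "\<bar>pd i f x * g x\<bar> \<le> A * B * jb (s + t - 1) x"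
      using f g by (auto intro: m01 m10)
    then show ?thesis using f g nn[of "s + t - 1" x] by (simp add: pd_mult_smooth)
  qed
  have 2: "\<bar>pd j (pd i (\<lambda>x. f x * g x)) x\<bar> \<le> 4 * A * B * jb (s + t - 2) x" for x i j
  proof -
    have "\<bar>f x * pd j (pd i g) x\<bar> \<le> A * B * jb (s + t - 2) x" "\<bar>pd j f x * pd i g x\<bar> \<le> A * B * jb (s + t - 2) x"
      "\<bar>pd i f x * pd j g x\<bar> \<le> A * B * jb (s + t - 2) x" "\<bar>pd j (pd i f) x * g x\<bar> \<le> A * B * jb (s + t - 2) x"
      using f g by (auto intro: m02 m11 m20)
    moreover have "pd j (pd i (\<lambda>x. f x * g x)) x
        = f x * pd j (pd i g) x + pd j f x * pd i g x + pd i f x * pd j g x + pd j (pd i f) x * g x"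
      using f g by (simp add: pd_mult_smooth pd_add_smooth smooth_mult smooth_pd)
    ultimately show ?thesis by simp
  qed
  show ?thesis unfolding symb_def using 0 1 2 f g AB by (auto intro: smooth_mult)
qed

lemma symb_jb: "symb s (1 + \<bar>s\<bar> + \<bar>s\<bar> * \<bar>s - 2\<bar>) (jb s)"
proof -
  have c: "\<bar>x $ i\<bar> * jb (t - 1) x \<le> jb t x" for x :: "real^3" and i t
  proof -
    have "\<bar>x $ i\<bar> * jb (t - 1) x \<le> jb 1 x * jb (t - 1) x" by (intro mult_right_mono coord_jb_le) simp
    also have "\<dots> = jb t x" by (simp flip: jb_add)
    finally show ?thesis .
  qed
  have 1: "\<bar>pd i (jb s) x\<bar> \<le> \<bar>s\<bar> * jb (s - 1) x" for x :: "real^3" and i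
    using mult_left_mono[OF c[of x i "s - 1"], of "\<bar>s\<bar>"] by (simp add: pd_jb abs_mult mult.assoc)
  have 2: "\<bar>pd j (pd i (jb s)) x\<bar> \<le> (\<bar>s\<bar> + \<bar>s\<bar> * \<bar>s - 2\<bar>) * jb (s - 2) x" for x :: "real^3" and i j
  proof -
    have "pd j (pd i (jb s)) x = s * (x $ i * ((s - 2) * x $ j * jb (s - 4) x)) + s * ((if j = i then 1 else 0) * jb (s - 2) x)"
      unfolding pd_jb[of i s] mult.assoc
      by (simp add: pd_mult_smooth pd_cmult_smooth smooth_mult smooth_coord smooth_jb pd_jb pd_coord mult.assoc distrib_left)
    also have "\<bar>\<dots>\<bar> \<le> \<bar>s\<bar> * \<bar>s - 2\<bar> * (\<bar>x $ i\<bar> * (\<bar>x $ j\<bar> * jb (s - 4) x)) + \<bar>s\<bar> * jb (s - 2) x"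
      by (rule order_trans[OF abs_triangle_ineq]) (auto simp: abs_mult mult_ac)
    also have "\<bar>x $ i\<bar> * (\<bar>x $ j\<bar> * jb (s - 4) x) \<le> jb (s - 2) x"
    proof -
      have "\<bar>x $ i\<bar> * (\<bar>x $ j\<bar> * jb (s - 4) x) \<le> \<bar>x $ i\<bar> * jb (s - 3) x"
        using c[of x j "s - 3"] by (intro mult_left_mono) auto
      also have "\<dots> \<le> jb (s - 2) x" using c[of x i "s - 2"] by simp
      finally show ?thesis .
    qed
    finally show ?thesis by (simp add: mult_left_mono distrib_right)
  qed
  let ?A = "1 + \<bar>s\<bar> + \<bar>s\<bar> * \<bar>s - 2\<bar>"
  have le: "\<bar>s\<bar> \<le> ?A" "\<bar>s\<bar> + \<bar>s\<bar> * \<bar>s - 2\<bar> \<le> ?A" "1 \<le> ?A" by simp_all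
  show ?thesis
    unfolding symb_def
  proof (intro conjI allI smooth_jb)
    show "0 \<le> ?A" using le by simp
    fix x :: "real^3" and i j
    show "\<bar>jb s x\<bar> \<le> ?A * jb s x" using mult_right_mono[OF le(3) jb_nonneg[of s x]] by simp
    show "\<bar>pd i (jb s) x\<bar> \<le> ?A * jb (s - 1) x"
      by (rule order_trans[OF 1 mult_right_mono[OF le(1) jb_nonneg]])
    show "\<bar>pd j (pd i (jb s)) x\<bar> \<le> ?A * jb (s - 2) x"
      by (rule order_trans[OF 2 mult_right_mono[OF le(2) jb_nonneg]])
  qed
qed

lemma cc_le_jb:
  assumes "cc f" obtains A where "0 \<le> A" "\<And>x. \<bar>f x\<bar> \<le> A * jb s x"
proof -
  have "cc (\<lambda>x. jb (-s) x * f x)" by (intro cc_mult smooth_continuous smooth_jb assms)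
  then obtain A where A: "0 < A" "\<And>x. \<bar>jb (-s) x * f x\<bar> \<le> A" by (rule cc_bounded) (rule that)
  have "\<bar>f x\<bar> \<le> A * jb s x" for x
    using A(2)[of x] by (simp add: abs_mult jb_minus divide_simps inverse_eq_divide)
  then show ?thesis using A(1) by (intro that[of A]) auto
qed

lemma tf_symb:
  assumes f: "test_function G f" obtains A where "symb s A f"
proof -
  obtain A where A: "0 \<le> A" "\<And>x. \<bar>f x\<bar> \<le> A * jb s x" by (rule cc_le_jb[OF cc_test[OF f]]) (rule that)
  have "\<forall>i. \<exists>B. 0 \<le> B \<and> (\<forall>x. \<bar>pd i f x\<bar> \<le> B * jb (s - 1) x)"
    using cc_le_jb[OF cc_test[OF test_function_pd[OF f]]] by metis
  then obtain B where B: "\<And>i. 0 \<le> B i" "\<And>i x. \<bar>pd i f x\<bar> \<le> B i * jb (s - 1) x" by metis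
  have "\<forall>i j. \<exists>C. 0 \<le> C \<and> (\<forall>x. \<bar>pd j (pd i f) x\<bar> \<le> C * jb (s - 2) x)"
    using cc_le_jb[OF cc_test[OF test_function_pd[OF test_function_pd[OF f]]]] by metis
  then obtain C where C: "\<And>i j. 0 \<le> C i j" "\<And>i j x. \<bar>pd j (pd i f) x\<bar> \<le> C i j * jb (s - 2) x" by metis
  define D where "D = A + (\<Sum>i\<in>UNIV. B i) + (\<Sum>i\<in>UNIV. \<Sum>j\<in>UNIV. C i j)"
  have sB: "B i \<le> (\<Sum>i\<in>UNIV. B i)" for i by (intro member_le_sum) (use B in auto)
  have "C i j \<le> (\<Sum>j\<in>UNIV. C i j)" for i j by (intro member_le_sum) (use C in auto)
  moreover have "(\<Sum>j\<in>UNIV. C i j) \<le> (\<Sum>i\<in>UNIV. \<Sum>j\<in>UNIV. C i j)" for i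
    by (intro member_le_sum) (use C in \<open>auto intro: sum_nonneg\<close>)
  ultimately have sC: "C i j \<le> (\<Sum>i\<in>UNIV. \<Sum>j\<in>UNIV. C i j)" for i j using order_trans by blast
  have nn: "0 \<le> (\<Sum>i\<in>UNIV. B i)" "0 \<le> (\<Sum>i\<in>UNIV. \<Sum>j\<in>UNIV. C i j)"
    using B C by (auto intro!: sum_nonneg)
  have le: "A \<le> D" "\<And>i. B i \<le> D" "\<And>i j. C i j \<le> D"
    using nn A(1) sB sC by (auto simp: D_def intro: add_increasing add_increasing2)
  have "symb s D f"
    unfolding symb_def
  proof (intro conjI allI test_function_smooth[OF f])
    show "0 \<le> D" using le A by simp
    fix x i j
    show "\<bar>f x\<bar> \<le> D * jb s x" by (rule order_trans[OF A(2) mult_right_mono[OF le(1) jb_nonneg]])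
    show "\<bar>pd i f x\<bar> \<le> D * jb (s - 1) x"
      by (rule order_trans[OF B(2) mult_right_mono[OF le(2) jb_nonneg]])
    show "\<bar>pd j (pd i f) x\<bar> \<le> D * jb (s - 2) x"
      by (rule order_trans[OF C(2) mult_right_mono[OF le(3) jb_nonneg]])
  qed
  then show ?thesis by (rule that)
qed

lemma symb_const: "symb 0 \<bar>c\<bar> (\<lambda>x. c)"
  by (simp add: symb_def)

lemma symb_diff:
  assumes "symb s A f" "symb s B g" shows "symb s (A + B) (\<lambda>x. f x - g x)"
proof -
  note f = assms(1)[unfolded symb_def] and g = assms(2)[unfolded symb_def]
  have "\<bar>a - b\<bar> \<le> (A + B) * c" if "\<bar>a\<bar> \<le> A * c" "\<bar>b\<bar> \<le> B * c" for a b c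
    using that by (simp add: distrib_right)
  then show ?thesis unfolding symb_def
    using f g by (simp add: pd_diff_smooth smooth_diff smooth_pd)
qed

text \<open>Dilations of a single plateau. A derivative costs a factor 1/R and lives where |x| \<le>
  2R, and there 1/R is at most three times \<open>jb (-1)\<close>. So the cut-offs are symbols of
  order 0 with one constant for all \<open>R\<close>, which allows their removal at the end of an
  estimate.\<close>

lemma infinity_cutoff:
  obtains \<kappa> :: "real \<Rightarrow> real^3 \<Rightarrow> real" and A where
    "\<And>R. 1 \<le> R \<Longrightarrow> tf (\<kappa> R)" "\<And>R. 1 \<le> R \<Longrightarrow> symb 0 A (\<kappa> R)"
    "\<And>R x. 1 \<le> R \<Longrightarrow> norm x \<le> R \<Longrightarrow> \<kappa> R x = 1"
    "\<And>R x i. 1 \<le> R \<Longrightarrow> norm x < R \<Longrightarrow> pd i (\<kappa> R) x = 0"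
    "\<And>R x. 1 \<le> R \<Longrightarrow> norm x < R \<Longrightarrow> lap (\<kappa> R) x = 0"
proof -
  obtain b where b: "smooth b" "\<And>x. 0 \<le> b x" "\<And>x. b x \<le> 1"
      "\<And>x. norm x \<le> 1 \<Longrightarrow> b x = 1" "\<And>x. 2 \<le> norm x \<Longrightarrow> b (x::real^3) = 0"
    by (rule plateau[of 1 2 "0::real^3"]) auto
  have tb: "tf b" using b(5) by (intro test_functionI[of _ "cball 0 2"] b(1)) auto
  obtain A where A: "symb 0 A b" by (rule tf_symb[OF tb]) (rule that)
  have bb: "\<bar>pd i b x\<bar> \<le> A" "\<bar>pd j (pd i b) x\<bar> \<le> A" for i j and x :: "real^3"
  proof -
    have "jb t x \<le> 1" if "t \<le> 0" for t
      using that powr_mono[of "t / 2" 0 "1 + (norm x)\<^sup>2"] one_norm_sq_pos[of x] by (simp add: jb_def)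
    then have "A * jb (- 1) x \<le> A" "A * jb (- 2) x \<le> A" using A by (auto simp: symb_def intro: mult_left_le)
    moreover have "\<bar>pd i b x\<bar> \<le> A * jb (- 1) x" "\<bar>pd j (pd i b) x\<bar> \<le> A * jb (- 2) x"
      using A by (simp_all add: symb_def)
    ultimately show "\<bar>pd i b x\<bar> \<le> A" "\<bar>pd j (pd i b) x\<bar> \<le> A"
      using order_trans by blast+
  qed
  define \<kappa> where "\<kappa> R x = b (inverse R *\<^sub>R x + 0)" for R :: real and x :: "real^3"
  have s: "smooth (\<kappa> R)" for R unfolding \<kappa>_def[abs_def] by (rule smooth_affine[OF b(1)])
  have p1: "pd i (\<kappa> R) = (\<lambda>x. inverse R * pd i b (inverse R *\<^sub>R x + 0))" for i R
    unfolding \<kappa>_def[abs_def] by (intro ext pd_affine smooth_differentiable b(1))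
  have p2: "pd j (pd i (\<kappa> R)) = (\<lambda>x. inverse R * (inverse R * pd j (pd i b) (inverse R *\<^sub>R x + 0)))" for i j R
    unfolding p1 pd_cmult_smooth[OF smooth_affine[OF smooth_pd[OF b(1)]]]
    by (intro ext arg_cong[where f="\<lambda>u. inverse R * u"] pd_affine smooth_differentiable smooth_pd b(1))
  have z1: "\<kappa> R x = 0" if "1 \<le> R" "2 * R \<le> norm x" for R x
    using that unfolding \<kappa>_def by (intro b(5)) (simp add: field_simps)
  have o1: "\<kappa> R x = 1" if "1 \<le> R" "norm x \<le> R" for R x
    using that unfolding \<kappa>_def by (intro b(4)) (simp add: field_simps)
  have zp: "pd i (\<kappa> R) x = 0" "pd j (pd i (\<kappa> R)) x = 0" if "1 \<le> R" "2 * R < norm x" for i j R x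
  proof -
    have z: "pd i (\<kappa> R) x = 0" if x: "x \<notin> cball 0 (2 * R)" for x i
      by (rule pd_zero_outside[OF closed_cball z1[OF \<open>1 \<le> R\<close>] x]) auto
    then show "pd i (\<kappa> R) x = 0" using that by simp
    show "pd j (pd i (\<kappa> R)) x = 0"
      by (rule pd_zero_outside[OF closed_cball z, of 0]) (use that in auto)
  qed
  have zi: "pd i (\<kappa> R) x = 0" "pd j (pd i (\<kappa> R)) x = 0" if "1 \<le> R" "norm x < R" for i j R x
  proof -
    have z: "pd i (\<kappa> R) x = 0" if x: "norm x < R" for x i
    proof -
      have "pd i (\<lambda>x. \<kappa> R x - 1) x = 0"
        by (rule pd_zero_outside[of "- ball 0 R"]) (use x o1[OF \<open>1 \<le> R\<close>] in auto)
      then show ?thesis by (simp add: pd_diff_smooth s)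
    qed
    then show "pd i (\<kappa> R) x = 0" using that by simp
    show "pd j (pd i (\<kappa> R)) x = 0"
      by (rule pd_zero_outside[of "- ball 0 R"]) (use z that in auto)
  qed
  have j1: "inverse R \<le> 3 * jb (-1) x" if "1 \<le> R" "norm x \<le> 2 * R" for R and x :: "real^3"
  proof -
    have "jb 1 x \<le> 3 * R"
    proof -
      have "1 + (norm x)\<^sup>2 \<le> (3 * R)\<^sup>2"
        using power_mono[OF that(2), of 2] one_le_power[OF that(1), of 2] by (simp add: power_mult_distrib)
      then have "sqrt (1 + (norm x)\<^sup>2) \<le> 3 * R" using that by (intro real_le_lsqrt) auto
      then show ?thesis using one_norm_sq_pos[of x] by (simp add: jb_def powr_half_sqrt)
    qed
    then show ?thesis using that by (simp add: jb_minus field_simps)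
  qed
  have A0: "0 \<le> A" using A by (simp add: symb_def)
  show ?thesis
  \<comment> \<open>Two derivatives produce the factor 3 twice; the summand 1 covers the function
    itself, whose values lie between 0 and 1.\<close>
  proof (rule that[of \<kappa> "9 * A + 1"])
    fix R :: real assume R: "1 \<le> R"
    show "tf (\<kappa> R)" using z1[OF R] by (intro test_functionI[of _ "cball 0 (2 * R)"] s) auto
    show "symb 0 (9 * A + 1) (\<kappa> R)"
      unfolding symb_def
    proof (intro conjI allI s)
      show "0 \<le> 9 * A + 1" using A0 by simp
      fix x i j
      show "\<bar>\<kappa> R x\<bar> \<le> (9 * A + 1) * jb 0 x" using b(2,3) A0 by (simp add: \<kappa>_def add_increasing)
      show "\<bar>pd i (\<kappa> R) x\<bar> \<le> (9 * A + 1) * jb (0 - 1) x"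
      proof (cases "norm x \<le> 2 * R")
        case True
        have "\<bar>pd i (\<kappa> R) x\<bar> \<le> (3 * jb (-1) x) * A"
          unfolding p1 abs_mult using R j1[OF R True] bb by (intro mult_mono) auto
        also have "\<dots> \<le> (9 * A + 1) * jb (0 - 1) x"
          using A0 by (simp add: distrib_right add_increasing2)
        finally show ?thesis .
      qed (use zp[OF R] A0 in \<open>simp add: add_nonneg_nonneg\<close>)
      show "\<bar>pd j (pd i (\<kappa> R)) x\<bar> \<le> (9 * A + 1) * jb (0 - 2) x"
      proof (cases "norm x \<le> 2 * R")
        case True
        have "\<bar>pd j (pd i (\<kappa> R)) x\<bar> \<le> (3 * jb (-1) x) * ((3 * jb (-1) x) * A)"
          unfolding p2 abs_mult using R j1[OF R True] bb by (intro mult_mono) auto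
        also have "\<dots> = 9 * A * jb (-2) x" using jb_add[of "-1" "-1" x] by simp
        also have "\<dots> \<le> (9 * A + 1) * jb (0 - 2) x" by (simp add: distrib_right)
        finally show ?thesis .
      qed (use zp[OF R] A0 in \<open>simp add: add_nonneg_nonneg\<close>)
    qed
    show "\<kappa> R x = 1" if "norm x \<le> R" for x by (rule o1[OF R that])
    show "pd i (\<kappa> R) x = 0" if "norm x < R" for x i by (rule zi[OF R that])
    show "lap (\<kappa> R) x = 0" if "norm x < R" for x unfolding lap_def using zi[OF R that] by simp
  qed
qed

text \<open>The Laplacian of the product of \<eta> and \<zeta> differs from \<eta> times that of
  \<zeta> by terms with derivatives on \<eta>. For a symbol of order 1 - s, the weight
  \<open>jb s\<close> turns the gradient of \<eta> into a bounded factor and its Laplacian into a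
  multiple of \<open>jb (-1)\<close>, to which Hardy applies; 24 is 2 * 3 from the gradient term
  plus 3 * 6 from the Laplacian. The commutator lives in \<open>S\<close>, so \<open>D\<close> may
  be a norm over a tail.\<close>

lemma weighted_estimate:
  assumes u: "lloc u"
    and eta: "symb (1 - s) A \<eta>" "test_function G \<eta>"
    and S: "\<And>x i. x \<notin> S \<Longrightarrow> pd i \<eta> x = 0" "\<And>x. x \<notin> S \<Longrightarrow> lap \<eta> x = 0"
    and D: "\<And>\<phi>. test_function G \<phi> \<Longrightarrow> (\<And>x. x \<notin> S \<Longrightarrow> \<phi> x = 0) \<Longrightarrow>
        \<bar>LINT x|lborel. u x * \<phi> x\<bar> \<le> D * n2 (\<lambda>x. jb s x * \<phi> x)" and D0: "0 \<le> D"
    and E: "\<And>\<zeta>. tf \<zeta> \<Longrightarrow> \<bar>LINT x|lborel. u x * lap (\<lambda>x. \<eta> x * \<zeta> x) x\<bar> \<le> E * gn \<zeta>" and E0: "0 \<le> E"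
    and p: "tf \<phi>"
  shows "\<bar>LINT x|lborel. u x * \<eta> x * pd i \<phi> x\<bar> \<le> (24 * A * D + E) * n2 \<phi>"
    and "\<bar>LINT x|lborel. u x * \<eta> x * \<phi> x\<bar> \<le> 6 * (24 * A * D + E) * n2 (\<lambda>x. jb 1 x * \<phi> x)"
proof -
  have A0: "0 \<le> A" and se: "smooth \<eta>" using eta(1) by (auto simp: symb_def)
  obtain R where R: "0 < R" "continuous_on UNIV \<eta>" "\<And>x. R < norm x \<Longrightarrow> \<eta> x = 0"
    using cc_test[OF eta(2)] by (rule ccE) (rule that)
  have l: "lloc (\<lambda>x. u x * \<eta> x)"
    using lloc_mult_continuous[OF u R(2)] by (simp add: mult.commute)
  have z: "u x * \<eta> x = 0" if "R < norm x" for x using R(3)[OF that] by simp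
  have b: "\<bar>LINT x|lborel. u x * \<eta> x * lap \<zeta> x\<bar> \<le> (24 * A * D + E) * gn \<zeta>" if t: "tf \<zeta>" for \<zeta>
  proof -
    have s: "smooth \<zeta>" by (rule test_function_smooth[OF t])
    have t1: "test_function G (\<lambda>x. \<eta> x * \<zeta> x)" by (rule test_function_mult2[OF eta(2) s])
    have t2: "test_function G (\<lambda>x. pd i \<eta> x * pd i \<zeta> x)" for i
      by (intro test_function_mult2 test_function_pd eta smooth_pd s)
    have t3: "test_function G (\<lambda>x. lap \<eta> x * \<zeta> x)"
      by (intro test_function_mult2 test_function_lap eta s)
    note i = lloc_cc_integrable[OF u cc_test]
    have e: "u x * \<eta> x * lap \<zeta> x = u x * lap (\<lambda>x. \<eta> x * \<zeta> x) x
        - 2 * (\<Sum>i\<in>UNIV. u x * (pd i \<eta> x * pd i \<zeta> x)) - u x * (lap \<eta> x * \<zeta> x)" for x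
      unfolding lap_mult[OF se s] sum_distrib_left[symmetric] by (simp add: algebra_simps)
    have "(LINT x|lborel. u x * \<eta> x * lap \<zeta> x) = (LINT x|lborel. u x * lap (\<lambda>x. \<eta> x * \<zeta> x) x)
        - 2 * (\<Sum>i\<in>UNIV. LINT x|lborel. u x * (pd i \<eta> x * pd i \<zeta> x)) - (LINT x|lborel. u x * (lap \<eta> x * \<zeta> x))"
      unfolding e using i[OF test_function_lap[OF t1]] i[OF t2] i[OF t3] by simp
    then have "\<bar>LINT x|lborel. u x * \<eta> x * lap \<zeta> x\<bar> \<le> \<bar>LINT x|lborel. u x * lap (\<lambda>x. \<eta> x * \<zeta> x) x\<bar>
        + 2 * (\<Sum>i\<in>UNIV. \<bar>LINT x|lborel. u x * (pd i \<eta> x * pd i \<zeta> x)\<bar>) + \<bar>LINT x|lborel. u x * (lap \<eta> x * \<zeta> x)\<bar>"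
      using sum_abs[of "\<lambda>i. LINT x|lborel. u x * (pd i \<eta> x * pd i \<zeta> x)" UNIV] by linarith
    also have "\<dots> \<le> E * gn \<zeta> + 2 * (3 * (D * (A * gn \<zeta>))) + D * (3 * A * (6 * gn \<zeta>))"
    proof (intro add_mono mult_left_mono sum_UNIV3_le E t)
      fix i :: 3
      have "\<bar>LINT x|lborel. u x * (pd i \<eta> x * pd i \<zeta> x)\<bar> \<le> D * n2 (\<lambda>x. jb s x * (pd i \<eta> x * pd i \<zeta> x))"
        by (rule D[OF t2]) (simp add: S)
      also have "n2 (\<lambda>x. jb s x * (pd i \<eta> x * pd i \<zeta> x)) \<le> A * n2 (pd i \<zeta>)"
      proof (rule n2_le_mult[OF test_function_pd[OF t]])
        show "(\<lambda>x. jb s x * (pd i \<eta> x * pd i \<zeta> x)) \<in> borel_measurable borel"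
          by (intro smooth_borel smooth_mult smooth_jb smooth_pd se s)
        fix x
        have "jb s x * \<bar>pd i \<eta> x\<bar> \<le> jb s x * (A * jb (1 - s - 1) x)"
          using eta(1) by (intro mult_left_mono) (auto simp: symb_def)
        also have "\<dots> = A" using jb_add[of s "-s" x] by simp
        finally show "\<bar>jb s x * (pd i \<eta> x * pd i \<zeta> x)\<bar> \<le> A * \<bar>pd i \<zeta> x\<bar>"
          using mult_right_mono[of "jb s x * \<bar>pd i \<eta> x\<bar>" A "\<bar>pd i \<zeta> x\<bar>"] by (simp add: abs_mult mult.assoc)
      qed
      also note n2_pd_le_gn[of i \<zeta>]
      finally show "\<bar>LINT x|lborel. u x * (pd i \<eta> x * pd i \<zeta> x)\<bar> \<le> D * (A * gn \<zeta>)"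
        using D0 A0 by (simp add: mult_left_mono)
    next
      have "\<bar>LINT x|lborel. u x * (lap \<eta> x * \<zeta> x)\<bar> \<le> D * n2 (\<lambda>x. jb s x * (lap \<eta> x * \<zeta> x))"
        by (rule D[OF t3]) (simp add: S)
      also have "n2 (\<lambda>x. jb s x * (lap \<eta> x * \<zeta> x)) \<le> (3 * A) * n2 (\<lambda>x. jb (-1) x * \<zeta> x)"
      proof (rule n2_le_mult[OF tf_jb_mult[OF t]])
        show "(\<lambda>x. jb s x * (lap \<eta> x * \<zeta> x)) \<in> borel_measurable borel"
          by (intro smooth_borel smooth_mult smooth_jb smooth_lap se s)
        fix x
        have "\<bar>lap \<eta> x\<bar> \<le> (\<Sum>i\<in>UNIV. \<bar>pd i (pd i \<eta>) x\<bar>)" unfolding lap_def by (rule sum_abs)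
        also have "\<dots> \<le> 3 * (A * jb (1 - s - 2) x)"
          using eta(1) by (intro sum_UNIV3_le) (auto simp: symb_def)
        finally have "jb s x * \<bar>lap \<eta> x\<bar> \<le> jb s x * (3 * (A * jb (1 - s - 2) x))"
          by (intro mult_left_mono) auto
        also have "\<dots> = 3 * A * jb (-1) x" using jb_add[of s "-1-s" x] by simp
        finally show "\<bar>jb s x * (lap \<eta> x * \<zeta> x)\<bar> \<le> (3 * A) * \<bar>jb (-1) x * \<zeta> x\<bar>"
          using mult_right_mono[of "jb s x * \<bar>lap \<eta> x\<bar>" "3 * A * jb (-1) x" "\<bar>\<zeta> x\<bar>"] by (simp add: abs_mult mult.assoc)
      qed
      also have "\<dots> \<le> (3 * A) * (6 * gn \<zeta>)" using hardy[OF t] A0 by (intro mult_left_mono) auto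
      finally show "\<bar>LINT x|lborel. u x * (lap \<eta> x * \<zeta> x)\<bar> \<le> D * (3 * A * (6 * gn \<zeta>))"
        using D0 by (simp add: mult_left_mono)
    qed auto
    also have "\<dots> = (24 * A * D + E) * gn \<zeta>" by (simp add: algebra_simps)
    finally show ?thesis .
  qed
  have "0 \<le> 24 * A * D + E" using A0 D0 E0 by simp
  from weak_gradient_bound[OF l z b this p]
  show "\<bar>LINT x|lborel. u x * \<eta> x * pd i \<phi> x\<bar> \<le> (24 * A * D + E) * n2 \<phi>"
    "\<bar>LINT x|lborel. u x * \<eta> x * \<phi> x\<bar> \<le> 6 * (24 * A * D + E) * n2 (\<lambda>x. jb 1 x * \<phi> x)"
    by auto
qed

text \<open>One term carries the derivative of \<zeta>, the other is controlled by Hardy: 7 = 1 +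
  6.\<close>

lemma n2_jb_pd_mult_le:
  assumes e: "symb 1 A \<eta>" and t: "tf \<zeta>"
  shows "n2 (\<lambda>x. jb (-1) x * pd i (\<lambda>x. \<eta> x * \<zeta> x) x) \<le> 7 * A * gn \<zeta>"
proof -
  have A0: "0 \<le> A" and se: "smooth \<eta>" using e by (auto simp: symb_def)
  have s: "smooth \<zeta>" by (rule test_function_smooth[OF t])
  have t1: "tf (\<lambda>x. (jb (-1) x * \<eta> x) * pd i \<zeta> x)" and t2: "tf (\<lambda>x. (jb (-1) x * pd i \<eta> x) * \<zeta> x)"
    by (intro test_function_mult test_function_pd smooth_mult smooth_jb smooth_pd se t)+
  have "(\<lambda>x. jb (-1) x * pd i (\<lambda>x. \<eta> x * \<zeta> x) x)
      = (\<lambda>x. (jb (-1) x * \<eta> x) * pd i \<zeta> x + (jb (-1) x * pd i \<eta> x) * \<zeta> x)"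
    by (simp add: pd_mult_smooth se s algebra_simps)
  then have "n2 (\<lambda>x. jb (-1) x * pd i (\<lambda>x. \<eta> x * \<zeta> x) x)
      \<le> n2 (\<lambda>x. (jb (-1) x * \<eta> x) * pd i \<zeta> x) + n2 (\<lambda>x. (jb (-1) x * pd i \<eta> x) * \<zeta> x)"
    using l2n_triangle[OF tf_sq_int[OF t1] tf_sq_int[OF t2]] by simp
  also have "\<dots> \<le> A * n2 (pd i \<zeta>) + A * n2 (\<lambda>x. jb (-1) x * \<zeta> x)"
  proof (intro add_mono)
    show "n2 (\<lambda>x. (jb (-1) x * \<eta> x) * pd i \<zeta> x) \<le> A * n2 (pd i \<zeta>)"
    proof (rule n2_le_mult[OF test_function_pd[OF t] tf_borel[OF t1]])
      fix x
      have "jb (-1) x * \<bar>\<eta> x\<bar> \<le> jb (-1) x * (A * jb 1 x)" using e by (intro mult_left_mono) (auto simp: symb_def)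
      also have "\<dots> = A" using jb_add[of "-1" 1 x] by simp
      finally show "\<bar>jb (-1) x * \<eta> x * pd i \<zeta> x\<bar> \<le> A * \<bar>pd i \<zeta> x\<bar>"
        by (simp add: abs_mult mult_right_mono)
    qed
    show "n2 (\<lambda>x. (jb (-1) x * pd i \<eta> x) * \<zeta> x) \<le> A * n2 (\<lambda>x. jb (-1) x * \<zeta> x)"
    proof (rule n2_le_mult[OF tf_jb_mult[OF t] tf_borel[OF t2]])
      fix x
      have "\<bar>pd i \<eta> x\<bar> \<le> A" using e by (auto simp: symb_def dest: spec[of _ x])
      then have "jb (-1) x * \<bar>\<zeta> x\<bar> * \<bar>pd i \<eta> x\<bar> \<le> jb (-1) x * \<bar>\<zeta> x\<bar> * A" by (intro mult_left_mono) auto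
      then show "\<bar>jb (-1) x * pd i \<eta> x * \<zeta> x\<bar> \<le> A * \<bar>jb (-1) x * \<zeta> x\<bar>" by (simp add: abs_mult mult_ac)
    qed
  qed
  also have "\<dots> \<le> A * gn \<zeta> + A * (6 * gn \<zeta>)"
    using A0 by (intro add_mono mult_left_mono n2_pd_le_gn hardy[OF t])
  finally show ?thesis by (simp add: algebra_simps)
qed

section \<open>Estimates at infinity and in the interior\<close>

text \<open>The vector \<open>R *\<^sub>R axis 1 1\<close> serves as a point of norm |R|, where the
  weight takes its largest value on the ball.\<close>

lemma indicator_le_jb:
  assumes "S \<subseteq> cball 0 R" "0 \<le> s"
  shows "indicator S x \<le> jb s (R *\<^sub>R axis 1 1 :: real^3) * jb (- s) (x :: real^3)"
proof (cases "x \<in> S")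
  case True
  then have "norm x \<le> R" using assms(1) by auto
  then have "1 + (norm x)\<^sup>2 \<le> 1 + (norm (R *\<^sub>R axis 1 1 :: real^3))\<^sup>2" by (simp add: power_mono)
  then have "jb s x \<le> jb s (R *\<^sub>R axis 1 1 :: real^3)"
    unfolding jb_def using assms(2) one_norm_sq_pos[of x] by (intro powr_mono2) auto
  then have "jb s x * jb (-s) x \<le> jb s (R *\<^sub>R axis 1 1 :: real^3) * jb (- s) x"
    by (rule mult_right_mono) simp
  moreover have "jb s x * jb (-s) x = 1" using jb_cancel[of s x] by (simp only: mult.commute)
  ultimately show ?thesis using True by (simp only: indicator_simps)
qed simp

lemma n2_bounded_le:
  assumes f: "test_function G f" and G: "G \<subseteq> cball 0 R" and s: "0 \<le> s"
  shows "n2 f \<le> jb s (R *\<^sub>R axis 1 1 :: real^3) * n2 (\<lambda>x. jb (- s) x * f x)"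
proof (rule n2_le_mult[OF tf_jb_mult[OF f] tf_borel[OF f]])
  fix x
  have "\<bar>f x\<bar> = indicator G x * \<bar>f x\<bar>"
    using test_function_outside[OF f] by (cases "x \<in> G") auto
  also have "\<dots> \<le> (jb s (R *\<^sub>R axis 1 1 :: real^3) * jb (- s) x) * \<bar>f x\<bar>"
    by (intro mult_right_mono indicator_le_jb[OF G s]) auto
  finally show "\<bar>f x\<bar> \<le> jb s (R *\<^sub>R axis 1 1 :: real^3) * \<bar>jb (- s) x * f x\<bar>"
    by (simp add: abs_mult mult.assoc)
qed

lemma CS_jb:
  assumes "sq_int lborel (\<lambda>x. jb (-s) x * f x)" "test_function G \<phi>"
  shows "\<bar>LINT x|lborel. f x * \<phi> x\<bar> \<le> n2 (\<lambda>x. jb (-s) x * f x) * n2 (\<lambda>x. jb s x * \<phi> x)"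
proof -
  have "(jb (-s) x * f x) * (jb s x * \<phi> x) = (jb (-s) x * jb s x) * (f x * \<phi> x)" for x
    by (simp only: mult_ac)
  then have "f x * \<phi> x = (jb (-s) x * f x) * (jb s x * \<phi> x)" for x by (simp add: jb_cancel)
  then show ?thesis
    using l2n_CS[OF assms(1) tf_sq_int[OF tf_jb_mult[OF assms(2)]], of s] by (simp only:)
qed

lemma CS_tf:
  assumes "sq_int lborel f" "test_function G \<phi>"
  shows "\<bar>LINT x|lborel. f x * \<phi> x\<bar> \<le> n2 f * n2 \<phi>"
  using l2n_CS[OF assms(1) tf_sq_int[OF assms(2)]] .

lemma tail_tendsto_0:
  assumes f: "sq_int lborel (f :: real^3 \<Rightarrow> real)"
  shows "(\<lambda>n. n2 (\<lambda>x. indicator {x. real n \<le> norm x} x * f x)) \<longlonglongrightarrow> 0"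
proof -
  have [measurable]: "f \<in> borel_measurable borel" using f by (auto simp: sq_int_def)
  have [measurable]: "{x::real^3. real n \<le> norm x} \<in> sets borel" for n by measurable
  have "(\<lambda>n. LINT x|lborel. (indicator {x. real n \<le> norm x} x * f x)\<^sup>2) \<longlonglongrightarrow> (LINT x|(lborel :: (real^3) measure). (0::real))"
  proof (rule integral_dominated_convergence[where w="\<lambda>x. (f x)\<^sup>2" and f="\<lambda>x. 0"
        and s="\<lambda>n x. (indicator {x. real n \<le> norm x} x * f x)\<^sup>2"])
    show "AE x in lborel. (\<lambda>n. (indicator {x. real n \<le> norm x} x * f x)\<^sup>2) \<longlonglongrightarrow> 0"
    proof (rule AE_I2)
      fix x :: "real^3"
      obtain N where N: "norm x < real N" using reals_Archimedean2 by blast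
      show "(\<lambda>n. (indicator {x. real n \<le> norm x} x * f x)\<^sup>2) \<longlonglongrightarrow> 0"
      proof (rule tendsto_eventually)
        show "\<forall>\<^sub>F n in sequentially. (indicator {x. real n \<le> norm x} x * f x)\<^sup>2 = 0"
          using eventually_ge_at_top[of N] by eventually_elim (use N in \<open>auto simp: indicator_def\<close>)
      qed
    qed
    show "integrable lborel (\<lambda>x. (f x)\<^sup>2)" using f by (simp add: sq_int_def)
  qed (auto simp: indicator_def)
  then have "(\<lambda>n. sqrt (LINT x|lborel. (indicator {x. real n \<le> norm x} x * f x)\<^sup>2)) \<longlonglongrightarrow> sqrt 0"
    by (intro tendsto_real_sqrt) simp
  then show ?thesis by (simp add: l2n_def)
qed

lemma pd_zero_on_open:
  assumes "open U" "\<And>x. x \<in> U \<Longrightarrow> f x = 0" "x \<in> U" shows "pd i f x = 0"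
  by (rule pd_zero_outside[of "- U"]) (use assms in auto)

text \<open>\<open>p\<close> is the weak gradient of \<open>u\<close>, and \<open>m\<close> plays the role of the extension of \<open>M\<close> by zero.\<close>

locale potential =
  fixes u :: "real^3 \<Rightarrow> real" and p m :: "3 \<Rightarrow> real^3 \<Rightarrow> real" and R0 :: real
  assumes u_borel: "u \<in> borel_measurable borel"
    and u_weight: "sq_int lborel (\<lambda>x. jb (-1) x * u x)"
    and p_sq: "\<And>i. sq_int lborel (p i)"
    and grad_u: "\<And>i \<phi>. tf \<phi> \<Longrightarrow> (LINT x|lborel. u x * pd i \<phi> x) = - (LINT x|lborel. p i x * \<phi> x)"
    and m_sq: "\<And>i. sq_int lborel (m i)"
    and m_zero: "\<And>i x. R0 < norm x \<Longrightarrow> m i x = 0"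
    and R0: "0 < R0"
    and lap_u: "\<And>\<phi>. tf \<phi> \<Longrightarrow> (LINT x|lborel. u x * lap \<phi> x) = - (\<Sum>i\<in>UNIV. LINT x|lborel. m i x * pd i \<phi> x)"
begin

lemma u_sqloc: "sqloc u"
proof -
  have "sqloc (\<lambda>x. jb 1 x * (jb (-1) x * u x))"
    by (intro sqloc_mult_continuous sq_int_sqloc u_weight smooth_continuous smooth_jb)
  moreover have "jb 1 x * (jb (-1) x * u x) = (jb (-1) x * jb 1 x) * u x" for x by (simp only: mult_ac)
  ultimately show ?thesis by (simp add: jb_cancel)
qed

lemma u_lloc: "lloc u"
  by (rule sqloc_lloc[OF u_sqloc])

lemma p_lloc: "lloc (p i)"
  by (intro sqloc_lloc sq_int_sqloc p_sq)

text \<open>\<open>m\<close> is supported in a ball, on which all weights are comparable. The weight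
  \<open>jb (-1)\<close> is the one that Hardy's inequality removes at the price of one
  derivative.\<close>

lemma m_bound: "\<exists>K\<ge>0. \<forall>i f. tf f \<longrightarrow> \<bar>LINT x|lborel. m i x * f x\<bar> \<le> K * n2 (\<lambda>x. jb (-1) x * f x)"
proof -
  let ?c = "jb 1 (R0 *\<^sub>R axis 1 1 :: real^3)"
  let ?K = "(\<Sum>i\<in>UNIV. n2 (m i)) * ?c"
  have nn: "0 \<le> (\<Sum>i\<in>UNIV. n2 (m i))" by (intro sum_nonneg) auto
  have "\<bar>LINT x|lborel. m i x * f x\<bar> \<le> ?K * n2 (\<lambda>x. jb (-1) x * f x)" if f: "tf f" for i f
  proof -
    note [measurable] = tf_borel[OF f]
    have e: "m i x * f x = m i x * (indicator (cball 0 R0) x * f x)" for x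
      using m_zero[of x i] by (cases "norm x \<le> R0") auto
    have "\<bar>LINT x|lborel. m i x * f x\<bar> \<le> n2 (m i) * n2 (\<lambda>x. indicator (cball 0 R0) x * f x)"
      unfolding e by (intro l2n_CS m_sq sq_int_indicator tf_sq_int[OF f]) simp
    also have "\<dots> \<le> (\<Sum>i\<in>UNIV. n2 (m i)) * (?c * n2 (\<lambda>x. jb (-1) x * f x))"
    proof (intro mult_mono nn)
      show "n2 (m i) \<le> (\<Sum>i\<in>UNIV. n2 (m i))" by (intro member_le_sum) auto
      show "n2 (\<lambda>x. indicator (cball 0 R0) x * f x) \<le> ?c * n2 (\<lambda>x. jb (-1) x * f x)"
      proof (rule n2_le_mult[OF tf_jb_mult[OF f]])
        fix x
        show "\<bar>indicator (cball 0 R0) x * f x\<bar> \<le> ?c * \<bar>jb (- 1) x * f x\<bar>"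
          using mult_right_mono[OF indicator_le_jb[of "cball 0 R0" R0 1 x], of "\<bar>f x\<bar>"]
          by (simp add: abs_mult mult.assoc)
      qed simp
    qed auto
    finally show ?thesis by (simp add: mult.assoc)
  qed
  then show ?thesis using nn by (intro exI[of _ ?K]) auto
qed

text \<open>A priori \<open>u\<close> is square integrable only with the weight
  \<open>jb (-1)\<close>. The source is a divergence, so pairing \<open>u\<close> with
  \<open>lap w\<close> costs a gradient of \<open>w\<close>, which Hardy and
  \<open>second_derivatives_le_lap\<close> bound by the norm of \<open>lap w\<close>. Riesz on the
  space of Laplacians yields a square-integrable \<open>q\<close> with the same Laplacian as
  \<open>u\<close>, and the harmonic difference is shown to vanish.\<close>

lemma u_L2: "\<exists>C\<ge>0. \<forall>\<phi>. tf \<phi> \<longrightarrow> \<bar>LINT x|lborel. u x * \<phi> x\<bar> \<le> C * n2 \<phi>"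
proof -
  obtain K where K: "0 \<le> K" "\<And>i f. tf f \<Longrightarrow> \<bar>LINT x|lborel. m i x * f x\<bar> \<le> K * n2 (\<lambda>x. jb (-1) x * f x)"
    using m_bound by blast
  \<comment> \<open>18 = 3 * 6: three components of \<open>m\<close>, each with Hardy's
    constant.\<close>
  have lb: "\<bar>LINT x|lborel. u x * lap w x\<bar> \<le> 18 * K * n2 (lap w)" if w: "tf w" for w
  proof -
    have "\<bar>LINT x|lborel. u x * lap w x\<bar> \<le> (\<Sum>i\<in>UNIV. \<bar>LINT x|lborel. m i x * pd i w x\<bar>)"
      unfolding lap_u[OF w] abs_minus_cancel by (rule sum_abs)
    also have "\<dots> \<le> 3 * (K * (6 * n2 (lap w)))"
    proof (rule sum_UNIV3_le)
      fix i :: 3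
      have "n2 (\<lambda>x. jb (-1) x * pd i w x) \<le> 6 * n2 (lap w)"
        using hardy[OF test_function_pd[OF w], of i] second_derivatives_le_lap[OF w, of i] by simp
      then show "\<bar>LINT x|lborel. m i x * pd i w x\<bar> \<le> K * (6 * n2 (lap w))"
        using K(2)[OF test_function_pd[OF w], of i i] mult_left_mono[OF _ K(1)] order_trans by blast
    qed
    finally show ?thesis by simp
  qed
  have iu: "integrable lborel (\<lambda>x. u x * f x)" if "tf f" for f
    by (rule lloc_cc_integrable[OF u_lloc cc_test[OF that]])
  have lapc: "(\<lambda>x. lap v x + c * lap w x) = lap (\<lambda>x. v x + c * w x)" if "tf v" "tf w" for v w c
    using that[THEN test_function_smooth]
    by (simp add: lap_def[abs_def] pd_add_smooth pd_cmult_smooth smooth_mult smooth_pd sum.distrib sum_distrib_left)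
  have "\<exists>q. sq_int lborel q \<and> (\<forall>f\<in>{lap w |w. tf w}. (LINT x|lborel. u x * f x) = (LINT x|lborel. q x * f x))"
  proof (rule L2_riesz[where C="18 * K"])
    fix f g c assume "f \<in> {lap w |w. tf w}" "g \<in> {lap w |w. tf w}"
    then obtain v w where vw: "f = lap v" "g = lap w" "tf v" "tf w" by auto
    show "(\<lambda>x. f x + c * g x) \<in> {lap w |w. tf w}"
      unfolding vw(1,2) lapc[OF vw(3,4)]
      using test_function_add[OF vw(3) test_function_mult[OF smooth_const vw(4)], of c] by auto
    show "(LINT x|lborel. u x * (f x + c * g x)) = (LINT x|lborel. u x * f x) + c * (LINT x|lborel. u x * g x)"
      using iu[OF test_function_lap[OF vw(3)]] iu[OF test_function_lap[OF vw(4)]]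
      by (simp add: vw(1,2) distrib_left mult.left_commute[of _ c])
  next
    show "sq_int lborel f" if "f \<in> {lap w |w. tf w}" for f
      using that tf_sq_int[OF test_function_lap] by auto
    show "{lap w |w. tf w} \<noteq> {}" by (auto intro!: exI[of _ "\<lambda>x. 0"])
    show "\<bar>LINT x|lborel. u x * f x\<bar> \<le> 18 * K * n2 f" if "f \<in> {lap w |w. tf w}" for f
      using that lb by auto
  qed
  then obtain q where q: "sq_int lborel q" "\<And>w. tf w \<Longrightarrow> (LINT x|lborel. u x * lap w x) = (LINT x|lborel. q x * lap w x)"
    by auto
  have q1: "q \<in> borel_measurable borel" and ql: "lloc q"
    using q(1) sqloc_lloc[OF sq_int_sqloc[OF q(1)]] by (auto simp: sq_int_def)
  define h where "h x = u x - q x" for x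
  have hl: "lloc h" unfolding h_def[abs_def] by (intro lloc_diff u_lloc ql)
  have hlap: "(LINT x|lborel. h x * lap w x) = 0" if "tf w" for w
    using q(2)[OF that] iu[OF test_function_lap[OF that]] lloc_cc_integrable[OF ql cc_test[OF test_function_lap[OF that]]]
    by (simp add: h_def left_diff_distrib)
  have hw: "sq_int lborel (\<lambda>x. jb (-1) x * h x)"
  proof -
    have "\<bar>jb (-1) x * q x\<bar> \<le> \<bar>q x\<bar>" for x
    proof -
      have "jb (-1) x \<le> 1" using powr_mono[of "- 1 / 2" 0 "1 + (norm x)\<^sup>2"] one_norm_sq_pos[of x] by (simp add: jb_def)
      then show ?thesis unfolding abs_mult by (intro mult_left_le_one_le) auto
    qed
    then have "sq_int lborel (\<lambda>x. jb (-1) x * q x)"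
      by (intro sq_int_bound[OF q(1)]) (auto intro!: borel_measurable_times q1 smooth_borel[OF smooth_jb])
    from sq_int_diff[OF u_weight this] show ?thesis by (simp add: h_def right_diff_distrib)
  qed
  obtain \<kappa> :: "real \<Rightarrow> real^3 \<Rightarrow> real" and A where kap:
    "\<And>R. 1 \<le> R \<Longrightarrow> tf (\<kappa> R)" "\<And>R. 1 \<le> R \<Longrightarrow> symb 0 A (\<kappa> R)"
    "\<And>R x. 1 \<le> R \<Longrightarrow> norm x \<le> R \<Longrightarrow> \<kappa> R x = 1"
    "\<And>R x i. 1 \<le> R \<Longrightarrow> norm x < R \<Longrightarrow> pd i (\<kappa> R) x = 0"
    "\<And>R x. 1 \<le> R \<Longrightarrow> norm x < R \<Longrightarrow> lap (\<kappa> R) x = 0"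
    by (rule infinity_cutoff) (rule that)
  \<comment> \<open>Liouville argument: the harmonic \<open>h\<close>, cut off at radius
    \<open>n\<close>, leaves only commutator terms, and these see just its weighted norm over the
    region outside that radius, which tends to zero.\<close>
  define D where "D n = n2 (\<lambda>x. indicator {x. real n \<le> norm x} x * (jb (-1) x * h x))" for n
  have D0: "D \<longlonglongrightarrow> 0" unfolding D_def by (rule tail_tendsto_0[OF hw])
  have h0: "(LINT x|lborel. h x * \<phi> x) = 0" if t: "tf \<phi>" for \<phi>
  proof -
    obtain R where R: "0 < R" "\<And>x. R < norm x \<Longrightarrow> \<phi> x = 0" using cc_test[OF t] by (rule ccE) (rule that)
    obtain N where N: "R + 1 < real N" using reals_Archimedean2 by blast
    have b: "\<bar>LINT x|lborel. h x * \<phi> x\<bar> \<le> 6 * (24 * A * D n + 0) * n2 (\<lambda>x. jb 1 x * \<phi> x)" if n: "N \<le> n" for n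
    proof -
      have n1: "1 \<le> real n" "R \<le> real n" using n N R(1) by auto
      have "\<bar>LINT x|lborel. h x * \<kappa> (real n) x * \<phi> x\<bar> \<le> 6 * (24 * A * D n + 0) * n2 (\<lambda>x. jb 1 x * \<phi> x)"
      proof (rule weighted_estimate(2)[OF hl, where s=1 and G=UNIV and S="{x. real n \<le> norm x}"])
        show "symb (1 - 1) A (\<kappa> (real n))" "tf (\<kappa> (real n))" using kap(1,2)[OF n1(1)] by simp_all
        show "pd i (\<kappa> (real n)) x = 0" if "x \<notin> {x. real n \<le> norm x}" for x i
          using that by (intro kap(4)[OF n1(1)]) auto
        show "lap (\<kappa> (real n)) x = 0" if "x \<notin> {x. real n \<le> norm x}" for x
          using that by (intro kap(5)[OF n1(1)]) auto
        show "0 \<le> D n" by (simp add: D_def)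
        fix \<psi> assume ps: "tf \<psi>" "\<And>x. x \<notin> {x. real n \<le> norm x} \<Longrightarrow> \<psi> x = 0"
        define g where "g x = indicator {x. real n \<le> norm x} x * h x" for x
        have g: "sq_int lborel (\<lambda>x. jb (-1) x * g x)"
          using sq_int_indicator[OF hw, of "{x. real n \<le> norm x}"] by (simp add: g_def mult.left_commute)
        have e: "h x * \<psi> x = g x * \<psi> x" for x using ps(2)[of x] by (auto simp: g_def indicator_def)
        show "\<bar>LINT x|lborel. h x * \<psi> x\<bar> \<le> D n * n2 (\<lambda>x. jb 1 x * \<psi> x)"
          using CS_jb[of 1 g, OF _ ps(1)] g unfolding e by (simp add: D_def g_def mult.left_commute)
      next
        fix \<zeta> assume "tf \<zeta>"
        then have "tf (\<lambda>x. \<kappa> (real n) x * \<zeta> x)"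
          by (intro test_function_mult test_function_smooth[OF kap(1)[OF n1(1)]])
        then show "\<bar>LINT x|lborel. h x * lap (\<lambda>x. \<kappa> (real n) x * \<zeta> x) x\<bar> \<le> 0 * gn \<zeta>"
          by (simp add: hlap)
      qed (use t in auto)
      moreover have "h x * \<kappa> (real n) x * \<phi> x = h x * \<phi> x" for x
        using kap(3)[OF n1(1), of x] R(2)[of x] n1 by (cases "norm x \<le> R") auto
      ultimately show ?thesis by simp
    qed
    have "(\<lambda>n. 6 * (24 * A * D n + 0) * n2 (\<lambda>x. jb 1 x * \<phi> x)) \<longlonglongrightarrow> 6 * (24 * A * 0 + 0) * n2 (\<lambda>x. jb 1 x * \<phi> x)"
      by (intro tendsto_intros D0)
    then have "\<bar>LINT x|lborel. h x * \<phi> x\<bar> \<le> 6 * (24 * A * 0 + 0) * n2 (\<lambda>x. jb 1 x * \<phi> x)"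
      using b by (intro LIMSEQ_le_const[of _ _ "\<bar>LINT x|lborel. h x * \<phi> x\<bar>"]) auto
    then show ?thesis by simp
  qed
  have "\<bar>LINT x|lborel. u x * \<phi> x\<bar> \<le> n2 q * n2 \<phi>" if t: "tf \<phi>" for \<phi>
  proof -
    have "(LINT x|lborel. u x * \<phi> x) = (LINT x|lborel. q x * \<phi> x)"
      using h0[OF t] iu[OF t] lloc_cc_integrable[OF ql cc_test[OF t]]
      by (simp add: h_def left_diff_distrib)
    then show ?thesis using CS_tf[OF q(1) t] by simp
  qed
  then show ?thesis by (intro exI[of _ "n2 q"]) auto
qed

text \<open>A bound for the pairing with \<open>jb s\<close> times the derivative of \<zeta> becomes
  a bound for the pairing with the derivative of \<phi> in a dual weighted norm; the derivative of
  the weight is a term of lower order.\<close>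

lemma pd_jb_split:
  fixes s :: real
  assumes t: "test_function G \<phi>"
  defines "\<zeta> \<equiv> \<lambda>x. jb (-s) x * \<phi> x"
  shows "pd i \<phi> x = jb s x * pd i \<zeta> x + s * (x $ i * jb (s - 2) x * \<zeta> x)"
proof -
  have z: "test_function G \<zeta>" unfolding \<zeta>_def by (rule tf_jb_mult[OF t])
  have "jb s x * (jb (-s) x * \<phi> x) = (jb (-s) x * jb s x) * \<phi> x" for x by (simp only: mult_ac)
  then have "\<phi> = (\<lambda>x. jb s x * \<zeta> x)" by (simp only: \<zeta>_def jb_cancel mult_1_left)
  then have "pd i \<phi> x = pd i (\<lambda>x. jb s x * \<zeta> x) x" by simp
  then show ?thesis by (simp add: pd_mult_smooth smooth_jb test_function_smooth[OF z] pd_jb mult.assoc)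
qed

lemma coord_jb_mult_le: "\<bar>x $ i * jb (t - 1) x * y\<bar> \<le> jb t (x::real^3) * \<bar>y\<bar>"
proof -
  have "\<bar>x $ i\<bar> * jb (t - 1) x \<le> jb 1 x * jb (t - 1) x" by (intro mult_right_mono coord_jb_le) simp
  also have "\<dots> = jb t x" by (simp flip: jb_add)
  finally show ?thesis by (simp add: abs_mult mult_right_mono)
qed

lemma test_function_eventually_cutoff:
  assumes "tf \<phi>" obtains R where "1 \<le> (R::real)" "\<And>x i. R < norm x \<Longrightarrow> pd i \<phi> x = 0"
proof -
  obtain R where R: "0 < R" "\<And>x. R < norm x \<Longrightarrow> \<phi> x = 0" using cc_test[OF assms] by (rule ccE) (rule that)
  show ?thesis
  proof (rule that[of "R + 1"])
    show "pd i \<phi> x = 0" if "R + 1 < norm x" for x i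
      by (rule pd_zero_outside[of "cball 0 R"]) (use R that in auto)
  qed (use R in simp)
qed

text \<open>The order-one symbol \<open>jb 1 x * \<kappa> R x\<close> is admissible in
  \<open>weighted_estimate\<close> because \<open>u\<close> is already square integrable, which is
  the case s = 0. The constant does not depend on \<open>R\<close>, so for each \<phi> the radius
  can be taken so large that the cut-off disappears.\<close>

lemma grad_weight: "\<exists>C\<ge>0. \<forall>i \<phi>. tf \<phi> \<longrightarrow> \<bar>LINT x|lborel. u x * pd i \<phi> x\<bar> \<le> C * n2 (\<lambda>x. jb (-1) x * \<phi> x)"
proof -
  obtain C0 where C0: "0 \<le> C0" "\<And>\<phi>. tf \<phi> \<Longrightarrow> \<bar>LINT x|lborel. u x * \<phi> x\<bar> \<le> C0 * n2 \<phi>"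
    using u_L2 by blast
  obtain K where K: "0 \<le> K" "\<And>i f. tf f \<Longrightarrow> \<bar>LINT x|lborel. m i x * f x\<bar> \<le> K * n2 (\<lambda>x. jb (-1) x * f x)"
    using m_bound by blast
  obtain \<kappa> :: "real \<Rightarrow> real^3 \<Rightarrow> real" and A where kap:
    "\<And>R. 1 \<le> R \<Longrightarrow> tf (\<kappa> R)" "\<And>R. 1 \<le> R \<Longrightarrow> symb 0 A (\<kappa> R)"
    "\<And>R x. 1 \<le> R \<Longrightarrow> norm x \<le> R \<Longrightarrow> \<kappa> R x = 1"
    by (rule infinity_cutoff) (rule that)
  obtain B where B: "symb 1 B (jb 1 :: real^3 \<Rightarrow> real)" using symb_jb by blast
  define A' where "A' = 4 * B * A"
  \<comment> \<open>21 = 3 * 7, from the three components of \<open>m\<close> and the constant of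
    \<open>n2_jb_pd_mult_le\<close>.\<close>
  define C1 where "C1 = 24 * A' * C0 + 21 * K * A'"
  have s1: "symb 1 A' (\<lambda>x. jb 1 x * \<kappa> R x)" if "1 \<le> R" for R
    using symb_mult[OF B kap(2)[OF that]] by (simp add: A'_def)
  have A0: "0 \<le> A'" using s1[of 1] by (simp add: symb_def)
  have C10: "0 \<le> C1" using A0 C0 K by (simp add: C1_def)
  have est: "\<bar>LINT x|lborel. u x * (jb 1 x * pd i \<phi> x)\<bar> \<le> C1 * n2 \<phi>" if t: "tf \<phi>" for i \<phi>
  proof -
    obtain R where R: "1 \<le> R" "\<And>x i. R < norm x \<Longrightarrow> pd i \<phi> x = 0" by (rule test_function_eventually_cutoff[OF t]) (rule that)
    have "\<bar>LINT x|lborel. u x * (jb 1 x * \<kappa> R x) * pd i \<phi> x\<bar> \<le> C1 * n2 \<phi>"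
      unfolding C1_def
    proof (rule weighted_estimate(1)[OF u_lloc, where s=0 and G=UNIV and S=UNIV])
      show "symb (1 - 0) A' (\<lambda>x. jb 1 x * \<kappa> R x)" using s1[OF R(1)] by simp
      show "tf (\<lambda>x. jb 1 x * \<kappa> R x)" by (rule tf_jb_mult[OF kap(1)[OF R(1)]])
      show "\<bar>LINT x|lborel. u x * \<psi> x\<bar> \<le> C0 * n2 (\<lambda>x. jb 0 x * \<psi> x)" if "tf \<psi>" for \<psi>
        using C0(2)[OF that] by simp
      fix \<zeta> assume z: "tf \<zeta>"
      have tz: "tf (\<lambda>x. jb 1 x * \<kappa> R x * \<zeta> x)"
        by (intro test_function_mult smooth_mult smooth_jb test_function_smooth[OF kap(1)[OF R(1)]] z)
      have "\<bar>LINT x|lborel. u x * lap (\<lambda>x. jb 1 x * \<kappa> R x * \<zeta> x) x\<bar>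
          \<le> (\<Sum>i\<in>UNIV. \<bar>LINT x|lborel. m i x * pd i (\<lambda>x. jb 1 x * \<kappa> R x * \<zeta> x) x\<bar>)"
        unfolding lap_u[OF tz] abs_minus_cancel by (rule sum_abs)
      also have "\<dots> \<le> 3 * (K * (7 * A' * gn \<zeta>))"
      proof (rule sum_UNIV3_le)
        fix i :: 3
        show "\<bar>LINT x|lborel. m i x * pd i (\<lambda>x. jb 1 x * \<kappa> R x * \<zeta> x) x\<bar> \<le> K * (7 * A' * gn \<zeta>)"
          using K(2)[OF test_function_pd[OF tz], of i i]
            mult_left_mono[OF n2_jb_pd_mult_le[OF s1[OF R(1)] z, of i] K(1)] by (rule order_trans)
      qed
      finally show "\<bar>LINT x|lborel. u x * lap (\<lambda>x. jb 1 x * \<kappa> R x * \<zeta> x) x\<bar> \<le> (21 * K * A') * gn \<zeta>" by simp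
    qed (use t C0 K A0 in auto)
    moreover have "u x * (jb 1 x * \<kappa> R x) * pd i \<phi> x = u x * (jb 1 x * pd i \<phi> x)" for x
      using kap(3)[OF R(1), of x] R(2)[of x i] by (cases "norm x \<le> R") auto
    ultimately show ?thesis by simp
  qed
  have "\<bar>LINT x|lborel. u x * pd i \<phi> x\<bar> \<le> (C1 + C0) * n2 (\<lambda>x. jb (-1) x * \<phi> x)" if t: "tf \<phi>" for i \<phi>
  proof -
    define \<zeta> where "\<zeta> = (\<lambda>x. jb (-1) x * \<phi> x)"
    have z: "tf \<zeta>" unfolding \<zeta>_def by (rule tf_jb_mult[OF t])
    have t1: "tf (\<lambda>x. jb 1 x * pd i \<zeta> x)" by (intro tf_jb_mult test_function_pd z)
    have t2: "tf (\<lambda>x. x $ i * jb (-1) x * \<zeta> x)" by (intro test_function_mult smooth_mult smooth_coord smooth_jb z)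
    have e: "pd i \<phi> x = jb 1 x * pd i \<zeta> x + x $ i * jb (-1) x * \<zeta> x" for x
      using pd_jb_split[OF t, of i x 1] by (simp add: \<zeta>_def)
    have "(LINT x|lborel. u x * pd i \<phi> x) = (LINT x|lborel. u x * (jb 1 x * pd i \<zeta> x)) + (LINT x|lborel. u x * (x $ i * jb (-1) x * \<zeta> x))"
      unfolding e using lloc_cc_integrable[OF u_lloc cc_test[OF t1]] lloc_cc_integrable[OF u_lloc cc_test[OF t2]]
      by (simp add: distrib_left)
    moreover have "n2 (\<lambda>x. x $ i * jb (-1) x * \<zeta> x) \<le> n2 \<zeta>"
      using coord_jb_mult_le[of _ i 0] by (intro n2_mono_tf[OF z tf_borel[OF t2]]) simp
    ultimately show ?thesis
      using est[OF z, of i] C0(2)[OF t2] mult_left_mono[OF _ C0(1), of "n2 (\<lambda>x. x $ i * jb (-1) x * \<zeta> x)" "n2 \<zeta>"]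
      unfolding \<zeta>_def[symmetric] distrib_right by linarith
  qed
  then show ?thesis using C10 C0 by (intro exI[of _ "C1 + C0"]) auto
qed

lemma p_weight: "\<exists>C\<ge>0. \<forall>i \<phi>. tf \<phi> \<longrightarrow> \<bar>LINT x|lborel. p i x * \<phi> x\<bar> \<le> C * n2 (\<lambda>x. jb (-1) x * \<phi> x)"
  using grad_weight by (simp add: grad_u)

lemma p_lap:
  assumes t: "tf \<phi>"
  shows "(LINT x|lborel. p j x * lap \<phi> x) = - (LINT x|lborel. u x * lap (pd j \<phi>) x)"
  using grad_u[OF test_function_lap[OF t], of j] by (simp add: pd_lap test_function_smooth[OF t])

text \<open>The argument of \<open>grad_weight\<close> one derivative higher: \<open>p j\<close>
  with s = -1 and a symbol of order two. The factor \<open>th\<close> removes a neighbourhood of the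
  support of \<open>m\<close>; outside it \<open>p j\<close> is harmonic, so the source contributes
  nothing.\<close>

lemma second_far:
  "\<exists>C\<ge>0. \<forall>i j \<phi>. test_function {x. R0 + 2 < norm x} \<phi> \<longrightarrow>
     \<bar>LINT x|lborel. p j x * pd i \<phi> x\<bar> \<le> C * n2 (\<lambda>x. jb (-2) x * \<phi> x)"
proof -
  obtain C0 where C0: "0 \<le> C0" "\<And>i \<phi>. tf \<phi> \<Longrightarrow> \<bar>LINT x|lborel. p i x * \<phi> x\<bar> \<le> C0 * n2 (\<lambda>x. jb (-1) x * \<phi> x)"
    using p_weight by blast
  obtain \<kappa> :: "real \<Rightarrow> real^3 \<Rightarrow> real" and A where kap:
    "\<And>R. 1 \<le> R \<Longrightarrow> tf (\<kappa> R)" "\<And>R. 1 \<le> R \<Longrightarrow> symb 0 A (\<kappa> R)"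
    "\<And>R x. 1 \<le> R \<Longrightarrow> norm x \<le> R \<Longrightarrow> \<kappa> R x = 1"
    by (rule infinity_cutoff) (rule that)
  obtain B where B: "symb 2 B (jb 2 :: real^3 \<Rightarrow> real)" using symb_jb by blast
  obtain b where b: "smooth b" "\<And>x. 0 \<le> b x" "\<And>x. b x \<le> 1"
      "\<And>x. norm x \<le> R0 + 1 \<Longrightarrow> b x = 1" "\<And>x. R0 + 2 \<le> norm x \<Longrightarrow> b (x::real^3) = 0"
    by (rule plateau[of "R0 + 1" "R0 + 2" "0::real^3"]) auto
  have tb: "tf b" using b(5) by (intro test_functionI[of _ "cball 0 (R0 + 2)"] b(1)) auto
  obtain A1 where A1: "symb 0 A1 b" by (rule tf_symb[OF tb]) (rule that)
  define th where "th x = 1 - b x" for x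
  have th: "symb 0 (1 + A1) th" using symb_diff[OF symb_const[of 1] A1] by (simp add: th_def[abs_def])
  have sth: "smooth th" using th by (simp add: symb_def)
  define A' where "A' = 4 * B * (4 * (1 + A1) * A)"
  define eta where "eta R x = jb 2 x * (th x * \<kappa> R x)" for R x
  have s1: "symb 2 A' (eta R)" if "1 \<le> R" for R
    using symb_mult[OF B symb_mult[OF th kap(2)[OF that]]] by (simp add: A'_def eta_def[abs_def])
  have te: "tf (eta R)" if "1 \<le> R" for R
    unfolding eta_def[abs_def] by (intro tf_jb_mult test_function_mult sth kap(1)[OF that])
  have A0: "0 \<le> A'" using s1[of 1] by (simp add: symb_def)
  define C1 where "C1 = 24 * A' * C0 + 0"
  have C10: "0 \<le> C1" using A0 C0 by (simp add: C1_def)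
  have "\<bar>LINT x|lborel. p j x * pd i \<phi> x\<bar> \<le> (C1 + 2 * C0) * n2 (\<lambda>x. jb (-2) x * \<phi> x)"
    if tt: "test_function {x. R0 + 2 < norm x} \<phi>" for i j \<phi>
  proof -
    define \<zeta> where "\<zeta> = (\<lambda>x. jb (-2) x * \<phi> x)"
    have z2: "test_function {x. R0 + 2 < norm x} \<zeta>" unfolding \<zeta>_def by (rule tf_jb_mult[OF tt])
    have z: "tf \<zeta>" by (rule test_function_UNIV[OF z2])
    have t1: "tf (\<lambda>x. jb 2 x * pd i \<zeta> x)" by (intro tf_jb_mult test_function_pd z)
    have t2: "tf (\<lambda>x. 2 * (x $ i * \<zeta> x))" by (intro test_function_mult smooth_const smooth_coord z)
    have e: "pd i \<phi> x = jb 2 x * pd i \<zeta> x + 2 * (x $ i * \<zeta> x)" for x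
      using pd_jb_split[OF tt, of i x 2] by (simp add: \<zeta>_def)
    obtain R where R: "1 \<le> R" "\<And>x i. R < norm x \<Longrightarrow> pd i \<zeta> x = 0" by (rule test_function_eventually_cutoff[OF z]) (rule that)
    have "\<bar>LINT x|lborel. p j x * eta R x * pd i \<zeta> x\<bar> \<le> C1 * n2 \<zeta>"
      unfolding C1_def
    proof (rule weighted_estimate(1)[OF p_lloc, where s="-1" and G=UNIV and S=UNIV])
      show "symb (1 - - 1) A' (eta R)" "tf (eta R)" using s1[OF R(1)] te[OF R(1)] by simp_all
      show "\<bar>LINT x|lborel. p j x * \<psi> x\<bar> \<le> C0 * n2 (\<lambda>x. jb (-1) x * \<psi> x)" if "tf \<psi>" for \<psi>
        by (rule C0(2)[OF that])
      fix \<xi> assume x: "tf \<xi>"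
      define f where "f x = eta R x * \<xi> x" for x
      have tf: "tf f" unfolding f_def[abs_def] by (intro test_function_mult test_function_smooth[OF te[OF R(1)]] x)
      have "m k x * pd k (pd j f) x = 0" for k x
      proof (cases "norm x \<le> R0")
        case True
        have f0: "f y = 0" if "y \<in> ball 0 (R0 + 1)" for y
          using that b(4)[of y] by (simp add: f_def eta_def th_def)
        have "pd j f y = 0" if "y \<in> ball 0 (R0 + 1)" for y
          by (rule pd_zero_on_open[OF open_ball f0 that])
        then have "pd k (pd j f) x = 0" by (rule pd_zero_on_open[OF open_ball[of 0 "R0 + 1"]]) (use True in auto)
        then show ?thesis by simp
      qed (use m_zero in simp)
      then have "(LINT x|lborel. m k x * pd k (pd j f) x) = 0" for k by (simp only: integral_zero)
      then have "(LINT x|lborel. p j x * lap f x) = 0"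
        by (simp add: p_lap[OF tf] lap_u[OF test_function_pd[OF tf]])
      then show "\<bar>LINT x|lborel. p j x * lap (\<lambda>x. eta R x * \<xi> x) x\<bar> \<le> 0 * gn \<xi>"
        by (simp add: f_def[abs_def])
    qed (use z C0 in auto)
    moreover have "p j x * eta R x * pd i \<zeta> x = p j x * (jb 2 x * pd i \<zeta> x)" for x
    proof (cases "R0 + 2 < norm x \<and> norm x \<le> R")
      case True
      then show ?thesis using kap(3)[OF R(1), of x] b(5)[of x] by (simp add: eta_def th_def)
    next
      case False
      then have "pd i \<zeta> x = 0"
        using R(2)[of x i] test_function_outside[OF test_function_pd[OF z2], of x i] by force
      then show ?thesis by simp
    qed
    ultimately have 1: "\<bar>LINT x|lborel. p j x * (jb 2 x * pd i \<zeta> x)\<bar> \<le> C1 * n2 \<zeta>" by simp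
    have "(LINT x|lborel. p j x * pd i \<phi> x) = (LINT x|lborel. p j x * (jb 2 x * pd i \<zeta> x)) + (LINT x|lborel. p j x * (2 * (x $ i * \<zeta> x)))"
      unfolding e using lloc_cc_integrable[OF p_lloc cc_test[OF t1]] lloc_cc_integrable[OF p_lloc cc_test[OF t2]]
      by (simp add: distrib_left)
    moreover have "n2 (\<lambda>x. jb (-1) x * (2 * (x $ i * \<zeta> x))) \<le> 2 * n2 \<zeta>"
    proof (rule n2_le_mult[OF z tf_borel[OF tf_jb_mult[OF t2]]])
      fix x show "\<bar>jb (-1) x * (2 * (x $ i * \<zeta> x))\<bar> \<le> 2 * \<bar>\<zeta> x\<bar>"
        using coord_jb_mult_le[of x i 0 "\<zeta> x"] by (simp add: abs_mult mult_ac)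
    qed
    ultimately show ?thesis
      using 1 C0(2)[OF t2, of j] mult_left_mono[OF _ C0(1), of "n2 (\<lambda>x. jb (-1) x * (2 * (x $ i * \<zeta> x)))" "2 * n2 \<zeta>"]
      unfolding \<zeta>_def[symmetric] distrib_right by linarith
  qed
  then show ?thesis using C10 C0 by (intro exI[of _ "C1 + 2 * C0"]) auto
qed

text \<open>Weakly, the Laplacian of \<open>p j\<close> is a derivative of \<open>F\<close>; moved
  to the test function, this derivative is controlled by the Dirichlet norm that
  \<open>weighted_estimate\<close> asks for. A compactly supported cut-off is a symbol of every
  order, and order 1 corresponds to s = 0.\<close>

lemma second_interior:
  assumes r: "0 < r" and F: "sq_int lborel F"
    and eq: "\<And>\<phi>. test_function (ball x0 r) \<phi> \<Longrightarrow> (LINT x|lborel. u x * lap \<phi> x) = (LINT x|lborel. F x * \<phi> x)"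
  shows "\<exists>C\<ge>0. \<forall>\<phi>. test_function (ball x0 (r/2)) \<phi> \<longrightarrow> \<bar>LINT x|lborel. p j x * pd i \<phi> x\<bar> \<le> C * n2 \<phi>"
proof -
  obtain b where b: "smooth b" "\<And>x. 0 \<le> b x" "\<And>x. b x \<le> 1"
      "\<And>x. norm (x - x0) \<le> r/2 \<Longrightarrow> b x = 1" "\<And>x. 3/4 * r \<le> norm (x - x0) \<Longrightarrow> b x = 0"
    by (rule plateau[of "r/2" "3/4*r" x0]) (use r in auto)
  have tb: "test_function (ball x0 r) b"
    using r b(5) by (intro test_functionI[of _ "cball x0 (3/4*r)"] b(1)) (auto simp: dist_norm norm_minus_commute)
  obtain A where A: "symb 1 A b" by (rule tf_symb[OF tb]) (rule that)
  have A0: "0 \<le> A" using A by (simp add: symb_def)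
  define R where "R = norm x0 + r"
  have R: "ball x0 r \<subseteq> cball 0 R"
  proof
    fix x assume "x \<in> ball x0 r"
    then show "x \<in> cball 0 R"
      using norm_triangle_sub[of x x0] by (simp add: R_def dist_norm norm_minus_commute)
  qed
  define c where "c = jb 1 (R *\<^sub>R axis 1 1 :: real^3)"
  define E where "E = n2 F * (c * (7 * A))"
  have "\<bar>LINT x|lborel. p j x * pd i \<phi> x\<bar> \<le> (24 * A * n2 (p j) + E) * n2 \<phi>" if t: "test_function (ball x0 (r/2)) \<phi>" for \<phi>
  proof -
    have "\<bar>LINT x|lborel. p j x * b x * pd i \<phi> x\<bar> \<le> (24 * A * n2 (p j) + E) * n2 \<phi>"
    proof (rule weighted_estimate(1)[OF p_lloc, where s=0 and G="ball x0 r" and S=UNIV])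
      show "symb (1 - 0) A b" "test_function (ball x0 r) b" using A tb by simp_all
      show "\<bar>LINT x|lborel. p j x * \<psi> x\<bar> \<le> n2 (p j) * n2 (\<lambda>x. jb 0 x * \<psi> x)" if "test_function (ball x0 r) \<psi>" for \<psi>
        using CS_tf[OF p_sq that] by simp
      fix \<zeta> assume z: "tf \<zeta>"
      have tz: "test_function (ball x0 r) (\<lambda>x. b x * \<zeta> x)"
        by (rule test_function_mult2[OF tb test_function_smooth[OF z]])
      have "(LINT x|lborel. p j x * lap (\<lambda>x. b x * \<zeta> x) x) = - (LINT x|lborel. F x * pd j (\<lambda>x. b x * \<zeta> x) x)"
        unfolding p_lap[OF test_function_UNIV[OF tz]] eq[OF test_function_pd[OF tz]] ..
      then have "\<bar>LINT x|lborel. p j x * lap (\<lambda>x. b x * \<zeta> x) x\<bar> \<le> n2 F * n2 (pd j (\<lambda>x. b x * \<zeta> x))"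
        using CS_tf[OF F test_function_pd[OF tz], of j] by simp
      also have "\<dots> \<le> n2 F * (c * n2 (\<lambda>x. jb (-1) x * pd j (\<lambda>x. b x * \<zeta> x) x))"
        unfolding c_def by (intro mult_left_mono n2_bounded_le[OF test_function_pd[OF tz] R]) auto
      also have "\<dots> \<le> n2 F * (c * (7 * A * gn \<zeta>))"
        by (intro mult_left_mono n2_jb_pd_mult_le[OF A z]) (auto simp: c_def)
      finally show "\<bar>LINT x|lborel. p j x * lap (\<lambda>x. b x * \<zeta> x) x\<bar> \<le> E * gn \<zeta>" by (simp add: E_def mult_ac)
    qed (use test_function_UNIV[OF t] A0 in \<open>auto simp: E_def c_def\<close>)
    moreover have "p j x * b x * pd i \<phi> x = p j x * pd i \<phi> x" for x
      using b(4)[of x] test_function_outside[OF test_function_pd[OF t], of x i]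
      by (cases "x \<in> ball x0 (r/2)") (auto simp: dist_norm norm_minus_commute)
    ultimately show ?thesis by simp
  qed
  then show ?thesis
    using A0 by (intro exI[of _ "24 * A * n2 (p j) + E"]) (auto simp: E_def c_def)
qed

lemma p_pd_add:
  assumes "test_function G f" "test_function G g"
  shows "(LINT x|lborel. p j x * pd i (\<lambda>x. f x + g x) x) = (LINT x|lborel. p j x * pd i f x) + (LINT x|lborel. p j x * pd i g x)"
  using lloc_cc_integrable[OF p_lloc cc_test[OF test_function_pd[OF assms(1)]], of j i]
    lloc_cc_integrable[OF p_lloc cc_test[OF test_function_pd[OF assms(2)]], of j i]
  by (simp add: pd_add_smooth test_function_smooth[OF assms(1)] test_function_smooth[OF assms(2)] distrib_left)

text \<open>A plateau between the radii R0 + 3 and R0 + 4 divides \<phi>: on the inner part all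
  weights are comparable, and the outer part is supported where \<open>second_far\<close>
  applies.\<close>

lemma second_weight:
  assumes near: "\<exists>C\<ge>0. \<forall>\<phi>. test_function G \<phi> \<longrightarrow> (\<forall>x. x \<notin> cball 0 (R0 + 4) \<longrightarrow> \<phi> x = 0) \<longrightarrow>
      \<bar>LINT x|lborel. p j x * pd i \<phi> x\<bar> \<le> C * n2 \<phi>"
  shows "\<exists>C\<ge>0. \<forall>\<phi>. test_function G \<phi> \<longrightarrow> \<bar>LINT x|lborel. p j x * pd i \<phi> x\<bar> \<le> C * n2 (\<lambda>x. jb (-2) x * \<phi> x)"
proof -
  obtain C where C: "0 \<le> C" "\<And>\<phi>. test_function G \<phi> \<Longrightarrow> (\<And>x. x \<notin> cball 0 (R0 + 4) \<Longrightarrow> \<phi> x = 0) \<Longrightarrow>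
      \<bar>LINT x|lborel. p j x * pd i \<phi> x\<bar> \<le> C * n2 \<phi>" using near by blast
  obtain D where D: "0 \<le> D" "\<And>\<phi>. test_function {x. R0 + 2 < norm x} \<phi> \<Longrightarrow>
     \<bar>LINT x|lborel. p j x * pd i \<phi> x\<bar> \<le> D * n2 (\<lambda>x. jb (-2) x * \<phi> x)"
    using second_far by blast
  obtain b where b: "smooth b" "\<And>x. 0 \<le> b x" "\<And>x. b x \<le> 1"
      "\<And>x. norm x \<le> R0 + 3 \<Longrightarrow> b x = 1" "\<And>x. R0 + 4 \<le> norm x \<Longrightarrow> b (x::real^3) = 0"
    by (rule plateau[of "R0 + 3" "R0 + 4" "0::real^3"]) auto
  let ?c = "jb 2 ((R0 + 4) *\<^sub>R axis 1 1 :: real^3)"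
  have "\<bar>LINT x|lborel. p j x * pd i \<phi> x\<bar> \<le> (C * ?c + D) * n2 (\<lambda>x. jb (-2) x * \<phi> x)" if t: "test_function G \<phi>" for \<phi>
  proof -
    have t1: "test_function G (\<lambda>x. b x * \<phi> x)" by (rule test_function_mult[OF b(1) t])
    have t2: "test_function G (\<lambda>x. (1 - b x) * \<phi> x)" by (intro test_function_mult smooth_diff smooth_const b(1) t)
    obtain S where S: "compact S" "S \<subseteq> G" "\<And>x. x \<notin> S \<Longrightarrow> \<phi> x = 0"
      using t by (rule test_functionE) (rule that)
    have t3: "test_function {x. R0 + 2 < norm x} (\<lambda>x. (1 - b x) * \<phi> x)"
    proof (rule test_functionI[of _ "S - ball 0 (R0 + 3)"])
      fix x assume "x \<notin> S - ball 0 (R0 + 3)"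
      then show "(1 - b x) * \<phi> x = 0" using S(3)[of x] b(4)[of x] by auto
    qed (use S test_function_smooth[OF t2] in \<open>auto intro: compact_diff\<close>)
    have t4: "test_function (cball 0 (R0 + 4)) (\<lambda>x. b x * \<phi> x)"
    proof (rule test_functionI[of _ "cball 0 (R0 + 4)"])
      fix x :: "real^3" assume "x \<notin> cball 0 (R0 + 4)" then show "b x * \<phi> x = 0" using b(5)[of x] by simp
    qed (use test_function_smooth[OF t1] in auto)
    have mono: "n2 (\<lambda>x. jb (-2) x * (a x * \<phi> x)) \<le> n2 (\<lambda>x. jb (-2) x * \<phi> x)"
      if a: "\<And>x. \<bar>a x\<bar> \<le> 1" "test_function G (\<lambda>x. a x * \<phi> x)" for a
    proof (rule n2_mono_tf[OF tf_jb_mult[OF t] tf_borel[OF tf_jb_mult[OF a(2)]]])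
      fix x show "\<bar>jb (-2) x * (a x * \<phi> x)\<bar> \<le> \<bar>jb (-2) x * \<phi> x\<bar>"
        using a(1)[of x] unfolding abs_mult by (intro mult_left_mono mult_left_le_one_le) auto
    qed
    have "\<phi> = (\<lambda>x. b x * \<phi> x + (1 - b x) * \<phi> x)" by (simp add: left_diff_distrib)
    then have "(LINT x|lborel. p j x * pd i \<phi> x) = (LINT x|lborel. p j x * pd i (\<lambda>x. b x * \<phi> x) x)
        + (LINT x|lborel. p j x * pd i (\<lambda>x. (1 - b x) * \<phi> x) x)"
      using p_pd_add[OF t1 t2, of j i] by simp
    moreover have "\<bar>LINT x|lborel. p j x * pd i (\<lambda>x. b x * \<phi> x) x\<bar> \<le> C * (?c * n2 (\<lambda>x. jb (-2) x * \<phi> x))"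
    proof -
      have "\<bar>LINT x|lborel. p j x * pd i (\<lambda>x. b x * \<phi> x) x\<bar> \<le> C * n2 (\<lambda>x. b x * \<phi> x)"
        by (intro C t1 test_function_outside[OF t4])
      also have "\<dots> \<le> C * (?c * n2 (\<lambda>x. jb (-2) x * (b x * \<phi> x)))"
        by (intro mult_left_mono C n2_bounded_le[OF t4 order_refl]) simp
      also have "\<dots> \<le> C * (?c * n2 (\<lambda>x. jb (-2) x * \<phi> x))"
        using b(2,3) by (intro mult_left_mono C mono t1) auto
      finally show ?thesis .
    qed
    moreover have "\<bar>LINT x|lborel. p j x * pd i (\<lambda>x. (1 - b x) * \<phi> x) x\<bar> \<le> D * n2 (\<lambda>x. jb (-2) x * \<phi> x)"
    proof -
      have "\<bar>1 - b x\<bar> \<le> 1" for x using b(2)[of x] b(3)[of x] by simp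
      from mult_left_mono[OF mono[OF this t2] D(1)] D(2)[OF t3] show ?thesis by linarith
    qed
    ultimately show ?thesis by (simp add: distrib_right mult.assoc)
  qed
  then show ?thesis using C(1) D(1) by (intro exI[of _ "C * ?c + D"]) auto
qed

end

section \<open>Measure-preserving flows along a graph\<close>

text \<open>The preimage of a box under \<open>g\<close> is its image under \<open>h\<close>, whose
  volume the change of variables computes with a Jacobian of modulus one; boxes determine
  \<open>lborel\<close>.\<close>

lemma lborel_distr_unimodular:
  fixes g h :: "real^3 \<Rightarrow> real^3"
  assumes gh: "\<And>x. g (h x) = x" "\<And>x. h (g x) = x"
    and der: "\<And>x. (h has_derivative h' x) (at x)"
    and det: "\<And>x. \<bar>det (matrix (h' x))\<bar> = 1"
    and g: "g \<in> borel_measurable borel"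
  shows "distr lborel borel g = lborel"
proof (rule lborel_eqI[symmetric])
  fix l u :: "real^3" assume lu: "\<And>b. b \<in> Basis \<Longrightarrow> l \<bullet> b \<le> u \<bullet> b"
  have inj: "inj_on h (box l u)" using gh(1) by (metis inj_onI)
  have im: "g -` box l u = h ` box l u"
    using gh by (auto simp: image_iff) (metis gh(2))
  have "((\<lambda>x. \<bar>det (matrix (h' x))\<bar>) has_integral measure lborel (box l u)) (box l u)"
    unfolding det by (rule has_integral_measure_lborel) (simp_all add: emeasure_lborel_box_eq)
  then have m: "h ` box l u \<in> lmeasurable" "measure lebesgue (h ` box l u) = measure lborel (box l u)"
    using has_measure_differentiable_image[of "box l u" h h' "measure lborel (box l u)"]
      has_derivative_at_withinI[OF der] inj by auto
  have "emeasure (distr lborel borel g) (box l u) = emeasure lborel (h ` box l u)"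
    using g by (simp add: emeasure_distr im)
  also have "\<dots> = emeasure lebesgue (h ` box l u)"
    using measurable_sets[OF g, of "box l u"] im by simp
  also have "\<dots> = ennreal (measure lebesgue (h ` box l u))"
    using m(1) by (rule emeasure_eq_measure2)
  also have "\<dots> = ennreal (\<Prod>b\<in>Basis. (u - l) \<bullet> b)"
    using lu by (simp add: m(2))
  finally show "emeasure (distr lborel borel g) (box l u) = ennreal (\<Prod>b\<in>Basis. (u - l) \<bullet> b)" .
qed simp

text \<open>Matrix determinant lemma: a rank-one update of the identity has determinant
  \<open>1 + c \<bullet> e\<close>.\<close>

lemma det_rank_one:
  fixes e c :: "real^3"
  assumes "c \<bullet> e = 0"
  shows "det (matrix (\<lambda>h. h + (c \<bullet> h) *\<^sub>R e)) = 1"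
proof -
  have "det (matrix (\<lambda>h. h + (c \<bullet> h) *\<^sub>R e)) = 1 + c \<bullet> e"
    by (simp add: det_3 matrix_def inner_axis axis_def inner_vec_def sum_3) (simp add: algebra_simps)
  with assms show ?thesis by simp
qed

text \<open>A graph chart stripped of its coordinates: \<open>Psi\<close> is the height of the
  graph, extended to space as a constant along the vertical direction \<open>e3\<close>, and
  \<open>DP\<close> is its gradient. The Lipschitz bound on \<open>DP\<close> is the C^{1,1}
  property.\<close>

locale graph_flow =
  fixes Psi :: "real^3 \<Rightarrow> real" and DP :: "real^3 \<Rightarrow> real^3" and e3 :: "real^3" and L :: real
  assumes Psi_inv: "\<And>x t. Psi (x + t *\<^sub>R e3) = Psi x"
    and DP_inv: "\<And>x t. DP (x + t *\<^sub>R e3) = DP x"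
    and DP_perp: "\<And>x. DP x \<bullet> e3 = 0"
    and Psi_der: "\<And>x. (Psi has_derivative (\<lambda>h. DP x \<bullet> h)) (at x)"
    and DP_lip: "\<And>x y. norm (DP x - DP y) \<le> L * norm (x - y)"
begin

lemma L_nonneg: "0 \<le> L"
  using order_trans[OF norm_ge_zero DP_lip[of "axis 1 1" 0]] by simp

lemma DP_continuous: "continuous_on A DP"
proof (rule continuous_on_subset[OF _ subset_UNIV])
  have "L-lipschitz_on UNIV DP"
    by (rule lipschitz_onI) (simp_all add: dist_norm DP_lip L_nonneg)
  then show "continuous_on UNIV DP" by (rule lipschitz_on_continuous_on)
qed

lemma Psi_continuous: "continuous_on A Psi"
  using Psi_der by (meson continuous_at_imp_continuous_on has_derivative_continuous)

definition flow :: "real^3 \<Rightarrow> real \<Rightarrow> real^3 \<Rightarrow> real^3" where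
  "flow a s x = x + s *\<^sub>R a + (Psi (x + s *\<^sub>R a) - Psi x) *\<^sub>R e3"

text \<open>The generator of \<open>flow a\<close>. For \<open>a\<close> orthogonal to
  \<open>e3\<close> it differentiates along a direction tangent to the vertical translates of the
  graph.\<close>

definition tang :: "real^3 \<Rightarrow> (real^3 \<Rightarrow> real) \<Rightarrow> real^3 \<Rightarrow> real" where
  "tang a f x = dd a f x + (DP x \<bullet> a) * dd e3 f x"

lemma flow_0 [simp]: "flow a 0 x = x"
  by (simp add: flow_def)

lemma Psi_flow: "Psi (flow a s x) = Psi (x + s *\<^sub>R a)"
  unfolding flow_def by (rule Psi_inv)

lemma DP_flow: "DP (flow a s x) = DP (x + s *\<^sub>R a)"
  unfolding flow_def by (rule DP_inv)

text \<open>\<open>Psi\<close> is unchanged by vertical shifts, so the vertical corrections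
  telescope and the maps form a one-parameter group.\<close>

lemma flow_flow: "flow a s (flow a t x) = flow a (s + t) x"
proof -
  have "flow a t x + s *\<^sub>R a = (x + (s + t) *\<^sub>R a) + (Psi (x + t *\<^sub>R a) - Psi x) *\<^sub>R e3"
    by (simp add: flow_def algebra_simps)
  then have "Psi (flow a t x + s *\<^sub>R a) = Psi (x + (s + t) *\<^sub>R a)" by (simp add: Psi_inv)
  then show ?thesis
    unfolding flow_def[of a s "flow a t x"] Psi_flow by (simp add: flow_def algebra_simps)
qed

lemma flow_inverse: "flow a s (flow a (- s) x) = x" "flow a (- s) (flow a s x) = x"
  by (simp_all add: flow_flow)

lemma flow_has_derivative:
  "(flow a s has_derivative (\<lambda>h. h + ((DP (x + s *\<^sub>R a) - DP x) \<bullet> h) *\<^sub>R e3)) (at x)"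
proof -
  have "((\<lambda>x. Psi (x + s *\<^sub>R a)) has_derivative (\<lambda>h. DP (x + s *\<^sub>R a) \<bullet> h)) (at x)"
    by (rule has_derivative_compose[of "\<lambda>x. x + s *\<^sub>R a" "\<lambda>h. h", OF _ Psi_der])
      (auto intro!: derivative_eq_intros)
  then show ?thesis
    unfolding flow_def[abs_def]
    by (auto intro!: derivative_eq_intros Psi_der simp: inner_diff_left)
qed

lemma flow_time_derivative:
  "((\<lambda>s. flow a s x) has_derivative (\<lambda>h. h *\<^sub>R (a + (DP (x + s *\<^sub>R a) \<bullet> a) *\<^sub>R e3))) (at s)"
proof -
  have "((\<lambda>s. Psi (x + s *\<^sub>R a)) has_derivative (\<lambda>h. DP (x + s *\<^sub>R a) \<bullet> (h *\<^sub>R a))) (at s)"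
    by (rule has_derivative_compose[of "\<lambda>s. x + s *\<^sub>R a" "\<lambda>h. h *\<^sub>R a", OF _ Psi_der])
      (auto intro!: derivative_eq_intros)
  then show ?thesis
    unfolding flow_def[abs_def]
    by (auto intro!: derivative_eq_intros simp: scaleR_add_right)
qed

lemma flow_joint_continuous: "continuous_on UNIV (\<lambda>z. flow a (fst z) (snd z))"
  unfolding flow_def
  by (intro continuous_intros continuous_on_compose2[OF Psi_continuous[of UNIV]]) auto

lemma flow_continuous: "continuous_on UNIV (flow a s)"
  unfolding flow_def[abs_def]
  by (intro continuous_intros continuous_on_compose2[OF Psi_continuous[of UNIV]]) auto

lemma flow_borel [measurable]: "flow a s \<in> borel_measurable borel"
  by (rule borel_measurable_continuous_onI[OF flow_continuous])

text \<open>The starting points of trajectories that meet \<open>K\<close> lie in the image of a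
  compact set: \<open>K\<close> moved by the inverse flow over a bounded time interval.\<close>

lemma flow_support:
  assumes "compact K"
  obtains R where "0 < R" "\<And>s x. \<bar>s\<bar> \<le> S \<Longrightarrow> flow a s x \<in> K \<Longrightarrow> norm x \<le> R"
proof -
  have "compact ((\<lambda>z. flow a (fst z) (snd z)) ` ({-S..S} \<times> K))"
    by (intro compact_continuous_image continuous_on_subset[OF flow_joint_continuous] compact_Times assms) auto
  from compact_imp_bounded[OF this]
  obtain R where R: "0 < R" "\<forall>y\<in>(\<lambda>z. flow a (fst z) (snd z)) ` ({-S..S} \<times> K). norm y \<le> R"
    unfolding bounded_pos by (elim exE conjE)
  have "norm x \<le> R" if "\<bar>s\<bar> \<le> S" "flow a s x \<in> K" for s x
  proof (rule R(2)[rule_format])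
    have "(- s, flow a s x) \<in> {-S..S} \<times> K" using that by auto
    then show "x \<in> (\<lambda>z. flow a (fst z) (snd z)) ` ({-S..S} \<times> K)"
      by (rule rev_image_eqI) (simp add: flow_inverse)
  qed
  with R(1) show ?thesis by (rule that)
qed

text \<open>The derivative of the flow is the identity plus a rank-one map with range along
  \<open>e3\<close>, whose covector is orthogonal to \<open>e3\<close>; hence the determinant is
  1.\<close>

lemma flow_distr: "distr lborel borel (flow a s) = lborel"
proof (rule lborel_distr_unimodular[where h="flow a (- s)"])
  fix x
  show "(flow a (- s) has_derivative (\<lambda>h. h + ((DP (x + (- s) *\<^sub>R a) - DP x) \<bullet> h) *\<^sub>R e3)) (at x)"
    by (rule flow_has_derivative)
  show "\<bar>det (matrix (\<lambda>h. h + ((DP (x + (- s) *\<^sub>R a) - DP x) \<bullet> h) *\<^sub>R e3))\<bar> = 1"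
    by (subst det_rank_one) (simp_all add: inner_diff_left DP_perp)
qed (simp_all add: flow_inverse flow_borel)

lemma integral_flow:
  fixes f :: "real^3 \<Rightarrow> real"
  assumes [measurable]: "f \<in> borel_measurable borel"
  shows "(LINT x|lborel. f (flow a s x)) = (LINT x|lborel. f x)"
  using integral_distr[of "flow a s" lborel borel f] by (simp add: flow_distr)

lemma integrable_flow:
  fixes f :: "real^3 \<Rightarrow> real"
  assumes [measurable]: "f \<in> borel_measurable borel"
  shows "integrable lborel (\<lambda>x. f (flow a s x)) \<longleftrightarrow> integrable lborel f"
  using integrable_distr_eq[of "flow a s" lborel borel f] by (simp add: flow_distr)

lemma n2_flow:
  assumes [measurable]: "f \<in> borel_measurable borel"
  shows "n2 (\<lambda>x. f (flow a s x)) = n2 f"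
  using integral_flow[of "\<lambda>x. (f x)\<^sup>2"] by (simp add: l2n_def)

lemma sq_int_flow:
  assumes "sq_int lborel f" shows "sq_int lborel (\<lambda>x. f (flow a s x))"
proof -
  have [measurable]: "f \<in> borel_measurable borel" using assms by (auto simp: sq_int_def)
  show ?thesis using assms integrable_flow[of "\<lambda>x. (f x)\<^sup>2"] by (simp add: sq_int_def)
qed

lemma cc_flow:
  assumes "cc f" shows "cc (\<lambda>x. f (flow a s x))"
proof -
  obtain K where K: "compact K" "\<And>x. x \<notin> K \<Longrightarrow> f x = 0" by (rule cc_compact_support[OF assms]) (rule that)
  obtain R where R: "0 < R" "\<And>t x. \<bar>t\<bar> \<le> \<bar>s\<bar> \<Longrightarrow> flow a t x \<in> K \<Longrightarrow> norm x \<le> R"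
    by (rule flow_support[OF K(1)]) (rule that)
  show ?thesis
  proof (rule ccI)
    show "continuous_on UNIV (\<lambda>x. f (flow a s x))"
      using assms by (intro continuous_on_compose2[of UNIV f, OF _ flow_continuous]) (auto simp: cc_def)
    fix x :: "real^3" assume "R < norm x"
    then show "f (flow a s x) = 0" using R(2)[of s x] K(2) by force
  qed
qed

lemma lloc_flow:
  assumes "lloc w" shows "lloc (\<lambda>x. w (flow a s x))"
  unfolding lloc_def
proof (intro conjI allI)
  have [measurable]: "w \<in> borel_measurable borel" by (rule lloc_borel[OF assms])
  show "(\<lambda>x. w (flow a s x)) \<in> borel_measurable borel" by measurable
  fix R
  obtain R' where R': "0 < R'" "\<And>t x. \<bar>t\<bar> \<le> \<bar>s\<bar> \<Longrightarrow> flow a t x \<in> cball 0 R \<Longrightarrow> norm x \<le> R'"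
    by (rule flow_support[of "cball 0 R"]) (auto intro: that)
  have "integrable lborel (\<lambda>x. indicator (cball 0 R') x * w x)" using assms by (simp add: lloc_def)
  then have "integrable lborel (\<lambda>x. indicator (cball 0 R') (flow a s x) * w (flow a s x))"
    by (subst integrable_flow) simp_all
  then show "integrable lborel (\<lambda>x. indicator (cball 0 R) x * w (flow a s x))"
  proof (rule Bochner_Integration.integrable_bound)
    have "x \<in> cball 0 R \<Longrightarrow> flow a s x \<in> cball 0 R'" for x
      using R'(2)[of "- s" "flow a s x"] by (simp add: flow_inverse)
    then show "AE x in lborel. norm (indicator (cball 0 R) x * w (flow a s x))
        \<le> norm (indicator (cball 0 R') (flow a s x) * w (flow a s x))"
      by (intro AE_I2) (auto simp: indicator_def)
  qed simp
qed

lemma integral_flow_pair: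
  fixes w f :: "real^3 \<Rightarrow> real"
  assumes [measurable]: "w \<in> borel_measurable borel" "f \<in> borel_measurable borel"
  shows "(LINT x|lborel. w x * f (flow a s x)) = (LINT x|lborel. w (flow a (- s) x) * f x)"
  using integral_flow[of "\<lambda>x. w (flow a (- s) x) * f x" a s] by (simp add: flow_inverse)

text \<open>The commutator of a derivative with the flow is an increment of \<open>DP\<close> times
  a vertical derivative. It is of order \<open>s\<close> because \<open>DP\<close> is Lipschitz, and
  no derivative of \<open>DP\<close> occurs.\<close>

lemma flow_compose_has_derivative:
  assumes "\<And>x. f differentiable (at x)"
  shows "((\<lambda>x. f (flow a s x)) has_derivative
    (\<lambda>h. dd h f (flow a s x) + ((DP (x + s *\<^sub>R a) - DP x) \<bullet> h) * dd e3 f (flow a s x))) (at x)"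
proof -
  have "((\<lambda>x. f (flow a s x)) has_derivative
     (\<lambda>h. dd (h + ((DP (x + s *\<^sub>R a) - DP x) \<bullet> h) *\<^sub>R e3) f (flow a s x))) (at x)"
    by (rule has_derivative_compose[OF flow_has_derivative has_derivative_dd[OF assms]])
  moreover have "dd (h + k *\<^sub>R e3) f y = dd h f y + k * dd e3 f y" for h k y
    by (simp add: dd_def distrib_right sum.distrib sum_distrib_left mult.assoc)
  ultimately show ?thesis by simp
qed

lemma flow_compose_differentiable:
  fixes f :: "real^3 \<Rightarrow> real"
  assumes "\<And>x. f differentiable (at x)" shows "(\<lambda>x. f (flow a s x)) differentiable (at x)"
  using flow_compose_has_derivative[OF assms] by (auto simp: differentiable_def)

lemma dd_flow:
  assumes "\<And>x. f differentiable (at x)"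
  shows "dd h (\<lambda>x. f (flow a s x)) x
    = dd h f (flow a s x) + ((DP (x + s *\<^sub>R a) - DP x) \<bullet> h) * dd e3 f (flow a s x)"
  by (rule dd_has_derivative[OF flow_compose_has_derivative[OF assms]])

lemma dd_e3_flow:
  assumes "\<And>x. f differentiable (at x)"
  shows "dd e3 (\<lambda>x. f (flow a s x)) x = dd e3 f (flow a s x)"
  by (simp add: dd_flow[OF assms] inner_diff_left DP_perp)

text \<open>A generator commutes exactly with its flow; the increments of \<open>DP\<close>
  cancel.\<close>

lemma tang_flow:
  assumes "\<And>x. f differentiable (at x)"
  shows "tang a (\<lambda>x. f (flow a s x)) x = tang a f (flow a s x)"
  by (simp add: tang_def dd_flow[OF assms] DP_flow inner_diff_left DP_perp algebra_simps)

lemma tang_cc: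
  assumes "test_function G f" shows "cc (tang a f)"
proof -
  have s: "smooth f" by (rule test_function_smooth[OF assms])
  show ?thesis unfolding tang_def[abs_def]
    by (intro cc_add cc_mult cc_test[OF test_function_dd[OF assms]] continuous_intros DP_continuous)
qed

lemma flow_pairing_derivative:
  assumes w: "lloc w" and f: "test_function G f"
  shows "((\<lambda>s. LINT x|lborel. w x * f (flow a s x)) has_real_derivative
    (LINT x|lborel. w x * tang a f (flow a s x))) (at s)"
proof -
  have sm: "smooth f" by (rule test_function_smooth[OF f])
  note [measurable] = lloc_borel[OF w] cc_borel[OF tang_cc[OF f]]
  obtain B where B: "0 < B" "\<And>x. \<bar>tang a f x\<bar> \<le> B" using tang_cc[OF f] by (rule cc_bounded) (rule that)
  obtain K where K: "compact K" "\<And>x. x \<notin> K \<Longrightarrow> tang a f x = 0" by (rule cc_compact_support[OF tang_cc[OF f]]) (rule that)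
  \<comment> \<open>Times up to |s| + 1 are covered, since differentiation under the integral asks
    for a majorant at distance up to 1 from \<open>s\<close>.\<close>
  obtain R where R: "0 < R" "\<And>t x. \<bar>t\<bar> \<le> \<bar>s\<bar> + 1 \<Longrightarrow> flow a t x \<in> K \<Longrightarrow> norm x \<le> R"
    by (rule flow_support[OF K(1)]) (rule that)
  show ?thesis
  proof (rule deriv_under_integral[where B="\<lambda>x. B * \<bar>indicator (cball 0 R) x * w x\<bar>"])
    fix t
    show "integrable lborel (\<lambda>x. w x * f (flow a t x))"
      by (intro lloc_cc_integrable w cc_flow cc_test[OF f])
    fix x
    have "((\<lambda>t. f (flow a t x)) has_derivative
        (\<lambda>h. dd (h *\<^sub>R (a + (DP (x + t *\<^sub>R a) \<bullet> a) *\<^sub>R e3)) f (flow a t x))) (at t)"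
      by (rule has_derivative_compose[OF flow_time_derivative has_derivative_dd[OF smooth_differentiable[OF sm]]])
    moreover have "dd (h *\<^sub>R (a + (DP (x + t *\<^sub>R a) \<bullet> a) *\<^sub>R e3)) f y
        = (dd a f y + (DP (x + t *\<^sub>R a) \<bullet> a) * dd e3 f y) * h" for h y
      by (simp add: dd_def algebra_simps sum.distrib sum_distrib_left)
    ultimately have "((\<lambda>t. f (flow a t x)) has_real_derivative tang a f (flow a t x)) (at t)"
      by (simp add: has_field_derivative_def tang_def DP_flow)
    then show "((\<lambda>t. w x * f (flow a t x)) has_real_derivative w x * tang a f (flow a t x)) (at t)"
      by (rule DERIV_cmult)
    assume t: "\<bar>t - s\<bar> \<le> 1"
    show "\<bar>w x * tang a f (flow a t x)\<bar> \<le> B * \<bar>indicator (cball 0 R) x * w x\<bar>"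
    proof (cases "norm x \<le> R")
      case True
      then show ?thesis using mult_left_mono[OF B(2)[of "flow a t x"], of "\<bar>w x\<bar>"]
        by (simp add: abs_mult mult.commute)
    next
      case False
      then have "tang a f (flow a t x) = 0" using R(2)[of t x] K(2) t by force
      then show ?thesis using B(1) by simp
    qed
  qed (use lloc_abs_integrable[OF w] in simp_all)
qed

text \<open>Mean value inequality in time. Its hypothesis bounds the pairing as a whole, so the
  tangential derivative may be moved onto \<open>w\<close> when that bound is proved.\<close>

lemma flow_difference_bound:
  assumes w: "lloc w" and f: "test_function G f"
    and b: "\<And>t. \<bar>t\<bar> \<le> \<bar>s\<bar> \<Longrightarrow> \<bar>LINT x|lborel. w x * tang a f (flow a t x)\<bar> \<le> C"
  shows "\<bar>LINT x|lborel. w x * (f (flow a s x) - f x)\<bar> \<le> C * \<bar>s\<bar>"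
proof -
  have "norm ((LINT x|lborel. w x * f (flow a s x)) - (LINT x|lborel. w x * f (flow a 0 x))) \<le> C * norm (s - 0)"
  proof (rule field_differentiable_bound[of "cball 0 \<bar>s\<bar>" "\<lambda>s. LINT x|lborel. w x * f (flow a s x)"])
    show "((\<lambda>s. LINT x|lborel. w x * f (flow a s x)) has_field_derivative
        (LINT x|lborel. w x * tang a f (flow a z x))) (at z within cball 0 \<bar>s\<bar>)" for z
      by (rule DERIV_subset[OF flow_pairing_derivative[OF w f]]) simp
  qed (use b in auto)
  moreover have "(LINT x|lborel. w x * (f (flow a s x) - f x))
      = (LINT x|lborel. w x * f (flow a s x)) - (LINT x|lborel. w x * f x)"
    using lloc_cc_integrable[OF w cc_flow[OF cc_test[OF f]], of a s] lloc_cc_integrable[OF w cc_test[OF f]]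
    by (simp add: right_diff_distrib)
  ultimately show ?thesis by simp
qed

end

text \<open>Uniform continuity of the flow near time zero, used backwards: \<open>x\<close> is
  reached from \<open>flow a s x\<close> in time -s. It keeps displaced test functions supported in
  a slightly larger ball.\<close>

lemma (in graph_flow) flow_small:
  assumes r: "r1 < r2"
  obtains s0 where "0 < s0" "s0 \<le> 1" "\<And>s x. \<bar>s\<bar> \<le> s0 \<Longrightarrow> flow a s x \<in> cball x0 r1 \<Longrightarrow> x \<in> cball x0 r2"
proof -
  have "uniformly_continuous_on ({-1..1} \<times> cball x0 r1) (\<lambda>z. flow a (fst z) (snd z))"
    by (intro compact_uniformly_continuous continuous_on_subset[OF flow_joint_continuous] compact_Times) auto
  then obtain d where d: "d > 0" "\<And>z z'. z \<in> {-1..1} \<times> cball x0 r1 \<Longrightarrow> z' \<in> {-1..1} \<times> cball x0 r1 \<Longrightarrow> dist z' z < d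
      \<Longrightarrow> dist (flow a (fst z') (snd z')) (flow a (fst z) (snd z)) < r2 - r1"
    using r unfolding uniformly_continuous_on_def by (metis diff_gt_0_iff_gt)
  show ?thesis
  proof (rule that[of "min 1 (d/2)"])
    fix s x assume s: "\<bar>s\<bar> \<le> min 1 (d/2)" and y: "flow a s x \<in> cball x0 r1"
    have "dist (flow a (- s) (flow a s x)) (flow a 0 (flow a s x)) < r2 - r1"
      using d(2)[of "(0, flow a s x)" "(- s, flow a s x)"] s y d(1) by (simp add: dist_Pair_Pair abs_le_iff)
    then have "dist x (flow a s x) < r2 - r1" by (simp add: flow_inverse)
    then show "x \<in> cball x0 r2"
      using y dist_triangle[of x0 x "flow a s x"] by (simp add: dist_commute)
  qed (use d in auto)
qed

section \<open>Tangential regularity\<close>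

lemma n2_dd_le:
  assumes "test_function G f" shows "n2 (dd h f) \<le> 3 * norm h * gn f"
proof -
  have "n2 (dd h f) \<le> (\<Sum>i\<in>UNIV. n2 (\<lambda>x. h $ i * pd i f x))"
    unfolding dd_def[abs_def]
    by (intro l2n_sum_le sq_int_cmult tf_sq_int[OF test_function_pd[OF assms]])
  also have "\<dots> \<le> 3 * (norm h * gn f)"
    unfolding l2n_cmult
    by (intro sum_UNIV3_le mult_mono component_le_norm_cart n2_pd_le_gn) auto
  finally show ?thesis by (simp add: mult.assoc)
qed

lemma n2_cc_le_mult:
  assumes "cc g" "f \<in> borel_measurable borel" "\<And>x. \<bar>f x\<bar> \<le> c * \<bar>g x\<bar>" "0 \<le> c"
  shows "sq_int lborel f" "n2 f \<le> c * n2 g"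
proof -
  have b: "\<bar>f x\<bar> \<le> \<bar>c * g x\<bar>" for x using assms(3)[of x] assms(4) by (simp add: abs_mult)
  note s = sq_int_cmult[OF cc_sq_int[OF assms(1)], of c]
  show "sq_int lborel f" by (rule sq_int_bound[OF s]) (use assms(2) b in auto)
  have "n2 f \<le> n2 (\<lambda>x. c * g x)" by (rule l2n_mono[OF s]) (use assms(2) b in auto)
  then show "n2 f \<le> c * n2 g" using assms(4) by (simp add: l2n_cmult)
qed

section \<open>Weak directional derivatives of the potential\<close>

context potential
begin

definition pe :: "real^3 \<Rightarrow> real^3 \<Rightarrow> real" where
  "pe e x = (\<Sum>i\<in>UNIV. e $ i * p i x)"

lemma pe_sq: "sq_int lborel (pe e)"
  unfolding pe_def[abs_def] by (intro sq_int_sum sq_int_cmult p_sq)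

lemma pe_sqloc: "sqloc (pe e)"
  by (rule sq_int_sqloc[OF pe_sq])

lemma pe_lloc: "lloc (pe e)"
  by (rule sqloc_lloc[OF pe_sqloc])

lemma pe_axis [simp]: "pe (axis i 1) = p i"
  by (rule ext) (simp add: pe_def axis_def if_distrib[of "\<lambda>u. u * _"] cong: if_cong)

lemma grad_u_dd:
  assumes "tf \<phi>" shows "(LINT x|lborel. u x * dd e \<phi> x) = - (LINT x|lborel. pe e x * \<phi> x)"
proof -
  have iu: "integrable lborel (\<lambda>x. u x * pd i \<phi> x)" for i
    by (rule lloc_cc_integrable[OF u_lloc cc_test[OF test_function_pd[OF assms]]])
  have ip: "integrable lborel (\<lambda>x. p i x * \<phi> x)" for i
    by (rule lloc_cc_integrable[OF p_lloc cc_test[OF assms]])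
  have "(LINT x|lborel. u x * dd e \<phi> x) = (LINT x|lborel. (\<Sum>i\<in>UNIV. e $ i * (u x * pd i \<phi> x)))"
    by (simp add: dd_def sum_distrib_left mult.left_commute)
  also have "\<dots> = (\<Sum>i\<in>UNIV. e $ i * (LINT x|lborel. u x * pd i \<phi> x))" using iu by simp
  also have "\<dots> = - (\<Sum>i\<in>UNIV. e $ i * (LINT x|lborel. p i x * \<phi> x))"
    by (simp add: grad_u[OF assms] sum_negf)
  also have "(\<Sum>i\<in>UNIV. e $ i * (LINT x|lborel. p i x * \<phi> x)) = (LINT x|lborel. (\<Sum>i\<in>UNIV. e $ i * (p i x * \<phi> x)))"
    using ip by simp
  also have "\<dots> = (LINT x|lborel. pe e x * \<phi> x)"
    by (simp add: pe_def sum_distrib_right mult.assoc)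
  finally show ?thesis .
qed

lemma grad_u_ext:
  assumes f: "cc f" "continuous_on UNIV f'" "has_dir e f f'"
  shows "(LINT x|lborel. u x * f' x) = - (LINT x|lborel. pe e x * f x)"
proof -
  obtain K where K: "compact K" "\<And>x. x \<notin> K \<Longrightarrow> f x = 0" by (rule cc_compact_support[OF f(1)]) (rule that)
  show ?thesis
    by (rule weak_derivative_extend[OF open_UNIV K(1) subset_UNIV _ K(2) f(2,3) u_lloc pe_lloc grad_u_dd])
      (use f(1) in \<open>auto simp: cc_def\<close>)
qed

lemma pe_symmetric:
  assumes "tf \<phi>"
  shows "(LINT x|lborel. pe e x * dd e' \<phi> x) = (LINT x|lborel. pe e' x * dd e \<phi> x)"
  using grad_u_dd[OF test_function_dd[OF assms], of e e'] grad_u_dd[OF test_function_dd[OF assms], of e' e]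
  by (simp add: dd_commute[OF test_function_smooth[OF assms]])

lemma u_lap_p:
  assumes "tf \<phi>"
  shows "(LINT x|lborel. u x * lap \<phi> x) = - (\<Sum>i\<in>UNIV. LINT x|lborel. p i x * pd i \<phi> x)"
proof -
  have "integrable lborel (\<lambda>x. u x * pd i (pd i \<phi>) x)" for i
    by (rule lloc_cc_integrable[OF u_lloc cc_test[OF test_function_pd[OF test_function_pd[OF assms]]]])
  then show ?thesis
    by (simp add: lap_def sum_distrib_left grad_u[OF test_function_pd[OF assms]] sum_negf)
qed

end

section \<open>Tangential derivatives and difference quotients of the potential\<close>

locale potential_flow = potential u p m R0 + graph_flow Psi DP e3 L
  for u p m R0 Psi DP e3 L
begin

lemma DP_coord_continuous [continuous_intros]:
  "continuous_on A (\<lambda>x. DP x \<bullet> h)" "continuous_on A (\<lambda>x. (DP (x + v) - DP x) \<bullet> h)"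
  by (intro continuous_intros DP_continuous continuous_on_compose2[OF DP_continuous[of UNIV]]; simp)+

text \<open>Weak counterpart of \<open>tang\<close>: the tangential derivative of \<open>u\<close>,
  formed from its weak gradient.\<close>

definition qa :: "real^3 \<Rightarrow> real^3 \<Rightarrow> real" where
  "qa a x = pe a x + (DP x \<bullet> a) * pe e3 x"

lemma qa_sqloc: "sqloc (qa a)"
  unfolding qa_def[abs_def] by (intro sqloc_add sqloc_mult_continuous pe_sqloc DP_coord_continuous)

lemma qa_lloc: "lloc (qa a)"
  by (rule sqloc_lloc[OF qa_sqloc])

lemma dd_flow_continuous:
  assumes "smooth f" shows "continuous_on UNIV (dd h (\<lambda>x. f (flow a s x)))"
  unfolding dd_flow[OF smooth_differentiable[OF assms]]
  by (intro continuous_intros DP_coord_continuous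
      continuous_on_compose2[OF smooth_continuous[OF smooth_dd[OF assms], of UNIV] flow_continuous]) auto

lemma has_dir_flow: "smooth f \<Longrightarrow> has_dir h (\<lambda>x. f (flow a s x)) (dd h (\<lambda>x. f (flow a s x)))"
  by (intro has_dir_differentiable flow_compose_differentiable smooth_differentiable)

lemma has_dir_e3_mult:
  assumes "\<And>x t. k (x + t *\<^sub>R e3) = k x" "has_dir e3 f f'"
  shows "has_dir e3 (\<lambda>x. k x * f x) (\<lambda>x. k x * f' x)"
  using assms unfolding has_dir_def by (simp add: DERIV_cmult)

lemma tang_pairing:
  assumes t: "test_function G \<xi>"
  shows "(LINT x|lborel. u x * tang a \<xi> (flow a s x)) = - (LINT x|lborel. qa a x * \<xi> (flow a s x))"
proof -
  define \<psi> where "\<psi> x = \<xi> (flow a s x)" for x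
  have sm: "smooth \<xi>" by (rule test_function_smooth[OF t])
  have c: "cc \<psi>" unfolding \<psi>_def by (rule cc_flow[OF cc_test[OF t]])
  have dc: "continuous_on UNIV (dd h \<psi>)" and hd: "has_dir h \<psi> (dd h \<psi>)" for h
    unfolding \<psi>_def[abs_def] by (rule dd_flow_continuous[OF sm], rule has_dir_flow[OF sm])
  have c2: "cc (\<lambda>x. (DP x \<bullet> a) * \<psi> x)" by (intro cc_mult DP_coord_continuous c)
  have hd2: "has_dir e3 (\<lambda>x. (DP x \<bullet> a) * \<psi> x) (\<lambda>x. (DP x \<bullet> a) * dd e3 \<psi> x)"
    by (rule has_dir_e3_mult[OF _ hd]) (simp add: DP_inv)
  have 1: "(LINT x|lborel. u x * dd a \<psi> x) = - (LINT x|lborel. pe a x * \<psi> x)"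
    by (rule grad_u_ext[OF c dc hd])
  have 2: "(LINT x|lborel. u x * ((DP x \<bullet> a) * dd e3 \<psi> x)) = - (LINT x|lborel. pe e3 x * ((DP x \<bullet> a) * \<psi> x))"
    by (rule grad_u_ext[OF c2 _ hd2]) (intro continuous_intros DP_coord_continuous dc)
  obtain K where K: "compact K" "\<And>x. x \<notin> K \<Longrightarrow> \<psi> x = 0" by (rule cc_compact_support[OF c]) (rule that)
  have cd: "cc (dd h \<psi>)" for h
    by (rule cc_compactI[OF dc K(1) has_dir_zero_outside[OF hd compact_imp_closed[OF K(1)] K(2)]])
  have "tang a \<xi> (flow a s x) = dd a \<psi> x + (DP x \<bullet> a) * dd e3 \<psi> x" for x
    using tang_flow[of \<xi> a s x] smooth_differentiable[OF sm] by (simp add: \<psi>_def[abs_def] tang_def)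
  then have "(LINT x|lborel. u x * tang a \<xi> (flow a s x))
      = (LINT x|lborel. u x * dd a \<psi> x + u x * ((DP x \<bullet> a) * dd e3 \<psi> x))"
    by (simp add: distrib_left)
  also have "\<dots> = (LINT x|lborel. u x * dd a \<psi> x) + (LINT x|lborel. u x * ((DP x \<bullet> a) * dd e3 \<psi> x))"
    by (intro Bochner_Integration.integral_add lloc_cc_integrable[OF u_lloc] cd cc_mult DP_coord_continuous)
  also have "\<dots> = - ((LINT x|lborel. pe a x * \<psi> x) + (LINT x|lborel. pe e3 x * ((DP x \<bullet> a) * \<psi> x)))"
    unfolding 1 2 by simp
  also have "\<dots> = - (LINT x|lborel. pe a x * \<psi> x + pe e3 x * ((DP x \<bullet> a) * \<psi> x))"
    by (subst Bochner_Integration.integral_add) (auto intro: lloc_cc_integrable pe_lloc c c2)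
  also have "\<dots> = - (LINT x|lborel. qa a x * \<psi> x)"
    by (simp add: qa_def algebra_simps)
  finally show ?thesis by (simp add: \<psi>_def)
qed

text \<open>A difference along the flow is an integral of tangential derivatives over time. These
  are bounded by the local norm of \<open>qa a\<close>, and volume preservation keeps the norm of
  the moved test function.\<close>

lemma diff_quotient_bound:
  "\<exists>C\<ge>0. \<forall>\<xi> s. test_function (ball x0 r) \<xi> \<longrightarrow> \<bar>s\<bar> \<le> 1 \<longrightarrow>
     \<bar>LINT x|lborel. u x * (\<xi> (flow a s x) - \<xi> x)\<bar> \<le> C * \<bar>s\<bar> * n2 \<xi>"
proof -
  obtain R where R: "0 < R" "\<And>s x. \<bar>s\<bar> \<le> 1 \<Longrightarrow> flow a s x \<in> cball x0 r \<Longrightarrow> norm x \<le> R"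
    by (rule flow_support[OF compact_cball]) (rule that)
  define Q where "Q = n2 (\<lambda>x. indicator (cball 0 R) x * qa a x)"
  have sQ: "sq_int lborel (\<lambda>x. indicator (cball 0 R) x * qa a x)" using qa_sqloc by (simp add: sqloc_def)
  have "\<bar>LINT x|lborel. u x * (\<xi> (flow a s x) - \<xi> x)\<bar> \<le> (Q * n2 \<xi>) * \<bar>s\<bar>"
    if t: "test_function (ball x0 r) \<xi>" and s: "\<bar>s\<bar> \<le> 1" for \<xi> s
  proof (rule flow_difference_bound[OF u_lloc t])
    fix t' assume t': "\<bar>t'\<bar> \<le> \<bar>s\<bar>"
    have "qa a x * \<xi> (flow a t' x) = (indicator (cball 0 R) x * qa a x) * \<xi> (flow a t' x)" for x
    proof (cases "norm x \<le> R")
      case False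
      then have "flow a t' x \<notin> cball x0 r" using R(2)[of t' x] t' s by fastforce
      then have "\<xi> (flow a t' x) = 0" by (intro test_function_outside[OF t]) auto
      then show ?thesis by simp
    qed simp
    then have "\<bar>LINT x|lborel. u x * tang a \<xi> (flow a t' x)\<bar>
        = \<bar>LINT x|lborel. (indicator (cball 0 R) x * qa a x) * \<xi> (flow a t' x)\<bar>"
      unfolding tang_pairing[OF t] abs_minus_cancel by (simp only:)
    also have "\<dots> \<le> Q * n2 (\<lambda>x. \<xi> (flow a t' x))"
      unfolding Q_def by (intro l2n_CS sQ sq_int_flow tf_sq_int[OF t])
    finally show "\<bar>LINT x|lborel. u x * tang a \<xi> (flow a t' x)\<bar> \<le> Q * n2 \<xi>"
      by (simp add: n2_flow[OF tf_borel[OF t]])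
  qed
  then show ?thesis by (intro exI[of _ Q]) (auto simp: Q_def mult_ac)
qed

end

text \<open>The equation near a boundary point after the surface term has been rewritten as a volume
  integral. In the application \<open>g\<close> jumps across the boundary, so its vertical
  derivative stays on the test function.\<close>

locale potential_interface = potential_flow u p m R0 Psi DP e3 L
  for u p m R0 Psi DP e3 L +
  fixes x0 :: "real^3" and r :: real and f g :: "real^3 \<Rightarrow> real"
  assumes r: "0 < r" and f_sq: "sq_int lborel f" and g_sq: "sq_int lborel g"
    and local_eq: "\<And>\<phi>. test_function (ball x0 r) \<phi> \<Longrightarrow>
      (LINT x|lborel. u x * lap \<phi> x) = (LINT x|lborel. f x * \<phi> x) + (LINT x|lborel. g x * dd e3 \<phi> x)"
begin

lemma f_lloc: "lloc f" and g_lloc: "lloc g"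
  using f_sq g_sq by (auto intro: sqloc_lloc sq_int_sqloc)

text \<open>Compositions with the flow have in general no second derivatives; the Laplacian is
  therefore replaced by its first-order form with \<open>p\<close>, which passes to the limit along
  \<open>test_approx\<close>.\<close>

lemma local_eq_ext:
  assumes K: "compact K" "K \<subseteq> ball x0 r" and h: "\<And>x. x \<notin> K \<Longrightarrow> h x = 0"
    and d: "\<And>x. h differentiable (at x)" and c: "\<And>e. continuous_on UNIV (dd e h)"
  shows "- (\<Sum>i\<in>UNIV. LINT x|lborel. p i x * pd i h x) = (LINT x|lborel. f x * h x) + (LINT x|lborel. g x * dd e3 h x)"
proof -
  have ch: "continuous_on UNIV h"
    using d by (intro continuous_at_imp_continuous_on) (auto intro: differentiable_imp_continuous_within)
  obtain F where F: "\<And>n::nat. test_function (ball x0 r) (F n)"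
    "\<And>w. lloc w \<Longrightarrow> (\<lambda>n. LINT x|lborel. w x * F n x) \<longlonglongrightarrow> (LINT x|lborel. w x * h x)"
    "\<And>w e f'. lloc w \<Longrightarrow> continuous_on UNIV f' \<Longrightarrow> has_dir e h f' \<Longrightarrow>
      (\<lambda>n. LINT x|lborel. w x * dd e (F n) x) \<longlonglongrightarrow> (LINT x|lborel. w x * f' x)"
    by (rule test_approx[OF open_ball K ch h]) (assumption, rule that)
  have F3: "(\<lambda>n. LINT x|lborel. w x * dd e (F n) x) \<longlonglongrightarrow> (LINT x|lborel. w x * dd e h x)" if "lloc w" for w e
    by (rule F(3)[OF that c has_dir_differentiable[OF d]])
  have "(\<lambda>n. - (\<Sum>i\<in>UNIV. LINT x|lborel. p i x * pd i (F n) x)) \<longlonglongrightarrow> - (\<Sum>i\<in>UNIV. LINT x|lborel. p i x * pd i h x)"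
    using F3[OF p_lloc, of _ "axis _ 1"] by (intro tendsto_minus tendsto_sum) simp
  moreover have "- (\<Sum>i\<in>UNIV. LINT x|lborel. p i x * pd i (F n) x)
      = (LINT x|lborel. f x * F n x) + (LINT x|lborel. g x * dd e3 (F n) x)" for n
    using local_eq[OF F(1)] u_lap_p[OF test_function_UNIV[OF F(1)]] by simp
  moreover have "(\<lambda>n. (LINT x|lborel. f x * F n x) + (LINT x|lborel. g x * dd e3 (F n) x))
      \<longlonglongrightarrow> (LINT x|lborel. f x * h x) + (LINT x|lborel. g x * dd e3 h x)"
    by (intro tendsto_add F(2) F3 f_lloc g_lloc)
  ultimately show ?thesis using LIMSEQ_unique by simp
qed

text \<open>The flow commutes with the Laplacian up to increments of \<open>DP\<close>. The equation
  is tested with the difference of the moved and the unmoved function, and each commutator is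
  written with one derivative on \<open>u\<close> and one on \<xi>; this is possible because the
  increments are constant along \<open>e3\<close> and pass through vertical integration by
  parts.\<close>

lemma lap_flow_identity:
  assumes t: "test_function (ball x0 r) \<xi>"
    and K: "compact K" "K \<subseteq> ball x0 r" "\<And>x. x \<notin> K \<Longrightarrow> \<xi> x = 0" "\<And>x. x \<notin> K \<Longrightarrow> \<xi> (flow a s x) = 0"
  shows "(LINT x|lborel. u x * (lap \<xi> (flow a s x) - lap \<xi> x))
    = (LINT x|lborel. f x * (\<xi> (flow a s x) - \<xi> x)) + (LINT x|lborel. g x * (dd e3 \<xi> (flow a s x) - dd e3 \<xi> x))
      + (\<Sum>i\<in>UNIV. LINT x|lborel. p i x * ((DP (x + s *\<^sub>R a) - DP x) $ i * dd e3 \<xi> (flow a s x)))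
      + (\<Sum>i\<in>UNIV. LINT x|lborel. pe e3 x * ((DP (x + s *\<^sub>R a) - DP x) $ i * pd i \<xi> (flow a s x)))"
proof -
  have sm: "smooth \<xi>" by (rule test_function_smooth[OF t])
  have df: "\<And>x. \<xi> differentiable (at x)" by (rule smooth_differentiable[OF sm])
  define c where "c i x = (DP (x + s *\<^sub>R a) - DP x) \<bullet> axis i 1" for i x
  have ci: "c i x = (DP (x + s *\<^sub>R a) - DP x) $ i" for i x by (simp add: c_def cart_eq_inner_axis)
  have cc': "continuous_on UNIV (c i)" for i unfolding c_def[abs_def] by (rule DP_coord_continuous)
  have cinv: "c i (x + t *\<^sub>R e3) = c i x" for i x t
    using DP_inv[of "x + s *\<^sub>R a" t] by (simp add: c_def DP_inv add_ac)
  define \<psi> where "\<psi> x = \<xi> (flow a s x)" for x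
  have dpsi: "\<psi> differentiable (at x)" for x
    unfolding \<psi>_def[abs_def] by (rule flow_compose_differentiable[OF df])
  have psi_dd: "dd h \<psi> x = dd h \<xi> (flow a s x) + ((DP (x + s *\<^sub>R a) - DP x) \<bullet> h) * dd e3 \<xi> (flow a s x)" for h x
    unfolding \<psi>_def[abs_def] by (rule dd_flow[OF df])
  have cddpsi: "continuous_on UNIV (dd h \<psi>)" for h
    unfolding \<psi>_def[abs_def] by (rule dd_flow_continuous[OF sm])
  have tq: "test_function (ball x0 r) (pd i \<xi>)" for i by (rule test_function_pd[OF t])
  have sq: "smooth (pd i \<xi>)" for i by (rule test_function_smooth[OF tq])
  have cf: "cc (\<lambda>x. k (flow a s x))" if "test_function (ball x0 r) k" for k
    by (rule cc_flow[OF cc_test[OF that]])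
  have cfc: "cc (\<lambda>x. c i x * k (flow a s x))" if "test_function (ball x0 r) k" for k i
    by (intro cc_mult cc' cf that)
  have step: "(LINT x|lborel. u x * pd i (pd i \<xi>) (flow a s x))
      = - (LINT x|lborel. p i x * pd i \<psi> x) + (LINT x|lborel. p i x * (c i x * dd e3 \<xi> (flow a s x)))
        + (LINT x|lborel. pe e3 x * (c i x * pd i \<xi> (flow a s x)))" for i
  proof -
    define q where "q x = pd i \<xi> (flow a s x)" for x
    have cq: "cc q" unfolding q_def by (rule cf[OF tq])
    have hq: "has_dir h q (dd h q)" and dq: "continuous_on UNIV (dd h q)" for h
      unfolding q_def[abs_def] by (rule has_dir_flow[OF sq], rule dd_flow_continuous[OF sq])
    obtain Q where Q: "compact Q" "\<And>x. x \<notin> Q \<Longrightarrow> q x = 0" by (rule cc_compact_support[OF cq]) (rule that)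
    have cdq: "cc (dd h q)" for h
      by (rule cc_compactI[OF dq Q(1) has_dir_zero_outside[OF hq compact_imp_closed[OF Q(1)] Q(2)]])
    have ccq: "cc (\<lambda>x. c i x * q x)" "cc (\<lambda>x. c i x * dd e3 q x)" by (intro cc_mult cc' cq cdq)+
    have e3q: "dd e3 q x = dd e3 (pd i \<xi>) (flow a s x)" for x
      unfolding q_def[abs_def] by (rule dd_e3_flow[OF smooth_differentiable[OF sq]])
    have qe: "q x = pd i \<psi> x - c i x * dd e3 \<xi> (flow a s x)" for x
      using psi_dd[of "axis i 1" x] by (simp add: q_def c_def)
    \<comment> \<open>Chain rule: the second derivative at the moved point is a derivative of
      \<open>q\<close> corrected by the vertical derivative of \<open>q\<close> with coefficient
      \<open>c i\<close>.\<close>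
    have "pd i (pd i \<xi>) (flow a s x) = dd (axis i 1) q x - c i x * dd e3 q x" for x
      unfolding e3q unfolding q_def[abs_def] dd_flow[OF smooth_differentiable[OF sq]] by (simp add: c_def)
    then have "(LINT x|lborel. u x * pd i (pd i \<xi>) (flow a s x))
        = (LINT x|lborel. u x * dd (axis i 1) q x - u x * (c i x * dd e3 q x))"
      by (simp add: right_diff_distrib)
    also have "\<dots> = (LINT x|lborel. u x * dd (axis i 1) q x) - (LINT x|lborel. u x * (c i x * dd e3 q x))"
      by (intro Bochner_Integration.integral_diff lloc_cc_integrable[OF u_lloc] cdq ccq)
    also have "(LINT x|lborel. u x * dd (axis i 1) q x) = - (LINT x|lborel. p i x * q x)"
      using grad_u_ext[OF cq dq hq, of "axis i 1"] by simp
    also have "(LINT x|lborel. u x * (c i x * dd e3 q x)) = - (LINT x|lborel. pe e3 x * (c i x * q x))"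
      by (rule grad_u_ext[OF ccq(1) _ has_dir_e3_mult[OF cinv hq]]) (intro continuous_intros cc' dq)
    also have "(LINT x|lborel. p i x * q x) = (LINT x|lborel. p i x * pd i \<psi> x - p i x * (c i x * dd e3 \<xi> (flow a s x)))"
      by (simp only: qe right_diff_distrib)
    also have "\<dots> = (LINT x|lborel. p i x * pd i \<psi> x) - (LINT x|lborel. p i x * (c i x * dd e3 \<xi> (flow a s x)))"
    proof (intro Bochner_Integration.integral_diff lloc_cc_integrable[OF p_lloc] cfc test_function_dd t)
      have "pd i \<psi> = (\<lambda>x. q x + c i x * dd e3 \<xi> (flow a s x))"
        using psi_dd[of "axis i 1"] by (auto simp: q_def c_def)
      then show "cc (pd i \<psi>)" by (simp add: cc_add cq cfc test_function_dd t)
    qed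
    finally show ?thesis by (simp add: q_def)
  qed
  define h where "h x = \<psi> x - \<xi> x" for x
  have dh: "dd e h x = dd e \<psi> x - dd e \<xi> x" for e x
    unfolding h_def[abs_def] by (rule dd_has_derivative[OF has_derivative_diff[OF has_derivative_dd[OF dpsi] has_derivative_dd[OF df]]])
  have main: "- (\<Sum>i\<in>UNIV. LINT x|lborel. p i x * pd i h x) = (LINT x|lborel. f x * h x) + (LINT x|lborel. g x * dd e3 h x)"
  proof (rule local_eq_ext[OF K(1,2)])
    show "h x = 0" if "x \<notin> K" for x using K(3,4)[OF that] by (simp add: h_def \<psi>_def)
    show "h differentiable (at x)" for x unfolding h_def[abs_def] by (intro differentiable_diff dpsi df)
    show "continuous_on UNIV (dd e h)" for e
      unfolding dh by (intro continuous_intros cddpsi smooth_continuous smooth_dd sm)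
  qed
  have ip: "integrable lborel (\<lambda>x. p i x * pd i \<psi> x)" for i
  proof -
    have "pd i \<psi> = (\<lambda>x. pd i \<xi> (flow a s x) + c i x * dd e3 \<xi> (flow a s x))"
      using psi_dd[of "axis i 1"] by (auto simp: c_def)
    then show ?thesis by (intro lloc_cc_integrable[OF p_lloc]) (simp add: cc_add cf cfc tq test_function_dd t)
  qed
  have ip2: "integrable lborel (\<lambda>x. p i x * pd i \<xi> x)" for i
    by (intro lloc_cc_integrable[OF p_lloc] cc_test[OF tq])
  have "pd i h x = pd i \<psi> x - pd i \<xi> x" for i x using dh[of "axis i 1" x] by simp
  then have S: "(\<Sum>i\<in>UNIV. LINT x|lborel. p i x * pd i h x)
      = (\<Sum>i\<in>UNIV. LINT x|lborel. p i x * pd i \<psi> x) - (\<Sum>i\<in>UNIV. LINT x|lborel. p i x * pd i \<xi> x)"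
    using ip ip2 by (simp add: right_diff_distrib sum_subtractf)
  have iu: "integrable lborel (\<lambda>x. u x * pd i (pd i \<xi>) (flow a s x))" for i
    by (intro lloc_cc_integrable[OF u_lloc] cf test_function_pd t)
  have "(LINT x|lborel. u x * (lap \<xi> (flow a s x) - lap \<xi> x))
      = (LINT x|lborel. u x * lap \<xi> (flow a s x)) - (LINT x|lborel. u x * lap \<xi> x)"
    using lloc_cc_integrable[OF u_lloc cf[OF test_function_lap[OF t]]] lloc_cc_integrable[OF u_lloc cc_test[OF test_function_lap[OF t]]]
    by (simp add: right_diff_distrib)
  also have "(LINT x|lborel. u x * lap \<xi> (flow a s x)) = (\<Sum>i\<in>UNIV. LINT x|lborel. u x * pd i (pd i \<xi>) (flow a s x))"
    using iu by (simp add: lap_def sum_distrib_left)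
  also have "\<dots> = - (\<Sum>i\<in>UNIV. LINT x|lborel. p i x * pd i \<psi> x) + (\<Sum>i\<in>UNIV. LINT x|lborel. p i x * (c i x * dd e3 \<xi> (flow a s x)))
      + (\<Sum>i\<in>UNIV. LINT x|lborel. pe e3 x * (c i x * pd i \<xi> (flow a s x)))"
    by (simp only: step sum.distrib sum_negf)
  also have "(LINT x|lborel. u x * lap \<xi> x) = - (\<Sum>i\<in>UNIV. LINT x|lborel. p i x * pd i \<xi> x)"
    by (rule u_lap_p[OF test_function_UNIV[OF t]])
  finally have "(LINT x|lborel. u x * (lap \<xi> (flow a s x) - lap \<xi> x))
      = - (\<Sum>i\<in>UNIV. LINT x|lborel. p i x * pd i h x)
       + (\<Sum>i\<in>UNIV. LINT x|lborel. p i x * (c i x * dd e3 \<xi> (flow a s x)))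
      + (\<Sum>i\<in>UNIV. LINT x|lborel. pe e3 x * (c i x * pd i \<xi> (flow a s x)))"
    unfolding S by simp
  moreover have "dd e3 h x = dd e3 \<xi> (flow a s x) - dd e3 \<xi> x" for x
    unfolding dh psi_dd by (simp add: inner_diff_left DP_perp)
  ultimately show ?thesis
    unfolding main ci by (simp add: h_def \<psi>_def)
qed

text \<open>All four terms of \<open>lap_flow_identity\<close> are of order |s| times the Dirichlet
  norm of \<xi>: the \<open>f\<close>-term by the flow derivative, the \<open>g\<close>-term by the
  hypothesis applied to the vertical derivative of \<xi>, and the two commutators by the Lipschitz
  bound on \<open>DP\<close>.\<close>

lemma tangential_estimate:
  assumes r1: "0 < r1" "r1 < r"
    and gb: "\<exists>C\<ge>0. \<exists>s0>0. \<forall>q s. test_function (ball x0 r1) q \<longrightarrow> \<bar>s\<bar> \<le> s0 \<longrightarrow>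
      \<bar>LINT x|lborel. g x * (q (flow a s x) - q x)\<bar> \<le> C * \<bar>s\<bar> * n2 q"
  shows "\<exists>C\<ge>0. \<exists>s0>0. s0 \<le> 1 \<and> (\<forall>\<xi> s. test_function (ball x0 r1) \<xi> \<longrightarrow> \<bar>s\<bar> \<le> s0 \<longrightarrow>
      \<bar>LINT x|lborel. u x * (lap \<xi> (flow a s x) - lap \<xi> x)\<bar> \<le> C * \<bar>s\<bar> * gn \<xi>)"
proof -
  obtain Cg s1 where gb: "0 \<le> Cg" "0 < s1" "\<And>q s. test_function (ball x0 r1) q \<Longrightarrow> \<bar>s\<bar> \<le> s1 \<Longrightarrow>
      \<bar>LINT x|lborel. g x * (q (flow a s x) - q x)\<bar> \<le> Cg * \<bar>s\<bar> * n2 q"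
    using gb by blast
  obtain s2 where s2: "0 < s2" "s2 \<le> 1" "\<And>s x. \<bar>s\<bar> \<le> s2 \<Longrightarrow> flow a s x \<in> cball x0 r1 \<Longrightarrow> x \<in> cball x0 ((r1 + r) / 2)"
    by (rule flow_small[of r1 "(r1 + r) / 2" a x0]) (use r1 in simp, rule that)
  have "compact ((\<lambda>x. DP x \<bullet> a) ` cball x0 r1)"
    by (intro compact_continuous_image DP_coord_continuous compact_cball)
  from compact_imp_bounded[OF this] obtain B where B: "0 < B" "\<forall>y\<in>(\<lambda>x. DP x \<bullet> a) ` cball x0 r1. norm y \<le> B"
    unfolding bounded_pos by (elim exE conjE)
  define CT where "CT = 3 * norm a + B * (3 * norm e3)"
  have CT0: "0 \<le> CT" using B by (simp add: CT_def)
  define P where "P = (\<Sum>i\<in>UNIV. n2 (p i))"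
  have P0: "0 \<le> P" unfolding P_def by (intro sum_nonneg) simp
  have Pi: "n2 (p i) \<le> P" for i unfolding P_def by (intro member_le_sum) auto
  define C where "C = n2 f * CT + Cg * (3 * norm e3) + 3 * (P * (L * norm a * (3 * norm e3))) + 3 * (n2 (pe e3) * (L * norm a))"
  have C0: "0 \<le> C" using CT0 gb P0 L_nonneg by (simp add: C_def)
  have main: "\<bar>LINT x|lborel. u x * (lap \<xi> (flow a s x) - lap \<xi> x)\<bar> \<le> C * \<bar>s\<bar> * gn \<xi>"
    if t: "test_function (ball x0 r1) \<xi>" and s: "\<bar>s\<bar> \<le> min s1 s2" for \<xi> s
  proof -
    have t2: "test_function (ball x0 r) \<xi>" by (rule test_function_mono[OF t]) (use r1 in auto)
    have sm: "smooth \<xi>" by (rule test_function_smooth[OF t])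
    have id: "(LINT x|lborel. u x * (lap \<xi> (flow a s x) - lap \<xi> x))
    = (LINT x|lborel. f x * (\<xi> (flow a s x) - \<xi> x)) + (LINT x|lborel. g x * (dd e3 \<xi> (flow a s x) - dd e3 \<xi> x))
      + (\<Sum>i\<in>UNIV. LINT x|lborel. p i x * ((DP (x + s *\<^sub>R a) - DP x) $ i * dd e3 \<xi> (flow a s x)))
      + (\<Sum>i\<in>UNIV. LINT x|lborel. pe e3 x * ((DP (x + s *\<^sub>R a) - DP x) $ i * pd i \<xi> (flow a s x)))"
    proof (rule lap_flow_identity[OF t2, of "cball x0 ((r1 + r) / 2)"])
      show "cball x0 ((r1 + r) / 2) \<subseteq> ball x0 r" using r1 by (auto simp: field_simps)
      show "\<xi> x = 0" if "x \<notin> cball x0 ((r1 + r) / 2)" for x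
        using that r1 by (intro test_function_outside[OF t]) auto
      show "\<xi> (flow a s x) = 0" if "x \<notin> cball x0 ((r1 + r) / 2)" for x
      proof (rule test_function_outside[OF t], rule notI)
        assume "flow a s x \<in> ball x0 r1"
        then have "x \<in> cball x0 ((r1 + r) / 2)" using s by (intro s2(3)[of s x]) auto
        with that show False by simp
      qed
    qed simp
    have tang: "n2 (tang a \<xi>) \<le> CT * gn \<xi>"
    proof -
      have ta: "test_function (ball x0 r1) (dd a \<xi>)" and te: "test_function (ball x0 r1) (dd e3 \<xi>)"
        by (rule test_function_dd[OF t])+
      have c2: "cc (\<lambda>x. (DP x \<bullet> a) * dd e3 \<xi> x)" by (intro cc_mult DP_coord_continuous cc_test[OF te])
      have "n2 (tang a \<xi>) \<le> n2 (dd a \<xi>) + n2 (\<lambda>x. (DP x \<bullet> a) * dd e3 \<xi> x)"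
        unfolding tang_def[abs_def] by (intro l2n_triangle tf_sq_int[OF ta] cc_sq_int c2)
      also have "n2 (\<lambda>x. (DP x \<bullet> a) * dd e3 \<xi> x) \<le> B * n2 (dd e3 \<xi>)"
      proof (rule n2_le_mult[OF te cc_borel[OF c2]])
        fix x show "\<bar>(DP x \<bullet> a) * dd e3 \<xi> x\<bar> \<le> B * \<bar>dd e3 \<xi> x\<bar>"
        proof (cases "x \<in> ball x0 r1")
          case True
          then have "\<bar>DP x \<bullet> a\<bar> \<le> B" using B(2) by auto
          then show ?thesis by (simp add: abs_mult mult_right_mono)
        qed (simp add: test_function_outside[OF te])
      qed
      also have "n2 (dd a \<xi>) + B * n2 (dd e3 \<xi>) \<le> 3 * norm a * gn \<xi> + B * (3 * norm e3 * gn \<xi>)"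
        using B(1) by (intro add_mono mult_left_mono n2_dd_le[OF t]) auto
      finally show ?thesis by (simp add: CT_def algebra_simps)
    qed
    have 1: "\<bar>LINT x|lborel. f x * (\<xi> (flow a s x) - \<xi> x)\<bar> \<le> (n2 f * (CT * gn \<xi>)) * \<bar>s\<bar>"
    proof (rule flow_difference_bound[OF f_lloc t])
      fix t'
      have ct: "cc (tang a \<xi>)" by (rule tang_cc[OF t])
      have "\<bar>LINT x|lborel. f x * tang a \<xi> (flow a t' x)\<bar> \<le> n2 f * n2 (\<lambda>x. tang a \<xi> (flow a t' x))"
        by (intro l2n_CS f_sq sq_int_flow cc_sq_int ct)
      also have "n2 (\<lambda>x. tang a \<xi> (flow a t' x)) = n2 (tang a \<xi>)" by (rule n2_flow[OF cc_borel[OF ct]])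
      also have "n2 f * n2 (tang a \<xi>) \<le> n2 f * (CT * gn \<xi>)" by (intro mult_left_mono tang) simp
      finally show "\<bar>LINT x|lborel. f x * tang a \<xi> (flow a t' x)\<bar> \<le> n2 f * (CT * gn \<xi>)" .
    qed
    have 2: "\<bar>LINT x|lborel. g x * (dd e3 \<xi> (flow a s x) - dd e3 \<xi> x)\<bar> \<le> Cg * \<bar>s\<bar> * (3 * norm e3 * gn \<xi>)"
      using order_trans[OF gb(3)[OF test_function_dd[OF t], of s] mult_left_mono[OF n2_dd_le[OF t]]] s gb(1) by simp
    have cb: "\<bar>LINT x|lborel. w x * ((DP (x + s *\<^sub>R a) - DP x) $ i * k (flow a s x))\<bar> \<le> n2 w * (L * norm a * \<bar>s\<bar> * n2 k)"
      if w: "sq_int lborel w" and k: "test_function (ball x0 r1) k" for w k i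
    proof -
      have ck: "cc (\<lambda>x. k (flow a s x))" by (rule cc_flow[OF cc_test[OF k]])
      have cdp: "continuous_on UNIV (\<lambda>x. (DP (x + s *\<^sub>R a) - DP x) $ i)"
        using DP_coord_continuous(2)[of UNIV "s *\<^sub>R a" "axis i 1"] by (simp add: cart_eq_inner_axis)
      have m: "(\<lambda>x. (DP (x + s *\<^sub>R a) - DP x) $ i * k (flow a s x)) \<in> borel_measurable borel"
        by (rule cc_borel[OF cc_mult[OF cdp ck]])
      have b: "\<bar>(DP (x + s *\<^sub>R a) - DP x) $ i * k (flow a s x)\<bar> \<le> (L * norm a * \<bar>s\<bar>) * \<bar>k (flow a s x)\<bar>" for x
      proof -
        have "\<bar>(DP (x + s *\<^sub>R a) - DP x) $ i\<bar> \<le> norm (DP (x + s *\<^sub>R a) - DP x)" by (rule component_le_norm_cart)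
        also have "\<dots> \<le> L * norm (x + s *\<^sub>R a - x)" by (rule DP_lip)
        finally show ?thesis unfolding abs_mult by (intro mult_right_mono) (simp_all add: mult_ac)
      qed
      have L0: "0 \<le> L * norm a * \<bar>s\<bar>" using L_nonneg by simp
      have "\<bar>LINT x|lborel. w x * ((DP (x + s *\<^sub>R a) - DP x) $ i * k (flow a s x))\<bar>
          \<le> n2 w * n2 (\<lambda>x. (DP (x + s *\<^sub>R a) - DP x) $ i * k (flow a s x))"
        by (intro l2n_CS w n2_cc_le_mult(1)[OF ck m b L0])
      also have "\<dots> \<le> n2 w * ((L * norm a * \<bar>s\<bar>) * n2 (\<lambda>x. k (flow a s x)))"
        by (intro mult_left_mono n2_cc_le_mult(2)[OF ck m b L0]) simp
      finally show ?thesis by (simp add: n2_flow[OF tf_borel[OF k]])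
    qed
    have La: "0 \<le> L * norm a * \<bar>s\<bar>" using L_nonneg by simp
    have 3: "\<bar>\<Sum>i\<in>UNIV. LINT x|lborel. p i x * ((DP (x + s *\<^sub>R a) - DP x) $ i * dd e3 \<xi> (flow a s x))\<bar>
        \<le> 3 * (P * (L * norm a * \<bar>s\<bar> * (3 * norm e3 * gn \<xi>)))"
    proof (rule order_trans[OF sum_abs sum_UNIV3_le])
      fix i :: 3
      have "n2 (p i) * (L * norm a * \<bar>s\<bar> * n2 (dd e3 \<xi>)) \<le> P * (L * norm a * \<bar>s\<bar> * (3 * norm e3 * gn \<xi>))"
        by (intro mult_mono mult_left_mono Pi n2_dd_le[OF t] La P0 mult_nonneg_nonneg) auto
      with cb[OF p_sq test_function_dd[OF t], of i i e3]
      show "\<bar>LINT x|lborel. p i x * ((DP (x + s *\<^sub>R a) - DP x) $ i * dd e3 \<xi> (flow a s x))\<bar>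
        \<le> P * (L * norm a * \<bar>s\<bar> * (3 * norm e3 * gn \<xi>))" by (rule order_trans)
    qed
    have 4: "\<bar>\<Sum>i\<in>UNIV. LINT x|lborel. pe e3 x * ((DP (x + s *\<^sub>R a) - DP x) $ i * pd i \<xi> (flow a s x))\<bar>
        \<le> 3 * (n2 (pe e3) * (L * norm a * \<bar>s\<bar> * gn \<xi>))"
    proof (rule order_trans[OF sum_abs sum_UNIV3_le])
      fix i :: 3
      have "n2 (pe e3) * (L * norm a * \<bar>s\<bar> * n2 (pd i \<xi>)) \<le> n2 (pe e3) * (L * norm a * \<bar>s\<bar> * gn \<xi>)"
        by (intro mult_left_mono n2_pd_le_gn La) auto
      with cb[OF pe_sq test_function_pd[OF t], of e3 i i]
      show "\<bar>LINT x|lborel. pe e3 x * ((DP (x + s *\<^sub>R a) - DP x) $ i * pd i \<xi> (flow a s x))\<bar>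
        \<le> n2 (pe e3) * (L * norm a * \<bar>s\<bar> * gn \<xi>)" by (rule order_trans)
    qed
    have "\<bar>A + B + C + D\<bar> \<le> a + b + c + d" if "\<bar>A\<bar> \<le> a" "\<bar>B\<bar> \<le> b" "\<bar>C\<bar> \<le> c" "\<bar>D\<bar> \<le> d" for A B C D a b c d :: real
      using that by linarith
    from this[OF 1 2 3 4] have "\<bar>LINT x|lborel. u x * (lap \<xi> (flow a s x) - lap \<xi> x)\<bar>
      \<le> (n2 f * (CT * gn \<xi>)) * \<bar>s\<bar> + Cg * \<bar>s\<bar> * (3 * norm e3 * gn \<xi>)
       + 3 * (P * (L * norm a * \<bar>s\<bar> * (3 * norm e3 * gn \<xi>))) + 3 * (n2 (pe e3) * (L * norm a * \<bar>s\<bar> * gn \<xi>))"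
      unfolding id .
    also have "\<dots> = C * \<bar>s\<bar> * gn \<xi>" by (simp add: C_def algebra_simps)
    finally show ?thesis .
  qed
  then show ?thesis
    using C0 gb(2) s2 by (intro exI[of _ C] conjI exI[of _ "min s1 s2"]) auto
qed

text \<open>Nirenberg's difference quotient method: the quotient \<open>W\<close> of
  \<open>u\<close> along the flow satisfies, uniformly in \<open>s\<close>, the hypotheses of
  \<open>weighted_estimate\<close> with a local cut-off, which bounds its gradient. Letting
  \<open>s\<close> tend to zero transfers the bound to the gradient of \<open>qa a\<close>.\<close>

lemma tangential_regularity:
  assumes r1: "0 < r2" "r2 < r1" "r1 < r"
    and gb: "\<exists>C\<ge>0. \<exists>s0>0. \<forall>q s. test_function (ball x0 r1) q \<longrightarrow> \<bar>s\<bar> \<le> s0 \<longrightarrow>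
      \<bar>LINT x|lborel. g x * (q (flow a s x) - q x)\<bar> \<le> C * \<bar>s\<bar> * n2 q"
  shows "\<exists>C\<ge>0. \<forall>i \<zeta>. test_function (ball x0 r2) \<zeta> \<longrightarrow> \<bar>LINT x|lborel. qa a x * pd i \<zeta> x\<bar> \<le> C * n2 \<zeta>"
proof -
  have r1': "0 < r1" using r1 by simp
  obtain C1 s0 where C1: "0 \<le> C1" "0 < s0" "s0 \<le> 1" "\<And>\<xi> s. test_function (ball x0 r1) \<xi> \<Longrightarrow> \<bar>s\<bar> \<le> s0 \<Longrightarrow>
      \<bar>LINT x|lborel. u x * (lap \<xi> (flow a s x) - lap \<xi> x)\<bar> \<le> C1 * \<bar>s\<bar> * gn \<xi>"
    using tangential_estimate[OF r1' r1(3) gb] by blast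
  obtain C2 where C2: "0 \<le> C2" "\<And>\<xi> s. test_function (ball x0 r1) \<xi> \<Longrightarrow> \<bar>s\<bar> \<le> 1 \<Longrightarrow>
     \<bar>LINT x|lborel. u x * (\<xi> (flow a s x) - \<xi> x)\<bar> \<le> C2 * \<bar>s\<bar> * n2 \<xi>"
    using diff_quotient_bound by blast
  obtain b where b: "smooth b" "\<And>x. 0 \<le> b x" "\<And>x. b x \<le> 1"
      "\<And>x. norm (x - x0) \<le> r2 \<Longrightarrow> b x = 1" "\<And>x. (r2 + r1)/2 \<le> norm (x - x0) \<Longrightarrow> b x = 0"
    by (rule plateau[of r2 "(r2 + r1)/2" x0]) (use r1 in auto)
  have tb: "test_function (ball x0 r1) b"
    by (rule test_functionI[of _ "cball x0 ((r2 + r1)/2)"])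
      (use r1 b in \<open>auto simp: dist_norm norm_minus_commute field_simps\<close>)
  obtain A where A: "symb 1 A b" by (rule tf_symb[OF tb]) (rule that)
  have A0: "0 \<le> A" using A by (simp add: symb_def)
  define R where "R = norm x0 + r1"
  have R: "ball x0 r1 \<subseteq> cball 0 R"
  proof
    fix x assume "x \<in> ball x0 r1"
    then show "x \<in> cball 0 R"
      using norm_triangle_sub[of x x0] by (simp add: R_def dist_norm norm_minus_commute)
  qed
  define c where "c = jb 1 (R *\<^sub>R axis 1 1 :: real^3)"
  have c0: "0 \<le> c" by (simp add: c_def)
  define E where "E = C1 * (3 * (c * (7 * A)))"
  have E0: "0 \<le> E" using C1 c0 A0 by (simp add: E_def)
  have gnb: "gn (\<lambda>x. b x * \<zeta> x) \<le> 3 * (c * (7 * A)) * gn \<zeta>" if z: "tf \<zeta>" for \<zeta>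
  proof -
    have tz: "test_function (ball x0 r1) (\<lambda>x. b x * \<zeta> x)" by (rule test_function_mult2[OF tb test_function_smooth[OF z]])
    have "gn (\<lambda>x. b x * \<zeta> x) \<le> (\<Sum>i\<in>UNIV. \<bar>n2 (pd i (\<lambda>x. b x * \<zeta> x))\<bar>)"
      unfolding gn_def using L2_set_le_sum_abs[of "\<lambda>i. n2 (pd i (\<lambda>x. b x * \<zeta> x))" UNIV] by (simp add: L2_set_def)
    also have "\<dots> \<le> 3 * (c * (7 * A * gn \<zeta>))"
    proof (rule sum_UNIV3_le)
      fix i :: 3
      have "n2 (pd i (\<lambda>x. b x * \<zeta> x)) \<le> c * n2 (\<lambda>x. jb (-1) x * pd i (\<lambda>x. b x * \<zeta> x) x)"
        unfolding c_def by (rule n2_bounded_le[OF test_function_pd[OF tz] R]) simp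
      also have "\<dots> \<le> c * (7 * A * gn \<zeta>)" by (intro mult_left_mono n2_jb_pd_mult_le[OF A z] c0)
      finally show "\<bar>n2 (pd i (\<lambda>x. b x * \<zeta> x))\<bar> \<le> c * (7 * A * gn \<zeta>)" by simp
    qed
    finally show ?thesis by simp
  qed
  define C where "C = 24 * A * C2 + E"
  have C0: "0 \<le> C" using A0 C2 E0 by (simp add: C_def)
  have bound: "\<bar>LINT x|lborel. u x * (pd i \<zeta> (flow a s x) - pd i \<zeta> x)\<bar> \<le> \<bar>s\<bar> * (C * n2 \<zeta>)"
    if z: "test_function (ball x0 r2) \<zeta>" and s: "s \<noteq> 0" "\<bar>s\<bar> \<le> s0" for i \<zeta> s
  proof -
    \<comment> \<open>The backward flow appears because volume preservation moves
      \<open>flow a s\<close> from the test function to \<open>u\<close>.\<close>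
    define W where "W x = (u (flow a (- s) x) - u x) / s" for x
    have lW: "lloc W"
      using lloc_cmult[OF lloc_diff[OF lloc_flow[OF u_lloc, of a "- s"] u_lloc], of "inverse s"]
      by (simp add: W_def[abs_def] divide_inverse mult.commute)
    have Wp: "(LINT x|lborel. W x * k x) = (LINT x|lborel. u x * (k (flow a s x) - k x)) / s" if k: "cc k" for k
    proof -
      have "(LINT x|lborel. W x * k x) = (LINT x|lborel. (u (flow a (- s) x) * k x - u x * k x) / s)"
        by (simp add: W_def left_diff_distrib)
      also have "\<dots> = ((LINT x|lborel. u (flow a (- s) x) * k x) - (LINT x|lborel. u x * k x)) / s"
        using lloc_cc_integrable[OF lloc_flow[OF u_lloc, of a "- s"] k] lloc_cc_integrable[OF u_lloc k] by simp
      also have "(LINT x|lborel. u (flow a (- s) x) * k x) = (LINT x|lborel. u x * k (flow a s x))"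
        by (rule integral_flow_pair[OF u_borel cc_borel[OF k], symmetric])
      also have "(LINT x|lborel. u x * k (flow a s x)) - (LINT x|lborel. u x * k x)
          = (LINT x|lborel. u x * (k (flow a s x) - k x))"
        using lloc_cc_integrable[OF u_lloc cc_flow[OF k, of a s]] lloc_cc_integrable[OF u_lloc k]
        by (simp add: right_diff_distrib)
      finally show ?thesis .
    qed
    have "\<bar>LINT x|lborel. W x * b x * pd i \<zeta> x\<bar> \<le> (24 * A * C2 + E) * n2 \<zeta>"
    proof (rule weighted_estimate(1)[OF lW, where s=0 and G="ball x0 r1" and S=UNIV])
      show "symb (1 - 0) A b" "test_function (ball x0 r1) b" using A tb by simp_all
      show "\<bar>LINT x|lborel. W x * \<psi> x\<bar> \<le> C2 * n2 (\<lambda>x. jb 0 x * \<psi> x)" if k: "test_function (ball x0 r1) \<psi>" for \<psi>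
        using C2(2)[OF k, of s] s C1(3) by (simp add: Wp[OF cc_test[OF k]] abs_divide divide_le_eq mult_ac)
      fix \<xi> assume x: "tf \<xi>"
      have tz: "test_function (ball x0 r1) (\<lambda>x. b x * \<xi> x)" by (rule test_function_mult2[OF tb test_function_smooth[OF x]])
      have "\<bar>LINT x|lborel. W x * lap (\<lambda>x. b x * \<xi> x) x\<bar> \<le> C1 * gn (\<lambda>x. b x * \<xi> x)"
        unfolding Wp[OF cc_test[OF test_function_lap[OF tz]]] abs_divide
        using C1(4)[OF tz s(2)] s(1) by (subst pos_divide_le_eq) (simp_all add: mult.assoc mult.commute[of "\<bar>s\<bar>"])
      also have "\<dots> \<le> C1 * (3 * (c * (7 * A)) * gn \<xi>)" by (intro mult_left_mono gnb x C1)
      finally show "\<bar>LINT x|lborel. W x * lap (\<lambda>x. b x * \<xi> x) x\<bar> \<le> E * gn \<xi>" by (simp add: E_def mult.assoc)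
    qed (use test_function_UNIV[OF z] C2 E0 in auto)
    moreover have "W x * b x * pd i \<zeta> x = W x * pd i \<zeta> x" for x
      using b(4)[of x] test_function_outside[OF test_function_pd[OF z], of x i]
      by (cases "x \<in> ball x0 r2") (auto simp: dist_norm norm_minus_commute)
    ultimately have "\<bar>LINT x|lborel. W x * pd i \<zeta> x\<bar> \<le> C * n2 \<zeta>" by (simp add: C_def)
    then show ?thesis using s(1)
      by (simp add: Wp[OF cc_test[OF test_function_pd[OF z]]] abs_divide divide_le_eq mult_ac)
  qed
  have "\<bar>LINT x|lborel. qa a x * pd i \<zeta> x\<bar> \<le> C * n2 \<zeta>" if z: "test_function (ball x0 r2) \<zeta>" for i \<zeta>
  proof -
    define F where "F s = (LINT x|lborel. u x * pd i \<zeta> (flow a s x))" for s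
    have tp: "test_function (ball x0 r2) (pd i \<zeta>)" by (rule test_function_pd[OF z])
    have "(F has_real_derivative (LINT x|lborel. u x * tang a (pd i \<zeta>) (flow a 0 x))) (at 0)"
      unfolding F_def[abs_def] by (rule flow_pairing_derivative[OF u_lloc tp])
    then have D: "(F has_real_derivative - (LINT x|lborel. qa a x * pd i \<zeta> x)) (at 0)"
      unfolding tang_pairing[OF tp] by simp
    have "((\<lambda>h. \<bar>(F (0 + h) - F 0) / h\<bar>) \<longlongrightarrow> \<bar>- (LINT x|lborel. qa a x * pd i \<zeta> x)\<bar>) (at 0)"
      using D unfolding DERIV_def by (rule tendsto_rabs)
    moreover have "\<forall>\<^sub>F h in at 0. \<bar>(F (0 + h) - F 0) / h\<bar> \<le> C * n2 \<zeta>"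
      unfolding eventually_at
    proof (intro exI[of _ s0] conjI C1 ballI impI)
      fix s :: real assume s: "s \<noteq> 0 \<and> dist s 0 < s0"
      have "F s - F 0 = (LINT x|lborel. u x * (pd i \<zeta> (flow a s x) - pd i \<zeta> x))"
        using lloc_cc_integrable[OF u_lloc cc_flow[OF cc_test[OF tp], of a s]] lloc_cc_integrable[OF u_lloc cc_test[OF tp]]
        by (simp add: F_def right_diff_distrib)
      then show "\<bar>(F (0 + s) - F 0) / s\<bar> \<le> C * n2 \<zeta>"
        using bound[OF z, of s i] s by (simp add: abs_divide divide_le_eq mult_ac)
    qed
    ultimately have "\<bar>- (LINT x|lborel. qa a x * pd i \<zeta> x)\<bar> \<le> C * n2 \<zeta>"
      by (intro tendsto_upperbound[of _ _ "at (0::real)"]) auto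
    then show ?thesis by simp
  qed
  then show ?thesis using C0 by blast
qed

end

section \<open>Normal regularity\<close>

text \<open>By Riesz, a linear functional with this property is a square-integrable function on
  \<open>G\<close>. Working with the bound instead allows sums and Lipschitz multiples without
  choosing representers.\<close>

definition bdd :: "(real^3) set \<Rightarrow> ((real^3 \<Rightarrow> real) \<Rightarrow> real) \<Rightarrow> bool" where
  "bdd G l \<longleftrightarrow> (\<exists>C\<ge>0. \<forall>\<phi>. test_function G \<phi> \<longrightarrow> \<bar>l \<phi>\<bar> \<le> C * n2 \<phi>)"

lemma bddI: "0 \<le> C \<Longrightarrow> (\<And>\<phi>. test_function G \<phi> \<Longrightarrow> \<bar>l \<phi>\<bar> \<le> C * n2 \<phi>) \<Longrightarrow> bdd G l"
  unfolding bdd_def by blast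

lemma bdd_cong: "bdd G l \<Longrightarrow> (\<And>\<phi>. test_function G \<phi> \<Longrightarrow> l' \<phi> = l \<phi>) \<Longrightarrow> bdd G l'"
  unfolding bdd_def by simp

lemma bdd_add:
  assumes "bdd G l" "bdd G k" shows "bdd G (\<lambda>\<phi>. l \<phi> + k \<phi>)"
proof -
  obtain C where C: "0 \<le> C" "\<And>\<phi>. test_function G \<phi> \<Longrightarrow> \<bar>l \<phi>\<bar> \<le> C * n2 \<phi>" using assms(1) unfolding bdd_def by blast
  obtain D where D: "0 \<le> D" "\<And>\<phi>. test_function G \<phi> \<Longrightarrow> \<bar>k \<phi>\<bar> \<le> D * n2 \<phi>" using assms(2) unfolding bdd_def by blast
  show ?thesis
  proof (rule bddI[of "C + D"])
    fix \<phi> assume "test_function G \<phi>"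
    from C(2)[OF this] D(2)[OF this] show "\<bar>l \<phi> + k \<phi>\<bar> \<le> (C + D) * n2 \<phi>" by (simp add: distrib_right)
  qed (use C D in simp)
qed

lemma bdd_cmult:
  assumes "bdd G l" shows "bdd G (\<lambda>\<phi>. c * l \<phi>)"
proof -
  obtain C where C: "0 \<le> C" "\<And>\<phi>. test_function G \<phi> \<Longrightarrow> \<bar>l \<phi>\<bar> \<le> C * n2 \<phi>" using assms unfolding bdd_def by blast
  show ?thesis
  proof (rule bddI[of "\<bar>c\<bar> * C"])
    fix \<phi> assume "test_function G \<phi>"
    from mult_left_mono[OF C(2)[OF this], of "\<bar>c\<bar>"] show "\<bar>c * l \<phi>\<bar> \<le> \<bar>c\<bar> * C * n2 \<phi>" by (simp add: abs_mult mult.assoc)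
  qed (use C in simp)
qed

lemma bdd_diff: "bdd G l \<Longrightarrow> bdd G k \<Longrightarrow> bdd G (\<lambda>\<phi>. l \<phi> - k \<phi>)"
  using bdd_add[OF _ bdd_cmult[of G k "-1"], of l] by simp

lemma bdd_sum:
  assumes "\<And>i. i \<in> I \<Longrightarrow> bdd G (l i)" shows "bdd G (\<lambda>\<phi>. \<Sum>i\<in>I. l i \<phi>)"
  using assms
proof (induction I rule: infinite_finite_induct)
  case (insert i I)
  then show ?case by (simp add: bdd_add)
qed (auto intro: bddI[of 0])

lemma bdd_mono: "bdd G l \<Longrightarrow> H \<subseteq> G \<Longrightarrow> bdd H l"
  unfolding bdd_def using test_function_mono by blast

lemma bdd_CS:
  assumes "sqloc w" "G \<subseteq> cball 0 R" shows "bdd G (\<lambda>\<phi>. LINT x|lborel. w x * \<phi> x)"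
proof (rule bddI[of "n2 (\<lambda>x. indicator (cball 0 R) x * w x)"])
  fix \<phi> assume t: "test_function G \<phi>"
  have s: "sq_int lborel (\<lambda>x. indicator (cball 0 R) x * w x)" using assms by (simp add: sqloc_def)
  have "w x * \<phi> x = (indicator (cball 0 R) x * w x) * \<phi> x" for x
  proof (cases "norm x \<le> R")
    case False
    then have "x \<notin> G" using assms(2) by auto
    then show ?thesis by (simp add: test_function_outside[OF t])
  qed simp
  then show "\<bar>LINT x|lborel. w x * \<phi> x\<bar> \<le> n2 (\<lambda>x. indicator (cball 0 R) x * w x) * n2 \<phi>"
    using CS_tf[OF s t] by (simp only:)
qed simp

lemma lipschitz_continuous:
  assumes "\<And>x y. \<bar>a x - a y\<bar> \<le> La * norm (x - y :: real^3)" shows "continuous_on A (a :: _ \<Rightarrow> real)"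
proof (rule continuous_on_subset[OF _ subset_UNIV])
  have "0 \<le> La" using order_trans[OF abs_ge_zero assms[of "axis 1 1" 0]] by simp
  then have "La-lipschitz_on UNIV a" by (intro lipschitz_onI) (simp_all add: dist_norm assms)
  then show "continuous_on UNIV a" by (rule lipschitz_on_continuous_on)
qed

text \<open>Multiplication by a Lipschitz function preserves weak differentiability; mollifying the
  multiplier avoids Rademacher's theorem.\<close>

lemma lipschitz_mult_bound:
  assumes w: "sqloc w" and G: "G \<subseteq> cball 0 R"
    and a: "\<And>x y. \<bar>a x - a y\<bar> \<le> La * norm (x - y)"
    and m: "continuous_on UNIV m"
    and b: "bdd G (\<lambda>\<phi>. LINT x|lborel. w x * (dd e \<phi> x + m x * dd e' \<phi> x))"
  shows "bdd G (\<lambda>\<phi>. LINT x|lborel. a x * w x * (dd e \<phi> x + m x * dd e' \<phi> x))"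
proof -
  obtain C where C: "0 \<le> C" "\<And>\<phi>. test_function G \<phi> \<Longrightarrow>
      \<bar>LINT x|lborel. w x * (dd e \<phi> x + m x * dd e' \<phi> x)\<bar> \<le> C * n2 \<phi>" using b unfolding bdd_def by blast
  have La0: "0 \<le> La" using order_trans[OF abs_ge_zero a[of "axis 1 1" 0]] by simp
  have ca: "continuous_on UNIV a" by (rule lipschitz_continuous[OF a])
  have wl: "lloc w" by (rule sqloc_lloc[OF w])
  have "compact (a ` cball 0 R)" "compact (m ` cball 0 R)"
    by (intro compact_continuous_image continuous_on_subset[OF ca] continuous_on_subset[OF m]; simp)+
  note cp = this[THEN compact_imp_bounded]
  obtain Ka where Ka: "0 < Ka" "\<forall>y\<in>a ` cball 0 R. norm y \<le> Ka" using cp(1) unfolding bounded_pos by (elim exE conjE)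
  obtain Km where Km: "0 < Km" "\<forall>y\<in>m ` cball 0 R. norm y \<le> Km" using cp(2) unfolding bounded_pos by (elim exE conjE)
  define D where "D = La * norm e + Km * (La * norm e')"
  define W where "W = n2 (\<lambda>x. indicator (cball 0 R) x * w x)"
  have sW: "sq_int lborel (\<lambda>x. indicator (cball 0 R) x * w x)" using w by (simp add: sqloc_def)
  \<comment> \<open>Since \<open>en n \<le> 1\<close>, the mollified multipliers are bounded by
    \<open>Ka + La\<close> on \<open>G\<close>; \<open>D\<close> bounds their derivatives there, and
    \<open>W\<close> pairs with the term in which the derivative falls on the multiplier.\<close>
  define N where "N = C * (Ka + La) + W * D"
  have D0: "0 \<le> D" using La0 Km by (simp add: D_def)
  have N0: "0 \<le> N" using C La0 Ka D0 by (simp add: N_def W_def)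
  define T where "T \<phi> x = dd e \<phi> x + m x * dd e' \<phi> x" for \<phi> x
  have Tcc: "cc (T \<phi>)" if "test_function G \<phi>" for \<phi>
    unfolding T_def[abs_def] by (intro cc_add cc_mult m cc_test[OF test_function_dd[OF that]])
  define en where "en n = inverse (real (Suc n))" for n
  have en: "0 < en n" "en n \<le> 1" "en \<longlonglongrightarrow> 0" for n using en_props unfolding en_def[abs_def] by auto
  show ?thesis
  proof (rule bddI[OF N0])
    fix \<phi> assume t: "test_function G \<phi>"
    have sm: "smooth \<phi>" by (rule test_function_smooth[OF t])
    define an where "an n = cv (en n) a" for n
    have san: "smooth (an n)" for n unfolding an_def by (intro cv_smooth en lloc_continuous ca)
    have anb: "\<bar>an n x - a x\<bar> \<le> La * en n" for n x
      unfolding an_def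
    proof (rule cv_bound[OF en(1) lloc_continuous[OF ca]])
      fix y assume "norm (x - y) < en n"
      then show "\<bar>a y - a x\<bar> \<le> La * en n"
        using a[of y x] mult_left_mono[OF less_imp_le La0, of "norm (x - y)" "en n"] by (simp add: norm_minus_commute)
    qed
    have andd: "\<bar>dd h (an n) x\<bar> \<le> La * norm h" for h n x
      unfolding an_def by (rule cv_lipschitz_dd[OF en(1) a ca])
    have est: "\<bar>LINT x|lborel. w x * (an n x * T \<phi> x)\<bar> \<le> N * n2 \<phi>" for n
    proof -
      have t1: "test_function G (\<lambda>x. an n x * \<phi> x)" by (rule test_function_mult[OF san t])
      have ct: "cc (\<lambda>x. T (an n) x * \<phi> x)"
        unfolding T_def by (intro cc_mult cc_test[OF t] continuous_intros m smooth_continuous smooth_dd san)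
      have e: "an n x * T \<phi> x = T (\<lambda>x. an n x * \<phi> x) x - T (an n) x * \<phi> x" for x
        unfolding T_def dd_mult_smooth[OF san sm] by (simp add: algebra_simps)
      have "(LINT x|lborel. w x * (an n x * T \<phi> x))
          = (LINT x|lborel. w x * T (\<lambda>x. an n x * \<phi> x) x) - (LINT x|lborel. w x * (T (an n) x * \<phi> x))"
        unfolding e using lloc_cc_integrable[OF wl Tcc[OF t1]] lloc_cc_integrable[OF wl ct] by (simp add: right_diff_distrib)
      moreover have "\<bar>LINT x|lborel. w x * T (\<lambda>x. an n x * \<phi> x) x\<bar> \<le> C * ((Ka + La) * n2 \<phi>)"
      proof -
        have "n2 (\<lambda>x. an n x * \<phi> x) \<le> (Ka + La) * n2 \<phi>"
        proof (rule n2_le_mult[OF t tf_borel[OF t1]])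
          fix x show "\<bar>an n x * \<phi> x\<bar> \<le> (Ka + La) * \<bar>\<phi> x\<bar>"
          proof (cases "x \<in> G")
            case True
            then have "\<bar>a x\<bar> \<le> Ka" using Ka(2) G by auto
            moreover have "La * en n \<le> La" using en(2) La0 by (intro mult_left_le) auto
            ultimately have "\<bar>an n x\<bar> \<le> Ka + La" using anb[of n x] by linarith
            then show ?thesis unfolding abs_mult by (intro mult_right_mono) auto
          qed (simp add: test_function_outside[OF t])
        qed
        with C(2)[OF t1] mult_left_mono[OF this C(1)] show ?thesis unfolding T_def by linarith
      qed
      moreover have "\<bar>LINT x|lborel. w x * (T (an n) x * \<phi> x)\<bar> \<le> W * (D * n2 \<phi>)"
      proof -
        have "w x * (T (an n) x * \<phi> x) = (indicator (cball 0 R) x * w x) * (T (an n) x * \<phi> x)" for x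
        proof (cases "norm x \<le> R")
          case False
          then have "x \<notin> G" using G by auto
          then show ?thesis by (simp add: test_function_outside[OF t])
        qed simp
        then have "\<bar>LINT x|lborel. w x * (T (an n) x * \<phi> x)\<bar> = \<bar>LINT x|lborel. (indicator (cball 0 R) x * w x) * (T (an n) x * \<phi> x)\<bar>"
          by (simp only:)
        also have "\<dots> \<le> W * n2 (\<lambda>x. T (an n) x * \<phi> x)"
          unfolding W_def by (rule l2n_CS[OF sW cc_sq_int[OF ct]])
        also have "n2 (\<lambda>x. T (an n) x * \<phi> x) \<le> D * n2 \<phi>"
        proof (rule n2_le_mult[OF t cc_borel[OF ct]])
          fix x show "\<bar>T (an n) x * \<phi> x\<bar> \<le> D * \<bar>\<phi> x\<bar>"
          proof (cases "x \<in> G")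
            case True
            then have "\<bar>m x\<bar> \<le> Km" using Km(2) G by auto
            then have "\<bar>m x * dd e' (an n) x\<bar> \<le> Km * (La * norm e')"
              unfolding abs_mult by (intro mult_mono andd) (use Km in auto)
            then have "\<bar>T (an n) x\<bar> \<le> D" using andd[of e n x] unfolding T_def D_def by linarith
            then show ?thesis unfolding abs_mult by (intro mult_right_mono) auto
          qed (simp add: test_function_outside[OF t])
        qed
        then have "W * n2 (\<lambda>x. T (an n) x * \<phi> x) \<le> W * (D * n2 \<phi>)" by (intro mult_left_mono) (simp_all add: W_def)
        finally show ?thesis .
      qed
      ultimately have "\<bar>LINT x|lborel. w x * (an n x * T \<phi> x)\<bar> \<le> C * ((Ka + La) * n2 \<phi>) + W * (D * n2 \<phi>)" by linarith
      then show ?thesis by (simp add: N_def algebra_simps)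
    qed
    obtain S where S: "0 < S" "continuous_on UNIV (T \<phi>)" "\<And>x. S < norm x \<Longrightarrow> T \<phi> x = 0"
      using Tcc[OF t] by (rule ccE) (rule that)
    obtain B where B: "0 < B" "\<And>x. \<bar>T \<phi> x\<bar> \<le> B" using Tcc[OF t] by (rule cc_bounded) (rule that)
    have "(\<lambda>n. LINT x|lborel. w x * (an n x * T \<phi> x)) \<longlonglongrightarrow> (LINT x|lborel. w x * (a x * T \<phi> x))"
    proof (rule pairing_tendsto[OF wl, where R=S])
      show "cc (\<lambda>x. an n x * T \<phi> x)" for n by (intro cc_mult smooth_continuous san Tcc t)
      show "cc (\<lambda>x. a x * T \<phi> x)" by (intro cc_mult ca Tcc t)
      fix b :: real assume b: "0 < b"
      have "(\<lambda>n. La * en n * B) \<longlonglongrightarrow> La * 0 * B" by (intro tendsto_intros en)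
      then have "\<forall>\<^sub>F n in sequentially. La * en n * B < b" using b by (intro order_tendstoD(2)) auto
      then show "\<forall>\<^sub>F n in sequentially. \<forall>x. \<bar>an n x * T \<phi> x - a x * T \<phi> x\<bar> \<le> b"
      proof eventually_elim
        case (elim n)
        show ?case
        proof
          fix x
          have "\<bar>an n x * T \<phi> x - a x * T \<phi> x\<bar> = \<bar>an n x - a x\<bar> * \<bar>T \<phi> x\<bar>"
            by (simp add: left_diff_distrib[symmetric] abs_mult)
          also have "\<dots> \<le> La * en n * B" using en(1)[of n] La0 by (intro mult_mono anb B) auto
          finally show "\<bar>an n x * T \<phi> x - a x * T \<phi> x\<bar> \<le> b" using elim by simp
        qed
      qed
    qed (use S in auto)
    from abs_LIMSEQ_le[OF this est]
    show "\<bar>LINT x|lborel. a x * w x * (dd e \<phi> x + m x * dd e' \<phi> x)\<bar> \<le> N * n2 \<phi>"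
      by (simp add: T_def mult_ac)
  qed
qed

lemma lipschitz_mult_bound_dd:
  assumes "sqloc w" "G \<subseteq> cball 0 R" "\<And>x y. \<bar>a x - a y\<bar> \<le> La * norm (x - y)"
    and "bdd G (\<lambda>\<phi>. LINT x|lborel. w x * dd e \<phi> x)"
  shows "bdd G (\<lambda>\<phi>. LINT x|lborel. a x * w x * dd e \<phi> x)"
  using lipschitz_mult_bound[OF assms(1-3), of "\<lambda>x. 0" e 0] assms(4) by simp

text \<open>It makes 1 / (1 + |DP|^2) a Lipschitz multiplier, although 1 + |DP|^2 itself may grow
  quadratically. The point is that n + m is at most twice the product of the denominators.\<close>

lemma inverse_one_plus_sq_lipschitz:
  fixes n m :: real
  assumes "0 \<le> n" "0 \<le> m"
  shows "\<bar>1 / (1 + n\<^sup>2) - 1 / (1 + m\<^sup>2)\<bar> \<le> 2 * \<bar>n - m\<bar>"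
proof -
  have p: "0 < 1 + n\<^sup>2" "0 < 1 + m\<^sup>2" by (simp_all add: add_pos_nonneg)
  have e: "1 / (1 + n\<^sup>2) - 1 / (1 + m\<^sup>2) = (m - n) * ((m + n) / ((1 + n\<^sup>2) * (1 + m\<^sup>2)))"
    using p by (simp add: divide_simps) (simp add: power2_eq_square algebra_simps)
  have q: "t \<le> 1 + t\<^sup>2" for t :: real
  proof -
    have "0 \<le> (t - 1/2)\<^sup>2" by simp
    then show ?thesis by (simp add: power2_eq_square algebra_simps)
  qed
  have "m \<le> (1 + n\<^sup>2) * (1 + m\<^sup>2)" "n \<le> (1 + n\<^sup>2) * (1 + m\<^sup>2)"
  proof -
    have "1 * (1 + m\<^sup>2) \<le> (1 + n\<^sup>2) * (1 + m\<^sup>2)"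
      using p by (intro mult_right_mono) auto
    with q[of m] show "m \<le> (1 + n\<^sup>2) * (1 + m\<^sup>2)" by (metis mult_1 order_trans)
    have "(1 + n\<^sup>2) * 1 \<le> (1 + n\<^sup>2) * (1 + m\<^sup>2)"
      using p by (intro mult_left_mono) auto
    with q[of n] show "n \<le> (1 + n\<^sup>2) * (1 + m\<^sup>2)" by (metis mult_1_right order_trans)
  qed
  then have "(m + n) / ((1 + n\<^sup>2) * (1 + m\<^sup>2)) \<le> 2"
    using p by (subst pos_divide_le_eq) auto
  then have A: "\<bar>m - n\<bar> * ((m + n) / ((1 + n\<^sup>2) * (1 + m\<^sup>2))) \<le> \<bar>m - n\<bar> * 2"
    by (intro mult_left_mono) auto
  have B: "0 \<le> (m + n) / ((1 + n\<^sup>2) * (1 + m\<^sup>2))" using assms p by simp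
  show ?thesis unfolding e abs_mult abs_of_nonneg[OF B] using A by (simp only: abs_minus_commute[of n m] mult.commute[of 2])
qed

section \<open>All second derivatives from the tangential ones and the equation\<close>

context potential_flow
begin

text \<open>A derivative of \<open>u\<close> along \<open>e1\<close> or \<open>e2\<close> is the
  tangential one minus \<open>DP \<bullet> e\<close> times the vertical one. Inserted into the
  equation, this leaves 1 + |DP|^2 times the second vertical derivative equal to square-integrable
  terms. Division by this Lipschitz-invertible factor gives the vertical derivative, and the frame
  gives the others.\<close>

lemma normal_regularity:
  assumes G: "G \<subseteq> cball 0 R"
    and frame: "\<And>i j. e1 $ i * e1 $ j + e2 $ i * e2 $ j + e3 $ i * e3 $ j = (if i = j then 1 else 0)"
    and F: "sqloc F"
    and eq: "\<And>\<phi>. test_function G \<phi> \<Longrightarrow> (LINT x|lborel. u x * lap \<phi> x) = (LINT x|lborel. F x * \<phi> x)"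
    and q: "\<And>i. bdd G (\<lambda>\<phi>. LINT x|lborel. qa e1 x * pd i \<phi> x)" "\<And>i. bdd G (\<lambda>\<phi>. LINT x|lborel. qa e2 x * pd i \<phi> x)"
  shows "bdd G (\<lambda>\<phi>. LINT x|lborel. p j x * pd i \<phi> x)"
proof -
  define k where "k e x = DP x \<bullet> e" for e x
  have kc: "continuous_on UNIV (k e)" for e unfolding k_def[abs_def] by (rule DP_coord_continuous)
  have klip: "\<bar>k e x - k e y\<bar> \<le> (L * norm e) * norm (x - y)" for e x y
  proof -
    have "\<bar>k e x - k e y\<bar> \<le> norm (DP x - DP y) * norm e"
      unfolding k_def inner_diff_left[symmetric] by (rule Cauchy_Schwarz_ineq2)
    also have "\<dots> \<le> L * norm (x - y) * norm e" by (intro mult_right_mono DP_lip) simp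
    finally show ?thesis by (simp add: mult_ac)
  qed
  have int: "integrable lborel (\<lambda>x. w x * dd h \<phi> x)" if "lloc w" "test_function G \<phi>" for w h \<phi>
    by (rule lloc_cc_integrable[OF that(1) cc_test[OF test_function_dd[OF that(2)]]])
  have intt: "integrable lborel (\<lambda>x. w x * tang a \<phi> x)" if "lloc w" "test_function G \<phi>" for w a \<phi>
    by (rule lloc_cc_integrable[OF that(1) tang_cc[OF that(2)]])
  have kw: "lloc (\<lambda>x. k e x * w x)" if "lloc w" for e w by (rule lloc_mult_continuous[OF that kc])
  have qdd: "bdd G (\<lambda>\<phi>. LINT x|lborel. qa e x * dd h \<phi> x)" if "e = e1 \<or> e = e2" for e h
  proof (rule bdd_cong[OF bdd_sum[OF bdd_cmult]])
    show "bdd G (\<lambda>\<phi>. LINT x|lborel. qa e x * pd i \<phi> x)" for i using q that by auto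
    fix \<phi> assume t: "test_function G \<phi>"
    have "integrable lborel (\<lambda>x. qa e x * pd i \<phi> x)" for i
      by (rule lloc_cc_integrable[OF qa_lloc cc_test[OF test_function_pd[OF t]]])
    then show "(LINT x|lborel. qa e x * dd h \<phi> x) = (\<Sum>i\<in>UNIV. h $ i * (LINT x|lborel. qa e x * pd i \<phi> x))"
      by (simp add: dd_def sum_distrib_left mult.left_commute[of _ "h $ _"])
  qed
  \<comment> \<open>By symmetry of second derivatives, \<open>tang e\<close> of the vertical
    derivative is the vertical derivative of \<open>qa e\<close>, the coefficient being constant
    along \<open>e3\<close>; multiplication by the Lipschitz function \<open>k e\<close> keeps the
    bound.\<close>
  have p3k: "bdd G (\<lambda>\<phi>. LINT x|lborel. k e x * pe e3 x * tang e \<phi> x)" if e: "e = e1 \<or> e = e2" for e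
    unfolding tang_def
  proof (rule lipschitz_mult_bound[OF pe_sqloc G klip DP_coord_continuous(1)])
    show "bdd G (\<lambda>\<phi>. LINT x|lborel. pe e3 x * (dd e \<phi> x + DP x \<bullet> e * dd e3 \<phi> x))"
    proof (rule bdd_cong[OF qdd[OF e, of e3]])
      fix \<phi> assume t: "test_function G \<phi>"
      have "(LINT x|lborel. pe e3 x * (dd e \<phi> x + DP x \<bullet> e * dd e3 \<phi> x))
          = (LINT x|lborel. pe e3 x * dd e \<phi> x + (k e x * pe e3 x) * dd e3 \<phi> x)"
        by (simp add: k_def algebra_simps)
      also have "\<dots> = (LINT x|lborel. pe e x * dd e3 \<phi> x) + (LINT x|lborel. (k e x * pe e3 x) * dd e3 \<phi> x)"
        using int[OF pe_lloc t] int[OF kw[OF pe_lloc] t] pe_symmetric[OF test_function_UNIV[OF t], of e3 e] by simp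
      also have "\<dots> = (LINT x|lborel. qa e x * dd e3 \<phi> x)"
        using int[OF pe_lloc t] int[OF kw[OF pe_lloc] t] by (simp add: qa_def k_def distrib_right)
      finally show "(LINT x|lborel. pe e3 x * (dd e \<phi> x + DP x \<bullet> e * dd e3 \<phi> x)) = (LINT x|lborel. qa e x * dd e3 \<phi> x)" .
    qed
  qed
  define J2 where "J2 x = 1 + (norm (DP x))\<^sup>2" for x
  have J2p: "0 < J2 x" for x unfolding J2_def by (simp add: add_pos_nonneg)
  have J2c: "continuous_on UNIV J2" unfolding J2_def[abs_def] by (intro continuous_intros DP_continuous)
  \<comment> \<open>Parseval's identity; \<open>frame\<close> states that the projections onto the
    three vectors add up to the identity.\<close>
  have pr: "(\<Sum>i\<in>UNIV. v $ i * w $ i) = (v \<bullet> e1) * (w \<bullet> e1) + (v \<bullet> e2) * (w \<bullet> e2) + (v \<bullet> e3) * (w \<bullet> e3)" for v w :: "real^3"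
  proof -
    have "(v \<bullet> e1) * (w \<bullet> e1) + (v \<bullet> e2) * (w \<bullet> e2) + (v \<bullet> e3) * (w \<bullet> e3)
       = (\<Sum>i\<in>UNIV. \<Sum>j\<in>UNIV. v $ i * w $ j * (e1 $ i * e1 $ j + e2 $ i * e2 $ j + e3 $ i * e3 $ j))"
      by (simp add: inner_vec_def sum_product sum.distrib[symmetric] algebra_simps)
    also have "\<dots> = (\<Sum>i\<in>UNIV. v $ i * w $ i)"
      by (simp add: frame if_distrib[of "\<lambda>u. _ * u"] cong: if_cong)
    finally show ?thesis by simp
  qed
  have J2k: "J2 x = 1 + (k e1 x)\<^sup>2 + (k e2 x)\<^sup>2" for x
  proof -
    have n: "(norm (DP x))\<^sup>2 = (\<Sum>i\<in>UNIV. DP x $ i * DP x $ i)"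
      unfolding norm_sq_vec by (simp only: power2_eq_square)
    show ?thesis unfolding J2_def n pr k_def using DP_perp[of x] by (simp add: power2_eq_square)
  qed
  have fr: "(\<Sum>i\<in>UNIV. p i x * pd i \<phi> x) = pe e1 x * dd e1 \<phi> x + pe e2 x * dd e2 \<phi> x + pe e3 x * dd e3 \<phi> x" for \<phi> x
  proof -
    have "pe e x = (\<chi> i. p i x) \<bullet> e" "dd e \<phi> x = (\<chi> i. pd i \<phi> x) \<bullet> e" for e
      by (simp_all add: pe_def dd_def inner_vec_def mult.commute)
    then show ?thesis using pr[of "\<chi> i. p i x" "\<chi> i. pd i \<phi> x"] by simp
  qed
  have Jw: "bdd G (\<lambda>\<phi>. LINT x|lborel. (J2 x * pe e3 x) * dd e3 \<phi> x)"
  proof (rule bdd_cong)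
    show "bdd G (\<lambda>\<phi>. (-1) * (LINT x|lborel. F x * \<phi> x)
        - (LINT x|lborel. qa e1 x * dd e1 \<phi> x) - (LINT x|lborel. qa e2 x * dd e2 \<phi> x)
        + (LINT x|lborel. k e1 x * pe e3 x * tang e1 \<phi> x) + (LINT x|lborel. k e2 x * pe e3 x * tang e2 \<phi> x))"
      by (intro bdd_add bdd_diff bdd_cmult bdd_CS[OF F G] qdd p3k) auto
    fix \<phi> assume t: "test_function G \<phi>"
    \<comment> \<open>With \<open>pe e\<close> replaced by \<open>qa e\<close> minus
      \<open>k e\<close> times \<open>pe e3\<close>, and \<open>dd e\<close> by
      \<open>tang e\<close> minus \<open>k e\<close> times \<open>dd e3\<close>, the purely vertical
      terms add up to the factor \<open>J2\<close>.\<close>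
    have pt: "J2 x * pe e3 x * dd e3 \<phi> x = (\<Sum>i\<in>UNIV. p i x * pd i \<phi> x)
       - qa e1 x * dd e1 \<phi> x - qa e2 x * dd e2 \<phi> x + k e1 x * pe e3 x * tang e1 \<phi> x + k e2 x * pe e3 x * tang e2 \<phi> x" for x
      unfolding fr by (simp add: J2k qa_def tang_def k_def power2_eq_square algebra_simps)
    have ip: "integrable lborel (\<lambda>x. p i x * pd i \<phi> x)" for i
      by (rule lloc_cc_integrable[OF p_lloc cc_test[OF test_function_pd[OF t]]])
    have "(LINT x|lborel. (\<Sum>i\<in>UNIV. p i x * pd i \<phi> x)) = - (LINT x|lborel. F x * \<phi> x)"
      using eq[OF t] u_lap_p[OF test_function_UNIV[OF t]] ip by simp
    then show "(LINT x|lborel. (J2 x * pe e3 x) * dd e3 \<phi> x) = (-1) * (LINT x|lborel. F x * \<phi> x)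
        - (LINT x|lborel. qa e1 x * dd e1 \<phi> x) - (LINT x|lborel. qa e2 x * dd e2 \<phi> x)
        + (LINT x|lborel. k e1 x * pe e3 x * tang e1 \<phi> x) + (LINT x|lborel. k e2 x * pe e3 x * tang e2 \<phi> x)"
      unfolding pt using ip int[OF qa_lloc t] intt[OF kw[OF pe_lloc] t] by simp
  qed
  have b33: "bdd G (\<lambda>\<phi>. LINT x|lborel. pe e3 x * dd e3 \<phi> x)"
  proof -
    have "bdd G (\<lambda>\<phi>. LINT x|lborel. (1 / J2 x) * (J2 x * pe e3 x) * dd e3 \<phi> x)"
    proof (rule lipschitz_mult_bound_dd[OF _ G _ Jw])
      show "sqloc (\<lambda>x. J2 x * pe e3 x)" by (rule sqloc_mult_continuous[OF pe_sqloc J2c])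
      fix x y
      have "\<bar>1 / J2 x - 1 / J2 y\<bar> \<le> 2 * \<bar>norm (DP x) - norm (DP y)\<bar>"
        unfolding J2_def by (rule inverse_one_plus_sq_lipschitz) simp_all
      also have "\<dots> \<le> 2 * norm (DP x - DP y)" using norm_triangle_ineq3[of "DP x" "DP y"] by simp
      also have "\<dots> \<le> 2 * L * norm (x - y)" using DP_lip[of x y] by simp
      finally show "\<bar>1 / J2 x - 1 / J2 y\<bar> \<le> 2 * L * norm (x - y)" .
    qed
    moreover have "J2 x \<noteq> 0" for x using J2p[of x] by simp
    ultimately show ?thesis by simp
  qed
  have split: "bdd G (\<lambda>\<phi>. LINT x|lborel. pe e x * dd h \<phi> x)"
    if e: "e = e1 \<or> e = e2" and b: "bdd G (\<lambda>\<phi>. LINT x|lborel. pe e3 x * dd h \<phi> x)" for e h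
  proof (rule bdd_cong[OF bdd_diff[OF qdd[OF e, of h] lipschitz_mult_bound_dd[OF pe_sqloc G klip b, of e]]])
    fix \<phi> assume t: "test_function G \<phi>"
    show "(LINT x|lborel. pe e x * dd h \<phi> x) = (LINT x|lborel. qa e x * dd h \<phi> x) - (LINT x|lborel. k e x * pe e3 x * dd h \<phi> x)"
      using int[OF pe_lloc t] int[OF kw[OF pe_lloc] t] by (simp add: qa_def k_def distrib_right)
  qed
  \<comment> \<open>Symmetry of second derivatives exchanges the vertical and the horizontal
    direction.\<close>
  have b3: "bdd G (\<lambda>\<phi>. LINT x|lborel. pe e3 x * dd e \<phi> x)" if e: "e = e1 \<or> e = e2" for e
    by (rule bdd_cong[OF split[OF e b33]]) (rule pe_symmetric[OF test_function_UNIV])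
  have all: "bdd G (\<lambda>\<phi>. LINT x|lborel. pe e x * dd h \<phi> x)" if "e \<in> {e1,e2,e3}" "h \<in> {e1,e2,e3}" for e h
    using that split[OF _ b33] split[OF _ b3] b3 b33 by auto
  define E where "E n = (if n = (0::nat) then e1 else if n = 1 then e2 else e3)" for n
  have E: "E n \<in> {e1,e2,e3}" for n by (simp add: E_def)
  have pj: "p j x = (\<Sum>n\<in>{0,1,2}. E n $ j * pe (E n) x)" for x
    using pr[of "\<chi> i. p i x" "axis j 1"]
    by (simp add: E_def pe_def inner_vec_def axis_def mult.commute if_distrib[of "\<lambda>u. u * _"] if_distrib[of "\<lambda>u. _ * u"] cong: if_cong)
  have pi: "pd i \<phi> x = (\<Sum>n\<in>{0,1,2}. E n $ i * dd (E n) \<phi> x)" for \<phi> x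
    using pr[of "\<chi> i. pd i \<phi> x" "axis i 1"]
    by (simp add: E_def dd_def inner_vec_def axis_def mult.commute if_distrib[of "\<lambda>u. u * _"] if_distrib[of "\<lambda>u. _ * u"] cong: if_cong)
  show ?thesis
  proof (rule bdd_cong)
    show "bdd G (\<lambda>\<phi>. \<Sum>n\<in>{0,1,2}. \<Sum>l\<in>{0,1,2}. (E n $ j * E l $ i) * (LINT x|lborel. pe (E n) x * dd (E l) \<phi> x))"
      by (intro bdd_sum bdd_cmult all E)
    fix \<phi> assume t: "test_function G \<phi>"
    have "p j x * pd i \<phi> x = (\<Sum>n\<in>{0,1,2}. \<Sum>l\<in>{0,1,2}. (E n $ j * E l $ i) * (pe (E n) x * dd (E l) \<phi> x))" for x
      unfolding pj pi sum_product by (intro sum.cong refl) (simp add: mult_ac)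
    then have "(LINT x|lborel. p j x * pd i \<phi> x)
        = (LINT x|lborel. (\<Sum>n\<in>{0,1,2}. \<Sum>l\<in>{0,1,2}. (E n $ j * E l $ i) * (pe (E n) x * dd (E l) \<phi> x)))" by (simp only:)
    also have "\<dots> = (\<Sum>n\<in>{0,1,2}. \<Sum>l\<in>{0,1,2}. (E n $ j * E l $ i) * (LINT x|lborel. pe (E n) x * dd (E l) \<phi> x))"
      by (subst Bochner_Integration.integral_sum, (intro Bochner_Integration.integrable_sum integrable_mult_right int pe_lloc t))
        (intro sum.cong refl, subst Bochner_Integration.integral_sum, (intro integrable_mult_right int pe_lloc t), simp)
    finally show "(LINT x|lborel. p j x * pd i \<phi> x)
        = (\<Sum>n\<in>{0,1,2}. \<Sum>l\<in>{0,1,2}. (E n $ j * E l $ i) * (LINT x|lborel. pe (E n) x * dd (E l) \<phi> x))" .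
  qed
qed

end

section \<open>Increments along the flow of a function with a trace\<close>

context graph_flow
begin

definition jac :: "real^3 \<Rightarrow> real" where
  "jac x = sqrt (1 + (norm (DP x))\<^sup>2)"

lemma jac_continuous: "continuous_on A jac"
  unfolding jac_def[abs_def] by (intro continuous_intros DP_continuous)

lemma jac_flow: "jac (flow a s x) = jac (x + s *\<^sub>R a)"
  by (simp add: jac_def DP_flow)

text \<open>sqrt (1 + n^2) is the norm of the plane vector (1, n), so the reverse triangle
  inequality applies, in the plane and again for the norm of \<open>DP\<close>.\<close>

lemma jac_lip: "\<bar>jac x - jac y\<bar> \<le> L * norm (x - y)"
proof -
  have s: "\<bar>sqrt (1 + n\<^sup>2) - sqrt (1 + m\<^sup>2)\<bar> \<le> \<bar>n - m\<bar>" for n m :: real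
  proof -
    have "norm (vector [1, n] :: real^2) = sqrt (1 + n\<^sup>2)" for n :: real
      by (simp add: norm_vec_def L2_set_def sum_2)
    moreover have "norm (vector [1, n] - vector [1, m] :: real^2) = \<bar>n - m\<bar>"
      by (simp add: norm_vec_def L2_set_def sum_2)
    ultimately show ?thesis using norm_triangle_ineq3[of "vector [1, n] :: real^2" "vector [1, m]"] by simp
  qed
  have "\<bar>jac x - jac y\<bar> \<le> \<bar>norm (DP x) - norm (DP y)\<bar>" unfolding jac_def by (rule s)
  also have "\<dots> \<le> norm (DP x - DP y)" by (rule norm_triangle_ineq3)
  also note DP_lip
  finally show ?thesis .
qed

lemma bounded_on_ball:
  assumes "continuous_on UNIV (f :: real^3 \<Rightarrow> real)" obtains B where "0 < B" "\<And>x. x \<in> cball x0 r \<Longrightarrow> \<bar>f x\<bar> \<le> B"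
proof -
  have "compact (f ` cball x0 r)" by (intro compact_continuous_image continuous_on_subset[OF assms]) auto
  from compact_imp_bounded[OF this] obtain B where "0 < B" "\<forall>y\<in>f ` cball x0 r. norm y \<le> B"
    unfolding bounded_pos by (elim exE conjE)
  then show ?thesis by (intro that[of B]) auto
qed

text \<open>Inside the ball the flow does not leave \<open>\<Omega>\<close>, so the increment of \<open>q\<close> can be moved to the
  approximants \<open>V k\<close>, whose increments are controlled by their gradients on \<open>\<Omega>\<close>.\<close>

lemma trace_flow_bound:
  assumes r: "0 < r1" "r1 < r" and O: "open \<Omega>"
    and side: "\<And>x s. x \<in> ball x0 r \<Longrightarrow> flow a s x \<in> ball x0 r \<Longrightarrow> flow a s x \<in> \<Omega> \<longleftrightarrow> x \<in> \<Omega>"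
    and v: "sq_int lborel v"
    and V: "\<And>k::nat. tf (V k)" "(\<lambda>k. n2 (\<lambda>x. indicator \<Omega> x * (V k x - v x))) \<longlonglongrightarrow> 0"
      "\<And>k. n2 (\<lambda>x. indicator \<Omega> x * V k x) \<le> C0" "\<And>k i. n2 (\<lambda>x. indicator \<Omega> x * pd i (V k) x) \<le> C1"
    and g: "g = (\<lambda>x. indicator (\<Omega> \<inter> ball x0 r) x * (jac x * v x))"
  shows "\<exists>C\<ge>0. \<exists>s0>0. \<forall>q s. test_function (ball x0 r1) q \<longrightarrow> \<bar>s\<bar> \<le> s0 \<longrightarrow>
      \<bar>LINT x|lborel. g x * (q (flow a s x) - q x)\<bar> \<le> C * \<bar>s\<bar> * n2 q"
proof -
  define r2 where "r2 = (r1 + r) / 2"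
  have r2: "r1 < r2" "r2 < r" using r by (simp_all add: r2_def)
  obtain s0 where s0: "0 < s0" "s0 \<le> 1" "\<And>s x. \<bar>s\<bar> \<le> s0 \<Longrightarrow> flow a s x \<in> cball x0 r1 \<Longrightarrow> x \<in> cball x0 r2"
    by (rule flow_small[OF r2(1), of a x0]) (rule that)
  have s0': "flow a s y \<in> cball x0 r2" if "\<bar>s\<bar> \<le> s0" "y \<in> cball x0 r1" for s y
    using s0(3)[of "- s" "flow a s y"] that by (simp add: flow_inverse)
  \<comment> \<open>The radius is enlarged by the norm of \<open>a\<close> because
    \<open>jac\<close> will be evaluated at \<open>x - s *\<^sub>R a\<close> with |s| at most
    1.\<close>
  obtain KJ where KJ: "0 < KJ" "\<And>x. x \<in> cball x0 (r + norm a) \<Longrightarrow> \<bar>jac x\<bar> \<le> KJ"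
    by (rule bounded_on_ball[OF jac_continuous]) (rule that)
  obtain KD where KD: "0 < KD" "\<And>x. x \<in> cball x0 r \<Longrightarrow> \<bar>DP x \<bullet> a\<bar> \<le> KD"
  proof -
    have "continuous_on UNIV (\<lambda>x. DP x \<bullet> a)" by (intro continuous_intros DP_continuous)
    then show ?thesis by (rule bounded_on_ball) (rule that)
  qed
  have [measurable]: "\<Omega> \<in> sets borel" using O by simp
  have [measurable]: "jac \<in> borel_measurable borel" by (rule borel_measurable_continuous_onI[OF jac_continuous])
  have [measurable]: "v \<in> borel_measurable borel" using v by (auto simp: sq_int_def)
  have Vs: "smooth (V k)" for k by (rule test_function_smooth[OF V(1)])
  have [measurable]: "V k \<in> borel_measurable borel" for k by (rule smooth_borel[OF Vs])
  have C00: "0 \<le> C0" "0 \<le> C1" using order_trans[OF l2n_nonneg V(3)] order_trans[OF l2n_nonneg V(4)] by auto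
  define CT where "CT = 3 * (norm a * C1) + KD * (3 * (norm e3 * C1))"
  have CT0: "0 \<le> CT" using C00 KD by (simp add: CT_def)
  define C where "C = L * norm a * C0 + KJ * CT"
  have C0: "0 \<le> C" using C00 CT0 KJ L_nonneg by (simp add: C_def)
  have ddb: "n2 (\<lambda>x. indicator \<Omega> x * dd h (V k) x) \<le> 3 * (norm h * C1)" for h k
  proof -
    have s: "sq_int lborel (\<lambda>x. h $ i * (indicator \<Omega> x * pd i (V k) x))" for i
      by (intro sq_int_cmult sq_int_indicator tf_sq_int[OF test_function_pd[OF V(1)]]) simp
    have "(\<lambda>x. indicator \<Omega> x * dd h (V k) x) = (\<lambda>x. \<Sum>i\<in>UNIV. h $ i * (indicator \<Omega> x * pd i (V k) x))"
      by (simp add: dd_def sum_distrib_left mult_ac)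
    then have "n2 (\<lambda>x. indicator \<Omega> x * dd h (V k) x) \<le> (\<Sum>i\<in>UNIV. n2 (\<lambda>x. h $ i * (indicator \<Omega> x * pd i (V k) x)))"
      using l2n_sum_le[of UNIV lborel "\<lambda>i x. h $ i * (indicator \<Omega> x * pd i (V k) x)"] s by simp
    also have "\<dots> \<le> 3 * (norm h * C1)"
      unfolding l2n_cmult by (intro sum_UNIV3_le mult_mono component_le_norm_cart V(4)) auto
    finally show ?thesis .
  qed
  have tb: "n2 (\<lambda>x. indicator (\<Omega> \<inter> cball x0 r2) x * tang a (V k) x) \<le> CT"
    and ts: "sq_int lborel (\<lambda>x. indicator (\<Omega> \<inter> cball x0 r2) x * tang a (V k) x)" for k
  proof -
    have tm: "tang a (V k) \<in> borel_measurable borel" by (rule cc_borel[OF tang_cc[OF V(1)]])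
    have s1: "sq_int lborel (\<lambda>x. indicator \<Omega> x * dd h (V k) x)" for h
      by (intro sq_int_indicator tf_sq_int[OF test_function_dd[OF V(1)]]) simp
    let ?B = "\<lambda>x. \<bar>indicator \<Omega> x * dd a (V k) x\<bar> + KD * \<bar>indicator \<Omega> x * dd e3 (V k) x\<bar>"
    have sB: "sq_int lborel ?B" by (intro sq_int_add sq_int_cmult sq_int_abs s1)
    have le: "\<bar>indicator (\<Omega> \<inter> cball x0 r2) x * tang a (V k) x\<bar> \<le> \<bar>?B x\<bar>" for x
    proof (cases "x \<in> \<Omega> \<inter> cball x0 r2")
      case True
      then have "\<bar>DP x \<bullet> a\<bar> \<le> KD" using r2 by (intro KD) auto
      then have "\<bar>(DP x \<bullet> a) * dd e3 (V k) x\<bar> \<le> KD * \<bar>dd e3 (V k) x\<bar>" unfolding abs_mult by (intro mult_right_mono) auto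
      then have "\<bar>tang a (V k) x\<bar> \<le> \<bar>dd a (V k) x\<bar> + KD * \<bar>dd e3 (V k) x\<bar>" unfolding tang_def by linarith
      also have "\<dots> \<le> \<bar>\<bar>dd a (V k) x\<bar> + KD * \<bar>dd e3 (V k) x\<bar>\<bar>" by (rule abs_ge_self)
      finally show ?thesis using True by simp
    qed simp
    have m: "(\<lambda>x. indicator (\<Omega> \<inter> cball x0 r2) x * tang a (V k) x) \<in> borel_measurable borel"
      using tm by (intro borel_measurable_times borel_measurable_indicator) (auto intro: borel_closed)
    show "sq_int lborel (\<lambda>x. indicator (\<Omega> \<inter> cball x0 r2) x * tang a (V k) x)"
      by (rule sq_int_bound[OF sB]) (use m le in auto)
    have "n2 (\<lambda>x. indicator (\<Omega> \<inter> cball x0 r2) x * tang a (V k) x) \<le> n2 ?B"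
      by (rule l2n_mono[OF sB]) (use m le in auto)
    also have "\<dots> \<le> n2 (\<lambda>x. \<bar>indicator \<Omega> x * dd a (V k) x\<bar>) + n2 (\<lambda>x. KD * \<bar>indicator \<Omega> x * dd e3 (V k) x\<bar>)"
      by (intro l2n_triangle sq_int_cmult sq_int_abs s1)
    also have "\<dots> \<le> CT"
      unfolding l2n_cmult l2n_abs CT_def using KD by (intro add_mono mult_mono ddb) auto
    finally show "n2 (\<lambda>x. indicator (\<Omega> \<inter> cball x0 r2) x * tang a (V k) x) \<le> CT" .
  qed
  define gk where "gk k x = indicator (\<Omega> \<inter> ball x0 r) x * (jac x * V k x)" for k x
  have jb: "sq_int lborel (\<lambda>x. indicator (\<Omega> \<inter> ball x0 r) x * (jac x * w x))"
    and jn: "n2 (\<lambda>x. indicator (\<Omega> \<inter> ball x0 r) x * (jac x * w x)) \<le> KJ * n2 (\<lambda>x. indicator \<Omega> x * w x)"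
    if w: "sq_int lborel w" for w
  proof -
    have [measurable]: "w \<in> borel_measurable borel" using w by (auto simp: sq_int_def)
    have s: "sq_int lborel (\<lambda>x. KJ * (indicator \<Omega> x * w x))" by (intro sq_int_cmult sq_int_indicator w) simp
    have le: "\<bar>indicator (\<Omega> \<inter> ball x0 r) x * (jac x * w x)\<bar> \<le> \<bar>KJ * (indicator \<Omega> x * w x)\<bar>" for x
    proof (cases "x \<in> \<Omega> \<inter> ball x0 r")
      case True
      then have "dist x0 x < r" by simp
      then have "dist x0 x \<le> r + norm a" using norm_ge_zero[of a] by linarith
      then have "\<bar>jac x\<bar> \<le> \<bar>KJ\<bar>" using KJ(1) KJ(2)[of x] by simp
      then show ?thesis using True by (simp add: abs_mult mult_right_mono)
    qed simp
    have m: "(\<lambda>x. indicator (\<Omega> \<inter> ball x0 r) x * (jac x * w x)) \<in> borel_measurable borel"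
      by (intro borel_measurable_times borel_measurable_indicator) (auto intro: borel_open)
    show "sq_int lborel (\<lambda>x. indicator (\<Omega> \<inter> ball x0 r) x * (jac x * w x))"
      by (rule sq_int_bound[OF s]) (use m le in auto)
    have "n2 (\<lambda>x. indicator (\<Omega> \<inter> ball x0 r) x * (jac x * w x)) \<le> n2 (\<lambda>x. KJ * (indicator \<Omega> x * w x))"
      by (rule l2n_mono[OF s]) (use m le in auto)
    then show "n2 (\<lambda>x. indicator (\<Omega> \<inter> ball x0 r) x * (jac x * w x)) \<le> KJ * n2 (\<lambda>x. indicator \<Omega> x * w x)"
      using KJ(1) by (simp add: l2n_cmult)
  qed
  have gks: "sq_int lborel (gk k)" for k unfolding gk_def[abs_def] by (rule jb[OF tf_sq_int[OF V(1)]])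
  have gs: "sq_int lborel g" unfolding g by (rule jb[OF v])
  have gkb: "\<bar>LINT x|lborel. gk k x * (q (flow a s x) - q x)\<bar> \<le> C * \<bar>s\<bar> * n2 q"
    if t: "test_function (ball x0 r1) q" and s: "\<bar>s\<bar> \<le> s0" for k q s
  proof -
    have cq: "cc q" by (rule cc_test[OF t])
    note [measurable] = cc_borel[OF cq]
    have [measurable]: "gk k \<in> borel_measurable borel" using gks by (auto simp: sq_int_def)
    define w where "w x = indicator \<Omega> x * (jac (x - s *\<^sub>R a) * q x)" for x
    have cj: "continuous_on UNIV (\<lambda>x. jac (x - s *\<^sub>R a))"
      by (intro continuous_on_compose2[OF jac_continuous[of UNIV]] continuous_intros) auto
    have cjq: "cc (\<lambda>x. jac (x - s *\<^sub>R a) * q x)" by (rule cc_mult[OF cj cq])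
    have sw: "sq_int lborel w" unfolding w_def[abs_def] by (intro sq_int_indicator cc_sq_int cjq) simp
    have wl: "lloc w" by (rule sqloc_lloc[OF sq_int_sqloc[OF sw]])
    have nw: "n2 w \<le> KJ * n2 q"
    proof (rule n2_le_mult[OF t])
      show "w \<in> borel_measurable borel" using sw by (auto simp: sq_int_def)
      fix x show "\<bar>w x\<bar> \<le> KJ * \<bar>q x\<bar>"
      proof (cases "x \<in> ball x0 r1")
        case True
        have "norm (s *\<^sub>R a) \<le> norm a" using s s0(2) by (simp add: mult_left_le_one_le)
        then have "x - s *\<^sub>R a \<in> cball x0 (r + norm a)"
          using True r dist_triangle[of x0 "x - s *\<^sub>R a" x] by (simp add: dist_norm)
        from KJ(2)[OF this] have "\<bar>jac (x - s *\<^sub>R a) * q x\<bar> \<le> KJ * \<bar>q x\<bar>"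
          unfolding abs_mult by (intro mult_right_mono) auto
        moreover have "\<bar>w x\<bar> \<le> \<bar>jac (x - s *\<^sub>R a) * q x\<bar>" by (simp add: w_def indicator_def)
        ultimately show ?thesis by linarith
      qed (simp add: w_def test_function_outside[OF t])
    qed
    \<comment> \<open>For \<open>x\<close> in the support of \<open>q\<close> both points lie in the
      ball, so \<open>side\<close> puts them on the same side of the boundary and the indicator can
      be frozen at \<open>x\<close>.\<close>
    have shift: "gk k (flow a (- s) x) * q x = w x * V k (flow a (- s) x)" for x
    proof (cases "x \<in> ball x0 r1")
      case True
      then have x: "x \<in> ball x0 r" "flow a (- s) x \<in> ball x0 r"
        using r2 r s0'[of "- s" x] s by auto
      show ?thesis using side[OF x] x(2) by (simp add: gk_def w_def jac_flow indicator_def)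
    qed (simp add: w_def test_function_outside[OF t])
    have here: "gk k x * q x = indicator \<Omega> x * (jac x * q x) * V k x" for x
    proof (cases "x \<in> ball x0 r1")
      case True
      then have "x \<in> ball x0 r" using r by auto
      then show ?thesis by (simp add: gk_def indicator_def)
    qed (simp add: test_function_outside[OF t])
    have cjx: "cc (\<lambda>x. (jac (x - s *\<^sub>R a) - jac x) * q x)"
      by (intro cc_mult continuous_intros cj jac_continuous cq)
    have i0: "integrable lborel (\<lambda>x. gk k x * q (flow a s x))" "integrable lborel (\<lambda>x. gk k x * q x)"
      by (intro sq_int_integrable_mult gks sq_int_flow cc_sq_int cq)+
    have i1: "integrable lborel (\<lambda>x. w x * V k (flow a (- s) x))"
      by (intro sq_int_integrable_mult sw sq_int_flow tf_sq_int[OF V(1)])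
    have i2: "integrable lborel (\<lambda>x. w x * V k x)"
      by (intro sq_int_integrable_mult sw tf_sq_int[OF V(1)])
    have s3: "sq_int lborel (\<lambda>x. indicator \<Omega> x * V k x)" by (intro sq_int_indicator tf_sq_int[OF V(1)]) simp
    have "(LINT x|lborel. gk k x * (q (flow a s x) - q x)) = (LINT x|lborel. gk k x * q (flow a s x)) - (LINT x|lborel. gk k x * q x)"
      using i0 by (simp add: right_diff_distrib)
    also have "(LINT x|lborel. gk k x * q (flow a s x)) = (LINT x|lborel. w x * V k (flow a (- s) x))"
      unfolding shift[symmetric] by (rule integral_flow_pair) simp_all
    also have "(LINT x|lborel. w x * V k (flow a (- s) x)) - (LINT x|lborel. gk k x * q x)
        = (LINT x|lborel. w x * (V k (flow a (- s) x) - V k x)) + ((LINT x|lborel. w x * V k x) - (LINT x|lborel. gk k x * q x))"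
      using i1 i2 by (simp add: right_diff_distrib)
    also have "(LINT x|lborel. w x * V k x) - (LINT x|lborel. gk k x * q x)
        = (LINT x|lborel. w x * V k x - gk k x * q x)"
      using i2 i0 by simp
    also have "\<dots> = (LINT x|lborel. ((jac (x - s *\<^sub>R a) - jac x) * q x) * (indicator \<Omega> x * V k x))"
      unfolding here by (simp add: w_def algebra_simps)
    \<comment> \<open>One increment falls on the approximant, the other on the Lipschitz area
      factor; both are of order \<open>s\<close>.\<close>
    finally have id: "(LINT x|lborel. gk k x * (q (flow a s x) - q x)) = (LINT x|lborel. w x * (V k (flow a (- s) x) - V k x))
       + (LINT x|lborel. ((jac (x - s *\<^sub>R a) - jac x) * q x) * (indicator \<Omega> x * V k x))" .
    have "\<bar>LINT x|lborel. w x * (V k (flow a (- s) x) - V k x)\<bar> \<le> (KJ * n2 q * CT) * \<bar>- s\<bar>"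
    proof (rule flow_difference_bound[OF wl V(1)])
      fix t' assume t': "\<bar>t'\<bar> \<le> \<bar>- s\<bar>"
      let ?T = "\<lambda>x. indicator (\<Omega> \<inter> cball x0 r2) x * tang a (V k) x"
      have "w x * tang a (V k) (flow a t' x) = w x * ?T (flow a t' x)" for x
      proof (cases "x \<in> ball x0 r1 \<and> x \<in> \<Omega>")
        case True
        then have x: "x \<in> ball x0 r" "flow a t' x \<in> cball x0 r2"
          using r2 r s0'[of t' x] s t' by auto
        then have "flow a t' x \<in> ball x0 r" using r2 by auto
        from side[OF x(1) this] True x(2) show ?thesis by simp
      next
        case False
        then show ?thesis by (auto simp: w_def test_function_outside[OF t])
      qed
      then have "\<bar>LINT x|lborel. w x * tang a (V k) (flow a t' x)\<bar> = \<bar>LINT x|lborel. w x * ?T (flow a t' x)\<bar>" by (simp only:)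
      also have "\<dots> \<le> n2 w * n2 (\<lambda>x. ?T (flow a t' x))" by (intro l2n_CS sw sq_int_flow ts)
      also have "n2 (\<lambda>x. ?T (flow a t' x)) = n2 ?T" using ts by (intro n2_flow) (auto simp: sq_int_def)
      also have "n2 w * n2 ?T \<le> (KJ * n2 q) * CT" using KJ(1) by (intro mult_mono nw tb) auto
      finally show "\<bar>LINT x|lborel. w x * tang a (V k) (flow a t' x)\<bar> \<le> KJ * n2 q * CT" .
    qed
    moreover have "\<bar>LINT x|lborel. ((jac (x - s *\<^sub>R a) - jac x) * q x) * (indicator \<Omega> x * V k x)\<bar> \<le> (L * norm a * \<bar>s\<bar> * n2 q) * C0"
    proof -
      have "\<bar>LINT x|lborel. ((jac (x - s *\<^sub>R a) - jac x) * q x) * (indicator \<Omega> x * V k x)\<bar>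
          \<le> n2 (\<lambda>x. (jac (x - s *\<^sub>R a) - jac x) * q x) * n2 (\<lambda>x. indicator \<Omega> x * V k x)"
        by (intro l2n_CS cc_sq_int cjx s3)
      also have "\<dots> \<le> (L * norm a * \<bar>s\<bar> * n2 q) * C0"
      proof (intro mult_mono V(3))
        show "n2 (\<lambda>x. (jac (x - s *\<^sub>R a) - jac x) * q x) \<le> L * norm a * \<bar>s\<bar> * n2 q"
        proof (rule n2_le_mult[OF t cc_borel[OF cjx]])
          fix x
          have "\<bar>jac (x - s *\<^sub>R a) - jac x\<bar> \<le> L * norm a * \<bar>s\<bar>"
            using jac_lip[of "x - s *\<^sub>R a" x] by (simp add: mult_ac)
          then show "\<bar>(jac (x - s *\<^sub>R a) - jac x) * q x\<bar> \<le> L * norm a * \<bar>s\<bar> * \<bar>q x\<bar>"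
            unfolding abs_mult by (rule mult_right_mono) simp
        qed
      qed (use L_nonneg in auto)
      finally show ?thesis .
    qed
    ultimately have "\<bar>LINT x|lborel. gk k x * (q (flow a s x) - q x)\<bar> \<le> (KJ * n2 q * CT) * \<bar>- s\<bar> + (L * norm a * \<bar>s\<bar> * n2 q) * C0"
      unfolding id by linarith
    then show ?thesis by (simp add: C_def algebra_simps)
  qed
  have "\<bar>LINT x|lborel. g x * (q (flow a s x) - q x)\<bar> \<le> C * \<bar>s\<bar> * n2 q"
    if t: "test_function (ball x0 r1) q" and s: "\<bar>s\<bar> \<le> s0" for q s
  proof -
    have sq: "sq_int lborel (\<lambda>x. q (flow a s x) - q x)"
      by (intro sq_int_diff sq_int_flow tf_sq_int[OF t])
    \<comment> \<open>The constant in \<open>gkb\<close> does not depend on \<open>k\<close>, so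
      convergence in norm on \<Omega> carries the bound over to \<open>g\<close>.\<close>
    have lim: "(\<lambda>k. LINT x|lborel. gk k x * (q (flow a s x) - q x)) \<longlonglongrightarrow> (LINT x|lborel. g x * (q (flow a s x) - q x))"
    proof (rule LIM_zero_cancel, rule Lim_null_comparison[OF always_eventually[OF allI]])
      fix k
      have sv: "sq_int lborel (\<lambda>x. V k x - v x)" by (intro sq_int_diff tf_sq_int[OF V(1)] v)
      have d: "gk k x - g x = indicator (\<Omega> \<inter> ball x0 r) x * (jac x * (V k x - v x))" for x
        by (simp add: gk_def g algebra_simps)
      have "(LINT x|lborel. gk k x * (q (flow a s x) - q x)) - (LINT x|lborel. g x * (q (flow a s x) - q x))
          = (LINT x|lborel. (gk k x - g x) * (q (flow a s x) - q x))"
        using sq_int_integrable_mult[OF gks sq] sq_int_integrable_mult[OF gs sq] by (simp add: left_diff_distrib)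
      also have "\<bar>\<dots>\<bar> \<le> n2 (\<lambda>x. gk k x - g x) * n2 (\<lambda>x. q (flow a s x) - q x)"
        by (intro l2n_CS sq_int_diff gks gs sq)
      also have "\<dots> \<le> (KJ * n2 (\<lambda>x. indicator \<Omega> x * (V k x - v x))) * n2 (\<lambda>x. q (flow a s x) - q x)"
        unfolding d by (intro mult_right_mono jn sv) simp
      finally show "norm ((LINT x|lborel. gk k x * (q (flow a s x) - q x)) - (LINT x|lborel. g x * (q (flow a s x) - q x)))
          \<le> (KJ * n2 (\<lambda>x. indicator \<Omega> x * (V k x - v x))) * n2 (\<lambda>x. q (flow a s x) - q x)" by simp
    next
      show "(\<lambda>k. (KJ * n2 (\<lambda>x. indicator \<Omega> x * (V k x - v x))) * n2 (\<lambda>x. q (flow a s x) - q x)) \<longlonglongrightarrow> 0"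
        by (intro tendsto_mult_left_zero tendsto_mult_right_zero V(2))
    qed
    show ?thesis by (rule abs_LIMSEQ_le[OF lim gkb[OF t s]])
  qed
  then show ?thesis using C0 s0 by (intro exI[of _ C] conjI exI[of _ s0]) auto
qed

end

section \<open>Surface measure and integration by parts in a graph chart\<close>

lemma prod_Basis_cart: "(\<Prod>b\<in>(Basis :: (real^'n::finite) set). f b) = (\<Prod>i\<in>UNIV. f (axis i 1))"
proof -
  have "(Basis :: (real^'n) set) = (\<lambda>i. axis i 1) ` UNIV" by (auto simp: Basis_vec_def)
  then have "(\<Prod>b\<in>(Basis :: (real^'n) set). f b) = (\<Prod>b\<in>(\<lambda>i. axis i 1) ` UNIV. f b)" by (simp only:)
  also have "\<dots> = (\<Prod>i\<in>UNIV. f (axis i 1))"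
    by (subst prod.reindex) (auto simp: inj_on_def axis_eq_axis)
  finally show ?thesis .
qed

lemma prod_UNIV3: "(\<Prod>i\<in>UNIV. f i) = f 1 * f 2 * f (3::3)" for f :: "3 \<Rightarrow> real"
proof -
  have "(1::3) \<noteq> 2" "(1::3) \<noteq> 3" "(2::3) \<noteq> 3" by simp_all
  then have "(1::3) \<notin> {2,3}" "(2::3) \<notin> {3}" by blast+
  then show ?thesis unfolding UNIV_3
    by (simp only: prod.insert finite_insert finite.emptyI empty_iff not_False_eq_True prod.empty mult_1_right mult.assoc)
qed

definition join3 :: "(real^2) \<times> real \<Rightarrow> real^3" where
  "join3 z = vector [fst z $ 1, fst z $ 2, snd z]"

lemma join3_nth [simp]: "join3 z $ 1 = fst z $ 1" "join3 z $ 2 = fst z $ 2" "join3 z $ 3 = snd z"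
  by (simp_all add: join3_def)

lemma join3_continuous: "continuous_on A join3"
proof (rule continuous_on_componentwise[THEN iffD2], rule ballI)
  fix b :: "real^3" assume "b \<in> Basis"
  then obtain i where b: "b = axis i 1" by (auto simp: Basis_vec_def)
  have "i = 1 \<or> i = 2 \<or> i = 3" using exhaust_3[of i] by simp
  then show "continuous_on A (\<lambda>x. join3 x \<bullet> b)"
    unfolding b inner_axis by (elim disjE; hypsubst; unfold join3_nth; intro continuous_intros)
qed

lemma join3_borel [measurable]: "join3 \<in> borel_measurable borel"
  by (rule borel_measurable_continuous_onI[OF join3_continuous])

text \<open>This identifies Lebesgue measure on space with the product of plane and line, so that
  Fubini can be applied along the vertical lines of a chart.\<close>

lemma join3_distr: "distr lborel borel join3 = lborel"
proof (rule lborel_eqI[symmetric])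
  fix l u :: "real^3" assume lu: "\<And>b. b \<in> Basis \<Longrightarrow> l \<bullet> b \<le> u \<bullet> b"
  have le: "l $ i \<le> u $ i" for i using lu[of "axis i 1"] by (simp add: inner_axis)
  let ?l = "vector [l $ 1, l $ 2] :: real^2" and ?u = "vector [u $ 1, u $ 2] :: real^2"
  have im: "join3 -` box l u = box ?l ?u \<times> box (l $ 3) (u $ 3)"
    by (auto simp: mem_box_cart forall_3 forall_2)
  have l2: "\<forall>b\<in>Basis. ?l \<bullet> b \<le> ?u \<bullet> b"
  proof
    fix b :: "real^2" assume "b \<in> Basis"
    then obtain i where b: "b = axis i 1" by (auto simp: Basis_vec_def)
    have "i = 1 \<or> i = 2" using exhaust_2[of i] by simp
    then show "?l \<bullet> b \<le> ?u \<bullet> b" unfolding b using le by (auto simp: inner_axis)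
  qed
  have "emeasure (distr lborel borel join3) (box l u) = emeasure (lborel \<Otimes>\<^sub>M lborel) (box ?l ?u \<times> box (l $ 3) (u $ 3))"
    by (simp add: emeasure_distr im lborel_prod)
  also have "\<dots> = emeasure lborel (box ?l ?u) * emeasure lborel (box (l $ 3) (u $ 3))"
    by (rule lborel.emeasure_pair_measure_Times) auto
  also have "emeasure lborel (box ?l ?u) = ennreal ((u $ 1 - l $ 1) * (u $ 2 - l $ 2))"
    using l2 by (simp add: emeasure_lborel_box_eq prod_Basis_cart inner_axis UNIV_2)
  also have "emeasure lborel (box (l $ 3) (u $ 3)) = ennreal (u $ 3 - l $ 3)"
    using le[of 3] by (simp add: emeasure_lborel_box_eq)
  also have "ennreal ((u $ 1 - l $ 1) * (u $ 2 - l $ 2)) * ennreal (u $ 3 - l $ 3) = ennreal (\<Prod>b\<in>Basis. (u - l) \<bullet> b)"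
  proof -
    have "(\<Prod>b\<in>Basis. (u - l) \<bullet> b) = ((u $ 1 - l $ 1) * (u $ 2 - l $ 2)) * (u $ 3 - l $ 3)"
      unfolding prod_Basis_cart prod_UNIV3 by (simp add: inner_axis)
    moreover have "0 \<le> (u $ 1 - l $ 1) * (u $ 2 - l $ 2)" "0 \<le> u $ 3 - l $ 3" using le by simp_all
    ultimately show ?thesis by (simp only: ennreal_mult)
  qed
  finally show "emeasure (distr lborel borel join3) (box l u) = ennreal (\<Prod>b\<in>Basis. (u - l) \<bullet> b)" .
qed simp

lemma matrix_vector_mult_columns3: "A *v w = (w $ 1) *\<^sub>R column 1 A + (w $ 2) *\<^sub>R column 2 A + (w $ 3) *\<^sub>R column 3 A"
  for A :: "real^3^'m"
  by (simp add: vec_eq_iff matrix_vector_mult_def column_def sum_3 mult.commute)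

locale chart =
  fixes \<Omega> :: "(real^3) set" and x0 :: "real^3" and r :: real and A :: "real^3^3" and \<psi> :: "real^2 \<Rightarrow> real"
  assumes graph_chart: "graph_chart \<Omega> x0 r A \<psi>"
begin

abbreviation "e1 \<equiv> column 1 A"
abbreviation "e2 \<equiv> column 2 A"
abbreviation "e3 \<equiv> column 3 A"

lemma r_pos: "0 < r" and orth: "orthogonal_matrix A" and C11: "C11 \<psi>"
  and side: "\<And>y t. chart_point x0 A y t \<in> ball x0 r \<Longrightarrow> chart_point x0 A y t \<in> \<Omega> \<longleftrightarrow> \<psi> y < t"
  using graph_chart by (auto simp: graph_chart_def)

lemma columns_inner: "column i A \<bullet> column j A = (if i = j then 1 else 0)"
proof -
  have "(transpose A ** A) $ i $ j = mat 1 $ i $ j" using orth by (simp add: orthogonal_matrix_def)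
  then show ?thesis
    by (simp add: matrix_matrix_mult_def transpose_def mat_def inner_vec_def column_def)
qed

lemma frame: "e1 $ i * e1 $ j + e2 $ i * e2 $ j + e3 $ i * e3 $ j = (if i = j then 1 else 0)"
proof -
  have "(A ** transpose A) $ i $ j = mat 1 $ i $ j" using orth by (simp add: orthogonal_matrix_def)
  then show ?thesis
    by (simp add: matrix_matrix_mult_def transpose_def mat_def column_def sum_3)
qed

lemma inner_e [simp]: "e1 \<bullet> e1 = 1" "e2 \<bullet> e2 = 1" "e3 \<bullet> e3 = 1" "e1 \<bullet> e2 = 0" "e1 \<bullet> e3 = 0" "e2 \<bullet> e3 = 0"
  "e2 \<bullet> e1 = 0" "e3 \<bullet> e1 = 0" "e3 \<bullet> e2 = 0"
  by (simp_all add: columns_inner)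

lemma norm_e: "norm e1 = 1" "norm e2 = 1" "norm e3 = 1"
  by (simp_all add: norm_eq_sqrt_inner)

text \<open>Together with \<open>tc\<close> this inverts \<open>chart_point\<close>: horizontal
  position and height in the frame of the columns of \<open>A\<close>.\<close>

definition yc :: "real^3 \<Rightarrow> real^2" where
  "yc x = vector [e1 \<bullet> (x - x0), e2 \<bullet> (x - x0)]"

definition tc :: "real^3 \<Rightarrow> real" where
  "tc x = e3 \<bullet> (x - x0)"

lemma yc_nth [simp]: "yc x $ 1 = e1 \<bullet> (x - x0)" "yc x $ 2 = e2 \<bullet> (x - x0)"
  by (simp_all add: yc_def)

lemma chart_point_columns: "chart_point x0 A y t = x0 + (y $ 1) *\<^sub>R e1 + (y $ 2) *\<^sub>R e2 + t *\<^sub>R e3"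
  by (simp add: chart_point_def matrix_vector_mult_columns3 add.assoc)

lemma yc_chart [simp]: "yc (chart_point x0 A y t) = y"
  by (simp add: vec_eq_iff forall_2 chart_point_columns inner_add_right)

lemma tc_chart [simp]: "tc (chart_point x0 A y t) = t"
  by (simp add: tc_def chart_point_columns inner_add_right)

lemma frame_vec: "(e1 \<bullet> v) *\<^sub>R e1 + (e2 \<bullet> v) *\<^sub>R e2 + (e3 \<bullet> v) *\<^sub>R e3 = v"
proof -
  have "A ** transpose A = mat 1" using orth by (simp add: orthogonal_matrix_def)
  then have "A *v (transpose A *v v) = v"
    by (simp only: matrix_vector_mul_assoc matrix_vector_mul_lid)
  moreover have "(transpose A *v v) $ i = column i A \<bullet> v" for i
    by (simp add: matrix_vector_mult_def transpose_def inner_vec_def column_def)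
  ultimately show ?thesis by (simp add: matrix_vector_mult_columns3)
qed

lemma chart_point_coords [simp]: "chart_point x0 A (yc x) (tc x) = x"
  using frame_vec[of "x - x0"] by (simp add: chart_point_columns tc_def add.assoc)

definition Psi :: "real^3 \<Rightarrow> real" where "Psi x = \<psi> (yc x)"

definition DP :: "real^3 \<Rightarrow> real^3" where
  "DP x = (grad \<psi> (yc x) $ 1) *\<^sub>R e1 + (grad \<psi> (yc x) $ 2) *\<^sub>R e2"

lemma yc_e3: "yc (x + t *\<^sub>R e3) = yc x"
  by (simp add: vec_eq_iff forall_2 inner_add_right inner_diff_right)

lemma yc_has_derivative: "(yc has_derivative (\<lambda>h. vector [e1 \<bullet> h, e2 \<bullet> h])) (at x)"
proof (rule has_derivative_componentwise_within[THEN iffD2], rule ballI)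
  fix b :: "real^2" assume "b \<in> Basis"
  then obtain i where b: "b = axis i 1" by (auto simp: Basis_vec_def)
  have "i = 1 \<or> i = 2" using exhaust_2[of i] by simp
  then show "((\<lambda>x. yc x \<bullet> b) has_derivative (\<lambda>h. vector [e1 \<bullet> h, e2 \<bullet> h] \<bullet> b)) (at x)"
    unfolding b by (auto simp: inner_axis inner_diff_right intro!: derivative_eq_intros)
qed

lemma yc_continuous: "continuous_on S yc"
  by (meson continuous_at_imp_continuous_on has_derivative_continuous yc_has_derivative)

lemma tc_continuous: "continuous_on S tc"
  unfolding tc_def[abs_def] by (intro continuous_intros)

lemma psi_diff: "\<psi> differentiable (at y)"
  using C11 by (simp add: C11_def)

lemma norm_yc_diff: "norm (yc x - yc y) \<le> 2 * norm (x - y)"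
proof -
  have "norm (yc x - yc y) \<le> (\<Sum>i\<in>UNIV. \<bar>(yc x - yc y) $ i\<bar>)" by (rule norm_le_l1_cart)
  also have "\<dots> = \<bar>e1 \<bullet> (x - y)\<bar> + \<bar>e2 \<bullet> (x - y)\<bar>" by (simp add: sum_2 inner_diff_right)
  also have "\<dots> \<le> norm (x - y) + norm (x - y)"
    using Cauchy_Schwarz_ineq2[of e1 "x - y"] Cauchy_Schwarz_ineq2[of e2 "x - y"] by (simp add: norm_e)
  finally show ?thesis by simp
qed

text \<open>The constant is 4 times that of the gradient of \<psi>: one factor 2 from the projection
  \<open>yc\<close>, the other from expanding \<open>DP\<close> in the two horizontal
  vectors.\<close>

lemma ex_graph_flow: "\<exists>L. graph_flow Psi DP e3 L"
proof -
  obtain L where L: "L-lipschitz_on UNIV (grad \<psi>)" using C11 by (auto simp: C11_def)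
  have L0: "0 \<le> L" using L by (rule lipschitz_on_nonneg)
  have "graph_flow Psi DP e3 (4 * L)"
  proof
    fix x y t
    show "Psi (x + t *\<^sub>R e3) = Psi x" "DP (x + t *\<^sub>R e3) = DP x"
      by (simp_all only: Psi_def DP_def yc_e3)
    show "DP x \<bullet> e3 = 0" by (simp add: DP_def inner_add_left)
    have "(Psi has_derivative (\<lambda>h. dd (vector [e1 \<bullet> h, e2 \<bullet> h]) \<psi> (yc x))) (at x)"
      unfolding Psi_def[abs_def] by (rule has_derivative_compose[OF yc_has_derivative has_derivative_dd[OF psi_diff]])
    moreover have "dd (vector [e1 \<bullet> h, e2 \<bullet> h]) \<psi> (yc x) = DP x \<bullet> h" for h
      by (simp add: dd_eq_grad DP_def inner_vec_def[of "grad \<psi> (yc x)"] sum_2 inner_add_left)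
    ultimately show "(Psi has_derivative (\<lambda>h. DP x \<bullet> h)) (at x)" by simp
    let ?g = "grad \<psi> (yc x) - grad \<psi> (yc y)"
    have "DP x - DP y = (?g $ 1) *\<^sub>R e1 + (?g $ 2) *\<^sub>R e2" by (simp add: DP_def scaleR_diff_left)
    then have "norm (DP x - DP y) \<le> \<bar>?g $ 1\<bar> + \<bar>?g $ 2\<bar>"
      using norm_triangle_ineq[of "(?g $ 1) *\<^sub>R e1" "(?g $ 2) *\<^sub>R e2"] by (simp only: norm_scaleR norm_e mult_1_right)
    also have "\<dots> \<le> 2 * norm ?g"
      using component_le_norm_cart[of ?g 1] component_le_norm_cart[of ?g 2] by simp
    also have "norm ?g \<le> L * norm (yc x - yc y)"
      using lipschitz_onD[OF L, of "yc x" "yc y"] by (simp add: dist_norm)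
    also have "L * norm (yc x - yc y) \<le> L * (2 * norm (x - y))" by (intro mult_left_mono norm_yc_diff L0)
    finally show "norm (DP x - DP y) \<le> 4 * L * norm (x - y)" by simp
  qed
  then show ?thesis by blast
qed

lemma norm_DP: "norm (DP x) = norm (grad \<psi> (yc x))"
proof -
  have "DP x \<bullet> DP x = grad \<psi> (yc x) \<bullet> grad \<psi> (yc x)"
    by (simp add: DP_def inner_add_left inner_add_right inner_vec_def[of "grad \<psi> (yc x)"] sum_2)
  then show ?thesis by (simp add: norm_eq_sqrt_inner)
qed

lemma Omega_iff: "x \<in> ball x0 r \<Longrightarrow> x \<in> \<Omega> \<longleftrightarrow> Psi x < tc x"
  using side[of "yc x" "tc x"] by (simp add: Psi_def)

lemma psi_continuous: "continuous_on S \<psi>"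
  by (meson continuous_at_imp_continuous_on differentiable_imp_continuous_within psi_diff)

lemma gradpsi_continuous: "continuous_on S (grad \<psi>)"
proof -
  obtain L where "L-lipschitz_on UNIV (grad \<psi>)" using C11 by (auto simp: C11_def)
  from lipschitz_on_continuous_on[OF this] show ?thesis by (rule continuous_on_subset) simp
qed

definition cp :: "(real^2) \<times> real \<Rightarrow> real^3" where
  "cp z = chart_point x0 A (fst z) (snd z)"

lemma cp_join3: "cp z = x0 + A *v join3 z"
  by (simp add: cp_def chart_point_def join3_def)

lemma cp_continuous: "continuous_on S cp"
  unfolding cp_def chart_point_columns by (intro continuous_intros)

lemma cp_borel [measurable]: "cp \<in> borel_measurable borel"
  by (rule borel_measurable_continuous_onI[OF cp_continuous])

text \<open>\<open>cp\<close> is \<open>join3\<close> followed by an affine isometry, whose Jacobian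
  has modulus one.\<close>

lemma cp_distr: "distr lborel borel cp = lborel"
proof -
  let ?g = "\<lambda>x. x0 + A *v x"
  have gm: "?g \<in> borel_measurable borel"
    by (rule borel_measurable_continuous_onI) (intro continuous_intros linear_continuous_on matrix_vector_mul_bounded_linear)
  have "distr lborel borel ?g = lborel"
  proof (rule lborel_distr_unimodular[where h="\<lambda>x. transpose A *v (x - x0)" and h'="\<lambda>x h. transpose A *v h"])
    have o: "A ** transpose A = mat 1" "transpose A ** A = mat 1" using orth by (simp_all add: orthogonal_matrix_def)
    show "?g (transpose A *v (x - x0)) = x" for x
      by (simp only: matrix_vector_mul_assoc matrix_vector_mul_lid o) simp
    show "transpose A *v (?g x - x0) = x" for x
      by (simp only: matrix_vector_mul_assoc matrix_vector_mul_lid o add_diff_cancel_left')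
    show "((\<lambda>x. transpose A *v (x - x0)) has_derivative (\<lambda>h. transpose A *v h)) (at x)" for x
      by (rule has_derivative_compose[of "\<lambda>x. x - x0" "\<lambda>h. h", OF _ bounded_linear_imp_has_derivative[OF matrix_vector_mul_bounded_linear]])
        (auto intro!: derivative_eq_intros)
    show "\<bar>det (matrix (\<lambda>h. transpose A *v h))\<bar> = 1" for x :: "real^3"
      using det_orthogonal_matrix[OF orth] unfolding matrix_of_matrix_vector_mul det_transpose by auto
  qed (rule gm)
  then have "distr (distr lborel borel join3) borel ?g = lborel" by (simp add: join3_distr)
  moreover have "distr (distr lborel borel join3) borel ?g = distr lborel borel (?g \<circ> join3)"
    using gm by (intro distr_distr) auto
  moreover have "?g \<circ> join3 = cp" by (auto simp: cp_join3)
  ultimately show ?thesis by simp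
qed

definition J2d :: "real^2 \<Rightarrow> real" where
  "J2d y = sqrt (1 + (norm (grad \<psi> y))\<^sup>2)"

lemma J2d_continuous: "continuous_on S J2d"
  unfolding J2d_def[abs_def] by (intro continuous_intros gradpsi_continuous)

lemma J2d_pos: "0 < J2d y"
  unfolding J2d_def by (simp add: add_pos_nonneg)

lemma J2d_yc: "J2d (yc x) = sqrt (1 + (norm (DP x))\<^sup>2)"
  by (simp add: J2d_def norm_DP)

lemma gp_borel: "(\<lambda>y. chart_point x0 A y (\<psi> y)) \<in> borel_measurable borel"
  unfolding chart_point_columns
  by (rule borel_measurable_continuous_onI) (intro continuous_intros psi_continuous)

text \<open>\<open>is_surface_measure\<close> gives the area formula for Borel subsets of the ball
  only. So \<sigma> and the pushforward of the area density are both restricted to the ball by an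
  indicator density, which makes them equal as measures and is invisible to
  \<open>h\<close>.\<close>

lemma surface_integral:
  assumes s: "is_surface_measure \<Omega> \<sigma>" and h: "h \<in> borel_measurable borel" "\<And>x. x \<notin> ball x0 r \<Longrightarrow> h x = 0"
  shows "(LINT x|\<sigma>. h x) = (LINT y|lborel. J2d y * h (chart_point x0 A y (\<psi> y)))"
proof -
  let ?c = "\<lambda>y. chart_point x0 A y (\<psi> y)"
  note [measurable] = gp_borel h(1) borel_measurable_continuous_onI[OF J2d_continuous]
  have ss: "sets \<sigma> = sets borel" using s by (simp add: is_surface_measure_def)
  have sp: "space \<sigma> = UNIV" using sets_eq_imp_space_eq[OF ss] by simp
  have hs: "h \<in> borel_measurable \<sigma>" using h(1) by (simp add: measurable_cong_sets[OF ss refl])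
  define \<nu> where "\<nu> = distr (density lborel (\<lambda>y. ennreal (J2d y))) borel ?c"
  let ?i = "indicator (ball x0 r) :: real^3 \<Rightarrow> real"
  have im: "?i \<in> borel_measurable borel" by (intro borel_measurable_indicator borel_open open_ball)
  have ims: "?i \<in> borel_measurable \<sigma>" using im by (simp add: measurable_cong_sets[OF ss refl])
  have e: "density \<sigma> (\<lambda>x. ennreal (?i x)) = density \<nu> (\<lambda>x. ennreal (?i x))"
  proof (rule measure_eqI)
    show "sets (density \<sigma> (\<lambda>x. ennreal (?i x))) = sets (density \<nu> (\<lambda>x. ennreal (?i x)))"
      by (simp add: ss \<nu>_def)
    fix B assume "B \<in> sets (density \<sigma> (\<lambda>x. ennreal (?i x)))"
    then have B: "B \<in> sets borel" by (simp add: ss)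
    have Bb: "B \<inter> ball x0 r \<in> sets borel" using B by (intro sets.Int) (auto intro: borel_open)
    have 1: "emeasure (density M (\<lambda>x. ennreal (?i x))) B = emeasure M (B \<inter> ball x0 r)" if M: "sets M = sets borel" for M :: "(real^3) measure"
    proof -
      have "?i \<in> borel_measurable M" using im by (simp add: measurable_cong_sets[OF M refl])
      then have "emeasure (density M (\<lambda>x. ennreal (?i x))) B = (\<integral>\<^sup>+x. ennreal (?i x) * indicator B x \<partial>M)"
        using B M by (intro emeasure_density) auto
      also have "\<dots> = (\<integral>\<^sup>+x. indicator (B \<inter> ball x0 r) x \<partial>M)"
        by (intro nn_integral_cong) (auto simp: indicator_def)
      also have "\<dots> = emeasure M (B \<inter> ball x0 r)" using Bb M by (intro nn_integral_indicator) auto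
      finally show ?thesis .
    qed
    have "emeasure \<sigma> (B \<inter> ball x0 r) = (\<integral>\<^sup>+ y. indicator (B \<inter> ball x0 r) (?c y) * ennreal (J2d y) \<partial>lborel)"
      using s graph_chart Bb unfolding is_surface_measure_def J2d_def by blast
    also have "\<dots> = emeasure \<nu> (B \<inter> ball x0 r)"
    proof -
      have "?c -` (B \<inter> ball x0 r) \<in> sets borel" using measurable_sets[OF gp_borel Bb] by simp
      then have "emeasure (density lborel (\<lambda>y. ennreal (J2d y))) (?c -` (B \<inter> ball x0 r))
          = (\<integral>\<^sup>+ y. ennreal (J2d y) * indicator (?c -` (B \<inter> ball x0 r)) y \<partial>lborel)"
        by (intro emeasure_density) auto
      moreover have "emeasure \<nu> (B \<inter> ball x0 r) = emeasure (density lborel (\<lambda>y. ennreal (J2d y))) (?c -` (B \<inter> ball x0 r))"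
        unfolding \<nu>_def using Bb gp_borel by (subst emeasure_distr) simp_all
      ultimately show ?thesis by (simp only: mult.commute[of "ennreal _"] indicator_vimage)
    qed
    finally show "emeasure (density \<sigma> (\<lambda>x. ennreal (?i x))) B = emeasure (density \<nu> (\<lambda>x. ennreal (?i x))) B"
      using 1[OF ss] 1[of \<nu>] by (simp add: \<nu>_def)
  qed
  have ih: "?i x *\<^sub>R h x = h x" for x using h(2)[of x] by (auto simp: indicator_def)
  have "(LINT x|\<sigma>. h x) = (LINT x|density \<sigma> (\<lambda>x. ennreal (?i x)). h x)"
    using integral_density[OF hs ims] unfolding ih by simp
  also have "\<dots> = (LINT x|\<nu>. ?i x *\<^sub>R h x)"
    unfolding e by (rule integral_density) (use im h(1) in \<open>simp_all add: \<nu>_def\<close>)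
  also have "\<dots> = (LINT y|density lborel (\<lambda>y. ennreal (J2d y)). h (?c y))"
    unfolding ih \<nu>_def by (rule integral_distr) auto
  also have "\<dots> = (LINT y|lborel. J2d y * h (?c y))"
    using J2d_pos by (subst integral_density) (auto simp: less_imp_le)
  finally show ?thesis .
qed

text \<open>The part of the graph in the ball projects into a bounded planar set, on which the
  continuous area density is bounded.\<close>

lemma surface_ball_finite:
  assumes s: "is_surface_measure \<Omega> \<sigma>" shows "emeasure \<sigma> (ball x0 r) < \<infinity>"
proof -
  let ?c = "\<lambda>y. chart_point x0 A y (\<psi> y)"
  have "compact (J2d ` cball 0 (2 * r))"
    by (intro compact_continuous_image J2d_continuous compact_cball)
  from compact_imp_bounded[OF this] obtain K where K: "0 < K" "\<forall>y\<in>J2d ` cball 0 (2 * r). norm y \<le> K"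
    unfolding bounded_pos by (elim exE conjE)
  have "emeasure \<sigma> (ball x0 r) = (\<integral>\<^sup>+ y. indicator (ball x0 r) (?c y) * ennreal (J2d y) \<partial>lborel)"
    using s graph_chart borel_open[OF open_ball] unfolding is_surface_measure_def J2d_def by blast
  also have "\<dots> \<le> (\<integral>\<^sup>+ (y::real^2). ennreal K * indicator (cball 0 (2 * r)) y \<partial>lborel)"
  proof (rule nn_integral_mono)
    fix y :: "real^2"
    show "indicator (ball x0 r) (?c y) * ennreal (J2d y) \<le> ennreal K * indicator (cball 0 (2 * r)) y"
    proof (cases "?c y \<in> ball x0 r")
      case True
      have "yc x0 = 0" by (simp add: vec_eq_iff forall_2)
      then have "norm y \<le> 2 * norm (?c y - x0)" using norm_yc_diff[of "?c y" x0] by simp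
      then have "y \<in> cball 0 (2 * r)" using True by (simp add: dist_norm norm_minus_commute)
      moreover from this have "J2d y \<le> K" using bspec[OF K(2), of "J2d y"] by auto
      ultimately show ?thesis using True by (simp add: ennreal_leI)
    qed simp
  qed
  also have "\<dots> = ennreal K * emeasure lborel (cball (0::real^2) (2 * r))"
    by (rule nn_integral_cmult_indicator) simp
  also have "\<dots> < \<infinity>" using emeasure_bounded_finite[OF bounded_cball, of "0::real^2" "2 * r"]
    by (simp add: ennreal_mult_less_top)
  finally show ?thesis .
qed

text \<open>Fundamental theorem of calculus on each vertical line: the area density is constant
  there, \<Omega> lies above the graph and \<open>h\<close> vanishes far up, so only the value on
  the graph remains, with a minus sign.\<close>

lemma surface_by_parts:
  assumes s: "is_surface_measure \<Omega> \<sigma>" and h: "test_function (ball x0 r) h"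
  shows "(LINT x|\<sigma>. h x) = - (LINT x|lborel. indicator \<Omega> x * (J2d (yc x) * dd e3 h x))"
proof -
  have sm: "smooth h" by (rule test_function_smooth[OF h])
  have th: "test_function (ball x0 r) (dd e3 h)" by (rule test_function_dd[OF h])
  obtain B where B: "0 < B" "\<And>x. B < norm x \<Longrightarrow> h x = 0" "\<And>x. B < norm x \<Longrightarrow> dd e3 h x = 0"
  proof -
    obtain B where "0 < B" "\<And>x. B < norm x \<Longrightarrow> h x = 0" using cc_test[OF h] by (rule ccE) (rule that)
    moreover obtain B' where "0 < B'" "\<And>x. B' < norm x \<Longrightarrow> dd e3 h x = 0" using cc_test[OF th] by (rule ccE) (rule that)
    ultimately show ?thesis by (intro that[of "max B B'"]) auto
  qed
  \<comment> \<open>\<Omega> is replaced by the full epigraph, which agrees with it in the ball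
    containing the support of \<open>h\<close>.\<close>
  define F where "F x = indicator {x. Psi x < tc x} x * (J2d (yc x) * dd e3 h x)" for x
  have Psic: "continuous_on UNIV Psi" unfolding Psi_def[abs_def]
    by (intro continuous_on_compose2[OF psi_continuous[of UNIV] yc_continuous]) auto
  have o: "open {x. Psi x < tc x}" by (intro open_Collect_less Psic tc_continuous)
  have cJ: "cc (\<lambda>x. J2d (yc x) * dd e3 h x)"
    by (intro cc_mult continuous_on_compose2[OF J2d_continuous[of UNIV] yc_continuous] cc_test[OF th]) auto
  have Fm: "F \<in> borel_measurable borel"
    unfolding F_def[abs_def] by (intro borel_measurable_times borel_measurable_indicator borel_open o cc_borel[OF cJ])
  have Fi: "integrable lborel F"
    unfolding F_def[abs_def] using integrable_mult_indicator[of "{x. Psi x < tc x}" lborel, OF _ cc_integrable[OF cJ]] o by simp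
  have "indicator \<Omega> x * (J2d (yc x) * dd e3 h x) = F x" for x
    using Omega_iff[of x] test_function_outside[OF th, of x] by (auto simp: F_def indicator_def)
  then have "(LINT x|lborel. indicator \<Omega> x * (J2d (yc x) * dd e3 h x)) = (LINT x|lborel. F x)" by simp
  also have "\<dots> = (LINT z|lborel. F (cp z))"
    using integral_distr[of cp lborel borel F] Fm by (simp add: cp_distr)
  also have "\<dots> = (LINT z|(lborel \<Otimes>\<^sub>M lborel). F (cp z))" by (simp add: lborel_prod)
  also have "\<dots> = (LINT y|lborel. LINT t|lborel. F (cp (y, t)))"
  proof (rule lborel_pair.integral_fst'[symmetric])
    have "integrable (distr lborel borel cp) F" using Fi by (simp add: cp_distr)
    then show "integrable (lborel \<Otimes>\<^sub>M lborel) (\<lambda>z. F (cp z))"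
      by (subst (asm) integrable_distr_eq) (use Fm in \<open>auto simp: lborel_prod\<close>)
  qed
  also have "\<dots> = (LINT y|lborel. - (J2d y * h (chart_point x0 A y (\<psi> y))))"
  proof (rule Bochner_Integration.integral_cong[OF refl])
    fix y :: "real^2"
    define k where "k t = h (chart_point x0 A y t)" for t
    define k' where "k' t = dd e3 h (chart_point x0 A y t)" for t
    have line: "chart_point x0 A y t = (x0 + (y $ 1) *\<^sub>R e1 + (y $ 2) *\<^sub>R e2) + t *\<^sub>R e3" for t
      by (simp add: chart_point_columns)
    have dk: "(k has_real_derivative k' t) (at t)" for t
      unfolding k_def[abs_def] k'_def line by (intro line_has_derivative smooth_differentiable sm)
    have ck: "isCont k' t" for t
    proof -
      have "continuous_on UNIV k'" unfolding k'_def[abs_def] line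
        by (intro continuous_on_compose2[OF smooth_continuous[OF smooth_dd[OF sm], of UNIV]] continuous_intros) auto
      then show ?thesis by (simp add: continuous_on_eq_continuous_at)
    qed
    \<comment> \<open>High enough to be past the support of \<open>h\<close>, and not below the
      graph, so that the interval of integration is nonempty.\<close>
    define T where "T = max (\<psi> y) (B + norm x0 + 1)"
    have far: "B < norm (chart_point x0 A y t)" if "T \<le> t" for t
    proof -
      have "t = e3 \<bullet> (chart_point x0 A y t - x0)" using tc_chart[of y t] by (simp only: tc_def)
      also have "\<dots> \<le> norm (chart_point x0 A y t - x0)"
        using norm_cauchy_schwarz[of e3 "chart_point x0 A y t - x0"] by (simp add: norm_e)
      also have "\<dots> \<le> norm (chart_point x0 A y t) + norm x0" by (rule norm_triangle_ineq4)
      finally show ?thesis using that by (simp add: T_def)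
    qed
    have kT: "k T = 0" unfolding k_def by (intro B far) simp
    have kT': "k' t = 0" if "T \<le> t" for t unfolding k'_def by (intro B far that)
    have "(LINT t|lborel. F (cp (y, t))) = (LINT t|lborel. J2d y * (k' t * indicator {\<psi> y..T} t))"
    proof (rule integral_cong_AE)
      have "continuous_on UNIV (\<lambda>t. cp (y, t))" unfolding cp_def fst_conv snd_conv line by (intro continuous_intros)
      then have "(\<lambda>t. cp (y, t)) \<in> borel_measurable borel" by (rule borel_measurable_continuous_onI)
      from measurable_compose[OF this Fm] show "(\<lambda>t. F (cp (y, t))) \<in> borel_measurable lborel" by simp
      have "continuous_on UNIV k'" using ck by (simp add: continuous_on_eq_continuous_at)
      from borel_measurable_continuous_onI[OF this]
      show "(\<lambda>t. J2d y * (k' t * indicator {\<psi> y..T} t)) \<in> borel_measurable lborel" by simp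
      \<comment> \<open>The open half-line of the epigraph and the closed interval of the
        fundamental theorem disagree only at this point, as \<open>k'\<close> vanishes from
        \<open>T\<close> on.\<close>
      have "AE t in lborel. t \<noteq> \<psi> y" by (rule AE_lborel_singleton)
      then show "AE t in lborel. F (cp (y, t)) = J2d y * (k' t * indicator {\<psi> y..T} t)"
      proof eventually_elim
        case (elim t)
        have "F (cp (y, t)) = (if \<psi> y < t then J2d y * k' t else 0)"
          by (simp add: F_def cp_def Psi_def k'_def)
        also have "\<dots> = J2d y * (k' t * indicator {\<psi> y..T} t)"
          using elim kT'[of t] by (auto simp: indicator_def)
        finally show ?case .
      qed
    qed
    also have "\<dots> = J2d y * (k T - k (\<psi> y))"
      using integral_FTC_Icc_real[of "\<psi> y" T k k'] dk ck by (simp add: T_def)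
    finally show "(LINT t|lborel. F (cp (y, t))) = - (J2d y * h (chart_point x0 A y (\<psi> y)))"
      using kT by (simp add: k_def)
  qed
  also have "\<dots> = - (LINT x|\<sigma>. h x)"
    using surface_integral[OF s tf_borel[OF h] test_function_outside[OF h]] by simp
  finally show ?thesis by simp
qed

end

text \<open>The frontier is compact, hence covered by finitely many chart balls of finite measure,
  and its complement is a null set.\<close>

lemma surface_measure_finite:
  assumes "bounded \<Omega>" "C11_boundary \<Omega>" and s: "is_surface_measure \<Omega> \<sigma>"
  shows "emeasure \<sigma> UNIV < \<infinity>"
proof -
  have ss: "sets \<sigma> = sets borel" using s by (simp add: is_surface_measure_def)
  have "\<forall>p\<in>frontier \<Omega>. \<exists>r. 0 < r \<and> emeasure \<sigma> (ball p r) < \<infinity>"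
  proof
    fix p assume "p \<in> frontier \<Omega>"
    then obtain r A \<psi> where "graph_chart \<Omega> p r A \<psi>" using assms(2) by (auto simp: C11_boundary_def)
    then interpret chart \<Omega> p r A \<psi> by unfold_locales
    show "\<exists>r. 0 < r \<and> emeasure \<sigma> (ball p r) < \<infinity>" using r_pos surface_ball_finite[OF s] by blast
  qed
  then obtain r where r: "\<And>p. p \<in> frontier \<Omega> \<Longrightarrow> 0 < r p" "\<And>p. p \<in> frontier \<Omega> \<Longrightarrow> emeasure \<sigma> (ball p (r p)) < \<infinity>"
    by metis
  have sub: "frontier \<Omega> \<subseteq> (\<Union>p\<in>frontier \<Omega>. ball p (r p))" using r(1) by force
  obtain F where F: "F \<subseteq> frontier \<Omega>" "finite F" "frontier \<Omega> \<subseteq> (\<Union>p\<in>F. ball p (r p))"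
    by (rule compactE_image[OF compact_frontier_bounded[OF assms(1)] _ sub]) (simp, rule that)
  have "emeasure \<sigma> UNIV \<le> emeasure \<sigma> ((- frontier \<Omega>) \<union> (\<Union>p\<in>F. ball p (r p)))"
    using F(3) by (intro emeasure_mono) (auto simp: ss intro!: borel_open)
  also have "\<dots> \<le> emeasure \<sigma> (- frontier \<Omega>) + emeasure \<sigma> (\<Union>p\<in>F. ball p (r p))"
    by (intro emeasure_subadditive) (auto simp: ss intro!: borel_open)
  also have "emeasure \<sigma> (- frontier \<Omega>) = 0" using s by (simp add: is_surface_measure_def)
  also have "0 + emeasure \<sigma> (\<Union>p\<in>F. ball p (r p)) \<le> (\<Sum>p\<in>F. emeasure \<sigma> (ball p (r p)))"
    using F(2) by (simp, intro emeasure_subadditive_finite) (auto simp: ss intro!: borel_open)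
  also have "\<dots> < \<infinity>" using r(2) F by (auto simp: less_top[symmetric] ennreal_sum_eq_top)
  finally show ?thesis .
qed

section \<open>Lebesgue-measurable functions, distributions and Borel representatives\<close>

text \<open>Bridge between two settings: \<open>f\<close> is Lebesgue measurable on
  \<open>S\<close>, as in the definitions of the spaces, and \<open>g\<close> is its Borel
  representative on the whole space, extended by zero, as in the estimates.\<close>

definition rep :: "(real^3) set \<Rightarrow> (real^3 \<Rightarrow> real) \<Rightarrow> (real^3 \<Rightarrow> real) \<Rightarrow> bool" where
  "rep S f g \<longleftrightarrow> f \<in> borel_measurable (lebesgue_on S) \<and> g \<in> borel_measurable borel \<and>
     (\<forall>x. x \<notin> S \<longrightarrow> g x = 0) \<and> (AE x in lebesgue_on S. f x = g x)"

lemma rep_borel: "rep S f g \<Longrightarrow> g \<in> borel_measurable borel"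
  and rep_zero: "rep S f g \<Longrightarrow> x \<notin> S \<Longrightarrow> g x = 0"
  by (auto simp: rep_def)

lemma borel_lebesgue_on: "(h :: real^3 \<Rightarrow> real) \<in> borel_measurable borel \<Longrightarrow> h \<in> borel_measurable (lebesgue_on S)"
  by (intro measurable_restrict_space1 measurable_completion) simp

lemma rep_self:
  assumes "open S" "h \<in> borel_measurable borel" shows "rep S h (\<lambda>x. indicator S x * h x)"
  using assms by (auto simp: rep_def borel_lebesgue_on AE_restrict_space_iff lmeasurable_iff_integrable)

lemma ex_rep:
  assumes S: "open S" and f: "f \<in> borel_measurable (lebesgue_on S)" obtains g where "rep S f g"
proof -
  have [measurable]: "S \<in> sets borel" and sl: "S \<in> sets lebesgue" using S by auto
  from borel_measurable_if_I[OF f sl] completion_ex_borel_measurable_real obtain h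
    where h: "h \<in> borel_measurable lborel" "AE x in lborel. (if x \<in> S then f x else 0) = h x" by blast
  have "AE x in lebesgue. (if x \<in> S then f x else 0) = h x" using h(2) by (rule AE_completion)
  then have "AE x in lebesgue_on S. f x = indicator S x * h x"
    using sl by (subst AE_restrict_space_iff) (auto elim!: eventually_mono)
  then have "rep S f (\<lambda>x. indicator S x * h x)" using f h(1) by (auto simp: rep_def)
  then show ?thesis by (rule that)
qed

lemma rep_mult_borel: "rep S f g \<Longrightarrow> h \<in> borel_measurable borel \<Longrightarrow> rep S (\<lambda>x. f x * h x) (\<lambda>x. g x * h x)"
proof -
  assume r: "rep S f g" and h: "h \<in> borel_measurable borel"
  have "(\<lambda>x. f x * h x) \<in> borel_measurable (lebesgue_on S)"
    using r borel_lebesgue_on[OF h] by (intro borel_measurable_times) (auto simp: rep_def)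
  then show ?thesis using r h by (auto simp: rep_def elim!: eventually_mono)
qed

lemma rep_add:
  assumes "rep S f g" "rep S f' g'" shows "rep S (\<lambda>x. f x + f' x) (\<lambda>x. g x + g' x)"
proof -
  have "AE x in lebesgue_on S. f x = g x" "AE x in lebesgue_on S. f' x = g' x" using assms by (auto simp: rep_def)
  then have "AE x in lebesgue_on S. f x + f' x = g x + g' x" by eventually_elim simp
  with assms show ?thesis by (auto simp: rep_def)
qed

lemma rep_cmult: "rep S f g \<Longrightarrow> rep S (\<lambda>x. c * f x) (\<lambda>x. c * g x)"
  using rep_mult_borel[of S f g "\<lambda>x. c"] by (simp add: mult.commute)

lemma rep_diff: "rep S f g \<Longrightarrow> rep S f' g' \<Longrightarrow> rep S (\<lambda>x. f x - f' x) (\<lambda>x. g x - g' x)"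
  using rep_add[of S f g "\<lambda>x. (-1) * f' x" "\<lambda>x. (-1) * g' x"] rep_cmult[of S f' g' "-1"] by simp

lemma rep_sum:
  assumes "finite I" "\<And>i. i \<in> I \<Longrightarrow> rep S (f i) (g i)" shows "rep S (\<lambda>x. \<Sum>i\<in>I. f i x) (\<lambda>x. \<Sum>i\<in>I. g i x)"
  using assms
proof (induct rule: finite_induct)
  case empty
  then show ?case by (simp add: rep_def)
next
  case (insert i I)
  then show ?case using rep_add[of S "f i" "g i"] by simp
qed

lemma rep_sq: "rep S f g \<Longrightarrow> rep S (\<lambda>x. (f x)\<^sup>2) (\<lambda>x. (g x)\<^sup>2)"
  by (auto simp: rep_def elim!: eventually_mono)

lemma lebesgue_on_borel:
  assumes S: "open S" and g: "g \<in> borel_measurable borel" "\<And>x. x \<notin> S \<Longrightarrow> g x = (0::real)"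
  shows "(LINT x|lebesgue_on S. g x) = (LINT x|lborel. g x)"
    and "integrable (lebesgue_on S) g \<longleftrightarrow> integrable lborel g"
proof -
  have sl: "S \<inter> space lebesgue \<in> sets lebesgue" using S by simp
  have e: "indicator S x *\<^sub>R g x = g x" for x using g(2)[of x] by (auto simp: indicator_def)
  show "(LINT x|lebesgue_on S. g x) = (LINT x|lborel. g x)"
    using integral_restrict_space[OF sl, of g] integral_completion[of g lborel] g(1) unfolding e by simp
  show "integrable (lebesgue_on S) g \<longleftrightarrow> integrable lborel g"
    using integrable_restrict_space[OF sl, of g] integrable_completion[of g lborel] g(1) unfolding e by simp
qed

lemma rep_integral:
  assumes S: "open S" and r: "rep S f g"
  shows "(LINT x|lebesgue_on S. f x) = (LINT x|lborel. g x)"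
    and "integrable (lebesgue_on S) f \<longleftrightarrow> integrable lborel g"
proof -
  have f: "f \<in> borel_measurable (lebesgue_on S)" "g \<in> borel_measurable (lebesgue_on S)" "AE x in lebesgue_on S. f x = g x"
    using r by (auto simp: rep_def borel_lebesgue_on)
  show "(LINT x|lebesgue_on S. f x) = (LINT x|lborel. g x)"
    using integral_cong_AE[OF f] lebesgue_on_borel(1)[OF S rep_borel[OF r] rep_zero[OF r]] by simp
  show "integrable (lebesgue_on S) f \<longleftrightarrow> integrable lborel g"
    using integrable_cong_AE[OF f] lebesgue_on_borel(2)[OF S rep_borel[OF r] rep_zero[OF r]] by simp
qed

lemma rep_L2:
  assumes "open S" "rep S f g" shows "L2 S f \<longleftrightarrow> sq_int lborel g"
  using rep_integral(2)[OF assms(1) rep_sq[OF assms(2)]] assms(2) by (simp add: L2_def sq_int_def rep_def)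

lemma rep_distr:
  assumes "open S" "rep S f g" "test_function S \<phi>" shows "distr_of S f \<phi> = (LINT x|lborel. g x * \<phi> x)"
  unfolding distr_of_def by (rule rep_integral(1)[OF assms(1) rep_mult_borel[OF assms(2) tf_borel[OF assms(3)]]])

lemma distr_of_borel:
  assumes "open S" "h \<in> borel_measurable borel" "test_function S \<phi>"
  shows "distr_of S h \<phi> = (LINT x|lborel. h x * \<phi> x)"
proof -
  have "indicator S x * h x * \<phi> x = h x * \<phi> x" for x using test_function_outside[OF assms(3), of x] by (auto simp: indicator_def)
  with rep_distr[OF assms(1) rep_self[OF assms(1,2)] assms(3)] show ?thesis by simp
qed

lemma distr_of_subset:
  assumes "open S" "test_function S \<phi>" shows "distr_of S f \<phi> = distr_of UNIV f \<phi>"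
proof -
  have sl: "S \<inter> space lebesgue \<in> sets lebesgue" using assms(1) by simp
  have e: "indicator S x *\<^sub>R (f x * \<phi> x) = f x * \<phi> x" for x
    using test_function_outside[OF assms(2), of x] by (auto simp: indicator_def)
  show ?thesis
    using integral_restrict_space[OF sl, of "\<lambda>x. f x * \<phi> x"]
    unfolding e distr_of_def lebesgue_on_UNIV_eq .
qed

lemma L2_borel:
  assumes "open S" "sq_int lborel h" shows "L2 S h"
  using rep_L2[OF assms(1) rep_self[OF assms(1)]] sq_int_indicator[OF assms(2)] assms by (auto simp: sq_int_def)

lemma L2_rep:
  assumes "open S" "L2 S f" obtains g where "rep S f g" "sq_int lborel g"
proof -
  have "f \<in> borel_measurable (lebesgue_on S)" using assms(2) by (simp add: L2_def)
  then obtain g where "rep S f g" by (rule ex_rep[OF assms(1)])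
  with assms show ?thesis using that rep_L2 by blast
qed

lemma lloc_locally_integrable:
  assumes w: "lloc w" shows "locally_integrable G w"
  unfolding locally_integrable_def
proof (intro allI impI)
  fix K :: "(real^3) set" assume K: "compact K \<and> K \<subseteq> G"
  then have kb: "K \<in> sets borel" by (auto intro: borel_closed compact_imp_closed)
  then have sl: "K \<inter> space lebesgue \<in> sets lebesgue" by simp
  have "bounded K" using K by (simp add: compact_imp_bounded)
  then obtain B where "0 < B" "\<forall>x\<in>K. norm x \<le> B" unfolding bounded_pos by (elim exE conjE)
  then have e: "indicator K x *\<^sub>R w x = indicator K x *\<^sub>R (indicator (cball 0 B) x * w x)" for x
    by (auto simp: indicator_def)
  have "integrable lborel (\<lambda>x. indicator K x *\<^sub>R (indicator (cball 0 B) x * w x))"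
    using w kb by (intro integrable_mult_indicator) (auto simp: lloc_def)
  then have "integrable lborel (\<lambda>x. indicator K x *\<^sub>R w x)" unfolding e .
  moreover have "(\<lambda>x. indicator K x *\<^sub>R w x) \<in> borel_measurable lborel"
    using kb w by (auto simp: lloc_def)
  ultimately show "integrable (lebesgue_on K) w"
    by (simp only: integrable_restrict_space[OF sl] integrable_completion)
qed

lemma locally_integrable_mono: "locally_integrable UNIV v \<Longrightarrow> locally_integrable G v"
  by (simp add: locally_integrable_def)

section \<open>Multi-indices and representation of distributions\<close>

lemma mi_order_3: "mi_order l = l $ 1 + l $ 2 + l $ 3"
  by (simp add: mi_order_def sum_3)

lemma ddiff_multi_axis: "ddiff_multi (axis i 1) T = ddiff i T" "mi_order (axis i 1) = 1"
  using exhaust_3[of i] by (auto simp: ddiff_multi_def mi_order_3 axis_def)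

lemma ddiff_multi_zero: "ddiff_multi 0 T = T" "mi_order 0 = 0"
  by (simp_all add: ddiff_multi_def mi_order_3)

text \<open>Reduces multi-index notation to at most two single derivatives by listing the ten
  cases.\<close>

lemma multi_index_le_2:
  assumes "mi_order l \<le> 2"
  obtains "mi_order l = 0" "\<And>T. ddiff_multi l T = T"
  | i where "mi_order l = 1" "\<And>T. ddiff_multi l T = ddiff i T"
  | i j where "mi_order l = 2" "\<And>T. ddiff_multi l T = ddiff i (ddiff j T)"
proof -
  define a b c where "a = l $ 1" and "b = l $ 2" and "c = l $ 3"
  have m: "mi_order l = a + b + c" by (simp add: mi_order_3 a_def b_def c_def)
  have d: "ddiff_multi l T = (ddiff 1 ^^ a) ((ddiff 2 ^^ b) ((ddiff 3 ^^ c) T))" for T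
    by (simp add: ddiff_multi_def a_def b_def c_def)
  have "a + b + c \<le> 2" using assms m by simp
  then have "a = 0 \<and> b = 0 \<and> c = 0 \<or> a = 1 \<and> b = 0 \<and> c = 0 \<or> a = 0 \<and> b = 1 \<and> c = 0 \<or> a = 0 \<and> b = 0 \<and> c = 1
    \<or> a = 2 \<and> b = 0 \<and> c = 0 \<or> a = 0 \<and> b = 2 \<and> c = 0 \<or> a = 0 \<and> b = 0 \<and> c = 2
    \<or> a = 1 \<and> b = 1 \<and> c = 0 \<or> a = 1 \<and> b = 0 \<and> c = 1 \<or> a = 0 \<and> b = 1 \<and> c = 1" by arith
  then show ?thesis
  proof (elim disjE)
    assume "a = 0 \<and> b = 0 \<and> c = 0" then show ?thesis using that(1) m d by simp
  next
    assume "a = 1 \<and> b = 0 \<and> c = 0" then show ?thesis using that(2)[of 1] m d by simp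
  next
    assume "a = 0 \<and> b = 1 \<and> c = 0" then show ?thesis using that(2)[of 2] m d by simp
  next
    assume "a = 0 \<and> b = 0 \<and> c = 1" then show ?thesis using that(2)[of 3] m d by simp
  next
    assume "a = 2 \<and> b = 0 \<and> c = 0" then show ?thesis using that(3)[of 1 1] m d by (simp add: numeral_2_eq_2)
  next
    assume "a = 0 \<and> b = 2 \<and> c = 0" then show ?thesis using that(3)[of 2 2] m d by (simp add: numeral_2_eq_2)
  next
    assume "a = 0 \<and> b = 0 \<and> c = 2" then show ?thesis using that(3)[of 3 3] m d by (simp add: numeral_2_eq_2)
  next
    assume "a = 1 \<and> b = 1 \<and> c = 0" then show ?thesis using that(3)[of 1 2] m d by simp
  next
    assume "a = 1 \<and> b = 0 \<and> c = 1" then show ?thesis using that(3)[of 1 3] m d by simp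
  next
    assume "a = 0 \<and> b = 1 \<and> c = 1" then show ?thesis using that(3)[of 2 3] m d by simp
  qed
qed

text \<open>\<open>test_riesz\<close> in the language of distributions; local integrability of
  \<open>w\<close> comes from dividing by the continuous positive weight.\<close>

lemma weighted_representation:
  assumes G: "open G"
    and lin: "\<And>f g c. test_function G f \<Longrightarrow> test_function G g \<Longrightarrow> T (\<lambda>x. f x + c * g x) = T f + c * T g"
    and b: "\<exists>C\<ge>0. \<forall>\<phi>. test_function G \<phi> \<longrightarrow> \<bar>T \<phi>\<bar> \<le> C * n2 (\<lambda>x. jb (- s) x * \<phi> x)"
  shows "\<exists>w. locally_integrable G w \<and> distr_eq G T (distr_of G w) \<and> L2 G (\<lambda>x. jb s x * w x)"
proof -
  obtain C where C: "\<And>\<phi>. test_function G \<phi> \<Longrightarrow> \<bar>T \<phi>\<bar> \<le> C * n2 (\<lambda>x. jb (- s) x * \<phi> x)" using b by blast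
  obtain w where w: "w \<in> borel_measurable borel" "sq_int lborel (\<lambda>x. jb s x * w x)"
    "\<And>\<phi>. test_function G \<phi> \<Longrightarrow> T \<phi> = (LINT x|lborel. w x * \<phi> x)"
    by (rule test_riesz[where G=G and L=T and s=s and C=C, OF lin C]) (assumption+, rule that)
  have e: "jb (- s) x * (jb s x * w x) = w x" for x by (simp add: jb_minus)
  have "sqloc w"
    using sqloc_mult_continuous[OF sq_int_sqloc[OF w(2)] smooth_continuous[OF smooth_jb, of UNIV "- s"]] unfolding e .
  then have "locally_integrable G w" by (intro lloc_locally_integrable sqloc_lloc)
  moreover have "distr_eq G T (distr_of G w)"
    unfolding distr_eq_def using w(3) distr_of_borel[OF G w(1)] by simp
  ultimately show ?thesis using L2_borel[OF G w(2)] by blast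
qed

section \<open>The transmission problem\<close>

lemma pd_lin_smooth: "smooth f \<Longrightarrow> smooth g \<Longrightarrow> pd i (\<lambda>x. f x + c * g x) = (\<lambda>x. pd i f x + c * pd i g x)"
  by (simp add: pd_add_smooth pd_cmult_smooth smooth_mult)

context potential
begin

lemma u_lin:
  assumes "tf f" "tf g"
  shows "(LINT x|lborel. u x * (f x + c * g x)) = (LINT x|lborel. u x * f x) + c * (LINT x|lborel. u x * g x)"
proof -
  have "(LINT x|lborel. u x * (f x + c * g x)) = (LINT x|lborel. u x * f x + c * (u x * g x))"
    by (rule Bochner_Integration.integral_cong) (simp_all add: algebra_simps)
  then show ?thesis
    using lloc_cc_integrable[OF u_lloc cc_test[OF assms(1)]] lloc_cc_integrable[OF u_lloc cc_test[OF assms(2)]] by simp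
qed

text \<open>\<open>v\<close> is the given function and \<open>u\<close> its Borel representative.
  Orders 0 and 1 hold globally by \<open>u_L2\<close> and \<open>grad_weight\<close>. Only the
  second derivatives depend on \<open>G\<close>: compactness and the estimate at infinity reduce
  them to local bounds without weight, for test functions supported in \<open>G\<close>, so
  \<open>G\<close> may touch the boundary from one side.\<close>

lemma weighted_W_2_2:
  assumes G: "open G" and v: "locally_integrable UNIV v" "\<And>\<phi>. tf \<phi> \<Longrightarrow> distr_of UNIV v \<phi> = (LINT x|lborel. u x * \<phi> x)"
    and near: "\<And>i j x. \<exists>r>0. bdd (G \<inter> ball x r) (\<lambda>\<phi>. LINT x|lborel. p j x * pd i \<phi> x)"
  shows "weighted_W 2 2 G v"
    and "\<exists>w. locally_integrable G w \<and> distr_eq G (ddiff i (ddiff j (distr_of G v))) (distr_of G w) \<and>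
      L2 G (\<lambda>x. ((norm x)\<^sup>2 + 1) * w x)"
proof -
  have vG: "distr_of G v \<phi> = (LINT x|lborel. u x * \<phi> x)" if "test_function G \<phi>" for \<phi>
    using distr_of_subset[OF G that, of v] v(2)[OF test_function_UNIV[OF that]] by simp
  note t1 = test_function_pd and U = test_function_UNIV and sm = test_function_smooth
  have w0: "\<exists>w. locally_integrable G w \<and> distr_eq G (distr_of G v) (distr_of G w) \<and> L2 G (\<lambda>x. jb 0 x * w x)"
  proof (rule weighted_representation[OF G])
    fix f g c assume t: "test_function G f" "test_function G g"
    then have "test_function G (\<lambda>x. f x + c * g x)" by (intro test_function_add test_function_mult) auto
    with t show "distr_of G v (\<lambda>x. f x + c * g x) = distr_of G v f + c * distr_of G v g"
      by (simp add: vG u_lin U)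
  next
    show "\<exists>C\<ge>0. \<forall>\<phi>. test_function G \<phi> \<longrightarrow> \<bar>distr_of G v \<phi>\<bar> \<le> C * n2 (\<lambda>x. jb (- 0) x * \<phi> x)"
      using u_L2 U by (fastforce simp: vG)
  qed
  have w1: "\<exists>w. locally_integrable G w \<and> distr_eq G (ddiff i (distr_of G v)) (distr_of G w) \<and> L2 G (\<lambda>x. jb 1 x * w x)" for i
  proof (rule weighted_representation[OF G])
    fix f g c assume t: "test_function G f" "test_function G g"
    then have "test_function G (\<lambda>x. f x + c * g x)" by (intro test_function_add test_function_mult) auto
    from t1[OF this, of i] have "test_function G (\<lambda>x. pd i f x + c * pd i g x)" by (simp add: pd_lin_smooth sm[OF t(1)] sm[OF t(2)])
    with t show "ddiff i (distr_of G v) (\<lambda>x. f x + c * g x) = ddiff i (distr_of G v) f + c * ddiff i (distr_of G v) g"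
      unfolding ddiff_def
      by (simp add: pd_lin_smooth[OF sm[OF t(1)] sm[OF t(2)]] vG u_lin U t1)
  next
    obtain C where C: "0 \<le> C" "\<And>i \<phi>. tf \<phi> \<Longrightarrow> \<bar>LINT x|lborel. u x * pd i \<phi> x\<bar> \<le> C * n2 (\<lambda>x. jb (-1) x * \<phi> x)"
      using grad_weight by blast
    have "\<bar>ddiff i (distr_of G v) \<phi>\<bar> \<le> C * n2 (\<lambda>x. jb (- 1) x * \<phi> x)" if "test_function G \<phi>" for \<phi>
      using C(2)[OF U[OF that], of i] by (simp add: ddiff_def vG[OF t1[OF that]])
    with C(1) show "\<exists>C\<ge>0. \<forall>\<phi>. test_function G \<phi> \<longrightarrow> \<bar>ddiff i (distr_of G v) \<phi>\<bar> \<le> C * n2 (\<lambda>x. jb (- 1) x * \<phi> x)"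
      by blast
  qed
  have w2: "\<exists>w. locally_integrable G w \<and> distr_eq G (ddiff i (ddiff j (distr_of G v))) (distr_of G w) \<and> L2 G (\<lambda>x. jb 2 x * w x)" for i j
  proof (rule weighted_representation[OF G])
    fix f g c assume t: "test_function G f" "test_function G g"
    then have "test_function G (\<lambda>x. f x + c * g x)" by (intro test_function_add test_function_mult) auto
    from t1[OF t1[OF this, of i], of j] have "test_function G (\<lambda>x. pd j (pd i f) x + c * pd j (pd i g) x)"
      by (simp add: pd_lin_smooth smooth_pd sm[OF t(1)] sm[OF t(2)])
    with t show "ddiff i (ddiff j (distr_of G v)) (\<lambda>x. f x + c * g x)
        = ddiff i (ddiff j (distr_of G v)) f + c * ddiff i (ddiff j (distr_of G v)) g"
      unfolding ddiff_def
      by (simp add: pd_lin_smooth smooth_pd sm[OF t(1)] sm[OF t(2)] vG u_lin U t1)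
  next
    have "\<exists>C\<ge>0. \<forall>\<phi>. test_function G \<phi> \<longrightarrow> (\<forall>x. x \<notin> cball 0 (R0 + 4) \<longrightarrow> \<phi> x = 0) \<longrightarrow>
      \<bar>LINT x|lborel. p j x * pd i \<phi> x\<bar> \<le> C * n2 \<phi>"
    proof (rule local_to_global_bound[OF compact_cball])
      fix x show "\<exists>r>0. \<exists>C\<ge>0. \<forall>\<phi>. test_function (G \<inter> ball x r) \<phi> \<longrightarrow> \<bar>LINT x|lborel. p j x * pd i \<phi> x\<bar> \<le> C * n2 \<phi>"
        using near[of x j i] by (simp add: bdd_def)
    qed (rule p_pd_add)
    from second_weight[OF this] obtain C where C: "0 \<le> C"
      "\<And>\<phi>. test_function G \<phi> \<Longrightarrow> \<bar>LINT x|lborel. p j x * pd i \<phi> x\<bar> \<le> C * n2 (\<lambda>x. jb (-2) x * \<phi> x)" by blast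
    have "\<bar>ddiff i (ddiff j (distr_of G v)) \<phi>\<bar> \<le> C * n2 (\<lambda>x. jb (- 2) x * \<phi> x)" if "test_function G \<phi>" for \<phi>
      using C(2)[OF that] grad_u[OF U[OF t1[OF that]], of j i] by (simp add: ddiff_def vG[OF t1[OF t1[OF that]]])
    with C(1) show "\<exists>C\<ge>0. \<forall>\<phi>. test_function G \<phi> \<longrightarrow> \<bar>ddiff i (ddiff j (distr_of G v)) \<phi>\<bar> \<le> C * n2 (\<lambda>x. jb (- 2) x * \<phi> x)"
      by blast
  qed
  have "\<exists>w. locally_integrable G w \<and> distr_eq G (ddiff_multi l (distr_of G v)) (distr_of G w) \<and> L2 G (\<lambda>x. jb (real (mi_order l)) x * w x)"
    if "mi_order l \<le> 2" for l
    using that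
  proof (cases rule: multi_index_le_2)
    case 1 then show ?thesis using w0 by simp
  next
    case (2 i) then show ?thesis using w1[of i] by simp
  next
    case (3 i j) then show ?thesis using w2[of i j] by simp
  qed
  then show "weighted_W 2 2 G v"
    unfolding weighted_W_def jb_def using locally_integrable_mono[OF v(1)] by simp
  show "\<exists>w. locally_integrable G w \<and> distr_eq G (ddiff i (ddiff j (distr_of G v))) (distr_of G w) \<and>
      L2 G (\<lambda>x. ((norm x)\<^sup>2 + 1) * w x)"
    using w2[of i j] unfolding jb_2 by (simp only: add.commute[of 1])
qed

end

lemma weighted_W_imp_sobolev_H:
  assumes G: "open G" and w: "weighted_W m m G v" shows "sobolev_H m G v"
  unfolding sobolev_H_def
proof (intro conjI allI impI)
  show "locally_integrable G v" using w by (simp add: weighted_W_def)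
  fix l assume "mi_order l \<le> m"
  with w obtain z where z: "distr_eq G (ddiff_multi l (distr_of G v)) (distr_of G z)"
    "L2 G (\<lambda>x. jb (real (mi_order l)) x * z x)"
    unfolding weighted_W_def jb_def by auto
  obtain h where h: "rep G (\<lambda>x. jb (real (mi_order l)) x * z x) h" "sq_int lborel h"
    using L2_rep[OF G z(2)] by blast
  let ?k = "\<lambda>x. jb (- real (mi_order l)) x"
  have kb: "?k \<in> borel_measurable borel" by (rule smooth_borel[OF smooth_jb])
  have e: "jb (real (mi_order l)) x * z x * ?k x = z x" for x by (simp add: jb_minus)
  have k1: "?k x \<le> 1" for x :: "real^3"
  proof -
    have "(1 + (norm x)\<^sup>2) powr (- real (mi_order l) / 2) \<le> (1 + (norm x)\<^sup>2) powr 0" by (intro powr_mono) auto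
    then show ?thesis using one_norm_sq_pos[of x] by (simp add: jb_def split: if_splits)
  qed
  have "rep G z (\<lambda>x. h x * ?k x)" using rep_mult_borel[OF h(1) kb] unfolding e .
  moreover have "sq_int lborel (\<lambda>x. h x * ?k x)"
  proof (rule sq_int_bound[OF h(2)])
    show "(\<lambda>x. h x * ?k x) \<in> borel_measurable lborel" using borel_measurable_times[OF rep_borel[OF h(1)] kb] by simp
    show "AE x in lborel. \<bar>h x * ?k x\<bar> \<le> \<bar>h x\<bar>"
      using mult_left_mono[OF k1] by (auto simp: abs_mult)
  qed
  ultimately have "L2 G z" using rep_L2[OF G] by blast
  with z(1) show "\<exists>w. L2 G w \<and> distr_eq G (ddiff_multi l (distr_of G v)) (distr_of G w)" by blast
qed

text \<open>Unfolds the trace into Borel representatives \<open>vv\<close> and \<open>W\<close> of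
  the function and its weak gradient, with convergence in norm of each component, the form in which
  the approximants enter the estimates.\<close>

lemma trace_approximation:
  assumes O: "open \<Omega>" and tr: "has_trace \<Omega> \<sigma> v Dv g"
  obtains vv W V where "sq_int lborel vv" "\<And>i. sq_int lborel (W i)" "sq_int \<sigma> g" "\<And>k::nat. tf (V k)"
    "(\<lambda>k. n2 (\<lambda>x. indicator \<Omega> x * (V k x - vv x))) \<longlonglongrightarrow> 0"
    "\<And>i. (\<lambda>k. n2 (\<lambda>x. indicator \<Omega> x * (pd i (V k) x - W i x))) \<longlonglongrightarrow> 0"
    "(\<lambda>k. l2n \<sigma> (\<lambda>x. V k x - g x)) \<longlonglongrightarrow> 0"
proof -
  have H: "L2 \<Omega> v" "\<And>i. L2 \<Omega> (\<lambda>x. Dv x $ i)" and g: "sq_int \<sigma> g"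
    using tr by (auto simp: has_trace_def H1_with_grad_def L2_vec_def sq_int_def)
  obtain V where V: "\<And>k::nat. tf (V k)"
    "(\<lambda>k. LINT x|lebesgue_on \<Omega>. (V k x - v x)\<^sup>2) \<longlonglongrightarrow> 0"
    "(\<lambda>k. LINT x|lebesgue_on \<Omega>. (norm (grad (V k) x - Dv x))\<^sup>2) \<longlonglongrightarrow> 0"
    "(\<lambda>k. LINT x|\<sigma>. (V k x - g x)\<^sup>2) \<longlonglongrightarrow> 0"
    using tr unfolding has_trace_def by blast
  obtain vv where vv: "rep \<Omega> v vv" "sq_int lborel vv" using L2_rep[OF O H(1)] by blast
  have "\<forall>i. \<exists>w. rep \<Omega> (\<lambda>x. Dv x $ i) w \<and> sq_int lborel w" using L2_rep[OF O H(2)] by metis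
  then obtain W where W: "\<And>i. rep \<Omega> (\<lambda>x. Dv x $ i) (W i)" "\<And>i. sq_int lborel (W i)" by metis
  have i1: "indicator \<Omega> x * V k x - vv x = indicator \<Omega> x * (V k x - vv x)" for k x
    using rep_zero[OF vv(1), of x] by (auto simp: indicator_def)
  have i2: "indicator \<Omega> x * pd i (V k) x - W i x = indicator \<Omega> x * (pd i (V k) x - W i x)" for k i x
    using rep_zero[OF W(1), of x] by (auto simp: indicator_def)
  have r1: "rep \<Omega> (\<lambda>x. V k x - v x) (\<lambda>x. indicator \<Omega> x * (V k x - vv x))" for k
    using rep_diff[OF rep_self[OF O tf_borel[OF V(1)]] vv(1)] unfolding i1 .
  have r2: "rep \<Omega> (\<lambda>x. pd i (V k) x - Dv x $ i) (\<lambda>x. indicator \<Omega> x * (pd i (V k) x - W i x))" for k i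
    using rep_diff[OF rep_self[OF O tf_borel[OF test_function_pd[OF V(1)[of k], of i]]] W(1)[of i]] unfolding i2 .
  have s2: "sq_int lborel (\<lambda>x. indicator \<Omega> x * (pd i (V k) x - W i x))" for k i
    using sq_int_diff[OF tf_sq_int[OF test_function_pd[OF V(1)]] W(2)] O by (intro sq_int_indicator) auto
  have "(\<lambda>k. sqrt (LINT x|lebesgue_on \<Omega>. (V k x - v x)\<^sup>2)) \<longlonglongrightarrow> 0"
    using tendsto_real_sqrt[OF V(2)] by simp
  then have c1: "(\<lambda>k. n2 (\<lambda>x. indicator \<Omega> x * (V k x - vv x))) \<longlonglongrightarrow> 0"
    unfolding rep_integral(1)[OF O rep_sq[OF r1]] l2n_def .
  have le: "n2 (\<lambda>x. indicator \<Omega> x * (pd i (V k) x - W i x)) \<le> sqrt (LINT x|lebesgue_on \<Omega>. (norm (grad (V k) x - Dv x))\<^sup>2)" for i k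
  proof -
    have "(norm (grad (V k) x - Dv x))\<^sup>2 = (\<Sum>i\<in>UNIV. (pd i (V k) x - Dv x $ i)\<^sup>2)" for x
      unfolding norm_sq_vec by (simp add: grad_def)
    then have "(LINT x|lebesgue_on \<Omega>. (norm (grad (V k) x - Dv x))\<^sup>2)
        = (LINT x|lborel. (\<Sum>i\<in>UNIV. (indicator \<Omega> x * (pd i (V k) x - W i x))\<^sup>2))"
      using rep_integral(1)[OF O rep_sum[where I=UNIV and f="\<lambda>i x. (pd i (V k) x - Dv x $ i)\<^sup>2", OF finite rep_sq[OF r2]]] by simp
    also have "\<dots> = (\<Sum>i\<in>UNIV. (LINT x|lborel. (indicator \<Omega> x * (pd i (V k) x - W i x))\<^sup>2))"
      using s2 by (intro Bochner_Integration.integral_sum) (simp add: sq_int_def)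
    finally have "(LINT x|lborel. (indicator \<Omega> x * (pd i (V k) x - W i x))\<^sup>2) \<le> (LINT x|lebesgue_on \<Omega>. (norm (grad (V k) x - Dv x))\<^sup>2)"
      using member_le_sum[of i UNIV "\<lambda>i. LINT x|lborel. (indicator \<Omega> x * (pd i (V k) x - W i x))\<^sup>2"] by simp
    then show ?thesis unfolding l2n_def by (rule real_sqrt_le_mono)
  qed
  have c2: "(\<lambda>k. n2 (\<lambda>x. indicator \<Omega> x * (pd i (V k) x - W i x))) \<longlonglongrightarrow> 0" for i
  proof (rule tendsto_sandwich[OF _ _ tendsto_const])
    show "(\<lambda>k. sqrt (LINT x|lebesgue_on \<Omega>. (norm (grad (V k) x - Dv x))\<^sup>2)) \<longlonglongrightarrow> 0"
      using tendsto_real_sqrt[OF V(3)] by simp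
  qed (use le in auto)
  have c3: "(\<lambda>k. l2n \<sigma> (\<lambda>x. V k x - g x)) \<longlonglongrightarrow> 0"
    using tendsto_real_sqrt[OF V(4)] by (simp add: l2n_def)
  show ?thesis by (rule that[OF vv(2) W(2) g V(1) c1 c2 c3])
qed

lemma cc_sq_int_finite:
  assumes "emeasure \<sigma> UNIV < \<infinity>" "sets \<sigma> = sets borel" "cc f" shows "sq_int \<sigma> f"
proof -
  obtain B where B: "0 < B" "\<And>x. \<bar>f x\<bar> \<le> B" using assms(3) by (rule cc_bounded) (rule that)
  have sp: "space \<sigma> = UNIV" using sets_eq_imp_space_eq[OF assms(2)] by simp
  interpret finite_measure \<sigma> by standard (use assms(1) sp in simp)
  have m: "f \<in> borel_measurable \<sigma>" using cc_borel[OF assms(3)] by (simp add: measurable_cong_sets[OF assms(2) refl])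
  have "norm ((f x)\<^sup>2) \<le> B\<^sup>2" for x using power_mono[OF B(2)[of x], of 2] by simp
  then have "integrable \<sigma> (\<lambda>x. (f x)\<^sup>2)"
    using m by (intro integrable_const_bound[where B="B\<^sup>2"]) auto
  with m show ?thesis by (simp add: sq_int_def)
qed

lemma tendsto_pairing:
  assumes a: "\<And>k::nat. sq_int M (a k)" "sq_int M b" and h: "sq_int M h"
    and l: "(\<lambda>k. l2n M (\<lambda>x. a k x - b x)) \<longlonglongrightarrow> 0"
  shows "(\<lambda>k. LINT x|M. a k x * h x) \<longlonglongrightarrow> (LINT x|M. b x * h x)"
proof -
  have b: "norm ((LINT x|M. a k x * h x) - (LINT x|M. b x * h x)) \<le> l2n M (\<lambda>x. a k x - b x) * l2n M h" for k
  proof -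
    have "(LINT x|M. a k x * h x) - (LINT x|M. b x * h x) = (LINT x|M. (a k x - b x) * h x)"
      using sq_int_integrable_mult[OF a(1) h] sq_int_integrable_mult[OF a(2) h] by (simp add: left_diff_distrib)
    then show ?thesis using l2n_CS[OF sq_int_diff[OF a(1,2)] h] by simp
  qed
  have "(\<lambda>k. l2n M (\<lambda>x. a k x - b x) * l2n M h) \<longlonglongrightarrow> 0"
    by (rule tendsto_mult_left_zero[OF l])
  with always_eventually[OF allI[OF b]]
  have "(\<lambda>k. (LINT x|M. a k x * h x) - (LINT x|M. b x * h x)) \<longlonglongrightarrow> 0"
    by (rule Lim_null_comparison)
  then show ?thesis by (rule LIM_zero_cancel)
qed

text \<open>\<open>surface_by_parts\<close> for the products of \<open>V k\<close> with \<phi>, in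
  the limit. The vertical derivative falls either on \<phi> or on the approximant, where it
  converges to a component of the weak gradient of the extension.\<close>

lemma (in chart) trace_by_parts:
  assumes O: "open \<Omega>" and s: "is_surface_measure \<Omega> \<sigma>" and fin: "emeasure \<sigma> UNIV < \<infinity>"
    and vv: "sq_int lborel vv" "\<And>i. sq_int lborel (W i)" "sq_int \<sigma> g" and V: "\<And>k::nat. tf (V k)"
    and lim: "(\<lambda>k. n2 (\<lambda>x. indicator \<Omega> x * (V k x - vv x))) \<longlonglongrightarrow> 0"
      "\<And>i. (\<lambda>k. n2 (\<lambda>x. indicator \<Omega> x * (pd i (V k) x - W i x))) \<longlonglongrightarrow> 0"
      "(\<lambda>k. l2n \<sigma> (\<lambda>x. V k x - g x)) \<longlonglongrightarrow> 0"
    and t: "test_function (ball x0 r) \<phi>"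
  shows "(LINT x|\<sigma>. g x * \<phi> x) = - ((LINT x|lborel. indicator \<Omega> x * vv x * (J2d (yc x) * dd e3 \<phi> x))
      + (\<Sum>i\<in>UNIV. LINT x|lborel. indicator \<Omega> x * W i x * (J2d (yc x) * (e3 $ i * \<phi> x))))"
proof -
  have ss: "sets \<sigma> = sets borel" using s by (simp add: is_surface_measure_def)
  have ob: "\<Omega> \<in> sets borel" using O by auto
  have Jc: "continuous_on UNIV (\<lambda>x. J2d (yc x))"
    by (rule continuous_on_compose2[OF J2d_continuous[of UNIV] yc_continuous]) auto
  have cd: "cc (\<lambda>x. J2d (yc x) * dd e3 \<phi> x)" by (intro cc_mult Jc cc_test[OF test_function_dd[OF t]])
  have cp: "cc (\<lambda>x. J2d (yc x) * (e3 $ i * \<phi> x))" for i by (intro cc_mult[OF Jc] cc_cmult cc_test[OF t])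
  have sV: "sq_int lborel (\<lambda>x. indicator \<Omega> x * V k x)" for k by (rule sq_int_indicator[OF tf_sq_int[OF V] ob])
  have sP: "sq_int lborel (\<lambda>x. indicator \<Omega> x * pd i (V k) x)" for k i
    by (rule sq_int_indicator[OF tf_sq_int[OF test_function_pd[OF V]] ob])
  have d: "(\<lambda>k. n2 (\<lambda>x. indicator \<Omega> x * V k x - indicator \<Omega> x * vv x)) \<longlonglongrightarrow> 0"
    "(\<lambda>k. n2 (\<lambda>x. indicator \<Omega> x * pd i (V k) x - indicator \<Omega> x * W i x)) \<longlonglongrightarrow> 0" for i
    using lim(1) lim(2)[of i] by (simp_all only: right_diff_distrib)
  have l1: "(\<lambda>k. LINT x|\<sigma>. V k x * \<phi> x) \<longlonglongrightarrow> (LINT x|\<sigma>. g x * \<phi> x)"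
    by (rule tendsto_pairing[OF cc_sq_int_finite[OF fin ss cc_test[OF V]] vv(3) cc_sq_int_finite[OF fin ss cc_test[OF t]] lim(3)])
  have l2: "(\<lambda>k. LINT x|lborel. indicator \<Omega> x * V k x * (J2d (yc x) * dd e3 \<phi> x))
      \<longlonglongrightarrow> (LINT x|lborel. indicator \<Omega> x * vv x * (J2d (yc x) * dd e3 \<phi> x))"
    by (rule tendsto_pairing[OF sV sq_int_indicator[OF vv(1) ob] cc_sq_int[OF cd] d(1)])
  have l3: "(\<lambda>k. LINT x|lborel. indicator \<Omega> x * pd i (V k) x * (J2d (yc x) * (e3 $ i * \<phi> x)))
      \<longlonglongrightarrow> (LINT x|lborel. indicator \<Omega> x * W i x * (J2d (yc x) * (e3 $ i * \<phi> x)))" for i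
    by (rule tendsto_pairing[OF sP sq_int_indicator[OF vv(2) ob] cc_sq_int[OF cp] d(2)])
  have k: "(LINT x|\<sigma>. V k x * \<phi> x) = - ((LINT x|lborel. indicator \<Omega> x * V k x * (J2d (yc x) * dd e3 \<phi> x))
      + (\<Sum>i\<in>UNIV. LINT x|lborel. indicator \<Omega> x * pd i (V k) x * (J2d (yc x) * (e3 $ i * \<phi> x))))" for k
  proof -
    have "test_function (ball x0 r) (\<lambda>x. V k x * \<phi> x)" by (intro test_function_mult test_function_smooth[OF V] t)
    from surface_by_parts[OF s this]
    have "(LINT x|\<sigma>. V k x * \<phi> x) = - (LINT x|lborel. indicator \<Omega> x * (J2d (yc x) * dd e3 (\<lambda>x. V k x * \<phi> x) x))" .
    also have "(LINT x|lborel. indicator \<Omega> x * (J2d (yc x) * dd e3 (\<lambda>x. V k x * \<phi> x) x))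
      = (LINT x|lborel. indicator \<Omega> x * V k x * (J2d (yc x) * dd e3 \<phi> x)
         + (\<Sum>i\<in>UNIV. indicator \<Omega> x * pd i (V k) x * (J2d (yc x) * (e3 $ i * \<phi> x))))"
    proof (rule Bochner_Integration.integral_cong[OF refl])
      fix x
      have "dd e3 (\<lambda>x. V k x * \<phi> x) x = V k x * dd e3 \<phi> x + (\<Sum>i\<in>UNIV. e3 $ i * pd i (V k) x) * \<phi> x"
        unfolding dd_mult_smooth[OF test_function_smooth[OF V] test_function_smooth[OF t]]
        by (simp only: dd_def[of e3 "V k"])
      then show "indicator \<Omega> x * (J2d (yc x) * dd e3 (\<lambda>x. V k x * \<phi> x) x) = indicator \<Omega> x * V k x * (J2d (yc x) * dd e3 \<phi> x)
         + (\<Sum>i\<in>UNIV. indicator \<Omega> x * pd i (V k) x * (J2d (yc x) * (e3 $ i * \<phi> x)))"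
        by (simp add: sum_3 algebra_simps)
    qed
    also have "\<dots> = (LINT x|lborel. indicator \<Omega> x * V k x * (J2d (yc x) * dd e3 \<phi> x))
         + (LINT x|lborel. (\<Sum>i\<in>UNIV. indicator \<Omega> x * pd i (V k) x * (J2d (yc x) * (e3 $ i * \<phi> x))))"
      by (intro Bochner_Integration.integral_add Bochner_Integration.integrable_sum
          sq_int_integrable_mult[OF sV cc_sq_int[OF cd]] sq_int_integrable_mult[OF sP cc_sq_int[OF cp]])
    also have "(LINT x|lborel. (\<Sum>i\<in>UNIV. indicator \<Omega> x * pd i (V k) x * (J2d (yc x) * (e3 $ i * \<phi> x))))
        = (\<Sum>i\<in>UNIV. LINT x|lborel. indicator \<Omega> x * pd i (V k) x * (J2d (yc x) * (e3 $ i * \<phi> x)))"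
      by (intro Bochner_Integration.integral_sum sq_int_integrable_mult[OF sP cc_sq_int[OF cp]])
    finally show ?thesis .
  qed
  have "(\<lambda>k. LINT x|\<sigma>. V k x * \<phi> x) \<longlonglongrightarrow> - ((LINT x|lborel. indicator \<Omega> x * vv x * (J2d (yc x) * dd e3 \<phi> x))
      + (\<Sum>i\<in>UNIV. LINT x|lborel. indicator \<Omega> x * W i x * (J2d (yc x) * (e3 $ i * \<phi> x))))"
    unfolding k by (intro tendsto_minus tendsto_add l2 tendsto_sum l3)
  with l1 show ?thesis by (rule LIMSEQ_unique)
qed

text \<open>\<open>D\<close> plays the role of the extension of \<open>div M\<close> by zero, and \<open>g\<close> that of the normal trace of \<open>M\<close>.\<close>

locale transmission = potential u p m R0 for u p m R0 +
  fixes \<Omega> :: "(real^3) set" and \<sigma> :: "(real^3) measure" and D g :: "real^3 \<Rightarrow> real"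
  assumes O: "open \<Omega>" and s: "is_surface_measure \<Omega> \<sigma>" and fin: "emeasure \<sigma> UNIV < \<infinity>"
    and D_sq: "sq_int lborel D"
    and green: "\<And>\<phi>. tf \<phi> \<Longrightarrow> (LINT x|lborel. u x * lap \<phi> x) = (LINT x|lborel. D x * \<phi> x) - (LINT x|\<sigma>. g x * \<phi> x)"
begin

text \<open>\<sigma> is concentrated on the frontier, where \<phi> vanishes.\<close>

lemma green_off_frontier:
  assumes t: "test_function (- frontier \<Omega>) \<phi>"
  shows "(LINT x|lborel. u x * lap \<phi> x) = (LINT x|lborel. D x * \<phi> x)"
proof -
  have "sets \<sigma> = sets borel" "emeasure \<sigma> (- frontier \<Omega>) = 0" using s by (auto simp: is_surface_measure_def)
  then have "- frontier \<Omega> \<in> null_sets \<sigma>" by (auto simp: null_sets_def intro!: borel_open)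
  then have "AE x in \<sigma>. x \<notin> - frontier \<Omega>" by (rule AE_not_in)
  then have "AE x in \<sigma>. g x * \<phi> x = 0"
    by eventually_elim (use test_function_outside[OF t] in auto)
  then have "(LINT x|\<sigma>. g x * \<phi> x) = 0" by (rule integral_eq_zero_AE)
  with green[OF test_function_UNIV[OF t]] show ?thesis by simp
qed

lemma bound_from_equation:
  assumes "0 < r" "\<And>\<phi>. test_function (ball x0 r) \<phi> \<Longrightarrow> (LINT x|lborel. u x * lap \<phi> x) = (LINT x|lborel. D x * \<phi> x)"
  shows "\<exists>r>0. \<forall>i j. bdd (ball x0 r) (\<lambda>\<phi>. LINT x|lborel. p j x * pd i \<phi> x)"
  using second_interior[OF assms(1) D_sq assms(2)] assms(1) unfolding bdd_def by (intro exI[of _ "r/2"]) simp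

lemma interior_bound:
  assumes "x0 \<notin> frontier \<Omega>"
  shows "\<exists>r>0. \<forall>i j. bdd (ball x0 r) (\<lambda>\<phi>. LINT x|lborel. p j x * pd i \<phi> x)"
proof -
  have "open (- frontier \<Omega>)" by (simp add: open_Compl)
  with assms obtain r where r: "0 < r" "ball x0 r \<subseteq> - frontier \<Omega>"
    by (meson ComplI openE)
  show ?thesis by (rule bound_from_equation[OF r(1) green_off_frontier[OF test_function_mono[OF _ r(2)]]])
qed

text \<open>The radii shrink as r, r/2, r/3: the equation with \<open>f\<close> and \<open>h\<close>
  holds in the largest ball, increments of \<open>h\<close> are controlled in the middle one, and
  second derivatives in the smallest. From the latter the frontier is removed, because off it the
  equation has the square-integrable right-hand side that normal regularity requires.\<close>

lemma boundary_bound: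
  assumes ch: "graph_chart \<Omega> x0 r A \<psi>" and tr: "has_trace \<Omega> \<sigma> v Dv g"
  shows "\<exists>r>0. \<forall>i j. bdd (ball x0 r - frontier \<Omega>) (\<lambda>\<phi>. LINT x|lborel. p j x * pd i \<phi> x)"
proof -
  interpret C: chart \<Omega> x0 r A \<psi> by unfold_locales (rule ch)
  obtain L where gf: "graph_flow C.Psi C.DP C.e3 L" using C.ex_graph_flow by blast
  interpret F: potential_flow u p m R0 C.Psi C.DP C.e3 L
    by (intro potential_flow.intro potential_axioms gf)
  obtain vv W V where vv: "sq_int lborel vv" "\<And>i. sq_int lborel (W i)" "sq_int \<sigma> g" and V: "\<And>k::nat. tf (V k)"
    and lim: "(\<lambda>k. n2 (\<lambda>x. indicator \<Omega> x * (V k x - vv x))) \<longlonglongrightarrow> 0"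
      "\<And>i. (\<lambda>k. n2 (\<lambda>x. indicator \<Omega> x * (pd i (V k) x - W i x))) \<longlonglongrightarrow> 0"
      "(\<lambda>k. l2n \<sigma> (\<lambda>x. V k x - g x)) \<longlonglongrightarrow> 0"
    by (rule trace_approximation[OF O tr]) (rule that)
  have ob: "\<Omega> \<in> sets borel" using O by auto
  have bb: "ball x0 r \<in> sets borel" by auto
  have jac: "F.jac x = C.J2d (C.yc x)" for x by (simp add: F.jac_def C.J2d_yc)
  \<comment> \<open>\<open>f\<close> is \<open>D\<close> plus the area density times the vertical
    derivative of the extension of the normal trace, and \<open>h\<close> is the area density times
    the extension. The density is constant along \<open>C.e3\<close> and contributes no
    derivative.\<close>
  define f where "f x = D x + indicator (\<Omega> \<inter> ball x0 r) x * (F.jac x * (\<Sum>i\<in>UNIV. C.e3 $ i * W i x))" for x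
  define h where "h x = indicator (\<Omega> \<inter> ball x0 r) x * (F.jac x * vv x)" for x
  have cut: "sq_int lborel (\<lambda>x. indicator (\<Omega> \<inter> ball x0 r) x * (F.jac x * w x))" if w: "sq_int lborel w" for w
  proof -
    obtain B where "0 < B" "ball x0 r \<subseteq> cball 0 B"
    proof -
      have "bounded (ball x0 r)" by simp
      then obtain B where "0 < B" "\<forall>x\<in>ball x0 r. norm x \<le> B" unfolding bounded_pos by (elim exE conjE)
      then show ?thesis by (intro that[of B]) auto
    qed
    then have e: "indicator (\<Omega> \<inter> ball x0 r) x * (F.jac x * w x)
        = indicator (\<Omega> \<inter> ball x0 r) x * (indicator (cball 0 B) x * (F.jac x * w x))" for x
      by (auto simp: indicator_def)
    have "sq_int lborel (\<lambda>x. indicator (cball 0 B) x * (F.jac x * w x))"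
      using sqloc_mult_continuous[OF sq_int_sqloc[OF w] F.jac_continuous] by (simp add: sqloc_def)
    then show ?thesis unfolding e by (rule sq_int_indicator) (use ob bb in auto)
  qed
  have Ws: "sq_int lborel (\<lambda>x. \<Sum>i\<in>UNIV. C.e3 $ i * W i x)" by (intro sq_int_sum sq_int_cmult vv)
  have f_sq: "sq_int lborel f" unfolding f_def[abs_def] by (intro sq_int_add D_sq cut Ws)
  have h_sq: "sq_int lborel h" unfolding h_def[abs_def] by (intro cut vv)
  have eq: "(LINT x|lborel. u x * lap \<phi> x) = (LINT x|lborel. f x * \<phi> x) + (LINT x|lborel. h x * dd C.e3 \<phi> x)"
    if t: "test_function (ball x0 r) \<phi>" for \<phi>
  proof -
    have z: "\<phi> x = 0" "dd C.e3 \<phi> x = 0" if "x \<notin> ball x0 r" for x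
      using test_function_outside[OF t that] test_function_outside[OF test_function_dd[OF t] that] by auto
    have e1: "indicator \<Omega> x * vv x * (C.J2d (C.yc x) * dd C.e3 \<phi> x) = h x * dd C.e3 \<phi> x" for x
      using z[of x] by (cases "x \<in> ball x0 r") (auto simp: h_def jac indicator_def)
    have Jc: "continuous_on UNIV (\<lambda>x. C.J2d (C.yc x))"
      by (rule continuous_on_compose2[OF C.J2d_continuous[of UNIV] C.yc_continuous]) auto
    have i: "integrable lborel (\<lambda>x. indicator \<Omega> x * W i x * (C.J2d (C.yc x) * (C.e3 $ i * \<phi> x)))" for i
      by (intro sq_int_integrable_mult sq_int_indicator vv ob cc_sq_int cc_mult[OF Jc] cc_cmult cc_test[OF t])
    have "(\<Sum>i\<in>UNIV. LINT x|lborel. indicator \<Omega> x * W i x * (C.J2d (C.yc x) * (C.e3 $ i * \<phi> x)))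
        = (LINT x|lborel. (\<Sum>i\<in>UNIV. indicator \<Omega> x * W i x * (C.J2d (C.yc x) * (C.e3 $ i * \<phi> x))))"
      by (rule Bochner_Integration.integral_sum[symmetric]) (rule i)
    also have "\<dots> = (LINT x|lborel. f x * \<phi> x - D x * \<phi> x)"
    proof (rule Bochner_Integration.integral_cong[OF refl])
      fix x
      show "(\<Sum>i\<in>UNIV. indicator \<Omega> x * W i x * (C.J2d (C.yc x) * (C.e3 $ i * \<phi> x))) = f x * \<phi> x - D x * \<phi> x"
        using z[of x] by (cases "x \<in> ball x0 r") (auto simp: f_def jac indicator_def sum_3 algebra_simps)
    qed
    also have "\<dots> = (LINT x|lborel. f x * \<phi> x) - (LINT x|lborel. D x * \<phi> x)"
      using f_sq D_sq tf_sq_int[OF t] by (intro Bochner_Integration.integral_diff sq_int_integrable_mult)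
    finally have "(LINT x|\<sigma>. g x * \<phi> x) = - ((LINT x|lborel. h x * dd C.e3 \<phi> x)
        + ((LINT x|lborel. f x * \<phi> x) - (LINT x|lborel. D x * \<phi> x)))"
      using C.trace_by_parts[OF O s fin vv V lim t] by (simp only: e1)
    then show ?thesis using green[OF test_function_UNIV[OF t]] by simp
  qed
  interpret I: potential_interface u p m R0 C.Psi C.DP C.e3 L x0 r f h
    by unfold_locales (use C.r_pos f_sq h_sq eq in auto)
  \<comment> \<open>Norm convergence makes the approximants bounded, as
    \<open>trace_flow_bound\<close> asks for bounds uniform in \<open>k\<close>.\<close>
  have V1: "\<exists>C. \<forall>k. n2 (\<lambda>x. indicator \<Omega> x * V k x) \<le> C"
    and V2: "\<exists>C. \<forall>k i. n2 (\<lambda>x. indicator \<Omega> x * pd i (V k) x) \<le> C"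
  proof -
    have gen: "\<exists>C. \<forall>k. n2 (\<lambda>x. indicator \<Omega> x * a k x) \<le> C"
      if a: "\<And>k::nat. tf (a k)" and b: "sq_int lborel b" and l: "(\<lambda>k. n2 (\<lambda>x. indicator \<Omega> x * (a k x - b x))) \<longlonglongrightarrow> 0" for a b
    proof -
      have "Bseq (\<lambda>k. n2 (\<lambda>x. indicator \<Omega> x * (a k x - b x)))" using l by (intro convergent_imp_Bseq convergentI)
      then obtain K where K: "\<And>k. norm (n2 (\<lambda>x. indicator \<Omega> x * (a k x - b x))) \<le> K" unfolding Bseq_def by blast
      have "n2 (\<lambda>x. indicator \<Omega> x * a k x) \<le> K + n2 (\<lambda>x. indicator \<Omega> x * b x)" for k
      proof -
        have "n2 (\<lambda>x. indicator \<Omega> x * (a k x - b x) + indicator \<Omega> x * b x)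
            \<le> n2 (\<lambda>x. indicator \<Omega> x * (a k x - b x)) + n2 (\<lambda>x. indicator \<Omega> x * b x)"
          by (intro l2n_triangle sq_int_indicator sq_int_diff tf_sq_int[OF a] b ob)
        moreover have "indicator \<Omega> x * (a k x - b x) + indicator \<Omega> x * b x = indicator \<Omega> x * a k x" for x
          by (simp add: algebra_simps)
        ultimately show ?thesis using K[of k] by simp
      qed
      then show ?thesis by blast
    qed
    show "\<exists>C. \<forall>k. n2 (\<lambda>x. indicator \<Omega> x * V k x) \<le> C" by (rule gen[OF V vv(1) lim(1)])
    have "\<forall>i. \<exists>C. \<forall>k. n2 (\<lambda>x. indicator \<Omega> x * pd i (V k) x) \<le> C"
      using gen[OF test_function_pd[OF V] vv(2) lim(2)] by blast
    then obtain c where c: "\<And>i k. n2 (\<lambda>x. indicator \<Omega> x * pd i (V k) x) \<le> c i" by metis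
    have "n2 (\<lambda>x. indicator \<Omega> x * pd i (V k) x) \<le> Max (range c)" for i k
      by (rule order_trans[OF c Max_ge]) auto
    then show "\<exists>C. \<forall>k i. n2 (\<lambda>x. indicator \<Omega> x * pd i (V k) x) \<le> C" by blast
  qed
  obtain C0 C1 where C01: "\<And>k. n2 (\<lambda>x. indicator \<Omega> x * V k x) \<le> C0" "\<And>k i. n2 (\<lambda>x. indicator \<Omega> x * pd i (V k) x) \<le> C1"
    using V1 V2 by metis
  have q: "bdd (ball x0 (r/3)) (\<lambda>\<phi>. LINT x|lborel. F.qa a x * pd i \<phi> x)" if a: "a \<bullet> C.e3 = 0" for a i
  proof -
    \<comment> \<open>For \<open>a\<close> orthogonal to \<open>C.e3\<close> the flow changes the
      height by exactly the increment of \<open>C.Psi\<close>, so the sign of the height above the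
      graph is preserved.\<close>
    have sd: "F.flow a s x \<in> \<Omega> \<longleftrightarrow> x \<in> \<Omega>" if "x \<in> ball x0 r" "F.flow a s x \<in> ball x0 r" for x s
    proof -
      have "C.tc (F.flow a s x) = C.tc x + (C.Psi (x + s *\<^sub>R a) - C.Psi x)"
        using a by (simp add: C.tc_def F.flow_def inner_add_right inner_diff_right inner_commute[of _ a])
      then show ?thesis using C.Omega_iff[OF that(1)] C.Omega_iff[OF that(2)] F.Psi_flow[of a s x] by simp
    qed
    have "\<exists>C\<ge>0. \<exists>s0>0. \<forall>q s. test_function (ball x0 (r/2)) q \<longrightarrow> \<bar>s\<bar> \<le> s0 \<longrightarrow>
      \<bar>LINT x|lborel. h x * (q (F.flow a s x) - q x)\<bar> \<le> C * \<bar>s\<bar> * n2 q"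
      by (rule F.trace_flow_bound[OF _ _ O sd vv(1) V lim(1) C01]) (use C.r_pos in \<open>auto simp: h_def[abs_def]\<close>)
    from I.tangential_regularity[OF _ _ _ this, of "r/3"] C.r_pos
    show ?thesis unfolding bdd_def by auto
  qed
  have "bdd (ball x0 (r/3) - frontier \<Omega>) (\<lambda>\<phi>. LINT x|lborel. p j x * pd i \<phi> x)" for i j
  proof -
    obtain B where B: "ball x0 (r/3) - frontier \<Omega> \<subseteq> cball 0 B"
    proof -
      have "bounded (ball x0 (r/3) - frontier \<Omega>)" by (rule bounded_diff) simp
      then obtain B where "\<forall>x\<in>ball x0 (r/3) - frontier \<Omega>. norm x \<le> B" unfolding bounded_iff by (elim exE)
      then show ?thesis by (intro that[of B]) auto
    qed
    show ?thesis
    proof (rule F.normal_regularity[OF B C.frame sq_int_sqloc[OF D_sq]])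
      fix \<phi> assume "test_function (ball x0 (r/3) - frontier \<Omega>) \<phi>"
      then show "(LINT x|lborel. u x * lap \<phi> x) = (LINT x|lborel. D x * \<phi> x)"
        by (intro green_off_frontier) (rule test_function_mono, auto)
    qed (intro bdd_mono[OF q] C.inner_e; blast)+
  qed
  then show ?thesis using C.r_pos by (intro exI[of _ "r/3"]) simp
qed

lemma near_bound:
  assumes "C11_boundary \<Omega>" "boundary_H_half \<Omega> \<sigma> g"
  shows "\<exists>r>0. bdd (ball x0 r - frontier \<Omega>) (\<lambda>\<phi>. LINT x|lborel. p j x * pd i \<phi> x)"
proof (cases "x0 \<in> frontier \<Omega>")
  case True
  then obtain r A \<psi> where "graph_chart \<Omega> x0 r A \<psi>" using assms(1) by (auto simp: C11_boundary_def)
  moreover obtain v Dv where "has_trace \<Omega> \<sigma> v Dv g" using assms(2) by (auto simp: boundary_H_half_def)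
  ultimately show ?thesis using boundary_bound by blast
next
  case False
  from interior_bound[OF this] obtain r where "0 < r" "bdd (ball x0 r) (\<lambda>\<phi>. LINT x|lborel. p j x * pd i \<phi> x)" by blast
  then show ?thesis using bdd_mono[OF _ Diff_subset] by blast
qed

end

section \<open>From the distributional problem to the potential\<close>

lemma distr_of_indicator:
  assumes S: "open S" and r: "rep S f g" and t: "tf \<phi>"
  shows "distr_of UNIV (\<lambda>x. indicator S x * f x) \<phi> = (LINT x|lborel. g x * \<phi> x)"
proof -
  have sl: "S \<inter> space lebesgue \<in> sets lebesgue" using S by simp
  have "distr_of UNIV (\<lambda>x. indicator S x * f x) \<phi> = (LINT x|lebesgue_on S. f x * \<phi> x)"
    using integral_restrict_space[OF sl, of "\<lambda>x. f x * \<phi> x"]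
    by (simp add: distr_of_def lebesgue_on_UNIV_eq mult.assoc)
  then show ?thesis using rep_integral(1)[OF S rep_mult_borel[OF r tf_borel[OF t]]] by simp
qed

lemma weighted_W_rep:
  assumes w: "weighted_W m k UNIV v" "mi_order l \<le> m"
  obtains h where "h \<in> borel_measurable borel"
    "sq_int lborel (\<lambda>x. jb (real k + real (mi_order l) - real m) x * h x)"
    "\<And>\<phi>. tf \<phi> \<Longrightarrow> ddiff_multi l (distr_of UNIV v) \<phi> = (LINT x|lborel. h x * \<phi> x)"
proof -
  let ?s = "real k + real (mi_order l) - real m"
  obtain z where z: "distr_eq UNIV (ddiff_multi l (distr_of UNIV v)) (distr_of UNIV z)" "L2 UNIV (\<lambda>x. jb ?s x * z x)"
    using w unfolding weighted_W_def jb_def by blast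
  obtain h where h: "rep UNIV (\<lambda>x. jb ?s x * z x) h" "sq_int lborel h" using L2_rep[OF open_UNIV z(2)] by blast
  have e: "jb ?s x * z x * jb (- ?s) x = z x" "jb ?s x * (h x * jb (- ?s) x) = h x" for x
    unfolding jb_minus by simp_all
  have r: "rep UNIV z (\<lambda>x. h x * jb (- ?s) x)"
    using rep_mult_borel[OF h(1) smooth_borel[OF smooth_jb[of "- ?s"]]] unfolding e .
  show ?thesis
  proof (rule that[OF rep_borel[OF r]])
    show "sq_int lborel (\<lambda>x. jb ?s x * (h x * jb (- ?s) x))" unfolding e by (rule h(2))
    show "ddiff_multi l (distr_of UNIV v) \<phi> = (LINT x|lborel. h x * jb (- ?s) x * \<phi> x)" if "tf \<phi>" for \<phi>
      using z(1) rep_distr[OF open_UNIV r that] that unfolding distr_eq_def by simp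
  qed
qed

text \<open>Replaces the solution, its weak gradient and the extension of \<open>M\<close> by Borel
  functions on the whole space; \<open>R0\<close> is the radius of a ball containing \<Omega>, so
  \<open>m\<close> vanishes beyond it.\<close>

lemma potential_of_solution:
  assumes O: "open \<Omega>" "bounded \<Omega>" and M: "L2_vec \<Omega> M" and w: "weighted_W 1 0 UNIV u"
    and eq: "distr_eq UNIV (distr_laplacian (distr_of UNIV u))
           (distr_div (\<lambda>i. distr_of UNIV (\<lambda>x. indicator \<Omega> x * M x $ i)))"
  obtains U P m R0 where "potential U P m R0" "\<And>i. rep \<Omega> (\<lambda>x. M x $ i) (m i)"
    "\<And>\<phi>. tf \<phi> \<Longrightarrow> distr_of UNIV u \<phi> = (LINT x|lborel. U x * \<phi> x)"
proof -
  obtain U where U: "U \<in> borel_measurable borel" "sq_int lborel (\<lambda>x. jb (-1) x * U x)"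
    "\<And>\<phi>. tf \<phi> \<Longrightarrow> distr_of UNIV u \<phi> = (LINT x|lborel. U x * \<phi> x)"
    by (rule weighted_W_rep[OF w, of 0]) (auto simp: ddiff_multi_zero)
  have "\<exists>h. sq_int lborel h \<and> (\<forall>\<phi>. tf \<phi> \<longrightarrow> ddiff i (distr_of UNIV u) \<phi> = (LINT x|lborel. h x * \<phi> x))" for i
    by (rule weighted_W_rep[OF w, of "axis i 1"]) (auto simp: ddiff_multi_axis simp del: One_nat_def)
  then obtain P where P: "\<And>i. sq_int lborel (P i)"
    "\<And>i \<phi>. tf \<phi> \<Longrightarrow> ddiff i (distr_of UNIV u) \<phi> = (LINT x|lborel. P i x * \<phi> x)" by metis
  have "\<forall>i. \<exists>h. rep \<Omega> (\<lambda>x. M x $ i) h \<and> sq_int lborel h" using L2_rep[OF O(1)] M unfolding L2_vec_def by metis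
  then obtain m where m: "\<And>i. rep \<Omega> (\<lambda>x. M x $ i) (m i)" "\<And>i. sq_int lborel (m i)" by metis
  obtain R0 where R0: "0 < R0" "\<forall>x\<in>\<Omega>. norm x \<le> R0" using O(2) unfolding bounded_pos by (elim exE conjE)
  have "potential U P m R0"
  proof
    fix i \<phi> assume t: "tf \<phi>"
    show "(LINT x|lborel. U x * pd i \<phi> x) = - (LINT x|lborel. P i x * \<phi> x)"
      using P(2)[OF t, of i] U(3)[OF test_function_pd[OF t]] by (simp add: ddiff_def)
  next
    fix i and x :: "real^3" assume "R0 < norm x"
    with R0(2) have "x \<notin> \<Omega>" by fastforce
    then show "m i x = 0" using rep_zero[OF m(1)] by blast
  next
    fix \<phi> assume t: "tf \<phi>"
    have i: "integrable lborel (\<lambda>x. U x * pd i (pd i \<phi>) x)" for i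
    proof -
      have e: "jb (-1) x * U x * (jb 1 x * pd i (pd i \<phi>) x) = U x * pd i (pd i \<phi>) x" for x
        by (simp add: jb_minus)
      have "sq_int lborel (\<lambda>x. jb 1 x * pd i (pd i \<phi>) x)"
        by (intro tf_sq_int[OF test_function_mult[OF smooth_jb test_function_pd[OF test_function_pd[OF t]]]])
      from sq_int_integrable_mult[OF U(2) this] show ?thesis unfolding e .
    qed
    have "(LINT x|lborel. U x * lap \<phi> x) = (\<Sum>i\<in>UNIV. LINT x|lborel. U x * pd i (pd i \<phi>) x)"
      unfolding lap_def sum_distrib_left using i by (intro Bochner_Integration.integral_sum)
    also have "\<dots> = distr_laplacian (distr_of UNIV u) \<phi>"
      by (simp add: distr_laplacian_def ddiff_def U(3)[OF test_function_pd[OF test_function_pd[OF t]]])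
    also have "\<dots> = distr_div (\<lambda>i. distr_of UNIV (\<lambda>x. indicator \<Omega> x * M x $ i)) \<phi>"
      using eq t by (simp add: distr_eq_def)
    also have "\<dots> = - (\<Sum>i\<in>UNIV. LINT x|lborel. m i x * pd i \<phi> x)"
      by (simp add: distr_div_def ddiff_def distr_of_indicator[OF O(1) m(1) test_function_pd[OF t]] sum_negf)
    finally show "(LINT x|lborel. U x * lap \<phi> x) = - (\<Sum>i\<in>UNIV. LINT x|lborel. m i x * pd i \<phi> x)" .
  qed (use U P m R0 in auto)
  then show ?thesis using m(1) U(3) by (rule that)
qed

text \<open>The constant sequence is an admissible approximation; finiteness of \<sigma> makes
  \<phi> square integrable on the boundary.\<close>

lemma has_trace_test_function:
  assumes O: "open \<Omega>" and ss: "sets \<sigma> = sets borel" and fin: "emeasure \<sigma> UNIV < \<infinity>" and t: "tf \<phi>"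
  shows "has_trace \<Omega> \<sigma> \<phi> (grad \<phi>) \<phi>"
proof -
  have "H1_with_grad \<Omega> \<phi> (grad \<phi>)"
    unfolding H1_with_grad_def L2_vec_def
  proof (intro conjI allI)
    show "L2 \<Omega> \<phi>" by (rule L2_borel[OF O tf_sq_int[OF t]])
    fix i
    show "L2 \<Omega> (\<lambda>x. grad \<phi> x $ i)"
      unfolding grad_def using L2_borel[OF O tf_sq_int[OF test_function_pd[OF t]]] by simp
    show "distr_eq \<Omega> (ddiff i (distr_of \<Omega> \<phi>)) (distr_of \<Omega> (\<lambda>x. grad \<phi> x $ i))"
      unfolding distr_eq_def
    proof (intro allI impI)
      fix \<xi> assume x: "test_function \<Omega> \<xi>"
      show "ddiff i (distr_of \<Omega> \<phi>) \<xi> = distr_of \<Omega> (\<lambda>x. grad \<phi> x $ i) \<xi>"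
        using distr_of_borel[OF O tf_borel[OF t] test_function_pd[OF x], of i]
          distr_of_borel[OF O tf_borel[OF test_function_pd[OF t]] x, of i]
          integral_by_parts_pd[OF test_function_smooth[OF t] x, of i]
        by (simp add: ddiff_def grad_def)
    qed
  qed
  moreover have "sq_int \<sigma> \<phi>" by (rule cc_sq_int_finite[OF fin ss cc_test[OF t]])
  ultimately show ?thesis
    unfolding has_trace_def sq_int_def using t by (intro conjI exI[of _ "\<lambda>k. \<phi>"]) auto
qed

text \<open>Green's formula, tested with \<phi> itself, expresses the pairing of \<open>M\<close>
  with the gradient of \<phi> by the divergence and the surface density. Up to sign this pairing is
  the right-hand side of the equation for the potential.\<close>

lemma transmission_of_normal_trace:
  assumes O: "open \<Omega>" "bounded \<Omega>" "C11_boundary \<Omega>" and s: "is_surface_measure \<Omega> \<sigma>"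
    and pot: "potential U P m R0" and m: "\<And>i. rep \<Omega> (\<lambda>x. M x $ i) (m i)"
    and nt: "has_normal_trace \<Omega> \<sigma> M g"
  obtains D where "transmission U P m R0 \<Omega> \<sigma> D g"
proof -
  interpret potential U P m R0 by (rule pot)
  have ss: "sets \<sigma> = sets borel" using s by (simp add: is_surface_measure_def)
  have fin: "emeasure \<sigma> UNIV < \<infinity>" by (rule surface_measure_finite[OF O(2,3) s])
  obtain d where d: "L2 \<Omega> d" "\<And>v Dv h. has_trace \<Omega> \<sigma> v Dv h \<Longrightarrow>
      (LINT x|lebesgue_on \<Omega>. M x \<bullet> Dv x + d x * v x) = (LINT x|\<sigma>. g x * h x)"
    using nt unfolding has_normal_trace_def has_div_L2_def by blast
  obtain D where D: "rep \<Omega> d D" "sq_int lborel D" using L2_rep[OF O(1) d(1)] by blast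
  have "transmission U P m R0 \<Omega> \<sigma> D g"
  proof (intro transmission.intro pot transmission_axioms.intro O(1) s fin D(2))
    fix \<phi> assume t: "tf \<phi>"
    have "M x \<bullet> grad \<phi> x + d x * \<phi> x = (\<Sum>i\<in>UNIV. M x $ i * pd i \<phi> x) + d x * \<phi> x" for x
      by (simp add: inner_vec_def grad_def)
    moreover have "rep \<Omega> (\<lambda>x. (\<Sum>i\<in>UNIV. M x $ i * pd i \<phi> x) + d x * \<phi> x)
        (\<lambda>x. (\<Sum>i\<in>UNIV. m i x * pd i \<phi> x) + D x * \<phi> x)"
      by (intro rep_add rep_sum rep_mult_borel m D(1) finite tf_borel[OF t] tf_borel[OF test_function_pd[OF t]])
    ultimately have "(LINT x|\<sigma>. g x * \<phi> x) = (LINT x|lborel. (\<Sum>i\<in>UNIV. m i x * pd i \<phi> x) + D x * \<phi> x)"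
      using d(2)[OF has_trace_test_function[OF O(1) ss fin t]] rep_integral(1)[OF O(1)] by simp
    also have "\<dots> = (\<Sum>i\<in>UNIV. LINT x|lborel. m i x * pd i \<phi> x) + (LINT x|lborel. D x * \<phi> x)"
    proof -
      have i: "integrable lborel (\<lambda>x. m i x * pd i \<phi> x)" for i
        by (rule sq_int_integrable_mult[OF m_sq tf_sq_int[OF test_function_pd[OF t]]])
      then show ?thesis using sq_int_integrable_mult[OF D(2) tf_sq_int[OF t]]
        by (subst Bochner_Integration.integral_add) (auto simp: Bochner_Integration.integral_sum)
    qed
    finally show "(LINT x|lborel. U x * lap \<phi> x) = (LINT x|lborel. D x * \<phi> x) - (LINT x|\<sigma>. g x * \<phi> x)"
      using lap_u[OF t] by simp
  qed
  then show ?thesis by (rule that)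
qed

theorem proposition2p4:
  fixes \<Omega> :: "(real^3) set"
    and \<sigma> :: "(real^3) measure"
    and M :: "real^3 \<Rightarrow> real^3"
    and u :: "real^3 \<Rightarrow> real"
  assumes "open \<Omega>" and "bounded \<Omega>" and "connected \<Omega>" and "C11_boundary \<Omega>"
    and "is_surface_measure \<Omega> \<sigma>"
    and "L2_vec \<Omega> M"
    and "\<exists>d. has_div_L2 \<Omega> M d"
    and "\<exists>g. boundary_H_half \<Omega> \<sigma> g \<and> has_normal_trace \<Omega> \<sigma> M g"
    and "weighted_W 1 0 UNIV u"
    and "distr_eq UNIV (distr_laplacian (distr_of UNIV u))
           (distr_div (\<lambda>i. distr_of UNIV (\<lambda>x. indicator \<Omega> x * M x $ i)))"
  shows "sobolev_H 2 \<Omega> u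
       \<and> (weighted_W 2 2 (- closure \<Omega>) u \<and>
          (\<forall>i j. \<exists>w. locally_integrable (- closure \<Omega>) w \<and>
                     distr_eq (- closure \<Omega>) (ddiff i (ddiff j (distr_of (- closure \<Omega>) u)))
                       (distr_of (- closure \<Omega>) w) \<and>
                     L2 (- closure \<Omega>) (\<lambda>x. ((norm x)\<^sup>2 + 1) * w x)))
       \<and> (has_normal_trace \<Omega> \<sigma> M (\<lambda>_. 0) \<longrightarrow> weighted_W 2 2 UNIV u)"
proof -
  note O = assms(1,2,4) and s = assms(5)
  obtain U P m R0 where pot: "potential U P m R0" and m: "\<And>i. rep \<Omega> (\<lambda>x. M x $ i) (m i)"
    and uU: "\<And>\<phi>. tf \<phi> \<Longrightarrow> distr_of UNIV u \<phi> = (LINT x|lborel. U x * \<phi> x)"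
    by (rule potential_of_solution[OF assms(1,2,6,9,10)]) (rule that)
  interpret potential U P m R0 by (rule pot)
  have u: "locally_integrable UNIV u" using assms(9) by (simp add: weighted_W_def)
  obtain g where g: "boundary_H_half \<Omega> \<sigma> g" "has_normal_trace \<Omega> \<sigma> M g" using assms(8) by blast
  obtain D where tr: "transmission U P m R0 \<Omega> \<sigma> D g" by (rule transmission_of_normal_trace[OF O s pot m g(2)])
  \<comment> \<open>The bounds of \<open>near_bound\<close> exclude the frontier, so they serve both
    sides of the boundary, with arbitrary centres.\<close>
  have off: "\<exists>r>0. bdd (G \<inter> ball x r) (\<lambda>\<phi>. LINT x|lborel. P j x * pd i \<phi> x)"
    if G: "G \<inter> frontier \<Omega> = {}" for G x i j
  proof -
    obtain r where r: "0 < r" "bdd (ball x r - frontier \<Omega>) (\<lambda>\<phi>. LINT x|lborel. P j x * pd i \<phi> x)"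
      using transmission.near_bound[OF tr O(3) g(1)] by blast
    have "G \<inter> ball x r \<subseteq> ball x r - frontier \<Omega>" using G by blast
    with r bdd_mono show ?thesis by blast
  qed
  have G1: "\<Omega> \<inter> frontier \<Omega> = {}" and G2: "- closure \<Omega> \<inter> frontier \<Omega> = {}"
    using O(1) by (auto simp: frontier_def interior_open)
  have G2o: "open (- closure \<Omega>)" by (simp add: open_Compl)
  \<comment> \<open>With normal trace zero the surface term is absent: the equation has a
    square-integrable right-hand side on every ball, and the interior estimate crosses the boundary.
    The radius 1 below is arbitrary.\<close>
  have "weighted_W 2 2 UNIV u" if nt: "has_normal_trace \<Omega> \<sigma> M (\<lambda>_. 0)"
  proof (rule weighted_W_2_2(1)[OF open_UNIV u uU])
    obtain D where "transmission U P m R0 \<Omega> \<sigma> D (\<lambda>_. 0)" by (rule transmission_of_normal_trace[OF O s pot m nt])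
    then interpret T: transmission U P m R0 \<Omega> \<sigma> D "\<lambda>_. 0" .
    fix i j x
    show "\<exists>r>0. bdd (UNIV \<inter> ball x r) (\<lambda>\<phi>. LINT x|lborel. P j x * pd i \<phi> x)"
      using T.bound_from_equation[of 1 x] T.green[OF test_function_UNIV] by simp blast
  qed
  then show ?thesis
    using weighted_W_imp_sobolev_H[OF O(1) weighted_W_2_2(1)[OF O(1) u uU off[OF G1]]]
      weighted_W_2_2[OF G2o u uU off[OF G2]] by blast
qed

end
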